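(* Let $S$ be a quasi-hereditary algebra with poset $(\Lambda^+,\le)$ and let $S'$ be a Ringel dual of $S$, with standard modules $\Delta'(\lambda)$ and costandard modules $\nabla'(\lambda)$, $\lambda\in\Lambda^+$. Then for every $\lambda\in\Lambda^+$: (i) $\Delta\text{.f.d.}(\nabla(\lambda))=\operatorname{p.d.}(\Delta'(\lambda))$; (ii) $\operatorname{i.d.}(\nabla(\lambda))=\nabla\text{.f.d.}(\Delta'(\lambda))$; (iii) $\operatorname{p.d.}(\Delta(\lambda))=\Delta\text{.f.d.}(\nabla'(\lambda))$; (iv) $\nabla\text{.f.d.}(\Delta(\lambda))=\operatorname{i.d.}(\nabla'(\lambda))$. Here the dimensions of modules with a prime are taken over $S'$ and those of modules without a prime over $S$.
   Context: $S$ is a finite-dimensional algebra over a field $k$; all modules are finite-dimensional. The simple $S$-modules are $L(\lambda)$, $\lambda\in\Lambda^+$ (a full set of pairwise non-isomorphic ones), with projective covers $P(\lambda)$ and injective hulls $I(\lambda)$; $\le$ is a fixed partial order on the finite set $\Lambda^+$. The standard module $\Delta(\lambda)$ is the largest quotient of $P(\lambda)$ all of whose composition factors $L(\mu)$ satisfy $\mu\le\lambda$. The costandard module $\nabla(\lambda)$ is the largest submodule of $I(\lambda)$ all of whose composition factors $L(\mu)$ satisfy $\mu\le\lambda$. The algebra $S$ is quasi-hereditary (with poset $(\Lambda^+,\le)$) if for each $\lambda\in\Lambda^+$: (i) $L(\lambda)$ occurs exactly once as a composition factor of $\Delta(\lambda)$; and (ii) $P(\lambda)$ has a filtration by standard modules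 in which $\Delta(\lambda)$ occurs once, and if $\Delta(\mu)$ occurs then $\mu\ge\lambda$. $\mathcal{F}(\nabla)$ (resp. $\mathcal{F}(\Delta)$) is the class of modules having a filtration with all sections of the form $\nabla(\mu)$ (resp. $\Delta(\mu)$). For a nonzero module $X$, the $\nabla$-filtration dimension $\nabla\text{.f.d.}(X)$ is the smallest $d\ge 0$ such that there is an exact sequence $0\to X\to M_0\to\cdots\to M_d\to 0$ with all $M_i\in\mathcal{F}(\nabla)$. Dually, the $\Delta$-filtration dimension $\Delta\text{.f.d.}(X)$ is the smallest $d\ge 0$ such that there is an exact sequence $0\to N_d\to\cdots\to N_0\to X\to 0$ with all $N_i\in\mathcal{F}(\Delta)$. $\operatorname{p.d.}$ and $\operatorname{i.d.}$ denote projective and injective dimension. A tilting module is a module in $\mathcal{F}(\nabla)\cap\mathcal{F}(\Delta)$. For each $\lambda\in\Lambda^+$ there is a unique indecomposable tilting module $T(\lambda)$ such that $L(\lambda)$ occurs exactly once as a composition factor and every other composition factor $L(\mu)$ has $\mu<\lambda$; every tilting module is a direct sum of modules $T(\mu_i)$. A full tilting module $T$ is a tilting module having every $T(\mu)$, $\mu\in\Lambda^+$, as a direct summand. A Ringel dual of $S$ is $S'=\operatorname{End}_S(T)^{\mathrm{op}}$ for a full tilting module $T$; it is unique up to Morita equivalence and is quasi-hereditary with poset $(\Lambda^+,\le')$, where $\le'$ is the order opposite to $\le$. Let $F=\operatorname{Hom}_S(T,-)$ from $S$-modules to $S'$-modules. The labelling by $\Lambda^+$ for $S'$ is such that the indecomposable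 projective $S'$-modules are $P'(\lambda)=FT(\lambda)$; then the standard modules are $\Delta'(\lambda)=F\nabla(\lambda)$, and $\nabla'(\lambda)$ denotes the corresponding costandard $S'$-module. *)

theory Defs
  imports "Jordan_Normal_Form.Missing_VectorSpace" "HOL-Algebra.AbelCoset" "HOL-Library.Extended_Nat"
begin

section \<open>Finite-dimensional algebras and their modules\<close>

text \<open>
  An algebra \<open>S\<close> over a field \<open>K\<close> and a left \<open>S\<close>-module \<open>M\<close> are both given by the
  module record of \<open>HOL-Algebra\<close>: for \<open>S\<close> the ring structure of the record is the multiplication
  of the algebra and the scalars are the elements of \<open>K\<close>; for \<open>M\<close> the scalars are the elements
  of \<open>S\<close> and the fields for multiplication and one are ignored.  The library locale
  \<open>module\<close> only covers commutative rings of scalars.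
\<close>

locale left_module = R?: ring R + M?: abelian_group M
  for R :: "('a, 'r) ring_scheme" and M :: "('a, 'm, 'n) module_scheme" +
  assumes smult_closed:
      "\<lbrakk>a \<in> carrier R; x \<in> carrier M\<rbrakk> \<Longrightarrow> a \<odot>\<^bsub>M\<^esub> x \<in> carrier M"
    and smult_l_distr:
      "\<lbrakk>a \<in> carrier R; b \<in> carrier R; x \<in> carrier M\<rbrakk> \<Longrightarrow>
        (a \<oplus>\<^bsub>R\<^esub> b) \<odot>\<^bsub>M\<^esub> x = a \<odot>\<^bsub>M\<^esub> x \<oplus>\<^bsub>M\<^esub> b \<odot>\<^bsub>M\<^esub> x"
    and smult_r_distr:
      "\<lbrakk>a \<in> carrier R; x \<in> carrier M; y \<in> carrier M\<rbrakk> \<Longrightarrow>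
        a \<odot>\<^bsub>M\<^esub> (x \<oplus>\<^bsub>M\<^esub> y) = a \<odot>\<^bsub>M\<^esub> x \<oplus>\<^bsub>M\<^esub> a \<odot>\<^bsub>M\<^esub> y"
    and smult_assoc:
      "\<lbrakk>a \<in> carrier R; b \<in> carrier R; x \<in> carrier M\<rbrakk> \<Longrightarrow>
        (a \<otimes>\<^bsub>R\<^esub> b) \<odot>\<^bsub>M\<^esub> x = a \<odot>\<^bsub>M\<^esub> (b \<odot>\<^bsub>M\<^esub> x)"
    and smult_one:
      "x \<in> carrier M \<Longrightarrow> \<one>\<^bsub>R\<^esub> \<odot>\<^bsub>M\<^esub> x = x"

definition fd_algebra :: "'k ring \<Rightarrow> ('k, 'a) module \<Rightarrow> bool" where
  "fd_algebra K S \<longleftrightarrow>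
     vectorspace K S \<and> vectorspace.fin_dim K S \<and> ring S \<and>
     (\<forall>c\<in>carrier K. \<forall>x\<in>carrier S. \<forall>y\<in>carrier S.
        (c \<odot>\<^bsub>S\<^esub> x) \<otimes>\<^bsub>S\<^esub> y = c \<odot>\<^bsub>S\<^esub> (x \<otimes>\<^bsub>S\<^esub> y) \<and>
        x \<otimes>\<^bsub>S\<^esub> (c \<odot>\<^bsub>S\<^esub> y) = c \<odot>\<^bsub>S\<^esub> (x \<otimes>\<^bsub>S\<^esub> y))"

text \<open>A module over a \<open>K\<close>-algebra is a \<open>K\<close>-space via \<open>c x = (c 1) x\<close>.\<close>

definition underlying_space ::
    "('k, 'a) module \<Rightarrow> ('a, 'm) module \<Rightarrow> ('k, 'm) module" where
  "underlying_space S M =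
     \<lparr>carrier = carrier M, mult = mult M, one = one M, zero = zero M, add = add M,
      smult = (\<lambda>c x. (c \<odot>\<^bsub>S\<^esub> \<one>\<^bsub>S\<^esub>) \<odot>\<^bsub>M\<^esub> x)\<rparr>"

definition fd_module :: "'k ring \<Rightarrow> ('k, 'a) module \<Rightarrow> ('a, 'm) module \<Rightarrow> bool" where
  "fd_module K S M \<longleftrightarrow> left_module S M \<and> vectorspace.fin_dim K (underlying_space S M)"

text \<open>
  Quantification over ``all modules'' below ranges over modules whose carrier is a subset of
  \<open>nat \<Rightarrow> 'k\<close>, where \<open>'k\<close> is the type of the scalars.  As this type contains a copy of
  \<open>K\<^sup>n\<close> for each \<open>n\<close>, every finite-dimensional \<open>S\<close>-module, on whatever type, is
  isomorphic to such a module.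
\<close>

type_synonym ('k, 'a) umodule = "('a, nat \<Rightarrow> 'k) module"

text \<open>
  \<open>Module.submodule\<close> is the locale of \<open>HOL-Algebra\<close>; the locale of the same name in
  \<open>VectorSpace\<close> assumes that the scalars commute.  The homomorphisms of
  \<open>LinearCombinations\<close> are defined for arbitrary rings of scalars.
\<close>

abbreviation submod :: "('k, 'a) module \<Rightarrow> ('a, 'm) module \<Rightarrow> 'm set \<Rightarrow> bool" where
  "submod S M N \<equiv> Module.submodule N S M"

abbreviation left_hom ::
    "('k, 'a) module \<Rightarrow> ('a, 'm) module \<Rightarrow> ('a, 'n) module \<Rightarrow> ('m \<Rightarrow> 'n) set" where
  "left_hom S M N \<equiv> LinearCombinations.module_hom S M N"

definition quot_module :: "('a, 'm) module \<Rightarrow> 'm set \<Rightarrow> ('a, 'm set) module" where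
  "quot_module M N =
     \<lparr>carrier = a_rcosets\<^bsub>M\<^esub> N, mult = (\<lambda>X Y. N), one = N, zero = N, add = set_add M,
      smult = (\<lambda>a X. \<Union>x\<in>X. N +>\<^bsub>M\<^esub> (a \<odot>\<^bsub>M\<^esub> x))\<rparr>"

definition module_iso ::
    "('k, 'a) module \<Rightarrow> ('a, 'm) module \<Rightarrow> ('a, 'n) module \<Rightarrow> bool" where
  "module_iso S M N \<longleftrightarrow> (\<exists>f\<in>left_hom S M N. bij_betw f (carrier M) (carrier N))"

definition nonzero_module :: "('a, 'm) module \<Rightarrow> bool" where
  "nonzero_module M \<longleftrightarrow> carrier M \<noteq> {\<zero>\<^bsub>M\<^esub>}"

definition simple_module :: "('k, 'a) module \<Rightarrow> ('a, 'm) module \<Rightarrow> bool" where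
  "simple_module S M \<longleftrightarrow>
     left_module S M \<and> nonzero_module M \<and>
     (\<forall>N. submod S M N \<longrightarrow> N = {\<zero>\<^bsub>M\<^esub>} \<or> N = carrier M)"

definition direct_decomp ::
    "('k, 'a) module \<Rightarrow> ('a, 'm) module \<Rightarrow> 'm set \<Rightarrow> 'm set \<Rightarrow> bool" where
  "direct_decomp S M U V \<longleftrightarrow>
     submod S M U \<and> submod S M V \<and> U \<inter> V = {\<zero>\<^bsub>M\<^esub>} \<and> U <+>\<^bsub>M\<^esub> V = carrier M"

definition indecomposable_module :: "('k, 'a) module \<Rightarrow> ('a, 'm) module \<Rightarrow> bool" where
  "indecomposable_module S M \<longleftrightarrow>
     left_module S M \<and> nonzero_module M \<and>
     (\<forall>U V. direct_decomp S M U V \<longrightarrow> U = {\<zero>\<^bsub>M\<^esub>} \<or> V = {\<zero>\<^bsub>M\<^esub>})"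

definition direct_summand ::
    "('k, 'a) module \<Rightarrow> ('a, 'n) module \<Rightarrow> ('a, 'm) module \<Rightarrow> bool" where
  "direct_summand S N M \<longleftrightarrow>
     (\<exists>U V. direct_decomp S M U V \<and> module_iso S N (M\<lparr>carrier := U\<rparr>))"


section \<open>Filtrations and composition factors\<close>

text \<open>
  \<open>has_filtration S D M ls\<close>: there is a filtration
  \<open>0 = N\<^sub>0 \<subseteq> \<dots> \<subseteq> N\<^sub>n = M\<close> by submodules with
  \<open>N\<^sub>i\<^sub>+\<^sub>1 / N\<^sub>i\<close> isomorphic to \<open>D (ls ! i)\<close>.
\<close>

definition has_filtration ::
    "('k, 'a) module \<Rightarrow> ('l \<Rightarrow> ('a, 'd) module) \<Rightarrow> ('a, 'm) module \<Rightarrow> 'l list \<Rightarrow> bool" where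
  "has_filtration S D M ls \<longleftrightarrow>
     (\<exists>N. N 0 = {\<zero>\<^bsub>M\<^esub>} \<and> N (length ls) = carrier M \<and>
        (\<forall>i\<le>length ls. submod S M (N i)) \<and>
        (\<forall>i<length ls. N i \<subseteq> N (Suc i) \<and>
           module_iso S (quot_module (M\<lparr>carrier := N (Suc i)\<rparr>) (N i)) (D (ls ! i))))"

text \<open>
  If \<open>L\<close> is a family of pairwise non-isomorphic simple modules, a filtration with sections
  \<open>L \<mu>\<close> is a composition series.  By the Jordan-Hoelder theorem the labels that occur, and
  how often, do not depend on the series, so that one series may be used to express statements
  about composition factors.
\<close>

definition composition_labels ::
    "('k, 'a) module \<Rightarrow> 'l set \<Rightarrow> ('l \<Rightarrow> ('a, 's) module) \<Rightarrow> ('a, 'm) module \<Rightarrow> 'l list \<Rightarrow> bool" where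
  "composition_labels S \<Lambda> L M ls \<longleftrightarrow> set ls \<subseteq> \<Lambda> \<and> has_filtration S L M ls"

definition factors_below ::
    "('k, 'a) module \<Rightarrow> 'l set \<Rightarrow> 'l rel \<Rightarrow> ('l \<Rightarrow> ('a, 's) module) \<Rightarrow> 'l \<Rightarrow> ('a, 'm) module \<Rightarrow> bool" where
  "factors_below S \<Lambda> r L \<nu> M \<longleftrightarrow>
     (\<exists>ls. composition_labels S \<Lambda> L M ls \<and> (\<forall>\<mu>\<in>set ls. (\<mu>, \<nu>) \<in> r))"

definition filtered ::
    "'k ring \<Rightarrow> ('k, 'a) module \<Rightarrow> 'l set \<Rightarrow> ('l \<Rightarrow> ('a, 'd) module) \<Rightarrow> ('a, 'm) module \<Rightarrow> bool" where
  "filtered K S \<Lambda> D M \<longleftrightarrow>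
     fd_module K S M \<and> (\<exists>ls. set ls \<subseteq> \<Lambda> \<and> has_filtration S D M ls)"


section \<open>Projective and injective modules\<close>

definition projective_module :: "'k ring \<Rightarrow> ('k, 'a) module \<Rightarrow> ('a, 'm) module \<Rightarrow> bool" where
  "projective_module K S P \<longleftrightarrow>
     fd_module K S P \<and>
     (\<forall>(M :: ('k, 'a) umodule) (N :: ('k, 'a) umodule) g h.
        fd_module K S M \<and> fd_module K S N \<and>
        g \<in> left_hom S M N \<and> g ` carrier M = carrier N \<and> h \<in> left_hom S P N \<longrightarrow>
        (\<exists>h'\<in>left_hom S P M. \<forall>x\<in>carrier P. g (h' x) = h x))"

definition injective_module :: "'k ring \<Rightarrow> ('k, 'a) module \<Rightarrow> ('a, 'm) module \<Rightarrow> bool" where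
  "injective_module K S I \<longleftrightarrow>
     fd_module K S I \<and>
     (\<forall>(M :: ('k, 'a) umodule) (N :: ('k, 'a) umodule) g h.
        fd_module K S M \<and> fd_module K S N \<and>
        g \<in> left_hom S M N \<and> inj_on g (carrier M) \<and> h \<in> left_hom S M I \<longrightarrow>
        (\<exists>h'\<in>left_hom S N I. \<forall>x\<in>carrier M. h' (g x) = h x))"

definition projective_cover ::
    "'k ring \<Rightarrow> ('k, 'a) module \<Rightarrow> ('a, 'p) module \<Rightarrow> ('a, 'm) module \<Rightarrow> bool" where
  "projective_cover K S P M \<longleftrightarrow>
     projective_module K S P \<and>
     (\<exists>f\<in>left_hom S P M. f ` carrier P = carrier M \<and>
        (\<forall>U. submod S P U \<and> U <+>\<^bsub>P\<^esub> a_kernel P M f = carrier P \<longrightarrow> U = carrier P))"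

definition injective_hull ::
    "'k ring \<Rightarrow> ('k, 'a) module \<Rightarrow> ('a, 'i) module \<Rightarrow> ('a, 'm) module \<Rightarrow> bool" where
  "injective_hull K S I M \<longleftrightarrow>
     injective_module K S I \<and>
     (\<exists>f\<in>left_hom S M I. inj_on f (carrier M) \<and>
        (\<forall>U. submod S I U \<and> U \<inter> f ` carrier M = {\<zero>\<^bsub>I\<^esub>} \<longrightarrow> U = {\<zero>\<^bsub>I\<^esub>}))"


section \<open>Resolutions and homological dimensions\<close>

text \<open>
  The exact sequences \<open>0 \<rightarrow> N\<^sub>d \<rightarrow> \<dots> \<rightarrow> N\<^sub>0 \<rightarrow> X \<rightarrow> 0\<close> and
  \<open>0 \<rightarrow> X \<rightarrow> M\<^sub>0 \<rightarrow> \<dots> \<rightarrow> M\<^sub>d \<rightarrow> 0\<close> are continued by zero modules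
  in the degrees above \<open>d\<close>.
\<close>

definition has_resolution ::
    "('k, 'a) module \<Rightarrow> (('a, 'u) module \<Rightarrow> bool) \<Rightarrow> ('a, 'm) module \<Rightarrow> nat \<Rightarrow> bool" where
  "has_resolution S C X d \<longleftrightarrow>
     (\<exists>(N :: nat \<Rightarrow> ('a, 'u) module) \<epsilon> \<delta>.
        (\<forall>i. left_module S (N i)) \<and>
        (\<forall>i\<le>d. C (N i)) \<and> (\<forall>i>d. carrier (N i) = {\<zero>\<^bsub>N i\<^esub>}) \<and>
        \<epsilon> \<in> left_hom S (N 0) X \<and> (\<forall>i. \<delta> i \<in> left_hom S (N (Suc i)) (N i)) \<and>
        \<epsilon> ` carrier (N 0) = carrier X \<and>
        \<delta> 0 ` carrier (N 1) = a_kernel (N 0) X \<epsilon> \<and>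
        (\<forall>i. \<delta> (Suc i) ` carrier (N (Suc (Suc i))) = a_kernel (N (Suc i)) (N i) (\<delta> i)))"

definition has_coresolution ::
    "('k, 'a) module \<Rightarrow> (('a, 'u) module \<Rightarrow> bool) \<Rightarrow> ('a, 'm) module \<Rightarrow> nat \<Rightarrow> bool" where
  "has_coresolution S C X d \<longleftrightarrow>
     (\<exists>(M :: nat \<Rightarrow> ('a, 'u) module) \<epsilon> \<delta>.
        (\<forall>i. left_module S (M i)) \<and>
        (\<forall>i\<le>d. C (M i)) \<and> (\<forall>i>d. carrier (M i) = {\<zero>\<^bsub>M i\<^esub>}) \<and>
        \<epsilon> \<in> left_hom S X (M 0) \<and> (\<forall>i. \<delta> i \<in> left_hom S (M i) (M (Suc i))) \<and>
        inj_on \<epsilon> (carrier X) \<and>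
        \<epsilon> ` carrier X = a_kernel (M 0) (M 1) (\<delta> 0) \<and>
        (\<forall>i. \<delta> i ` carrier (M i) = a_kernel (M (Suc i)) (M (Suc (Suc i))) (\<delta> (Suc i))))"

text \<open>The dimensions are \<open>\<infinity>\<close> if there is no finite resolution of the required kind.\<close>

definition resolution_dim ::
    "('k, 'a) module \<Rightarrow> (('a, 'u) module \<Rightarrow> bool) \<Rightarrow> ('a, 'm) module \<Rightarrow> enat" where
  "resolution_dim S C X = (INF d \<in> {d. has_resolution S C X d}. enat d)"

definition coresolution_dim ::
    "('k, 'a) module \<Rightarrow> (('a, 'u) module \<Rightarrow> bool) \<Rightarrow> ('a, 'm) module \<Rightarrow> enat" where
  "coresolution_dim S C X = (INF d \<in> {d. has_coresolution S C X d}. enat d)"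

definition proj_dim :: "'k ring \<Rightarrow> ('k, 'a) module \<Rightarrow> ('a, 'm) module \<Rightarrow> enat" where
  "proj_dim K S X = resolution_dim S (projective_module K S :: ('k, 'a) umodule \<Rightarrow> bool) X"

definition inj_dim :: "'k ring \<Rightarrow> ('k, 'a) module \<Rightarrow> ('a, 'm) module \<Rightarrow> enat" where
  "inj_dim K S X = coresolution_dim S (injective_module K S :: ('k, 'a) umodule \<Rightarrow> bool) X"

text \<open>In the next two definitions \<open>D\<close> is the family of standard, respectively costandard, modules.\<close>

definition Delta_fd ::
    "'k ring \<Rightarrow> ('k, 'a) module \<Rightarrow> 'l set \<Rightarrow> ('l \<Rightarrow> ('a, 'd) module) \<Rightarrow> ('a, 'm) module \<Rightarrow> enat" where
  "Delta_fd K S \<Lambda> D X = resolution_dim S (filtered K S \<Lambda> D :: ('k, 'a) umodule \<Rightarrow> bool) X"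

definition Nabla_fd ::
    "'k ring \<Rightarrow> ('k, 'a) module \<Rightarrow> 'l set \<Rightarrow> ('l \<Rightarrow> ('a, 'd) module) \<Rightarrow> ('a, 'm) module \<Rightarrow> enat" where
  "Nabla_fd K S \<Lambda> D X = coresolution_dim S (filtered K S \<Lambda> D :: ('k, 'a) umodule \<Rightarrow> bool) X"


section \<open>Quasi-hereditary algebras\<close>

definition labelled_simples ::
    "'k ring \<Rightarrow> ('k, 'a) module \<Rightarrow> 'l set \<Rightarrow> ('l \<Rightarrow> ('a, 's) module) \<Rightarrow>
     ('l \<Rightarrow> ('a, 'p) module) \<Rightarrow> ('l \<Rightarrow> ('a, 'i) module) \<Rightarrow> bool" where
  "labelled_simples K S \<Lambda> L P I \<longleftrightarrow>
     (\<forall>\<nu>\<in>\<Lambda>. fd_module K S (L \<nu>) \<and> simple_module S (L \<nu>)) \<and>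
     (\<forall>\<nu>\<in>\<Lambda>. \<forall>\<mu>\<in>\<Lambda>. module_iso S (L \<nu>) (L \<mu>) \<longrightarrow> \<nu> = \<mu>) \<and>
     (\<forall>M :: ('k, 'a) umodule. fd_module K S M \<and> simple_module S M \<longrightarrow>
        (\<exists>\<nu>\<in>\<Lambda>. module_iso S M (L \<nu>))) \<and>
     (\<forall>\<nu>\<in>\<Lambda>. projective_cover K S (P \<nu>) (L \<nu>) \<and> injective_hull K S (I \<nu>) (L \<nu>))"

text \<open>
  The order is a relation with \<open>(\<mu>, \<nu>) \<in> r\<close> standing for \<open>\<mu> \<le> \<nu>\<close>.
  The largest quotient of \<open>P \<nu>\<close> with a given property is the quotient by the least
  submodule \<open>U\<close> such that \<open>P \<nu> / U\<close> has this property.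
\<close>

definition standard ::
    "('k, 'a) module \<Rightarrow> 'l set \<Rightarrow> 'l rel \<Rightarrow> ('l \<Rightarrow> ('a, 's) module) \<Rightarrow>
     ('l \<Rightarrow> ('a, 'p) module) \<Rightarrow> 'l \<Rightarrow> ('a, 'p set) module" where
  "standard S \<Lambda> r L P \<nu> =
     quot_module (P \<nu>)
       (LEAST U. submod S (P \<nu>) U \<and> factors_below S \<Lambda> r L \<nu> (quot_module (P \<nu>) U))"

definition costandard ::
    "('k, 'a) module \<Rightarrow> 'l set \<Rightarrow> 'l rel \<Rightarrow> ('l \<Rightarrow> ('a, 's) module) \<Rightarrow>
     ('l \<Rightarrow> ('a, 'i) module) \<Rightarrow> 'l \<Rightarrow> ('a, 'i) module" where
  "costandard S \<Lambda> r L I \<nu> =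
     (I \<nu>)\<lparr>carrier :=
       (GREATEST U. submod S (I \<nu>) U \<and> factors_below S \<Lambda> r L \<nu> ((I \<nu>)\<lparr>carrier := U\<rparr>))\<rparr>"

definition quasi_hereditary ::
    "'k ring \<Rightarrow> ('k, 'a) module \<Rightarrow> 'l set \<Rightarrow> 'l rel \<Rightarrow> ('l \<Rightarrow> ('a, 's) module) \<Rightarrow>
     ('l \<Rightarrow> ('a, 'p) module) \<Rightarrow> ('l \<Rightarrow> ('a, 'i) module) \<Rightarrow> bool" where
  "quasi_hereditary K S \<Lambda> r L P I \<longleftrightarrow>
     fd_algebra K S \<and> finite \<Lambda> \<and> partial_order_on \<Lambda> r \<and> labelled_simples K S \<Lambda> L P I \<and>
     (\<forall>\<nu>\<in>\<Lambda>.
        (\<exists>ls. composition_labels S \<Lambda> L (standard S \<Lambda> r L P \<nu>) ls \<and> count_list ls \<nu> = 1) \<and>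
        (\<exists>ls. set ls \<subseteq> \<Lambda> \<and> has_filtration S (standard S \<Lambda> r L P) (P \<nu>) ls \<and>
           count_list ls \<nu> = 1 \<and> (\<forall>\<mu>\<in>set ls. (\<nu>, \<mu>) \<in> r)))"


section \<open>Tilting modules and the Ringel dual\<close>

definition tilting_module ::
    "'k ring \<Rightarrow> ('k, 'a) module \<Rightarrow> 'l set \<Rightarrow> ('l \<Rightarrow> ('a, 'd) module) \<Rightarrow>
     ('l \<Rightarrow> ('a, 'n) module) \<Rightarrow> ('a, 'm) module \<Rightarrow> bool" where
  "tilting_module K S \<Lambda> D N M \<longleftrightarrow> filtered K S \<Lambda> D M \<and> filtered K S \<Lambda> N M"

definition indecomposable_tilting ::
    "'k ring \<Rightarrow> ('k, 'a) module \<Rightarrow> 'l set \<Rightarrow> 'l rel \<Rightarrow> ('l \<Rightarrow> ('a, 's) module) \<Rightarrow>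
     ('l \<Rightarrow> ('a, 'd) module) \<Rightarrow> ('l \<Rightarrow> ('a, 'n) module) \<Rightarrow> 'l \<Rightarrow> ('a, 'm) module \<Rightarrow> bool" where
  "indecomposable_tilting K S \<Lambda> r L D N \<nu> M \<longleftrightarrow>
     tilting_module K S \<Lambda> D N M \<and> indecomposable_module S M \<and>
     (\<exists>ls. composition_labels S \<Lambda> L M ls \<and> count_list ls \<nu> = 1 \<and>
        (\<forall>\<mu>\<in>set ls. \<mu> \<noteq> \<nu> \<longrightarrow> (\<mu>, \<nu>) \<in> r))"

definition full_tilting ::
    "'k ring \<Rightarrow> ('k, 'a) module \<Rightarrow> 'l set \<Rightarrow> ('l \<Rightarrow> ('a, 'd) module) \<Rightarrow>
     ('l \<Rightarrow> ('a, 'n) module) \<Rightarrow> ('l \<Rightarrow> ('a, 'm) module) \<Rightarrow> ('a, 't) module \<Rightarrow> bool" where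
  "full_tilting K S \<Lambda> D N T M \<longleftrightarrow>
     tilting_module K S \<Lambda> D N M \<and> (\<forall>\<mu>\<in>\<Lambda>. direct_summand S (T \<mu>) M)"

text \<open>
  The elements of \<open>Hom\<close> are taken extensional, so that each homomorphism is represented by
  exactly one function.  In \<open>End_op\<close> the product of \<open>f\<close> and \<open>g\<close> is
  \<open>g \<circ> f\<close>, hence precomposition makes \<open>Hom (T, M)\<close> a left module over it.
\<close>

definition End_op :: "('k, 'a) module \<Rightarrow> ('a, 't) module \<Rightarrow> ('k, 't \<Rightarrow> 't) module" where
  "End_op S T =
     \<lparr>carrier = left_hom S T T \<inter> extensional (carrier T),
      mult = (\<lambda>f g. compose (carrier T) g f),
      one = (\<lambda>x\<in>carrier T. x),
      zero = (\<lambda>x\<in>carrier T. \<zero>\<^bsub>T\<^esub>),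
      add = (\<lambda>f g. \<lambda>x\<in>carrier T. f x \<oplus>\<^bsub>T\<^esub> g x),
      smult = (\<lambda>c f. \<lambda>x\<in>carrier T. (c \<odot>\<^bsub>S\<^esub> \<one>\<^bsub>S\<^esub>) \<odot>\<^bsub>T\<^esub> f x)\<rparr>"

definition Hom_module ::
    "('k, 'a) module \<Rightarrow> ('a, 't) module \<Rightarrow> ('a, 'm) module \<Rightarrow> ('t \<Rightarrow> 't, 't \<Rightarrow> 'm) module" where
  "Hom_module S T M =
     \<lparr>carrier = left_hom S T M \<inter> extensional (carrier T),
      mult = (\<lambda>f g. \<lambda>x\<in>carrier T. \<zero>\<^bsub>M\<^esub>),
      one = (\<lambda>x\<in>carrier T. \<zero>\<^bsub>M\<^esub>),
      zero = (\<lambda>x\<in>carrier T. \<zero>\<^bsub>M\<^esub>),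
      add = (\<lambda>f g. \<lambda>x\<in>carrier T. f x \<oplus>\<^bsub>M\<^esub> g x),
      smult = (\<lambda>s f. compose (carrier T) f s)\<rparr>"

end

(* Ext^1(X, -) vanishes on F(Nabla) exactly for X in F(Delta), and dually. Hence F = Hom(T, -) is
   exact on F(Nabla). A module of F(Nabla) is a quotient of a sum of modules T(mu) with kernel again in
   F(Nabla), and F is fully faithful there and sends the T(mu) to the indecomposable projectives. Thus F
   identifies F(Nabla) with F(Delta') as exact categories. Projectives of S' come from tilting modules,
   so the projective dimension of Delta' = F Nabla is the tilting resolution length of Nabla, which is
   its Delta-filtration dimension: (i). Likewise F carries injectives to the modules of F(Delta') that
   are Ext-injective there, so injective coresolutions of Nabla become coresolutions of Delta' by tilting
   modules of S', whose shortest length is the Nabla'-filtration dimension: (ii).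
   For (iii) and (iv) the same is applied to S' with its full tilting module F(DS), where DS is the dual
   of the regular module. No identification of rings is needed: the Nakayama correspondence gives
   Hom(F(DS), F I(lambda)) = Hom(DS, I(lambda)) = P(lambda) as S-modules, so the second Ringel dual
   functor takes values in S-modules and maps Nabla'(lambda) to Delta(lambda). *)
theory Submission
  imports Defs
begin

text \<open>The field is arbitrary, so [X : L(l)] = 1 cannot be read as dim Hom(P(l), X) = 1. It is
  replaced by the condition that every map P(l) -> X factors through each nonzero one by an
  endomorphism of P(l), and local endomorphism rings by "bijective or nilpotent". Quasi-heredity
  constrains only the standard side. On the costandard side [Nabla(l) : L(l)] = 1, the vanishing of
  Ext^1(Delta, Nabla) and the Ext criterion for F(Nabla) all have to be derived. The second half
  reuses the first for another functor and another algebra. Hence algebra, order and functor enter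
  through axioms on homomorphisms (\<open>hw\<close>, \<open>ringel\<close>), which F Nabla
  satisfies again with the order reversed. Ext^1 = 0 always means that extensions split; where Ext^2
  would enter, the argument is shifted along a projective or injective presentation. Lengths of
  resolutions are compared by exchanging the first term, as in Schanuel's lemma, so that one tilting
  approximation or one injective embedding is a full induction step.\<close>

abbreviation (input) zero_of ("0[_]") where "0[X] == zero X"
abbreviation (input) one_of ("1[_]") where "1[X] == one X"
abbreviation (input) plus_of ("(_ +[_]/ _)" [65,0,66] 65) where "x +[X] y == add X x y"
abbreviation (input) mult_of ("(_ **[_]/ _)" [70,0,71] 70) where "x **[X] y == mult X x y"
abbreviation (input) smult_of ("(_ *[_]/ _)" [70,0,71] 70) where "a *[X] x == smult X a x"
abbreviation (input) minus_of ("(_ -[_]/ _)" [65,0,66] 65) where "x -[X] y == a_minus X x y"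
abbreviation (input) uminus_of ("(-[_]/ _)" [0,81] 80) where "-[X] x == a_inv X x"
abbreviation (input) iff_ascii (infixr "<->" 25) where "P <-> Q == P = Q"
abbreviation "car == carrier"
abbreviation (input) sc where "sc S c == c *[S] 1[S]"
abbreviation "us == underlying_space"
abbreviation "Proj == projective_module"
abbreviation "Inj == injective_module"

abbreviation sbm :: "('a, 'r) ring_scheme => ('a, 'm, 'n) module_scheme => 'm set => bool" where
  "sbm R M N == Module.submodule N R M"

abbreviation lhom :: "('a, 'r) ring_scheme => ('a, 'm, 'x) module_scheme => ('a, 'n, 'y) module_scheme => ('m => 'n) set" where
  "lhom R M N == LinearCombinations.module_hom R M N"

section \<open>Left modules\<close>

context left_module
begin

lemma minus_eq_zero [simp]: "[|x : car M; y : car M|] ==> x -[M] y = 0[M] <-> x = y"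
  by (metis M.add.inv_closed M.minus_equality M.minus_minus M.r_neg a_minus_def)

lemma minus_add_cancel: "[|x : car M; y : car M|] ==> (x -[M] y) +[M] y = x"
  by (simp add: a_minus_def M.a_assoc M.l_neg)

lemma neg_zero [simp]: "-[M] 0[M] = 0[M]"
  by (rule M.minus_equality) auto

lemma smult_r_null [simp]: "a : car R ==> a *[M] 0[M] = 0[M]"
  using smult_r_distr[of a "0[M]" "0[M]"] smult_closed[of a "0[M]"]
  by (metis M.add.l_cancel_one' M.l_zero M.zero_closed)

lemma smult_l_null [simp]: "x : car M ==> 0[R] *[M] x = 0[M]"
  using smult_l_distr[of "0[R]" "0[R]" x] smult_closed[of "0[R]" x]
  by (metis M.add.l_cancel_one' R.l_zero R.zero_closed)

lemma smult_l_minus: "[|a : car R; x : car M|] ==> (-[R] a) *[M] x = -[M] (a *[M] x)"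
  using smult_l_distr[of "-[R] a" a x]
  by (metis M.minus_equality R.add.inv_closed R.l_neg smult_closed smult_l_null)

lemma smult_r_minus: "[|a : car R; x : car M|] ==> a *[M] (-[M] x) = -[M] (a *[M] x)"
  using smult_r_distr[of a "-[M] x" x]
  by (metis M.add.inv_closed M.l_neg M.minus_equality smult_closed smult_r_null)

text \<open>Negatives are covered by the scalar -1, since \<open>-x = (-1) x\<close>.\<close>

lemma submodI:
  assumes "U <= car M" "0[M] : U" "!!x y. x : U ==> y : U ==> x +[M] y : U"
    "!!a x. a : car R ==> x : U ==> a *[M] x : U"
  shows "Module.submodule U R M"
proof -
  have "-[M] x : U" if "x : U" for x
    using assms(4)[of "-[R] 1[R]" x] smult_l_minus[of "1[R]" x] that assms(1) smult_one by auto
  thus ?thesis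
    using assms unfolding Module.submodule_def submodule_axioms_def subgroup_def a_inv_def by auto
qed

lemma submodD:
  assumes "Module.submodule U R M"
  shows "U <= car M" "0[M] : U" "!!x y. x : U ==> y : U ==> x +[M] y : U"
    "!!a x. a : car R ==> x : U ==> a *[M] x : U" "!!x. x : U ==> -[M] x : U"
    "!!x y. x : U ==> y : U ==> x -[M] y : U"
  using assms unfolding Module.submodule_def submodule_axioms_def subgroup_def a_inv_def a_minus_def by auto

lemma submod_carrier: "Module.submodule (car M) R M"
  by (rule submodI) (auto simp: smult_closed)

lemma submod_zero: "Module.submodule {0[M]} R M"
  by (rule submodI) auto

end

lemma left_moduleI:
  assumes "ring R"
    and "!!x y. x : car M ==> y : car M ==> x +[M] y : car M"
    and "0[M] : car M"
    and "!!x y z. x : car M ==> y : car M ==> z : car M ==> (x +[M] y) +[M] z = x +[M] (y +[M] z)"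
    and "!!x y. x : car M ==> y : car M ==> x +[M] y = y +[M] x"
    and "!!x. x : car M ==> 0[M] +[M] x = x"
    and "!!x. x : car M ==> EX y:car M. y +[M] x = 0[M]"
    and "!!a x. a : car R ==> x : car M ==> a *[M] x : car M"
    and "!!a b x. a : car R ==> b : car R ==> x : car M ==>
        (a +[R] b) *[M] x = a *[M] x +[M] b *[M] x"
    and "!!a x y. a : car R ==> x : car M ==> y : car M ==>
        a *[M] (x +[M] y) = a *[M] x +[M] a *[M] y"
    and "!!a b x. a : car R ==> b : car R ==> x : car M ==>
        (a **[R] b) *[M] x = a *[M] (b *[M] x)"
    and "!!x. x : car M ==> 1[R] *[M] x = x"
  shows "left_module R M"
proof (intro left_module.intro left_module_axioms.intro)
  show "abelian_group M"
    by (rule abelian_groupI) (use assms in auto)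
qed (use assms in auto)

lemma left_homI:
  assumes "!!x. x : car X ==> f x : car Y"
    "!!x y. x : car X ==> y : car X ==> f (x +[X] y) = f x +[Y] f y"
    "!!a x. a : car S ==> x : car X ==> f (a *[X] x) = a *[Y] f x"
  shows "f : lhom S X Y"
  using assms unfolding LinearCombinations.module_hom_def by auto

lemma left_homD:
  assumes "f : lhom S X Y"
  shows lhom_closed: "!!x. x : car X ==> f x : car Y"
    and lhom_add: "!!x y. x : car X ==> y : car X ==> f (x +[X] y) = f x +[Y] f y"
    and lhom_smult: "!!a x. a : car S ==> x : car X ==> f (a *[X] x) = a *[Y] f x"
  using assms unfolding LinearCombinations.module_hom_def by auto

locale lhom_loc = X: left_module S X + Y: left_module S Y for S X Y +
  fixes f
  assumes f: "f : lhom S X Y"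
begin

lemma closed [simp, intro]: "x : car X ==> f x : car Y"
  using f lhom_closed by metis

lemma add [simp]: "x : car X ==> y : car X ==> f (x +[X] y) = f x +[Y] f y"
  using f lhom_add by metis

lemma smult [simp]: "a : car S ==> x : car X ==> f (a *[X] x) = a *[Y] f x"
  using f lhom_smult by metis

lemma zero [simp]: "f 0[X] = 0[Y]"
  using add[of "0[X]" "0[X]"] closed[of "0[X]"]
  by (metis X.M.l_zero X.M.zero_closed Y.M.add.l_cancel_one')

lemma neg [simp]: "x : car X ==> f (-[X] x) = -[Y] f x"
  by (metis X.M.add.inv_closed X.M.l_neg Y.M.minus_equality add closed zero)

lemma minus [simp]: "x : car X ==> y : car X ==> f (x -[X] y) = f x -[Y] f y"
  by (simp add: a_minus_def)

lemma inj_iff: "inj_on f (car X) <-> (ALL x:car X. f x = 0[Y] --> x = 0[X])"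
proof
  assume "inj_on f (car X)"
  thus "ALL x:car X. f x = 0[Y] --> x = 0[X]"
    using zero by (metis X.M.zero_closed inj_onD)
next
  assume *: "ALL x:car X. f x = 0[Y] --> x = 0[X]"
  show "inj_on f (car X)"
  proof (rule inj_onI)
    fix x y assume xy: "x : car X" "y : car X" "f x = f y"
    hence "f (x -[X] y) = 0[Y]" by (simp add: Y.minus_eq_zero)
    with * xy have "x -[X] y = 0[X]" by blast
    with xy show "x = y" by simp
  qed
qed

lemma submod_image:
  assumes "Module.submodule U S X" shows "Module.submodule (f ` U) S Y"
proof (rule Y.submodI)
  note U = X.submodD[OF assms]
  show "f ` U <= car Y" "0[Y] : f ` U" using U(1,2) zero by (auto intro!: image_eqI[of _ f])
  show "x +[Y] y : f ` U" if "x : f ` U" "y : f ` U" for x y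
  proof -
    from that obtain u v where "u : U" "v : U" "x = f u" "y = f v" by auto
    thus ?thesis using U(1) U(3)[of u v] by (intro image_eqI[of _ f "u +[X] v"]) (auto simp: subset_iff)
  qed
  show "a *[Y] x : f ` U" if "a : car S" "x : f ` U" for a x
  proof -
    from that obtain u where "u : U" "x = f u" by auto
    thus ?thesis using U(1) U(4)[of a u] that by (intro image_eqI[of _ f "a *[X] u"]) (auto simp: subset_iff)
  qed
qed

lemma submod_preimage:
  assumes "Module.submodule V S Y" shows "Module.submodule {x : car X. f x : V} S X"
proof (rule X.submodI)
  note V = Y.submodD[OF assms]
  show "0[X] : {x : car X. f x : V}" using V(2) by simp
qed (use Y.submodD[OF assms] X.smult_closed in auto)

lemma submod_kernel: "Module.submodule {x : car X. f x = 0[Y]} S X"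
  using submod_preimage[OF Y.submod_zero] by simp

end

lemma lhom_locI: "left_module S X ==> left_module S Y ==> f : lhom S X Y ==> lhom_loc S X Y f"
  by (simp add: lhom_loc_axioms_def lhom_loc_def)

lemma sub_left_module:
  assumes "left_module S M" "sbm S M U"
  shows "left_module S (M(|carrier := U|))"
proof -
  interpret M: left_module S M by fact
  note U = M.submodD[OF assms(2)]
  have [simp]: "x : U ==> x : car M" for x using U by auto
  show ?thesis
  proof (rule left_moduleI)
    show "EX y:car (M(|carrier := U|)). y +[M(|carrier := U|)] x = 0[M(|carrier := U|)]" if "x : car (M(|carrier := U|))" for x
      using U(5)[of x] that by (auto intro!: bexI[of _ "-[M] x"] M.M.l_neg)
  qed (use U(2-4) M.R.ring_axioms in "auto simp: M.M.a_ac M.smult_l_distr M.smult_r_distr M.smult_assoc M.smult_one")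
qed

lemma submod_of_submod:
  assumes "left_module S M" "sbm S M U"
  shows "sbm S (M(|carrier := U|)) V <-> sbm S M V & V <= U"
proof -
  interpret M: left_module S M by fact
  interpret U: left_module S "M(|carrier := U|)" by (rule sub_left_module) fact+
  note U = M.submodD[OF assms(2)]
  show ?thesis
  proof
    assume V: "sbm S (M(|carrier := U|)) V"
    note V = U.submodD[OF V]
    have "V <= car M" using V(1) U(1) by auto
    with V show "sbm S M V & V <= U" by (auto intro!: M.submodI)
  next
    assume V: "sbm S M V & V <= U"
    note V' = M.submodD[OF conjunct1[OF V]]
    show "sbm S (M(|carrier := U|)) V" by (rule U.submodI) (use V V' in auto)
  qed
qed

lemma incl_left_hom: "sbm S M U ==> left_module S M ==> (%x. x) : lhom S (M(|carrier := U|)) M"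
  by (rule left_homI) (auto dest: left_module.submodD)

lemma lhom_id: "(%x. x) : lhom S M M"
  by (rule left_homI) auto

lemma lhom_comp:
  assumes "f : lhom S X Y" "g : lhom S Y Z"
  shows "(%x. g (f x)) : lhom S X Z"
  by (rule left_homI) (simp_all add: left_homD[OF assms(1)] left_homD[OF assms(2)])

lemma lhom_cong: "(!!x. x : car X ==> f x = g x) ==> left_module S X ==> f : lhom S X Y ==> g : lhom S X Y"
proof -
  assume *: "!!x. x : car X ==> f x = g x" "left_module S X" "f : lhom S X Y"
  interpret X: left_module S X by fact
  show "g : lhom S X Y"
    using left_homD[OF *(3)] by (intro left_homI) (simp_all add: *(1)[symmetric] X.smult_closed)
qed

lemma lhom_zero: "left_module S Y ==> (%x. 0[Y]) : lhom S X Y"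
proof -
  assume "left_module S Y"
  then interpret Y: left_module S Y .
  show ?thesis by (rule left_homI) auto
qed

lemma lhom_plus:
  assumes "left_module S Y" "f : lhom S X Y" "g : lhom S X Y"
  shows "(%x. f x +[Y] g x) : lhom S X Y"
proof -
  interpret Y: left_module S Y by fact
  note f = left_homD[OF assms(2)] and g = left_homD[OF assms(3)]
  show ?thesis
    by (rule left_homI) (simp_all add: f g Y.smult_r_distr Y.M.a_ac)
qed

lemma lhom_uminus:
  assumes "left_module S Y" "f : lhom S X Y"
  shows "(%x. -[Y] f x) : lhom S X Y"
proof -
  interpret Y: left_module S Y by fact
  note f = left_homD[OF assms(2)]
  show ?thesis
    by (rule left_homI) (simp_all add: f Y.smult_r_minus Y.M.minus_add Y.M.a_comm)
qed

lemma lhom_minus: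
  assumes "left_module S Y" "f : lhom S X Y" "g : lhom S X Y"
  shows "(%x. f x -[Y] g x) : lhom S X Y"
  using lhom_plus[OF assms(1,2) lhom_uminus[OF assms(1,3)]] by (simp add: a_minus_def)

text \<open>The value at \<open>z\<close> is read off at an arbitrary preimage; two preimages differ
  by an element of the kernel of \<open>g\<close>, and \<open>h\<close> kills that kernel.\<close>

lemma factor_epi:
  assumes "left_module S Y" "left_module S Z" "left_module S W"
    and g: "g : lhom S Y Z" "g ` car Y = car Z" and h: "h : lhom S Y W"
    and ker: "!!y. y : car Y ==> g y = 0[Z] ==> h y = 0[W]"
  shows "EX k:lhom S Z W. ALL y:car Y. k (g y) = h y"
proof -
  interpret g: lhom_loc S Y Z g using assms by (simp add: lhom_locI)
  interpret h: lhom_loc S Y W h using assms by (simp add: lhom_locI)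
  define k where "k z = h (SOME y. y : car Y & g y = z)" for z
  have k: "k (g y) = h y" if y: "y : car Y" for y
  proof -
    define y' where "y' = (SOME y'. y' : car Y & g y' = g y)"
    have y': "y' : car Y" "g y' = g y"
      unfolding y'_def using someI[of "%y'. y' : car Y & g y' = g y" y] y by auto
    have "g (y' -[Y] y) = 0[Z]" using y y' by (simp add: g.Y.minus_eq_zero)
    hence "h (y' -[Y] y) = 0[W]" using ker y y' by simp
    hence "h y' = h y" using y y' by (simp add: h.Y.minus_eq_zero)
    thus ?thesis by (simp add: k_def y'_def)
  qed
  have "k : lhom S Z W"
  proof (rule left_homI)
    show "k x : car W" if "x : car Z" for x
    proof -
      obtain u where "u : car Y" "x = g u" using `x : car Z` g(2)[symmetric] by auto
      thus ?thesis using k[of u] by simp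
    qed
    show "k (x +[Z] y) = k x +[W] k y" if "x : car Z" "y : car Z" for x y
    proof -
      obtain u v where "u : car Y" "v : car Y" "x = g u" "y = g v"
        using `x : car Z` `y : car Z` unfolding g(2)[symmetric] by auto
      thus ?thesis using k[of "u +[Y] v"] k[of u] k[of v] by simp
    qed
    show "k (a *[Z] x) = a *[W] k x" if "a : car S" "x : car Z" for a x
    proof -
      obtain u where "u : car Y" "x = g u" using `x : car Z` g(2)[symmetric] by auto
      thus ?thesis using k[of "a *[Y] u"] k[of u] that by (simp add: g.X.smult_closed)
    qed
  qed
  with k show ?thesis by blast
qed

lemma factor_mono:
  assumes "left_module S X" "left_module S Y"
    and f: "f : lhom S X Y" "inj_on f (car X)" and h: "h : lhom S W Y"
    and W: "left_module S W"
    and im: "!!w. w : car W ==> h w : f ` car X"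
  shows "EX k:lhom S W X. ALL w:car W. f (k w) = h w"
proof -
  interpret f: lhom_loc S X Y f using assms by (simp add: lhom_locI)
  interpret h: lhom_loc S W Y h using assms by (simp add: lhom_locI)
  define k where "k w = inv_into (car X) f (h w)" for w
  have k: "k w : car X" "f (k w) = h w" if "w : car W" for w
    using im[OF that] by (auto simp: k_def inv_into_into f_inv_into_f)
  have eq: "k w = x" if "w : car W" "x : car X" "f x = h w" for w x
    using that f(2) k by (metis inj_onD)
  have "k : lhom S W X"
  proof (rule left_homI)
    show "k x : car X" if "x : car W" for x by (rule k[OF that])
    show "k (x +[W] y) = k x +[X] k y" if "x : car W" "y : car W" for x y
      by (rule eq) (use that k in auto)
    show "k (a *[W] x) = a *[X] k x" if "a : car S" "x : car W" for a x
      by (rule eq) (use that k h.X.smult_closed f.X.smult_closed in auto)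
  qed
  with k show ?thesis by blast
qed

lemma lhom_inverse:
  assumes "left_module S X" "left_module S Y" "f : lhom S X Y" "bij_betw f (car X) (car Y)"
  obtains g where "g : lhom S Y X" "!!x. x : car X ==> g (f x) = x"
    "!!y. y : car Y ==> f (g y) = y" "bij_betw g (car Y) (car X)"
proof -
  have f: "inj_on f (car X)" "f ` car X = car Y" using assms(4) by (auto simp: bij_betw_def)
  have "EX k:lhom S Y X. ALL y:car Y. f (k y) = y"
    by (rule factor_mono) (use assms f in "auto intro: lhom_id")
  then obtain g where g: "g : lhom S Y X" "!!y. y : car Y ==> f (g y) = y" by blast
  have gf: "g (f x) = x" if "x : car X" for x
    using g that f by (metis assms(3) inj_onD lhom_closed)
  have "bij_betw g (car Y) (car X)"
    by (rule bij_betw_byWitness[where f' = f]) (use g gf assms(3) lhom_closed in fastforce)+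
  with g gf show thesis using that by blast
qed

lemma lhom_inverse_ex:
  assumes "left_module S X" "left_module S Y" "f : lhom S X Y" "bij_betw f (car X) (car Y)"
  shows "EX g:lhom S Y X. (ALL x:car X. g (f x) = x) & (ALL y:car Y. f (g y) = y) & bij_betw g (car Y) (car X)"
  by (rule lhom_inverse[OF assms]) blast

section \<open>Isomorphism\<close>

lemma module_iso_refl: "module_iso S X X"
  unfolding module_iso_def by (rule bexI[of _ "%x. x"]) (auto simp: lhom_id bij_betw_def)

lemma module_iso_sym: "left_module S X ==> left_module S Y ==> module_iso S X Y ==> module_iso S Y X"
  unfolding module_iso_def by (metis lhom_inverse)

lemma module_iso_trans: "module_iso S X Y ==> module_iso S Y Z ==> module_iso S X Z"
proof -
  assume "module_iso S X Y" "module_iso S Y Z"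
  then obtain f g where "f : lhom S X Y" "bij_betw f (car X) (car Y)"
     "g : lhom S Y Z" "bij_betw g (car Y) (car Z)" unfolding module_iso_def by blast
  thus ?thesis unfolding module_iso_def
    using bij_betw_trans[of f "car X" "car Y" g "car Z"] lhom_comp[of f S X Y g Z]
    by (intro bexI[of _ "%x. g (f x)"]) (auto simp: comp_def)
qed

section \<open>Quotients, products and transport\<close>

text \<open>\<open>quot_module\<close> multiplies a coset by a scalar through a union over its
  elements. The point to check is that all members of this union are one and the same coset.\<close>

lemma quot_left_module:
  fixes M :: "('a, 'm) module"
  assumes "left_module S M" "sbm S M U"
  shows "left_module S (quot_module M U)" (is ?th1)
    and "(%x. U +>\<^bsub>M\<^esub> x) : lhom S M (quot_module M U)" (is ?th2)
    and "(%x. U +>\<^bsub>M\<^esub> x) ` car M = car (quot_module M U)" (is ?th3)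
    and "x : car M ==> U +>\<^bsub>M\<^esub> x = 0[quot_module M U] <-> x : U"
proof -
  interpret M: left_module S M by fact
  note U = M.submodD[OF assms(2)]
  have "subgroup U (add_monoid M)" using assms(2) unfolding Module.submodule_def by auto
  then interpret U: abelian_subgroup U M by (metis M.M.abelian_group_axioms abelian_subgroupI3 additive_subgroupI)
  have coset: "U +>\<^bsub>M\<^esub> x = U +>\<^bsub>M\<^esub> y <-> x -[M] y : U" if "x : car M" "y : car M" for x y
  proof
    assume "U +>\<^bsub>M\<^esub> x = U +>\<^bsub>M\<^esub> y"
    hence "x : U +>\<^bsub>M\<^esub> y" using U.a_rcos_self that by auto
    thus "x -[M] y : U" using U.a_rcos_module[of y x] that by (simp add: a_minus_def)
  next
    assume "x -[M] y : U"
    hence "x : U +>\<^bsub>M\<^esub> y" using U.a_rcos_module[of y x] that by (simp add: a_minus_def)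
    thus "U +>\<^bsub>M\<^esub> x = U +>\<^bsub>M\<^esub> y" using U.a_repr_independence' that by metis
  qed
  have add: "(U +>\<^bsub>M\<^esub> x) <+>\<^bsub>M\<^esub> (U +>\<^bsub>M\<^esub> y) = U +>\<^bsub>M\<^esub> (x +[M] y)" if "x : car M" "y : car M" for x y
    by (rule U.a_rcos_sum) fact+
  have smult: "(\<Union>z\<in>U +>\<^bsub>M\<^esub> x. U +>\<^bsub>M\<^esub> (a *[M] z)) = U +>\<^bsub>M\<^esub> (a *[M] x)"
    if "a : car S" "x : car M" for a x
  proof -
    have "U +>\<^bsub>M\<^esub> (a *[M] z) = U +>\<^bsub>M\<^esub> (a *[M] x)" if z: "z : U +>\<^bsub>M\<^esub> x" for z
    proof -
      note that = `a : car S` `x : car M`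
      from z obtain u where u: "u : U" "z = u +[M] x" by (auto simp: a_r_coset_def' )
      have uc: "u : car M" using u(1) U(1) by auto
      have "a *[M] z -[M] a *[M] x = a *[M] u +[M] (a *[M] x +[M] -[M] (a *[M] x))"
        unfolding u(2) a_minus_def using uc that by (simp add: M.smult_r_distr M.smult_closed M.M.a_assoc)
      also have "... = a *[M] u" using uc that by (simp only: M.M.r_neg M.smult_closed M.M.r_zero)
      finally have "a *[M] z -[M] a *[M] x = a *[M] u" .
      hence mem: "a *[M] z -[M] a *[M] x : U" by (simp only: U(4)[OF that(1) u(1)])
      have "a *[M] z : car M" unfolding u(2) by (intro M.smult_closed M.M.a_closed uc that)
      from coset[OF this M.smult_closed[OF that]] mem show ?thesis by (rule iffD2)
    qed
    moreover have "x : U +>\<^bsub>M\<^esub> x" using U.a_rcos_self that by auto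
    ultimately show ?thesis by blast
  qed
  have carr: "car (quot_module M U) = (%x. U +>\<^bsub>M\<^esub> x) ` car M"
    by (auto simp: quot_module_def A_RCOSETS_def')
  have zero: "0[quot_module M U] = U +>\<^bsub>M\<^esub> 0[M]"
    using U(1) by (simp add: quot_module_def)
  have qadd: "(U +>\<^bsub>M\<^esub> x) +[quot_module M U] (U +>\<^bsub>M\<^esub> y) = U +>\<^bsub>M\<^esub> (x +[M] y)" if "x : car M" "y : car M" for x y
    using add that by (simp add: quot_module_def)
  have qsm: "a *[quot_module M U] (U +>\<^bsub>M\<^esub> x) = U +>\<^bsub>M\<^esub> (a *[M] x)" if "a : car S" "x : car M" for a x
    using smult that by (simp add: quot_module_def)
  show ?th1
  proof (rule left_moduleI)
    show "EX y:car (quot_module M U). y +[quot_module M U] x = 0[quot_module M U]" if x: "x : car (quot_module M U)" for x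
    proof -
      obtain z where z: "z : car M" "x = U +>\<^bsub>M\<^esub> z" using x carr by auto
      show ?thesis
        by (rule bexI[of _ "U +>\<^bsub>M\<^esub> (-[M] z)"]) (use z carr in "auto simp: qadd zero M.M.l_neg")
    qed
  qed (use M.R.ring_axioms in "auto simp: carr zero qadd qsm M.M.a_ac M.smult_closed M.smult_l_distr M.smult_r_distr M.smult_assoc M.smult_one")
  show ?th2 by (rule left_homI) (auto simp: carr qadd qsm)
  show ?th3 by (simp add: carr)
  show "U +>\<^bsub>M\<^esub> x = 0[quot_module M U] <-> x : U" if "x : car M"
    using coset[of x "0[M]"] that by (simp add: zero a_minus_def)
qed

definition prod_module :: "('a, 'm) module => ('a, 'n) module => ('a, 'm \<times> 'n) module" where
  "prod_module X Y =
     (|carrier = car X \<times> car Y, mult = (%x y. x), one = (0[X], 0[Y]), zero = (0[X], 0[Y]),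
      add = (%x y. (fst x +[X] fst y, snd x +[Y] snd y)),
      smult = (%a x. (a *[X] fst x, a *[Y] snd x))|)"

lemma prod_left_module:
  assumes "left_module S X" "left_module S Y"
  shows "left_module S (prod_module X Y)"
    "fst : lhom S (prod_module X Y) X" "snd : lhom S (prod_module X Y) Y"
    "(%x. (x, 0[Y])) : lhom S X (prod_module X Y)" "(%y. (0[X], y)) : lhom S Y (prod_module X Y)"
proof -
  interpret X: left_module S X by fact
  interpret Y: left_module S Y by fact
  show "left_module S (prod_module X Y)"
  proof (rule left_moduleI)
    show "EX y:car (prod_module X Y). y +[prod_module X Y] x = 0[prod_module X Y]" if "x : car (prod_module X Y)" for x
      by (rule bexI[of _ "(-[X] fst x, -[Y] snd x)"]) (use that in "auto simp: prod_module_def X.M.l_neg Y.M.l_neg")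
  qed (use X.R.ring_axioms in "auto simp: prod_module_def X.M.a_ac Y.M.a_ac X.smult_closed
     Y.smult_closed X.smult_l_distr Y.smult_l_distr X.smult_r_distr Y.smult_r_distr X.smult_assoc Y.smult_assoc X.smult_one Y.smult_one")
  show "fst : lhom S (prod_module X Y) X" "snd : lhom S (prod_module X Y) Y"
    "(%x. (x, 0[Y])) : lhom S X (prod_module X Y)" "(%y. (0[X], y)) : lhom S Y (prod_module X Y)"
    by (auto intro!: left_homI simp: prod_module_def)
qed

text \<open>Carries the structure along an injection \<open>u\<close>; this is how a module on any
  type is brought to the carrier type of \<open>umodule\<close>.\<close>

definition transport_module :: "('m => 'n) => ('a, 'm) module => ('a, 'n) module" where
  "transport_module u M = (let v = inv_into (car M) u in
     (|carrier = u ` car M, mult = (%x y. x), one = u 0[M], zero = u 0[M],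
      add = (%x y. u (v x +[M] v y)), smult = (%a x. u (a *[M] v x))|))"

lemma transport_left_module:
  assumes "left_module S M" "inj_on u (car M)"
  shows "left_module S (transport_module u M)" "u : lhom S M (transport_module u M)"
    "bij_betw u (car M) (car (transport_module u M))"
proof -
  interpret M: left_module S M by fact
  define v where "v = inv_into (car M) u"
  have v [simp]: "v (u x) = x" if "x : car M" for x using that assms(2) by (simp add: v_def)
  have [simp]: "car (transport_module u M) = u ` car M" "0[transport_module u M] = u 0[M]"
    "x +[transport_module u M] y = u (v x +[M] v y)" "a *[transport_module u M] x = u (a *[M] v x)" for x y a
    by (auto simp: transport_module_def v_def Let_def)
  show "left_module S (transport_module u M)"
  proof (rule left_moduleI)
    show "EX y:car (transport_module u M). y +[transport_module u M] x = 0[transport_module u M]"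
      if "x : car (transport_module u M)" for x
    proof -
      obtain z where "z : car M" "x = u z" using `x : _` by auto
      thus ?thesis by (auto intro!: bexI[of _ "-[M] z"] simp: M.M.l_neg)
    qed
  qed (use M.R.ring_axioms in "auto simp: M.M.a_ac M.smult_closed M.smult_l_distr M.smult_r_distr M.smult_assoc M.smult_one")
  show "u : lhom S M (transport_module u M)" by (rule left_homI) auto
  show "bij_betw u (car M) (car (transport_module u M))" using assms(2) by (simp add: bij_betw_def)
qed

section \<open>Finite-dimensional vector spaces\<close>

lemma (in vectorspace) left_module: "left_module K V"
  by (intro left_module.intro left_module_axioms.intro)
     (use R.ring_axioms M.abelian_group_axioms in "auto simp: smult_l_distr smult_r_distr smult_assoc1")

lemma (in vectorspace) submodule_iff: "LinearCombinations.submodule K U V <-> sbm K V U"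
proof -
  interpret V: left_module K V by (rule left_module)
  show ?thesis
  proof
    assume U: "LinearCombinations.submodule K U V"
    show "sbm K V U"
      using U unfolding LinearCombinations.submodule_def by (intro V.submodI) auto
  next
    assume "sbm K V U"
    note U = V.submodD[OF this]
    show "LinearCombinations.submodule K U V"
      using U(1-5) module_axioms unfolding LinearCombinations.submodule_def by auto
  qed
qed

text \<open>Finite generation expressed by submodules alone, so that it passes along homomorphisms
  without any handling of linear combinations.\<close>

lemma (in vectorspace) fin_dim_iff:
  "fin_dim <-> (EX A. finite A & A <= car V & (ALL U. sbm K V U & A <= U --> U = car V))"
proof
  interpret V: left_module K V by (rule left_module)
  assume "fin_dim"
  then obtain A where A: "finite A" "A <= car V" "span A = car V"
    unfolding fin_dim_def by auto
  have "U = car V" if "sbm K V U" "A <= U" for U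
    using span_is_subset[OF that(2)] that(1) A V.submodD(1)[OF that(1)] by (auto simp: submodule_iff)
  with A show "EX A. finite A & A <= car V & (ALL U. sbm K V U & A <= U --> U = car V)" by blast
next
  assume "EX A. finite A & A <= car V & (ALL U. sbm K V U & A <= U --> U = car V)"
  then obtain A where A: "finite A" "A <= car V" "!!U. sbm K V U ==> A <= U ==> U = car V" by blast
  have "span A = car V"
    by (rule A(3)) (use span_is_submodule[OF A(2)] in_own_span[OF A(2)] in "auto simp: submodule_iff")
  with A show "fin_dim" unfolding fin_dim_def by auto
qed

lemma vectorspaceI: "field K ==> left_module K V ==> vectorspace K V"
proof -
  assume K: "field K" and V: "left_module K V"
  interpret K: field K by fact
  interpret V: left_module K V by fact
  show ?thesis
    by (intro vectorspace.intro Module.module.intro Module.module_axioms.intro K)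
      (auto simp: K.is_cring V.M.abelian_group_axioms V.smult_closed V.smult_l_distr V.smult_r_distr V.smult_assoc V.smult_one)
qed

locale vs_hom = V: vectorspace K V + W: vectorspace K W for K V W +
  fixes T
  assumes T: "T : lhom K V W"
begin

sublocale lhom_loc K V W T
  using V.left_module W.left_module T by (rule lhom_locI)

lemma linear_map: "linear_map K V W T"
  by (intro linear_map.intro mod_hom.intro mod_hom_axioms.intro V.vectorspace_axioms W.vectorspace_axioms
     V.module_axioms W.module_axioms T)

lemma fin_dim_image:
  assumes "V.fin_dim" "T ` car V = car W"
  shows "W.fin_dim"
  using linear_map.rank_nullity_main(2)[OF linear_map] assms by simp

text \<open>Generators of the kernel together with lifts of generators of the image generate the
  whole space.\<close>

lemma fin_dim_ext:
  assumes ker: "vectorspace.fin_dim K (V(|carrier := {x : car V. T x = 0[W]}|))"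
    and im: "vectorspace.fin_dim K (W(|carrier := T ` car V|))"
  shows "V.fin_dim"
proof -
  let ?N = "{x : car V. T x = 0[W]}"
  have N: "sbm K V ?N" by (rule submod_kernel)
  have I: "sbm K W (T ` car V)" by (rule submod_image[OF X.submod_carrier])
  interpret N: vectorspace K "V(|carrier := ?N|)"
    by (rule vectorspaceI) (use V.field.field_axioms sub_left_module[OF V.left_module N] in auto)
  interpret I: vectorspace K "W(|carrier := T ` car V|)"
    by (rule vectorspaceI) (use V.field.field_axioms sub_left_module[OF W.left_module I] in auto)
  obtain A where A: "finite A" "A <= ?N" "!!U. sbm K (V(|carrier := ?N|)) U ==> A <= U ==> U = ?N"
    using ker unfolding N.fin_dim_iff by auto
  obtain B where B: "finite B" "B <= T ` car V" "!!U. sbm K (W(|carrier := T ` car V|)) U ==> B <= U ==> U = T ` car V"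
    using im unfolding I.fin_dim_iff by auto
  obtain B' where B': "B' <= car V" "finite B'" "B = T ` B'"
    using B(1,2) by (meson finite_subset_image)
  have "U = car V" if U: "sbm K V U" "A Un B' <= U" for U
  proof -
    note UD = X.submodD[OF U(1)]
    have "U Int ?N = ?N"
    proof (rule A(3))
      show "sbm K (V(|carrier := ?N|)) (U Int ?N)"
        unfolding submod_of_submod[OF V.left_module N]
        by (intro conjI X.submodI) (use UD X.submodD[OF N] in auto)
    qed (use U(2) A(2) in auto)
    hence NU: "?N <= U" by blast
    have "T ` U = T ` car V"
    proof (rule B(3))
      show "sbm K (W(|carrier := T ` car V|)) (T ` U)"
        unfolding submod_of_submod[OF W.left_module I] using submod_image[OF U(1)] UD(1) by auto
    qed (use U(2) B' in auto)
    have "x : U" if x: "x : car V" for x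
    proof -
      from x \<open>T ` U = T ` car V\<close> obtain u where u: "u : U" "T u = T x" by (metis imageE imageI)
      have uc: "u : car V" using u UD by auto
      hence "x -[V] u : ?N" using x u by simp
      hence "(x -[V] u) +[V] u : U" using NU u UD by blast
      moreover have "(x -[V] u) +[V] u = x" using x uc by (rule X.minus_add_cancel)
      ultimately show ?thesis by simp
    qed
    with UD show ?thesis by auto
  qed
  moreover have "A Un B' <= car V" using A B' by auto
  ultimately show ?thesis unfolding V.fin_dim_iff using A(1) B'(2) by (metis finite_UnI)
qed

end

lemma (in vectorspace) sub_vectorspace: "sbm K V U ==> vectorspace K (V(|carrier := U|))"
  by (rule vectorspaceI) (use field.field_axioms sub_left_module[OF left_module] in auto)

text \<open>Independent subsets of \<open>U\<close> stay independent in \<open>V\<close>, so their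
  size is bounded by \<open>dim\<close>; a maximal one is a basis of \<open>U\<close>.\<close>

lemma (in vectorspace) fin_dim_sub:
  assumes fd: "fin_dim" and U: "sbm K V U"
  shows "vectorspace.fin_dim K (V(|carrier := U|))"
proof -
  interpret U: vectorspace K "V(|carrier := U|)" by (rule sub_vectorspace) fact
  have UV: "U <= car V" using left_module.submodD(1)[OF left_module U] .
  have li: "U.lin_dep A <-> lin_dep A" if "A <= U" for A
    using span_li_not_depend(2)[of A U] that U by (simp add: submodule_iff)
  define Q where "Q = (%A. A <= car (V(|carrier := U|)) & U.lin_indpt A)"
  have "EX A. finite A & maximal A Q"
  proof (rule maximal_exists)
    show "finite A & card A <= dim" if "Q A" for A
      using li_le_dim[OF fd, of A] that li[of A] UV by (auto simp: Q_def)
    show "Q {}" by (auto simp: Q_def U.lin_dep_def)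
  qed
  then obtain A where "finite A" "maximal A Q" by blast
  moreover from this have "U.basis A" by (auto simp: Q_def intro: U.max_li_is_basis)
  ultimately show ?thesis unfolding U.fin_dim_def U.basis_def by blast
qed

lemma (in vectorspace) dim_zero_iff:
  assumes "fin_dim" shows "dim = 0 <-> car V = {0[V]}"
proof
  assume "dim = 0"
  obtain B where B: "finite B" "basis B" using finite_basis_exists[OF assms] by blast
  with `dim = 0` have "card B = 0" using dim_basis by metis
  with B(1) have "B = {}" by simp
  with B(2) show "car V = {0[V]}" unfolding basis_def using span_empty by simp
next
  assume "car V = {0[V]}"
  hence "basis {}" unfolding basis_def using span_empty by (auto simp: lin_dep_def)
  thus "dim = 0" using dim_basis by force
qed

text \<open>\<open>beta b\<close> is the coordinate at \<open>b\<close>; its linearity is the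
  uniqueness of coordinates.\<close>

lemma (in vectorspace) dual_basis:
  assumes "fin_dim"
  obtains B beta where "finite B" "B <= car V" "!!b. b : B ==> beta b : car V \<rightarrow> car K"
    "!!b x y. b : B ==> x : car V ==> y : car V ==> beta b (x +[V] y) = beta b x +[K] beta b y"
    "!!b c x. b : B ==> c : car K ==> x : car V ==> beta b (c *[V] x) = c **[K] beta b x"
    "!!x. x : car V ==> x = (\<Oplus>\<^bsub>V\<^esub>b\<in>B. beta b x *[V] b)"
proof -
  obtain B where B: "finite B" "basis B" using finite_basis_exists[OF assms] by blast
  hence BV: "B <= car V" by (simp add: basis_def)
  have uniq: "EX! a. a : B \<rightarrow>\<^sub>E car K & lincomb a B = v" if "v : car V" for v
    using basis_criterion[OF B(1) BV] B(2) that by blast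
  define a where "a v = (THE a. a : B \<rightarrow>\<^sub>E car K & lincomb a B = v)" for v
  have a: "a v : B \<rightarrow>\<^sub>E car K" "lincomb (a v) B = v" if "v : car V" for v
    using theI'[OF uniq[OF that]] unfolding a_def by auto
  have eq: "a v = f" if "v : car V" "f : B \<rightarrow>\<^sub>E car K" "lincomb f B = v" for v f
    using uniq[OF that(1)] a[OF that(1)] that by blast
  have aB: "a v b : car K" if "v : car V" "b : B" for v b using a(1)[OF that(1)] that by auto
  show thesis
  proof
    show "finite B" "B <= car V" by fact+
    show "(%v. a v b) : car V \<rightarrow> car K" if "b : B" for b using aB that by auto
    show "v = (\<Oplus>\<^bsub>V\<^esub>b\<in>B. a v b *[V] b)" if "v : car V" for v
      using a(2)[OF that] by (simp add: lincomb_def)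
    show "a (x +[V] y) b = a x b +[K] a y b" if "b : B" "x : car V" "y : car V" for b x y
    proof -
      have "a (x +[V] y) = (\<lambda>b\<in>B. a x b +[K] a y b)"
      proof (rule eq)
        have "lincomb (\<lambda>b\<in>B. a x b +[K] a y b) B = (\<Oplus>\<^bsub>V\<^esub>b\<in>B. a x b *[V] b +[V] a y b *[V] b)"
          unfolding lincomb_def by (rule M.finsum_cong') (use aB that BV in "auto simp: smult_l_distr subset_iff")
        also have "... = lincomb (a x) B +[V] lincomb (a y) B"
          unfolding lincomb_def by (rule M.finsum_addf) (use aB that BV in "auto simp: subset_iff")
        finally show "lincomb (\<lambda>b\<in>B. a x b +[K] a y b) B = x +[V] y" using a(2) that by simp
      qed (use aB that in auto)
      thus ?thesis using that by simp
    qed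
    show "a (c *[V] x) b = c **[K] a x b" if "b : B" "c : car K" "x : car V" for b c x
    proof -
      have "a (c *[V] x) = (\<lambda>b\<in>B. c **[K] a x b)"
      proof (rule eq)
        have "lincomb (\<lambda>b\<in>B. c **[K] a x b) B = lincomb (%b. c **[K] a x b) B"
          by (rule lincomb_cong) (use aB that BV in auto)
        also have "... = c *[V] lincomb (a x) B"
          by (rule lincomb_smult) (use aB that BV in auto)
        finally show "lincomb (\<lambda>b\<in>B. c **[K] a x b) B = c *[V] x" using a(2) that by simp
      qed (use aB that in auto)
      thus ?thesis using that by simp
    qed
  qed
qed

text \<open>A vector is sent to its chosen coefficients along an enumerated generating set and is
  recovered from them as a linear combination. This makes \<open>nat => 'k\<close> large enough to
  carry every finite-dimensional module.\<close>

lemma (in vectorspace) fin_dim_inj: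
  assumes "fin_dim"
  shows "EX u :: 'c => nat => 'a. inj_on u (car V)"
proof -
  obtain A where A: "finite A" "A <= car V" "span A = car V" using assms unfolding fin_dim_def by auto
  obtain e where e: "bij_betw e {0..<card A} A" using ex_bij_betw_nat_finite[OF A(1)] by blast
  have "EX a. a : A \<rightarrow> car K & lincomb a A = v" if "v : car V" for v
    using finite_in_span[OF A(1,2)] that A(3) by blast
  then obtain c where c: "!!v. v : car V ==> c v : A \<rightarrow> car K & lincomb (c v) A = v" by metis
  define u where "u v i = c v (e i)" for v i
  have "inj_on u (car V)"
  proof (rule inj_onI)
    fix x y assume xy: "x : car V" "y : car V" "u x = u y"
    have "c x b = c y b" if "b : A" for b
    proof -
      obtain i where "b = e i" using e `b : A` by (auto simp: bij_betw_def)
      thus ?thesis using xy(3) by (simp add: u_def fun_eq_iff)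
    qed
    hence "lincomb (c x) A = lincomb (c y) A"
      by (intro lincomb_cong) (use A c xy in auto)
    with c xy show "x = y" by metis
  qed
  thus ?thesis by blast
qed

section \<open>Finite-dimensional modules\<close>

locale fdalg =
  fixes K :: "'k ring" and S :: "('k, 'a) module"
  assumes fd_algebra: "fd_algebra K S"
begin

lemma vs_S: "vectorspace K S" and fin_dim_S: "vectorspace.fin_dim K S" and ring_S: "ring S"
  and smult_mult: "!!c x y. c : car K ==> x : car S ==> y : car S ==>
    (c *[S] x) **[S] y = c *[S] (x **[S] y)"
  and mult_smult: "!!c x y. c : car K ==> x : car S ==> y : car S ==>
    x **[S] (c *[S] y) = c *[S] (x **[S] y)"
  using fd_algebra unfolding fd_algebra_def by auto

sublocale S: ring S by (rule ring_S)
sublocale SV: vectorspace K S by (rule vs_S)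

lemma field_K: "field K" using SV.field.field_axioms .

lemma scal_closed: "c : car K ==> c *[S] 1[S] : car S" by simp

lemma us_simps [simp]:
  "car (us S M) = car M" "0[us S M] = 0[M]"
  "x +[us S M] y = x +[M] y" "c *[us S M] x = (sc S c) *[M] x"
  by (simp_all add: underlying_space_def)

lemma us_sub: "us S (M(|carrier := U|)) = (us S M)(|carrier := U|)"
  by (simp add: underlying_space_def)

lemma us_vs:
  assumes "left_module S M" shows "vectorspace K (us S M)"
proof (rule vectorspaceI[OF field_K])
  interpret M: left_module S M by fact
  have [simp]: "(1[K] *[S] 1[S]) = 1[S]" by simp
  show "left_module K (us S M)"
  proof (rule left_moduleI)
    show "EX y:car (us S M). y +[us S M] x = 0[us S M]"
      if "x : car (us S M)" for x
      using that by (auto intro!: bexI[of _ "-[M] x"] simp: M.M.l_neg)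
    show "(a **[K] b) *[us S M] x = a *[us S M] (b *[us S M] x)"
      if "a : car K" "b : car K" "x : car (us S M)" for a b x
    proof -
      have "(a **[K] b) *[S] 1[S] = (sc S a) **[S] (sc S b)"
        using that by (simp add: smult_mult SV.smult_assoc1)
      thus ?thesis using that by (simp add: M.smult_assoc)
    qed
  qed (use field_K in "auto simp: M.M.a_ac M.smult_closed M.smult_r_distr M.smult_one SV.smult_l_distr M.smult_l_distr
      intro: cring.axioms field.axioms domain.axioms")
qed

lemma us_hom: "f : lhom S X Y ==> f : lhom K (us S X) (us S Y)"
  by (rule left_homI) (auto simp: lhom_closed lhom_add lhom_smult)

lemma us_vs_hom:
  "left_module S X ==> left_module S Y ==> f : lhom S X Y ==>
    vs_hom K (us S X) (us S Y) f"
  by (intro vs_hom.intro vs_hom_axioms.intro us_vs us_hom)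

lemma us_submod:
  assumes "left_module S M" "sbm S M U" shows "sbm K (us S M) U"
proof -
  interpret M: left_module S M by fact
  interpret V: vectorspace K "us S M" using us_vs assms by blast
  interpret V: left_module K "us S M" by (rule V.left_module)
  show ?thesis by (rule V.submodI) (use M.submodD[OF assms(2)] in auto)
qed

abbreviation Ob :: "('a, 'm) module => bool" where "Ob M == fd_module K S M"

lemma ObD: "Ob M ==> left_module S M" "Ob M ==> vectorspace.fin_dim K (us S M)"
  by (simp_all add: fd_module_def)

text \<open>This is the dimension over \<open>K\<close>, not the composition length. It is additive
  on exact sequences and serves as the induction measure throughout.\<close>

definition len :: "('a, 'm) module => nat" where
  "len M = vectorspace.dim K (us S M)"

lemma Ob_sub: "Ob M ==> sbm S M U ==> Ob (M(|carrier := U|))"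
  unfolding fd_module_def us_sub
  using sub_left_module us_submod us_vs vectorspace.fin_dim_sub by blast

lemma Ob_surj: "Ob X ==> left_module S Y ==> f : lhom S X Y ==> f ` car X = car Y ==> Ob Y"
  unfolding fd_module_def using vs_hom.fin_dim_image[OF us_vs_hom[of X Y f]] by simp

lemma Ob_quot: "Ob X ==> sbm S X U ==> Ob (quot_module X U)"
  using Ob_surj[OF _ quot_left_module(1-3)] ObD by metis

lemma Ob_ext:
  assumes "left_module S X" "left_module S Y" "f : lhom S X Y"
    "Ob (X(|carrier := {x : car X. f x = 0[Y]}|))" "Ob (Y(|carrier := f ` car X|))"
  shows "Ob X"
  using vs_hom.fin_dim_ext[OF us_vs_hom[OF assms(1-3)]] assms unfolding fd_module_def us_sub by simp

lemma len_surj: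
  assumes "Ob X" "left_module S Y" "f : lhom S X Y"
  shows "len X = len (Y(|carrier := f ` car X|)) + len (X(|carrier := {x : car X. f x = 0[Y]}|))"
proof -
  interpret vs_hom K "us S X" "us S Y" f
    using us_vs_hom assms ObD by blast
  interpret L: linear_map K "us S X" "us S Y" f by (rule linear_map)
  have "L.im = f ` car X" "L.ker = {x : car X. f x = 0[Y]}"
    by (auto simp: L.im_def L.ker_def)
  with L.rank_nullity[OF ObD(2)[OF assms(1)]] show ?thesis unfolding len_def us_sub by simp
qed

lemma len_zero_iff: "Ob X ==> len X = 0 <-> car X = {0[X]}"
  unfolding len_def using vectorspace.dim_zero_iff[OF us_vs ObD(2)] ObD(1) by fastforce

lemma Ob_prod:
  assumes "Ob X" "Ob Y" shows "Ob (prod_module X Y)"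
proof (rule Ob_ext)
  note P = prod_left_module[OF ObD(1)[OF assms(1)] ObD(1)[OF assms(2)]]
  interpret X: left_module S X using assms ObD by auto
  interpret Y: left_module S Y using assms ObD by auto
  show "left_module S (prod_module X Y)" "left_module S X" "fst : lhom S (prod_module X Y) X"
    using P X.left_module_axioms by auto
  interpret fst: lhom_loc S "prod_module X Y" X fst by (rule lhom_locI) fact+
  have "fst ` car (prod_module X Y) = car X"
  proof -
    have "x : fst ` car (prod_module X Y)" if "x : car X" for x
      by (rule image_eqI[of _ _ "(x, 0[Y])"]) (use that in "auto simp: prod_module_def")
    thus ?thesis by (auto simp: prod_module_def)
  qed
  thus "Ob (X(|carrier := fst ` car (prod_module X Y)|))" using assms by simp
  let ?N = "{x : car (prod_module X Y). fst x = 0[X]}"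
  show "Ob ((prod_module X Y)(|carrier := ?N|))"
  proof (rule Ob_surj[OF assms(2)])
    show "left_module S ((prod_module X Y)(|carrier := ?N|))"
      by (rule sub_left_module[OF P(1) fst.submod_kernel])
    show "(%y. (0[X], y)) : lhom S Y ((prod_module X Y)(|carrier := ?N|))"
      by (rule left_homI) (auto simp: prod_module_def)
    show "(%y. (0[X], y)) ` car Y = car ((prod_module X Y)(|carrier := ?N|))"
      by (auto simp: prod_module_def)
  qed
qed

text \<open>The carriers of all modules are moved into one type, so that classes of modules can be handled as predicates.\<close>

definition uemb :: "('a, 'm) module => 'm => nat => 'k" where
  "uemb M = (SOME u. inj_on u (car M))"

definition um :: "('a, 'm) module => ('k, 'a) umodule" where
  "um M = transport_module (uemb M) M"

lemma um:
  fixes M :: "('a, 'm) module"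
  assumes "Ob M"
  shows "Ob (um M)" "uemb M : lhom S M (um M)" "bij_betw (uemb M) (car M) (car (um M))"
proof -
  have "EX u :: 'm => nat => 'k. inj_on u (car M)"
    using vectorspace.fin_dim_inj[OF us_vs ObD(2)] ObD(1) assms by force
  hence "inj_on (uemb M) (car M)" unfolding uemb_def by (rule someI_ex)
  note t = transport_left_module[OF ObD(1)[OF assms] this]
  show h: "uemb M : lhom S M (um M)" "bij_betw (uemb M) (car M) (car (um M))"
    unfolding um_def by (rule t)+
  show "Ob (um M)"
    by (rule Ob_surj[OF assms _ h(1)]) (use t(1) h(2) in "auto simp: um_def bij_betw_def")
qed

lemma um_iso:
  assumes "Ob M" shows "module_iso S M (um M)" "module_iso S (um M) M"
proof -
  show *: "module_iso S M (um M)" unfolding module_iso_def by (rule bexI[of _ "uemb M"]) (rule um(2,3)[OF assms])+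
  show "module_iso S (um M) M" by (rule module_iso_sym[OF _ _ *]) (rule ObD(1)[OF assms] ObD(1)[OF um(1)[OF assms]])+
qed

lemma zero_umodule: "EX Z :: ('k, 'a) umodule. Ob Z & car Z = {0[Z]}"
proof -
  define Z :: "('a, unit) module" where "Z = (|carrier = {()}, mult = (%x y. ()), one = (), zero = (), add = (%x y. ()), smult = (%a x. ())|)"
  have "left_module S (Z :: ('a, unit) module)" by (rule left_moduleI) (auto simp: Z_def S.ring_axioms)
  moreover have "vectorspace.fin_dim K (us S Z)"
  proof -
    interpret Z: vectorspace K "us S Z" by (rule us_vs) fact
    interpret Z: left_module K "us S Z" by (rule Z.left_module)
    have "U = car (us S Z)" if "sbm K (us S Z) U" for U
      using Z.submodD(2)[OF that] by (auto simp: Z_def)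
    thus ?thesis unfolding Z.fin_dim_iff by (intro exI[of _ "{}"]) auto
  qed
  ultimately have Z: "Ob Z" by (simp add: fd_module_def)
  interpret u: lhom_loc S Z "um Z" "uemb Z" by (rule lhom_locI[OF ObD(1)[OF Z] ObD(1)[OF um(1)[OF Z]] um(2)[OF Z]])
  have "car (um Z) = uemb Z ` {()}" using um(3)[OF Z] by (auto simp: Z_def bij_betw_def)
  also have "... = {0[um Z]}" using u.zero by (simp add: Z_def)
  finally show ?thesis using um(1)[OF Z] by blast
qed

end

section \<open>Short exact sequences\<close>

context fdalg
begin

definition ses :: "('k, 'a) umodule => _ => ('k, 'a) umodule => _ => ('k, 'a) umodule => bool" where
  "ses X f Y g Z <-> Ob X & Ob Y & Ob Z & f : lhom S X Y & g : lhom S Y Z &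
     inj_on f (car X) & g ` car Y = car Z &
     (ALL x:car X. g (f x) = 0[Z]) & (ALL y:car Y. g y = 0[Z] --> (EX x:car X. f x = y))"

definition Ses :: "('k, 'a) umodule => ('k, 'a) umodule => ('k, 'a) umodule => bool" where
  "Ses X Y Z <-> (EX f g. ses X f Y g Z)"

lemma SesI: "ses X f Y g Z ==> Ses X Y Z" unfolding Ses_def by blast

lemma sesD:
  assumes "ses X f Y g Z"
  shows "Ob X" "Ob Y" "Ob Z" "f : lhom S X Y" "g : lhom S Y Z" "inj_on f (car X)" "g ` car Y = car Z"
    "!!x. x : car X ==> g (f x) = 0[Z]"
    "!!y. y : car Y ==> g y = 0[Z] ==> EX x:car X. f x = y"
    "!!z. z : car Z ==> EX y:car Y. g y = z"
    "left_module S X" "left_module S Y" "left_module S Z"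
    "lhom_loc S X Y f" "lhom_loc S Y Z g"
proof -
  show *: "Ob X" "Ob Y" "Ob Z" "f : lhom S X Y" "g : lhom S Y Z" "inj_on f (car X)" "g ` car Y = car Z"
    "!!x. x : car X ==> g (f x) = 0[Z]"
    "!!y. y : car Y ==> g y = 0[Z] ==> EX x:car X. f x = y"
    using assms unfolding ses_def by blast+
  show "EX y:car Y. g y = z" if "z : car Z" for z
    using that *(7) by (metis imageE)
  show "left_module S X" "left_module S Y" "left_module S Z" by (rule ObD, fact)+
  thus "lhom_loc S X Y f" "lhom_loc S Y Z g" using * by (auto intro: lhom_locI)
qed

lemma hom_loc: "Ob X ==> Ob Y ==> f : lhom S X Y ==> lhom_loc S X Y f"
  by (intro lhom_locI ObD(1))

lemma sesI:
  assumes "Ob X" "Ob Y" "Ob Z" "f : lhom S X Y" "g : lhom S Y Z"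
    "!!x. x : car X ==> f x = 0[Y] ==> x = 0[X]"
    "!!z. z : car Z ==> EX y:car Y. g y = z"
    "!!x. x : car X ==> g (f x) = 0[Z]"
    "!!y. y : car Y ==> g y = 0[Z] ==> EX x:car X. f x = y"
  shows "ses X f Y g Z"
proof -
  have "inj_on f (car X)"
    using lhom_loc.inj_iff[OF hom_loc[OF assms(1,2,4)]] assms(6) by blast
  moreover have "g ` car Y = car Z"
    using assms(7) lhom_closed[OF assms(5)] by blast
  ultimately show ?thesis unfolding ses_def using assms by blast
qed

lemma ses_ker:
  assumes "Ob Y" "Ob Z" "g : lhom S Y Z" "g ` car Y = car Z"
  shows "ses (Y(|carrier := {y : car Y. g y = 0[Z]}|)) (%x. x) Y g Z"
proof -
  interpret g: lhom_loc S Y Z g by (rule hom_loc) fact+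
  show ?thesis
    unfolding ses_def by (use assms Ob_sub[OF assms(1) g.submod_kernel] incl_left_hom[OF g.submod_kernel] ObD(1) in auto)
qed

text \<open>The quotient module lives on sets of elements, so \<open>um\<close> brings it back to
  the common carrier type before it can be the third term.\<close>

lemma ses_coker:
  assumes "Ob X" "Ob Y" "f : lhom S X Y" "inj_on f (car X)"
  obtains Z g where "ses X f Y g Z"
proof -
  interpret f: lhom_loc S X Y f by (rule hom_loc) fact+
  have U: "sbm S Y (f ` car X)" by (rule f.submod_image[OF f.X.submod_carrier])
  let ?Q = "quot_module Y (f ` car X)"
  note q = quot_left_module[OF ObD(1)[OF assms(2)] U]
  note u = um[OF Ob_quot[OF assms(2) U]]
  interpret u: lhom_loc S ?Q "um ?Q" "uemb ?Q" by (rule hom_loc[OF Ob_quot[OF assms(2) U] u(1,2)])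
  define g where "g y = uemb ?Q (f ` car X +>\<^bsub>Y\<^esub> y)" for y
  have g: "g : lhom S Y (um ?Q)" unfolding g_def by (rule lhom_comp[OF q(2) u(2)])
  have gz: "g y = 0[um ?Q] <-> y : f ` car X" if "y : car Y" for y
  proof -
    have "f ` car X +>\<^bsub>Y\<^esub> y : car ?Q" using q(3) that by blast
    hence "g y = 0[um ?Q] <-> f ` car X +>\<^bsub>Y\<^esub> y = 0[?Q]"
      unfolding g_def using u(3) u.inj_iff u.zero by (auto simp: bij_betw_def)
    with q(4)[OF that] show ?thesis by simp
  qed
  have "g ` car Y = car (um ?Q)"
  proof -
    have "g ` car Y = uemb ?Q ` ((%y. f ` car X +>\<^bsub>Y\<^esub> y) ` car Y)" unfolding g_def image_image ..
    thus ?thesis using q(3) u(3) by (simp add: bij_betw_def)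
  qed
  hence "ses X f Y g (um ?Q)"
    unfolding ses_def using assms u(1) g gz by auto
  thus thesis by (rule that)
qed

lemma img_factor:
  assumes "Ob X" "Ob Y" "f : lhom S X Y"
  shows "Ob (Y(|carrier := f ` car X|))" "f : lhom S X (Y(|carrier := f ` car X|))"
    "(%x. x) : lhom S (Y(|carrier := f ` car X|)) Y"
proof -
  interpret f: lhom_loc S X Y f by (rule hom_loc) fact+
  have U: "sbm S Y (f ` car X)" by (rule f.submod_image[OF f.X.submod_carrier])
  show "Ob (Y(|carrier := f ` car X|))" "(%x. x) : lhom S (Y(|carrier := f ` car X|)) Y"
    using Ob_sub[OF assms(2) U] incl_left_hom[OF U] ObD assms by auto
  show "f : lhom S X (Y(|carrier := f ` car X|))" by (rule left_homI) auto
qed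

definition biprod :: "('k, 'a) umodule => ('k, 'a) umodule => ('k, 'a) umodule => _ => _ => _ => _ => bool" where
  "biprod X Y B i j p q <-> Ob B & i : lhom S X B & j : lhom S Y B & p : lhom S B X & q : lhom S B Y &
    (ALL x:car X. p (i x) = x) & (ALL x:car X. q (i x) = 0[Y]) &
    (ALL y:car Y. q (j y) = y) & (ALL y:car Y. p (j y) = 0[X]) &
    (ALL b:car B. i (p b) +[B] j (q b) = b)"

lemma biprodD:
  assumes "biprod X Y B i j p q"
  shows "Ob B" "i : lhom S X B" "j : lhom S Y B" "p : lhom S B X" "q : lhom S B Y"
    "!!x. x : car X ==> p (i x) = x" "!!x. x : car X ==> q (i x) = 0[Y]"
    "!!y. y : car Y ==> q (j y) = y" "!!y. y : car Y ==> p (j y) = 0[X]"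
    "!!b. b : car B ==> i (p b) +[B] j (q b) = b"
  using assms unfolding biprod_def by blast+

lemma biproduct:
  fixes X Y :: "('k, 'a) umodule"
  assumes "Ob X" "Ob Y"
  obtains B i j p q where "biprod X Y B i j p q"
proof -
  let ?P = "prod_module X Y"
  note P = prod_left_module[OF ObD(1)[OF assms(1)] ObD(1)[OF assms(2)]]
  note oP = Ob_prod[OF assms]
  interpret X: left_module S X by (rule ObD) fact
  interpret Y: left_module S Y by (rule ObD) fact
  note u = um[OF oP]
  obtain v where v: "v : lhom S (um ?P) ?P" "!!x. x : car ?P ==> v (uemb ?P x) = x"
    "!!y. y : car (um ?P) ==> uemb ?P (v y) = y"
    using lhom_inverse_ex[OF P(1) ObD(1)[OF u(1)] u(2,3)] by blast
  interpret u: lhom_loc S ?P "um ?P" "uemb ?P" by (rule hom_loc[OF oP u(1,2)])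
  have c: "car ?P = car X \<times> car Y" by (simp add: prod_module_def)
  show thesis
  proof (rule that[of "um ?P" "%x. uemb ?P (x, 0[Y])" "%y. uemb ?P (0[X], y)" "%b. fst (v b)" "%b. snd (v b)"], unfold biprod_def, intro conjI ballI)
    show "Ob (um ?P)" by fact
    show "(%x. uemb ?P (x, 0[Y])) : lhom S X (um ?P)" by (rule lhom_comp[OF P(4) u(2)])
    show "(%x. uemb ?P (0[X], x)) : lhom S Y (um ?P)" by (rule lhom_comp[OF P(5) u(2)])
    show "(%x. fst (v x)) : lhom S (um ?P) X" by (rule lhom_comp[OF v(1) P(2)])
    show "(%x. snd (v x)) : lhom S (um ?P) Y" by (rule lhom_comp[OF v(1) P(3)])
    show "uemb ?P (fst (v b), 0[Y]) +[um ?P] uemb ?P (0[X], snd (v b)) = b" if b: "b : car (um ?P)" for b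
    proof -
      have "v b : car ?P" using v(1) b lhom_closed by metis
      hence vb: "fst (v b) : car X" "snd (v b) : car Y" by (auto simp: c)
      hence "uemb ?P (fst (v b), 0[Y]) +[um ?P] uemb ?P (0[X], snd (v b)) =
         uemb ?P ((fst (v b), 0[Y]) +[?P] (0[X], snd (v b)))" by (subst u.add) (auto simp: c)
      also have "(fst (v b), 0[Y]) +[?P] (0[X], snd (v b)) = v b" using vb by (simp add: prod_module_def)
      finally show ?thesis using v(3)[OF b] by simp
    qed
  qed (auto simp: v(2) c)
qed

text \<open>The pullback of \<open>g\<close> and \<open>h\<close>, with its elementwise description
  and its universal property side by side, because exactness arguments use the first and
  constructions of maps the second.\<close>

definition pb :: "('k, 'a) umodule => _ => ('k, 'a) umodule => _ => ('k, 'a) umodule => _ => _ => bool" where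
  "pb Y g W h B a b <-> Ob B & a : lhom S B Y & b : lhom S B W & (ALL x:car B. g (a x) = h (b x)) &
    (ALL y:car Y. ALL w:car W. g y = h w --> (EX x:car B. a x = y & b x = w)) &
    (ALL x:car B. a x = 0[Y] --> b x = 0[W] --> x = 0[B]) &
    (ALL (V :: ('k, 'a) umodule) u v. Ob V --> u : lhom S V Y --> v : lhom S V W -->
       (ALL x:car V. g (u x) = h (v x)) --> (EX k:lhom S V B. ALL x:car V. a (k x) = u x & b (k x) = v x))"

lemma pbD:
  assumes "pb Y g W h B a b"
  shows "Ob B" "a : lhom S B Y" "b : lhom S B W" "!!x. x : car B ==> g (a x) = h (b x)"
    "!!y w. y : car Y ==> w : car W ==> g y = h w ==> EX x:car B. a x = y & b x = w"
    "!!x. x : car B ==> a x = 0[Y] ==> b x = 0[W] ==> x = 0[B]"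
    "!!(V :: ('k, 'a) umodule) u v. Ob V ==> u : lhom S V Y ==> v : lhom S V W ==> (!!x. x : car V ==> g (u x) = h (v x)) ==>
       EX k:lhom S V B. ALL x:car V. a (k x) = u x & b (k x) = v x"
proof -
  note c = assms[unfolded pb_def]
  show "Ob B" "a : lhom S B Y" "b : lhom S B W" using c by simp_all
  show "!!x. x : car B ==> g (a x) = h (b x)"
    using c by simp
  show "!!y w. y : car Y ==> w : car W ==> g y = h w ==> EX x:car B. a x = y & b x = w"
    using c by simp
  show "!!x. x : car B ==> a x = 0[Y] ==> b x = 0[W] ==> x = 0[B]"
    using c by simp
  show "EX k:lhom S V B. ALL x:car V. a (k x) = u x & b (k x) = v x"
    if "Ob V" "u : lhom S V Y" "v : lhom S V W" "!!x. x : car V ==> g (u x) = h (v x)" for V :: "('k, 'a) umodule" and u v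
    using c[THEN conjunct2, THEN conjunct2, THEN conjunct2, THEN conjunct2, THEN conjunct2, THEN conjunct2] that
    by blast
qed

lemma pullback:
  assumes "Ob Y" "Ob W" "Ob (Z :: ('k, 'a) umodule)" "g : lhom S Y Z" "h : lhom S W Z"
  obtains B a b where "pb Y g W h B a b"
proof -
  obtain D i j p q where D': "biprod Y W D i j p q" using biproduct[OF assms(1,2)] .
  note D = biprodD[OF D']
  interpret i: lhom_loc S Y D i by (rule hom_loc) fact+
  interpret j: lhom_loc S W D j by (rule hom_loc) fact+
  interpret p: lhom_loc S D Y p by (rule hom_loc) fact+
  interpret q: lhom_loc S D W q by (rule hom_loc) fact+
  interpret g: lhom_loc S Y Z g by (rule hom_loc) fact+
  interpret h: lhom_loc S W Z h by (rule hom_loc) fact+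
  define d where "d x = g (p x) -[Z] h (q x)" for x
  have d: "d : lhom S D Z" unfolding d_def
    by (intro lhom_minus lhom_comp[OF D(4) assms(4)] lhom_comp[OF D(5) assms(5)]) (rule ObD, fact)
  interpret d: lhom_loc S D Z d by (rule hom_loc) fact+
  define U where "U = {x : car D. d x = 0[Z]}"
  have U: "sbm S D U" unfolding U_def by (rule d.submod_kernel)
  have Ui: "x : U <-> x : car D & g (p x) = h (q x)" for x
    by (auto simp: U_def d_def)
  have inD: "i y +[D] j w : U & p (i y +[D] j w) = y & q (i y +[D] j w) = w"
    if "y : car Y" "w : car W" "g y = h w" for y w
    unfolding Ui using that by (simp add: D(6-9))
  show thesis
  proof (rule that[of "D(|carrier := U|)" p q], unfold pb_def, intro conjI ballI allI impI)
    show "Ob (D(|carrier := U|))" by (rule Ob_sub[OF D(1) U])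
    show "p : lhom S (D(|carrier := U|)) Y" "q : lhom S (D(|carrier := U|)) W"
      using lhom_comp[OF incl_left_hom[OF U ObD(1)[OF D(1)]] D(4)] lhom_comp[OF incl_left_hom[OF U ObD(1)[OF D(1)]] D(5)] by auto
    show "EX x:car (D(|carrier := U|)). p x = y & q x = w" if "y : car Y" "w : car W" "g y = h w" for y w
      using inD[OF that] by auto
    show "x = 0[D(|carrier := U|)]" if "x : car (D(|carrier := U|))" "p x = 0[Y]" "q x = 0[W]" for x
      using D(10)[of x] that by (auto simp: Ui)
    show "EX k:lhom S V (D(|carrier := U|)). ALL x:car V. p (k x) = u x & q (k x) = v x"
      if V: "Ob V" "u : lhom S V Y" "v : lhom S V W" "ALL x:car V. g (u x) = h (v x)" for V :: "('k, 'a) umodule" and u v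
    proof (rule bexI[of _ "%x. i (u x) +[D] j (v x)"])
      have *: "(%x. i (u x) +[D] j (v x)) : lhom S V D"
        by (intro lhom_plus lhom_comp[OF V(2) D(2)] lhom_comp[OF V(3) D(3)]) (rule ObD, fact)
      have **: "i (u x) +[D] j (v x) : U & p (i (u x) +[D] j (v x)) = u x & q (i (u x) +[D] j (v x)) = v x"
        if "x : car V" for x
        by (rule inD) (use that V lhom_closed in metis)+
      thus "ALL x:car V. p (i (u x) +[D] j (v x)) = u x & q (i (u x) +[D] j (v x)) = v x" by blast
      show "(%x. i (u x) +[D] j (v x)) : lhom S V (D(|carrier := U|))"
        by (rule left_homI) (use ** left_homD[OF *] in auto)
    qed
  qed (auto simp: Ui)
qed

text \<open>The pushout of \<open>f\<close> and \<open>h\<close>. Among the elementwise clauses, the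
  one on \<open>a y = b w\<close> says that the images of \<open>Y\<close> and \<open>W\<close> meet
  only in what comes from \<open>X\<close>.\<close>

definition po :: "('k, 'a) umodule => _ => ('k, 'a) umodule => _ => ('k, 'a) umodule => ('k, 'a) umodule => _ => _ => bool" where
  "po X f Y h W B a b <-> Ob B & a : lhom S Y B & b : lhom S W B & (ALL x:car X. a (f x) = b (h x)) &
    (ALL z:car B. EX y:car Y. EX w:car W. z = a y +[B] b w) &
    (ALL y:car Y. ALL w:car W. a y = b w --> (EX x:car X. y = f x & w = h x)) &
    (ALL (V :: ('k, 'a) umodule) u v. Ob V --> u : lhom S Y V --> v : lhom S W V -->
       (ALL x:car X. u (f x) = v (h x)) --> (EX k:lhom S B V. (ALL y:car Y. k (a y) = u y) & (ALL w:car W. k (b w) = v w)))"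

lemma poD:
  assumes "po X f Y h W B a b"
  shows "Ob B" "a : lhom S Y B" "b : lhom S W B" "!!x. x : car X ==> a (f x) = b (h x)"
    "!!z. z : car B ==> EX y:car Y. EX w:car W. z = a y +[B] b w"
    "!!y w. y : car Y ==> w : car W ==> a y = b w ==> EX x:car X. y = f x & w = h x"
    "!!(V :: ('k, 'a) umodule) u v. Ob V ==> u : lhom S Y V ==> v : lhom S W V ==> (!!x. x : car X ==> u (f x) = v (h x)) ==>
       EX k:lhom S B V. (ALL y:car Y. k (a y) = u y) & (ALL w:car W. k (b w) = v w)"
proof -
  note c = assms[unfolded po_def]
  show "Ob B" "a : lhom S Y B" "b : lhom S W B" using c by simp_all
  show "!!x. x : car X ==> a (f x) = b (h x)"
    using c by simp
  show "!!z. z : car B ==> EX y:car Y. EX w:car W. z = a y +[B] b w"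
    using c by simp
  show "!!y w. y : car Y ==> w : car W ==> a y = b w ==> EX x:car X. y = f x & w = h x"
    using c by simp
  show "EX k:lhom S B V. (ALL y:car Y. k (a y) = u y) & (ALL w:car W. k (b w) = v w)"
    if "Ob V" "u : lhom S Y V" "v : lhom S W V" "!!x. x : car X ==> u (f x) = v (h x)" for V :: "('k, 'a) umodule" and u v
    using c[THEN conjunct2, THEN conjunct2, THEN conjunct2, THEN conjunct2, THEN conjunct2, THEN conjunct2] that
    by blast
qed

lemma pushout:
  assumes "Ob X" "Ob Y" "Ob W" "f : lhom S X Y" "h : lhom S X W"
    and inj: "inj_on f (car X)"
  obtains B a b where "po X f Y h W B a b"
proof -
  obtain D i j p q where D': "biprod Y W D i j p q" using biproduct[OF assms(2,3)] .
  note D = biprodD[OF D']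
  interpret i: lhom_loc S Y D i by (rule hom_loc) fact+
  interpret j: lhom_loc S W D j by (rule hom_loc) fact+
  interpret p: lhom_loc S D Y p by (rule hom_loc) fact+
  interpret q: lhom_loc S D W q by (rule hom_loc) fact+
  interpret f: lhom_loc S X Y f by (rule hom_loc) fact+
  interpret h: lhom_loc S X W h by (rule hom_loc) fact+
  \<comment> \<open>The pushout is the cokernel of the antidiagonal map. Injectivity of
    \<open>f\<close> makes \<open>d\<close> injective, so that \<open>ses_coker\<close>
    applies.\<close>
  define d where "d x = i (f x) -[D] j (h x)" for x
  have d: "d : lhom S X D" unfolding d_def
    by (intro lhom_minus lhom_comp[OF assms(4) D(2)] lhom_comp[OF assms(5) D(3)]) (rule ObD, fact)
  interpret d: lhom_loc S X D d by (rule hom_loc) fact+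
  have pd: "p (d x) = f x" "q (d x) = -[W] h x" if "x : car X" for x
    using that by (auto simp: d_def D(6-9) a_minus_def)
  have "inj_on d (car X)"
  proof (rule inj_onI)
    fix x y assume "x : car X" "y : car X" "d x = d y"
    hence "f x = f y" using pd(1)[of x] pd(1)[of y] by simp
    thus "x = y" using inj `x : _` `y : _` by (simp add: inj_on_def)
  qed
  then obtain B c where B: "ses X d D c B" using ses_coker[OF assms(1) D(1) d] by blast
  note B' = sesD[OF B]
  interpret c: lhom_loc S D B c by (rule B'(15))
  show thesis
  proof (rule that[of B "%y. c (i y)" "%w. c (j w)"], unfold po_def, intro conjI ballI allI impI)
    show "Ob B" by (rule B')
    show "(%y. c (i y)) : lhom S Y B" "(%w. c (j w)) : lhom S W B"
      by (rule lhom_comp[OF D(2) B'(5)], rule lhom_comp[OF D(3) B'(5)])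
    show "c (i (f x)) = c (j (h x))" if "x : car X" for x
    proof -
      have "c (i (f x)) -[B] c (j (h x)) = 0[B]"
        using B'(8)[OF that] that by (simp add: d_def)
      thus ?thesis using that by simp
    qed
    show "EX y:car Y. EX w:car W. z = c (i y) +[B] c (j w)" if z: "z : car B" for z
    proof -
      obtain x where x: "x : car D" "c x = z" using B'(10)[OF z] by blast
      have "c (i (p x) +[D] j (q x)) = c (i (p x)) +[B] c (j (q x))" using x(1) by (intro c.add) auto
      hence "z = c (i (p x)) +[B] c (j (q x))" using D(10)[OF x(1)] x(2) by simp
      thus ?thesis using x by blast
    qed
    show "EX x:car X. y = f x & w = h x" if yw: "y : car Y" "w : car W" "c (i y) = c (j w)" for y w
    proof -
      have "c (i y -[D] j w) = 0[B]" using yw by simp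
      then obtain x where x: "x : car X" "d x = i y -[D] j w" using B'(9)[of "i y -[D] j w"] yw by auto
      have "p (d x) = y" "q (d x) = -[W] w" unfolding x(2) using yw by (auto simp: D(6-9) a_minus_def)
      hence y: "y = f x" and w: "-[W] w = -[W] h x" using pd[OF x(1)] by auto
      have "w = -[W] (-[W] w)" by (rule sym, rule j.X.M.minus_minus, rule yw)
      also have "... = h x" unfolding w by (rule j.X.M.minus_minus, rule h.closed, rule x)
      finally have "w = h x" .
      with y have "y = f x & w = h x" by blast
      with x show ?thesis by blast
    qed
    show "EX k:lhom S B V. (ALL y:car Y. k (c (i y)) = u y) & (ALL w:car W. k (c (j w)) = v w)"
      if V: "Ob V" "u : lhom S Y V" "v : lhom S W V" "ALL x:car X. u (f x) = v (h x)" for V :: "('k, 'a) umodule" and u v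
    proof -
      interpret u: lhom_loc S Y V u by (rule hom_loc) fact+
      interpret v: lhom_loc S W V v by (rule hom_loc) fact+
      define t where "t x = u (p x) +[V] v (q x)" for x
      have t: "t : lhom S D V" unfolding t_def
        by (intro lhom_plus lhom_comp[OF D(4) V(2)] lhom_comp[OF D(5) V(3)]) (rule ObD, fact)
      have "EX k:lhom S B V. ALL y:car D. k (c y) = t y"
      proof (rule factor_epi)
        show "left_module S D" "left_module S B" "left_module S V" using B' V ObD by auto
        show "c : lhom S D B" "c ` car D = car B" "t : lhom S D V" by fact+
        show "t y = 0[V]" if y: "y : car D" "c y = 0[B]" for y
        proof -
          obtain x where x: "x : car X" "d x = y" using B'(9)[OF y] by blast
          have "t y = u (f x) +[V] v (-[W] h x)" unfolding x(2)[symmetric] t_def using pd[OF x(1)] by simp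
          also have "... = 0[V]" using V(4)[THEN bspec, OF x(1)] x(1) by (simp add: u.Y.M.r_neg)
          finally show ?thesis .
        qed
      qed
      then obtain k where k: "k : lhom S B V" "!!y. y : car D ==> k (c y) = t y" by blast
      thus ?thesis by (intro bexI[of _ k]) (auto simp: t_def D(6-9))
    qed
  qed
qed

end

context fdalg
begin

lemma hom_factor_epi:
  fixes W :: "('k, 'a) umodule"
  assumes "ses X f Y g Z" "Ob W" "h : lhom S Y W" "!!x. x : car X ==> h (f x) = 0[W]"
  obtains k where "k : lhom S Z W" "ALL y:car Y. k (g y) = h y"
proof -
  note s = sesD[OF assms(1)]
  have "EX k:lhom S Z W. ALL y:car Y. k (g y) = h y"
  proof (rule factor_epi[OF s(12,13) ObD(1)[OF assms(2)] s(5,7) assms(3)])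
    fix y assume "y : car Y" "g y = 0[Z]"
    then obtain x where "x : car X" "f x = y" using s(9) by blast
    thus "h y = 0[W]" using assms(4) by blast
  qed
  thus thesis using that by blast
qed

lemma hom_factor_mono:
  fixes W :: "('k, 'a) umodule"
  assumes "ses X f Y g Z" "Ob W" "h : lhom S W Y" "!!w. w : car W ==> g (h w) = 0[Z]"
  obtains k where "k : lhom S W X" "ALL w:car W. f (k w) = h w"
proof -
  note s = sesD[OF assms(1)]
  have "EX k:lhom S W X. ALL w:car W. f (k w) = h w"
  proof (rule factor_mono[OF s(11,12,4,6) assms(3) ObD(1)[OF assms(2)]])
    fix w assume w: "w : car W"
    hence "EX x:car X. f x = h w" using s(9)[OF lhom_closed[OF assms(3) w] assms(4)[OF w]] by simp
    thus "h w : f ` car X" by force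
  qed
  thus thesis using that by blast
qed

lemma ses_biprod:
  assumes "biprod X Y B i j p q" "Ob X" "Ob Y"
  shows "ses X i B q Y"
proof -
  note D = biprodD[OF assms(1)]
  interpret j: lhom_loc S Y B j by (rule hom_loc) fact+
  interpret p: lhom_loc S B X p by (rule hom_loc) fact+
  show ?thesis
  proof (rule sesI)
    show "x = 0[X]" if "x : car X" "i x = 0[B]" for x
      using D(6)[OF that(1)] that(2) by simp
    show "EX y:car B. q y = z" if "z : car Y" for z using D(8) that by (auto intro!: bexI[of _ "j z"])
    show "EX x:car X. i x = y" if "y : car B" "q y = 0[Y]" for y
    proof (rule bexI[of _ "p y"])
      show "i (p y) = y" using D(10)[OF that(1)] that lhom_closed[OF D(2), of "p y"] by simp
    qed (use that in auto)
  qed (use D assms in auto)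
qed

section \<open>Vanishing of first extension groups\<close>

text \<open>Ext^1(X, Y) = 0 in Yoneda form: every extension of \<open>X\<close> by \<open>Y\<close>
  splits. The exact sequences of Ext are replaced by the lifting and extension lemmas below.\<close>

definition Ev :: "('k, 'a) umodule => ('k, 'a) umodule => bool" where
  "Ev X Y <-> (ALL B i p. ses Y i B p X --> (EX r:lhom S B Y. ALL y:car Y. r (i y) = y))"

lemma EvD: "Ev X Y ==> ses Y i B p X ==> EX r:lhom S B Y. ALL y:car Y. r (i y) = y"
  unfolding Ev_def by blast

lemma section_of_retraction:
  assumes s: "ses Y i B p X" and r: "r : lhom S B Y" "!!y. y : car Y ==> r (i y) = y"
  obtains k where "k : lhom S X B" "ALL x:car X. p (k x) = x" "ALL x:car X. r (k x) = 0[Y]"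
    "ALL b:car B. i (r b) +[B] k (p b) = b"
proof -
  note D = sesD[OF s]
  interpret i: lhom_loc S Y B i by (rule D)
  interpret p: lhom_loc S B X p by (rule D)
  interpret r: lhom_loc S B Y r by (rule hom_loc) fact+
  define h where "h b = b -[B] i (r b)" for b
  have h: "h : lhom S B B" unfolding h_def
    by (intro lhom_minus lhom_id lhom_comp[OF r(1) D(4)] D(12))
  have "h (i y) = 0[B]" if "y : car Y" for y using that r(2) by (simp add: h_def)
  then obtain k where k: "k : lhom S X B" "ALL b:car B. k (p b) = h b"
    using hom_factor_epi[OF s D(2) h] by metis
  have pk: "p (k x) = x" "r (k x) = 0[Y]" if x: "x : car X" for x
  proof -
    obtain b where b: "b : car B" "p b = x" using D(10)[OF x] by blast
    hence "k x = h b" using k(2) by blast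
    thus "p (k x) = x" "r (k x) = 0[Y]" using x b D(8)[of "r b"] r(2)[of "r b"]
      by (simp_all add: h_def a_minus_def i.X.M.r_neg)
  qed
  have "i (r b) +[B] k (p b) = b" if b: "b : car B" for b
    using k(2) b i.Y.minus_add_cancel[of b "i (r b)"] by (simp add: h_def i.Y.M.a_comm)
  with pk k(1) show thesis using that by blast
qed

lemma retraction_of_section:
  assumes s: "ses Y i B p X" and k: "k : lhom S X B" "!!x. x : car X ==> p (k x) = x"
  obtains r where "r : lhom S B Y" "ALL y:car Y. r (i y) = y"
proof -
  note D = sesD[OF s]
  interpret i: lhom_loc S Y B i by (rule D)
  interpret p: lhom_loc S B X p by (rule D)
  interpret k: lhom_loc S X B k by (rule hom_loc) fact+
  define h where "h b = b -[B] k (p b)" for b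
  have h: "h : lhom S B B" unfolding h_def
    by (intro lhom_minus lhom_id lhom_comp[OF D(5) k(1)] D(12))
  have "p (h b) = 0[X]" if "b : car B" for b using that k(2) by (simp add: h_def)
  then obtain r where r: "r : lhom S B Y" "ALL b:car B. i (r b) = h b"
    using hom_factor_mono[OF s D(2) h] by metis
  have "r (i y) = y" if y: "y : car Y" for y
  proof -
    have "i (r (i y)) = i y" using r(2) y D(8)[OF y] by (simp add: h_def a_minus_def)
    thus ?thesis using D(6) y lhom_closed[OF r(1), of "i y"] by (simp add: inj_on_def)
  qed
  with r(1) that show thesis by blast
qed

lemma EvI_section:
  assumes "!!B i p. ses Y i B p X ==> EX k:lhom S X B. ALL x:car X. p (k x) = x"
  shows "Ev X Y"
  unfolding Ev_def
proof (intro allI impI)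
  fix B i p assume s: "ses Y i B p X"
  from assms[OF s] obtain k where k: "k : lhom S X B" "!!x. x : car X ==> p (k x) = x" by blast
  show "EX r:lhom S B Y. ALL y:car Y. r (i y) = y" by (rule retraction_of_section[OF s k]) blast+
qed

lemma Ev_section:
  assumes "Ev X Y" "ses Y i B p X"
  shows "EX k:lhom S X B. ALL x:car X. p (k x) = x"
proof -
  obtain r where r: "r : lhom S B Y" "!!y. y : car Y ==> r (i y) = y" using EvD[OF assms] by blast
  show ?thesis by (rule section_of_retraction[OF assms(2) r]) blast+
qed

text \<open>The part Hom(B, Y) -> Hom(A, Y) -> Ext^1(X, Y) of the long exact sequence. Pushing out
  along \<open>h\<close> gives an extension of \<open>X\<close> by \<open>Y\<close>; its retraction,
  restricted to \<open>B\<close>, extends \<open>h\<close>.\<close>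

lemma Ev_extend:
  assumes E: "Ev X Y" and s: "ses A i B p X" and Y: "Ob Y" and h: "h : lhom S A Y"
  shows "EX k:lhom S B Y. ALL a:car A. k (i a) = h a"
proof -
  note D = sesD[OF s]
  interpret i: lhom_loc S A B i by (rule D)
  interpret p: lhom_loc S B X p by (rule D)
  interpret h: lhom_loc S A Y h by (rule hom_loc) fact+
  obtain C a b where C': "po A i B h Y C a b" using pushout[OF D(1,2) Y D(4) h D(6)] .
  note C = poD(1-6)[OF C'] and univ = poD(7)[OF C']
  interpret a: lhom_loc S B C a by (rule hom_loc) fact+
  interpret b: lhom_loc S Y C b by (rule hom_loc) fact+
  obtain q where q: "q : lhom S C X" "ALL y:car B. q (a y) = p y" "ALL w:car Y. q (b w) = 0[X]"
    using univ[OF D(3) D(5) lhom_zero[OF D(13)]] D(8) by auto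
  interpret q: lhom_loc S C X q by (rule hom_loc) fact+
  have "ses Y b C q X"
  proof (rule sesI)
    show "y = 0[Y]" if y: "y : car Y" "b y = 0[C]" for y
    proof -
      obtain x where x: "x : car A" "0[B] = i x" "y = h x"
        using C(6)[of "0[B]" y] y by auto
      hence "x = 0[A]" using D(6) i.inj_iff by metis
      with x show ?thesis by simp
    qed
    show "EX y:car C. q y = z" if z: "z : car X" for z
      using D(10)[OF z] q(2) a.closed by metis
    show "EX y:car Y. b y = z" if z: "z : car C" "q z = 0[X]" for z
    proof -
      obtain y w where yw: "y : car B" "w : car Y" "z = a y +[C] b w" using C(5)[OF z(1)] by blast
      hence "p y = 0[X]" using z(2) q by simp
      then obtain x where x: "x : car A" "i x = y" using D(9)[OF yw(1)] by blast
      have "z = b (h x +[Y] w)" using yw x C(4)[OF x(1)] by simp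
      thus ?thesis using yw x by blast
    qed
  qed (use C q Y D in auto)
  then obtain r where r: "r : lhom S C Y" "ALL y:car Y. r (b y) = y" using EvD[OF E] by blast
  have "ALL x:car A. r (a (i x)) = h x" using C(4) r(2) by simp
  thus ?thesis using lhom_comp[OF C(2) r(1)] by (intro bexI[of _ "%x. r (a x)"]) auto
qed

text \<open>Dual to \<open>Ev_extend\<close>: the sequence is pulled back along \<open>h\<close>,
  and a section of the pullback is a lift.\<close>

lemma Ev_lift:
  assumes E: "Ev X Y" and s: "ses Y i B p C" and X: "Ob X" and h: "h : lhom S X C"
  shows "EX k:lhom S X B. ALL x:car X. p (k x) = h x"
proof -
  note D = sesD[OF s]
  interpret i: lhom_loc S Y B i by (rule D)
  interpret p: lhom_loc S B C p by (rule D)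
  interpret h: lhom_loc S X C h by (rule hom_loc) fact+
  obtain Q a b where Q': "pb B p X h Q a b" using pullback[OF D(2) X D(3) D(5) h] .
  note Q = pbD(1-6)[OF Q'] and univ = pbD(7)[OF Q']
  interpret a: lhom_loc S Q B a by (rule hom_loc) fact+
  interpret b: lhom_loc S Q X b by (rule hom_loc) fact+
  obtain j where j: "j : lhom S Y Q" "ALL x:car Y. a (j x) = i x & b (j x) = 0[X]"
    using univ[OF D(1) D(4) lhom_zero[OF ObD(1)[OF X]]] D(8) by auto
  interpret j: lhom_loc S Y Q j by (rule hom_loc) fact+
  have "ses Y j Q b X"
  proof (rule sesI)
    show "y = 0[Y]" if y: "y : car Y" "j y = 0[Q]" for y
    proof -
      have "i y = 0[B]" using j(2) y a.zero by metis
      thus ?thesis using D(6) i.inj_iff y by blast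
    qed
    show "EX y:car Q. b y = z" if z: "z : car X" for z
    proof -
      obtain y where "y : car B" "p y = h z" using D(10)[of "h z"] z by auto
      thus ?thesis using Q(5)[of y z] z by blast
    qed
    show "EX y:car Y. j y = z" if z: "z : car Q" "b z = 0[X]" for z
    proof -
      have "p (a z) = 0[C]" using Q(4)[OF z(1)] z(2) by simp
      then obtain y where y: "y : car Y" "i y = a z" using D(9)[of "a z"] z by auto
      have "z -[Q] j y = 0[Q]" by (rule Q(6)) (use y z j(2) in auto)
      thus ?thesis using y z by (intro bexI[of _ y]) auto
    qed
  qed (use Q j X D in auto)
  from Ev_section[OF E this] obtain k where k: "k : lhom S X Q" "ALL x:car X. b (k x) = x" by blast
  have "ALL x:car X. p (a (k x)) = h x" using Q(4) k lhom_closed[OF k(1)] by simp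
  thus ?thesis using lhom_comp[OF k(1) Q(2)] by (intro bexI[of _ "%x. a (k x)"]) auto
qed

lemma Ev_projective:
  assumes P: "Proj K S P" and "Ob Y" shows "Ev P Y"
proof (rule EvI_section)
  fix B i p assume s: "ses Y i B p P"
  note D = sesD[OF s]
  show "EX k:lhom S P B. ALL x:car P. p (k x) = x"
    using P D(2,3,5,7) lhom_id[of S P] unfolding projective_module_def by blast
qed

lemma Ev_injective:
  assumes I: "Inj K S I" shows "Ev X I"
  unfolding Ev_def
proof (intro allI impI)
  fix B i p assume s: "ses I i B p X"
  note D = sesD[OF s]
  show "EX r:lhom S B I. ALL y:car I. r (i y) = y"
    using I D(1,2,4,6) lhom_id[of S I] unfolding injective_module_def by blast
qed

lemma projective_lift:
  fixes M N :: "('k, 'a) umodule"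
  assumes "Proj K S P" "Ob M" "Ob N" "g : lhom S M N" "g ` car M = car N" "h : lhom S P N"
  shows "EX k:lhom S P M. ALL x:car P. g (k x) = h x"
  using assms unfolding projective_module_def by blast

lemma injective_extend:
  fixes M N :: "('k, 'a) umodule"
  assumes "Inj K S I" "Ob M" "Ob N" "g : lhom S M N" "inj_on g (car M)" "h : lhom S M I"
  shows "EX k:lhom S N I. ALL x:car M. k (g x) = h x"
  using assms unfolding injective_module_def by blast

text \<open>The part Hom(P, Y) -> Hom(K', Y) -> Ext^1(X, Y) -> Ext^1(P, Y) = 0: if the first arrow
  is onto, the third group vanishes.\<close>

lemma Ev_from_extend:
  assumes s: "ses K' i P p X" and E: "Ev P Y" and Y: "Ob Y"
    and ext: "!!h. h : lhom S K' Y ==> EX k:lhom S P Y. ALL x:car K'. k (i x) = h x"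
  shows "Ev X Y"
proof (rule EvI_section)
  fix B j q assume t: "ses Y j B q X"
  note D = sesD[OF s] and D' = sesD[OF t]
  interpret i: lhom_loc S K' P i by (rule D)
  interpret j: lhom_loc S Y B j by (rule D')
  interpret q: lhom_loc S B X q by (rule D')
  obtain l where l: "l : lhom S P B" "ALL x:car P. q (l x) = p x" using Ev_lift[OF E t D(2) D(5)] by blast
  interpret l: lhom_loc S P B l by (rule hom_loc) fact+
  have "q (l (i x)) = 0[X]" if "x : car K'" for x using l(2) D(8) that by simp
  then obtain h where h: "h : lhom S K' Y" "ALL x:car K'. j (h x) = l (i x)"
    using hom_factor_mono[OF t D(1) lhom_comp[OF D(4) l(1)]] by blast
  obtain k where k: "k : lhom S P Y" "ALL x:car K'. k (i x) = h x" using ext[OF h(1)] by blast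
  interpret k: lhom_loc S P Y k by (rule hom_loc) fact+
  \<comment> \<open>\<open>l\<close> lifts \<open>p\<close> to the extension and is corrected by
    \<open>j k\<close> so as to kill the image of \<open>K'\<close>; the result descends to
    \<open>X\<close> and splits \<open>q\<close>.\<close>
  define m where "m x = l x -[B] j (k x)" for x
  have m: "m : lhom S P B" unfolding m_def
    by (intro lhom_minus l(1) lhom_comp[OF k(1) D'(4)] D'(12))
  have "m (i x) = 0[B]" if "x : car K'" for x using that h(2) k(2) by (simp add: m_def)
  then obtain n where n: "n : lhom S X B" "ALL x:car P. n (p x) = m x"
    using hom_factor_epi[OF s D'(2) m] by blast
  have "q (n x) = x" if x: "x : car X" for x
  proof -
    obtain y where y: "y : car P" "p y = x" using D(10)[OF x] by blast
    hence "n x = m y" using n(2) by blast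
    thus ?thesis using x y l(2) D'(8)[of "k y"] by (simp add: m_def a_minus_def)
  qed
  with n(1) show "EX k:lhom S X B. ALL x:car X. q (k x) = x" by blast
qed

lemma Ev_from_lift:
  assumes s: "ses Y i I p Q" and E: "Ev X I" and X: "Ob X"
    and ext: "!!h. h : lhom S X Q ==> EX k:lhom S X I. ALL x:car X. p (k x) = h x"
  shows "Ev X Y"
  unfolding Ev_def
proof (intro allI impI)
  fix B j q assume t: "ses Y j B q X"
  note D = sesD[OF s] and D' = sesD[OF t]
  interpret i: lhom_loc S Y I i by (rule D)
  interpret p: lhom_loc S I Q p by (rule D)
  interpret j: lhom_loc S Y B j by (rule D')
  interpret q: lhom_loc S B X q by (rule D')
  obtain l where l: "l : lhom S B I" "ALL x:car Y. l (j x) = i x" using Ev_extend[OF E t D(2) D(4)] by blast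
  interpret l: lhom_loc S B I l by (rule hom_loc) fact+
  have "p (l (j x)) = 0[Q]" if "x : car Y" for x using l(2) D(8) that by simp
  then obtain h where h: "h : lhom S X Q" "ALL x:car B. h (q x) = p (l x)"
    using hom_factor_epi[OF t D(3) lhom_comp[OF l(1) D(5)]] by blast
  obtain k where k: "k : lhom S X I" "ALL x:car X. p (k x) = h x" using ext[OF h(1)] by blast
  interpret k: lhom_loc S X I k by (rule hom_loc) fact+
  define m where "m x = l x -[I] k (q x)" for x
  have m: "m : lhom S B I" unfolding m_def
    by (intro lhom_minus l(1) lhom_comp[OF D'(5) k(1)] D(12))
  have "p (m x) = 0[Q]" if "x : car B" for x using that h(2) k(2) by (simp add: m_def)
  then obtain n where n: "n : lhom S B Y" "ALL x:car B. i (n x) = m x"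
    using hom_factor_mono[OF s D'(2) m] by blast
  have "n (j y) = y" if y: "y : car Y" for y
  proof -
    have "i (n (j y)) = i y" using n(2) y l(2) D'(8)[OF y] by (simp add: m_def a_minus_def)
    thus ?thesis using D(6) y lhom_closed[OF n(1), of "j y"] by (simp add: inj_on_def)
  qed
  with n(1) show "EX r:lhom S B Y. ALL y:car Y. r (j y) = y" by blast
qed

end

section \<open>Exact sequences under isomorphism, subquotients of extensions, and
  filtrations\<close>

context fdalg
begin

abbreviation zmod :: "('k, 'a) umodule => bool" where
  "zmod X == Ob X & car X = {0[X]}"

lemma zmod_ex: "EX Z. zmod Z" using zero_umodule by blast

lemma ses_iso_right:
  assumes "ses Y i B p X" "Ob X'" "f : lhom S X X'" "bij_betw f (car X) (car X')"
  shows "ses Y i B (%b. f (p b)) X'"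
proof -
  note D = sesD[OF assms(1)]
  interpret f: lhom_loc S X X' f by (rule hom_loc) fact+
  have f: "inj_on f (car X)" "f ` car X = car X'" using assms(4) by (auto simp: bij_betw_def)
  show ?thesis
  proof (rule sesI)
    show "x = 0[Y]" if "x : car Y" "i x = 0[B]" for x
      using lhom_loc.inj_iff[OF D(14)] D(6) that by blast
    show "EX y:car B. f (p y) = z" if z: "z : car X'" for z
      using z D(10) unfolding f(2)[symmetric] by blast
    show "EX x:car Y. i x = y" if y: "y : car B" "f (p y) = 0[X']" for y
    proof -
      have "p y = 0[X]" using f.inj_iff f(1) y lhom_closed[OF D(5) y(1)] by blast
      thus ?thesis using D(9) y by blast
    qed
  qed (use D assms lhom_comp[OF D(5) assms(3)] in auto)
qed

lemma ses_iso_left: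
  assumes "ses Y i B p X" "Ob Y'" "f : lhom S Y' Y" "bij_betw f (car Y') (car Y)"
  shows "ses Y' (%y. i (f y)) B p X"
proof -
  note D = sesD[OF assms(1)]
  interpret f: lhom_loc S Y' Y f by (rule hom_loc) fact+
  have f: "inj_on f (car Y')" "f ` car Y' = car Y" using assms(4) by (auto simp: bij_betw_def)
  show ?thesis
  proof (rule sesI)
    show "x = 0[Y']" if "x : car Y'" "i (f x) = 0[B]" for x
    proof -
      have "f x = 0[Y]" using lhom_loc.inj_iff[OF D(14)] D(6) that f.closed by blast
      thus ?thesis using f.inj_iff f(1) that by blast
    qed
    show "EX x:car Y'. i (f x) = y" if "y : car B" "p y = 0[X]" for y
      using D(9)[OF that] unfolding f(2)[symmetric] by blast
  qed (use D assms lhom_comp[OF assms(3) D(4)] in auto)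
qed

lemma ses_iso_mid:
  assumes "ses Y i B p X" "Ob B'" "f : lhom S B B'" "bij_betw f (car B) (car B')"
  shows "EX p'. ses Y (%y. f (i y)) B' p' X"
proof -
  note D = sesD[OF assms(1)]
  interpret f: lhom_loc S B B' f by (rule hom_loc) fact+
  obtain g where g: "g : lhom S B' B" "ALL x:car B. g (f x) = x" "ALL y:car B'. f (g y) = y"
    using lhom_inverse_ex[OF f.X.left_module_axioms f.Y.left_module_axioms assms(3,4)] by blast
  note gc = lhom_closed[OF g(1)]
  have "ses Y (%y. f (i y)) B' (%x. p (g x)) X"
  proof (rule sesI)
    show "x = 0[Y]" if "x : car Y" "f (i x) = 0[B']" for x
    proof -
      have "i x = 0[B]" using f.inj_iff assms(4) that lhom_closed[OF D(4)] unfolding bij_betw_def by blast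
      thus ?thesis using lhom_loc.inj_iff[OF D(14)] D(6) that by blast
    qed
    show "EX y:car B'. p (g y) = z" if "z : car X" for z
      using D(10)[OF that] g(2) f.closed by metis
    show "EX x:car Y. f (i x) = y" if "y : car B'" "p (g y) = 0[X]" for y
      using D(9)[OF gc[OF that(1)] that(2)] g(3) that by force
  qed (use D assms g lhom_comp[OF D(4) assms(3)] lhom_comp[OF g(1) D(5)] lhom_closed[OF D(4)] in auto)
  thus ?thesis by blast
qed

lemma ses_of_iso:
  assumes "zmod Z" "Ob X" "Ob Y" "f : lhom S X Y" "bij_betw f (car X) (car Y)"
  shows "ses Z (%_. 0[X]) X f Y" "ses X f Y (%_. 0[Z]) Z"
proof -
  interpret f: lhom_loc S X Y f by (rule hom_loc) fact+
  interpret Z: left_module S Z using assms ObD by blast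
  have f: "inj_on f (car X)" "f ` car X = car Y" using assms(5) by (auto simp: bij_betw_def)
  show "ses Z (%_. 0[X]) X f Y" unfolding ses_def
    using assms f f.inj_iff lhom_zero[OF f.X.left_module_axioms] by auto
  have ex: "ALL y:car Y. EX x:car X. f x = y" unfolding f(2)[symmetric] by blast
  show "ses X f Y (%_. 0[Z]) Z" unfolding ses_def
    using ex assms f lhom_zero[OF Z.left_module_axioms] f.Y.M.zero_closed by auto
qed

lemma ses_zero_left: "ses X f Y g Z ==> car X = {0[X]} ==> bij_betw g (car Y) (car Z)"
proof -
  assume s: "ses X f Y g Z" "car X = {0[X]}"
  note D = sesD[OF s(1)]
  interpret f: lhom_loc S X Y f by (rule D)
  interpret g: lhom_loc S Y Z g by (rule D)
  show ?thesis unfolding bij_betw_def g.inj_iff using D(7,9) s(2) by auto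
qed

lemma ses_zero_right: "ses X f Y g Z ==> car Z = {0[Z]} ==> bij_betw f (car X) (car Y)"
proof -
  assume s: "ses X f Y g Z" "car Z = {0[Z]}"
  note D = sesD[OF s(1)]
  interpret f: lhom_loc S X Y f by (rule D)
  interpret g: lhom_loc S Y Z g by (rule D)
  have "f ` car X = car Y" using s(2) D(9) g.closed f.closed by blast
  thus ?thesis unfolding bij_betw_def using D(6) by auto
qed

text \<open>\<open>Y1\<close> is the preimage of \<open>Z1\<close> under \<open>g\<close>. The maps
  are kept explicit because splittings have to be compared across the two sequences.\<close>

lemma ses_preimage:
  assumes s: "ses X f Y g Z" and t: "ses Z1 i Z q Z2"
  obtains Y1 f1 j g1 where "ses X f1 Y1 g1 Z1" "ses Y1 j Y (%y. q (g y)) Z2"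
    "ALL x:car X. j (f1 x) = f x" "ALL y:car Y1. i (g1 y) = g (j y)"
proof -
  note D = sesD[OF s] and D' = sesD[OF t]
  interpret f: lhom_loc S X Y f by (rule D)
  interpret g: lhom_loc S Y Z g by (rule D)
  interpret i: lhom_loc S Z1 Z i by (rule D')
  interpret q: lhom_loc S Z Z2 q by (rule D')
  have qg: "(%y. q (g y)) : lhom S Y Z2" by (rule lhom_comp[OF D(5) D'(5)])
  have "(%y. q (g y)) ` car Y = car Z2" using D(7) D'(7) by (simp add: image_image[symmetric])
  from ses_ker[OF D(2) D'(3) qg this] obtain Y1 j where Y1: "ses Y1 j Y (%y. q (g y)) Z2" by blast
  note E = sesD[OF Y1]
  interpret j: lhom_loc S Y1 Y j by (rule E)
  obtain f1 where f1: "f1 : lhom S X Y1" "ALL x:car X. j (f1 x) = f x"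
    using hom_factor_mono[OF Y1 D(1,4)] D(8) by auto
  obtain g1 where g1: "g1 : lhom S Y1 Z1" "ALL y:car Y1. i (g1 y) = g (j y)"
    using hom_factor_mono[OF t E(1) lhom_comp[OF E(4) D(5)]] E(8) by blast
  interpret f1: lhom_loc S X Y1 f1 by (rule hom_loc) fact+
  interpret g1: lhom_loc S Y1 Z1 g1 by (rule hom_loc) fact+
  have "ses X f1 Y1 g1 Z1"
  proof (rule sesI)
    show "x = 0[X]" if "x : car X" "f1 x = 0[Y1]" for x
    proof -
      have "f x = 0[Y]" using f1(2) that j.zero by metis
      thus ?thesis using f.inj_iff D(6) that by blast
    qed
    show "EX y:car Y1. g1 y = z" if z: "z : car Z1" for z
    proof -
      obtain y where y: "y : car Y" "g y = i z" using D(10)[of "i z"] z by auto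
      hence "q (g y) = 0[Z2]" using D'(8)[OF z] by simp
      then obtain y1 where y1: "y1 : car Y1" "j y1 = y" using E(9)[OF y(1)] by blast
      hence "i (g1 y1) = i z" using g1(2) y by simp
      hence "g1 y1 = z" using D'(6) z y1 by (simp add: inj_on_def)
      with y1 show ?thesis by blast
    qed
    show "g1 (f1 x) = 0[Z1]" if x: "x : car X" for x
    proof -
      have "i (g1 (f1 x)) = 0[Z]" using g1(2) f1(2) x D(8) by simp
      thus ?thesis using i.inj_iff D'(6) x by blast
    qed
    show "EX x:car X. f1 x = y" if y: "y : car Y1" "g1 y = 0[Z1]" for y
    proof -
      have "g (j y) = 0[Z]" using g1(2) y i.zero by metis
      then obtain x where x: "x : car X" "f x = j y" using D(9)[of "j y"] y by auto
      hence "j (f1 x) = j y" using f1(2) by simp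
      hence "f1 x = y" using E(6) x y by (simp add: inj_on_def)
      with x show ?thesis by blast
    qed
  qed (use D D' E f1 g1 in auto)
  with Y1 f1 g1 that show thesis by blast
qed

text \<open>\<open>Y'\<close> is \<open>Y\<close> modulo \<open>X1\<close>, which again is an
  extension of \<open>Z\<close>, now by the quotient \<open>X2\<close>.\<close>

lemma ses_quotient:
  assumes s: "ses X f Y g Z" and t: "ses X1 i X q X2"
  obtains Y' f' p' g' where "ses X1 (%x. f (i x)) Y g' Y'" "ses X2 f' Y' p' Z"
    "ALL x:car X. g' (f x) = f' (q x)" "ALL y:car Y. p' (g' y) = g y"
proof -
  note D = sesD[OF s] and D' = sesD[OF t]
  interpret f: lhom_loc S X Y f by (rule D)
  interpret g: lhom_loc S Y Z g by (rule D)
  interpret i: lhom_loc S X1 X i by (rule D')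
  interpret q: lhom_loc S X X2 q by (rule D')
  have fi: "(%x. f (i x)) : lhom S X1 Y" by (rule lhom_comp[OF D'(4) D(4)])
  have "inj_on (%x. f (i x)) (car X1)"
    using D(6) D'(6) i.closed by (simp add: inj_on_def)
  then obtain Y' g' where Y': "ses X1 (%x. f (i x)) Y g' Y'" using ses_coker[OF D'(1) D(2) fi] by blast
  note E = sesD[OF Y']
  interpret g': lhom_loc S Y Y' g' by (rule E)
  obtain f' where f': "f' : lhom S X2 Y'" "ALL x:car X. f' (q x) = g' (f x)"
    using hom_factor_epi[OF t E(3) lhom_comp[OF D(4) E(5)]] E(8) by blast
  obtain p' where p': "p' : lhom S Y' Z" "ALL y:car Y. p' (g' y) = g y"
    using hom_factor_epi[OF Y' D(3) D(5)] D(8) by auto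
  interpret f': lhom_loc S X2 Y' f' by (rule hom_loc) fact+
  interpret p': lhom_loc S Y' Z p' by (rule hom_loc) fact+
  have "ses X2 f' Y' p' Z"
  proof (rule sesI)
    show "z = 0[X2]" if z: "z : car X2" "f' z = 0[Y']" for z
    proof -
      obtain x where x: "x : car X" "q x = z" using D'(10)[OF z(1)] by blast
      hence "g' (f x) = 0[Y']" using f'(2)[rule_format, OF x(1)] x(2) z(2) by simp
      then obtain x1 where "x1 : car X1" "f (i x1) = f x" using E(9)[of "f x"] x by auto
      hence "x = i x1" using D(6) x by (simp add: inj_on_def)
      thus ?thesis using D'(8) x `x1 : _` by simp
    qed
    show "EX y:car Y'. p' y = z" if z: "z : car Z" for z
      using D(10)[OF z] p'(2) g'.closed by metis
    show "p' (f' z) = 0[Z]" if z: "z : car X2" for z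
    proof -
      obtain x where x: "x : car X" "q x = z" using D'(10)[OF z] by blast
      hence "p' (f' z) = p' (g' (f x))" using f'(2) by metis
      thus ?thesis using p'(2) x D(8) by simp
    qed
    show "EX x:car X2. f' x = y" if y: "y : car Y'" "p' y = 0[Z]" for y
    proof -
      obtain u where u: "u : car Y" "g' u = y" using E(10)[OF y(1)] by blast
      hence "g u = 0[Z]" using p'(2) y by metis
      then obtain x where x: "x : car X" "f x = u" using D(9)[OF u(1)] by blast
      hence "f' (q x) = y" using f'(2) u by simp
      with x show ?thesis by blast
    qed
  qed (use D D' E f' p' in auto)
  with Y' f' p' that show thesis by (metis (no_types, lifting))
qed

lemma Ses_preimage: "Ses X Y Z ==> Ses Z1 Z Z2 ==> EX Y1. Ses X Y1 Z1 & Ses Y1 Y Z2"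
  unfolding Ses_def by (metis ses_preimage)

lemma Ses_quotient: "Ses X Y Z ==> Ses X1 X X2 ==> EX Y'. Ses X1 Y Y' & Ses X2 Y' Z"
  unfolding Ses_def by (metis ses_quotient)

text \<open>The extension is first split over \<open>X1\<close>; the retraction found there extends
  to all of \<open>B\<close> because Ext^1(X2, Y) = 0.\<close>

lemma Ev_ext_left:
  assumes "ses X1 i X q X2" "Ev X1 Y" "Ev X2 Y" "Ob Y"
  shows "Ev X Y"
  unfolding Ev_def
proof (intro allI impI)
  fix B j p assume t: "ses Y j B p X"
  obtain B1 f1 jj g1 where B: "ses Y f1 B1 g1 X1" "ses B1 jj B (%b. q (p b)) X2" "ALL y:car Y. jj (f1 y) = j y"
    using ses_preimage[OF t assms(1)] by metis
  obtain r1 where r1: "r1 : lhom S B1 Y" "ALL y:car Y. r1 (f1 y) = y" using EvD[OF assms(2) B(1)] by blast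
  obtain r where r: "r : lhom S B Y" "ALL b:car B1. r (jj b) = r1 b"
    using Ev_extend[OF assms(3) B(2) assms(4) r1(1)] by blast
  have "r (j y) = y" if y: "y : car Y" for y
  proof -
    have "f1 y : car B1" using lhom_closed[OF sesD(4)[OF B(1)] y] .
    hence "r (jj (f1 y)) = r1 (f1 y)" using r(2) by blast
    thus ?thesis using r1(2) B(3) y by simp
  qed
  with r(1) show "EX r:lhom S B Y. ALL y:car Y. r (j y) = y" by blast
qed

lemma Ev_ext_right:
  assumes "ses Y1 i Y q Y2" "Ev X Y1" "Ev X Y2"
  shows "Ev X Y"
proof (rule EvI_section)
  fix B j p assume t: "ses Y j B p X"
  obtain B' f' p' g' where B: "ses Y1 (%x. j (i x)) B g' B'" "ses Y2 f' B' p' X" "ALL y:car B. p' (g' y) = p y"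
    using ses_quotient[OF t assms(1)] by metis
  obtain k' where k': "k' : lhom S X B'" "ALL x:car X. p' (k' x) = x" using Ev_section[OF assms(3) B(2)] by blast
  obtain k where k: "k : lhom S X B" "ALL x:car X. g' (k x) = k' x"
    using Ev_lift[OF assms(2) B(1) sesD(3)[OF t] k'(1)] by blast
  have "ALL x:car X. p (k x) = x"
  proof
    fix x assume x: "x : car X"
    have "k x : car B" using lhom_closed[OF k(1) x] .
    hence "p (k x) = p' (g' (k x))" using B(3) by simp
    thus "p (k x) = x" using k(2) k'(2) x by simp
  qed
  with k(1) show "EX k:lhom S X B. ALL x:car X. p (k x) = x" by blast
qed

lemma Ev_iso_left:
  assumes "Ev X Y" "module_iso S X X'" "Ob X" "Ob X'" shows "Ev X' Y"
  unfolding Ev_def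
proof (intro allI impI)
  fix B i p assume s: "ses Y i B p X'"
  from assms(2) obtain f where f: "f : lhom S X X'" "bij_betw f (car X) (car X')" unfolding module_iso_def by blast
  obtain g where g: "g : lhom S X' X" "bij_betw g (car X') (car X)"
    using lhom_inverse_ex[OF ObD(1) ObD(1) f] assms(3,4) by blast
  show "EX r:lhom S B Y. ALL y:car Y. r (i y) = y"
    by (rule EvD[OF assms(1) ses_iso_right[OF s assms(3) g]])
qed

lemma Ev_iso_right:
  assumes "Ev X Y" "module_iso S Y Y'" "Ob Y" "Ob Y'" shows "Ev X Y'"
proof (rule EvI_section)
  fix B i p assume s: "ses Y' i B p X"
  from assms(2) obtain f where f: "f : lhom S Y Y'" "bij_betw f (car Y) (car Y')" unfolding module_iso_def by blast
  show "EX k:lhom S X B. ALL x:car X. p (k x) = x"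
    by (rule Ev_section[OF assms(1) ses_iso_left[OF s assms(3) f]])
qed

lemma Ev_zero:
  assumes "zmod Z" "Ob X" shows "Ev Z X" "Ev X Z"
proof -
  interpret X: left_module S X using assms ObD by blast
  interpret Z: left_module S Z using assms ObD by blast
  show "Ev Z X"
  proof (rule EvI_section)
    fix B i p assume "ses X i B p Z"
    from sesD[OF this] interpret p: lhom_loc S B Z p by simp
    show "EX k:lhom S Z B. ALL x:car Z. p (k x) = x"
      using assms(1) by (intro bexI[of _ "%_. 0[B]"] lhom_zero) (auto simp: p.X.left_module_axioms)
  qed
  show "Ev X Z" unfolding Ev_def
    using assms(1) by (intro allI impI bexI[of _ "%_. 0[Z]"] lhom_zero) (auto simp: Z.left_module_axioms)
qed

section \<open>Filtrations\<close>

text \<open>Filtrations grow at the top: \<open>Z\<close> is the new top section and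
  \<open>X\<close> the part filtered so far.\<close>

inductive Filt :: "(('k, 'a) umodule => bool) => ('k, 'a) umodule => bool" for C where
  Filt_zero: "zmod X ==> Filt C X"
| Filt_step: "Ses X Y Z ==> Filt C X ==> C Z ==> Filt C Y"

lemma SesD: "Ses X Y Z ==> Ob X" "Ses X Y Z ==> Ob Y" "Ses X Y Z ==> Ob Z"
  unfolding Ses_def by (auto dest: sesD(1-3))

lemma Filt_Ob: "Filt C X ==> Ob X"
  by (induction rule: Filt.induct) (auto dest: SesD)

lemma Filt_mono: "Filt C X ==> (!!Z. C Z ==> D Z) ==> Filt D X"
  by (induction rule: Filt.induct) (auto intro: Filt.intros)

lemma Ses_iso_mid: "Ses X Y Z ==> Ob Y' ==> module_iso S Y Y' ==> Ses X Y' Z"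
  unfolding Ses_def module_iso_def using ses_iso_mid by metis

lemma Ses_iso_right: "Ses X Y Z ==> Ob Z' ==> module_iso S Z Z' ==> Ses X Y Z'"
  unfolding Ses_def module_iso_def using ses_iso_right by metis

lemma Ses_iso_left: "Ses X Y Z ==> Ob X' ==> module_iso S X' X ==> Ses X' Y Z"
  unfolding Ses_def module_iso_def using ses_iso_left by metis

lemma Ses_of_iso:
  assumes "zmod Z" "Ob X" "Ob Y" "module_iso S X Y"
  shows "Ses Z X Y" "Ses X Y Z"
  using ses_of_iso[OF assms(1-3)] assms(4) unfolding module_iso_def Ses_def by blast+

lemma Ses_zero_right: "Ses X Y Z ==> car Z = {0[Z]} ==> module_iso S X Y"
  unfolding Ses_def module_iso_def using ses_zero_right sesD(4) by metis

lemma zmod_iso: "zmod X ==> Ob Y ==> module_iso S X Y ==> zmod Y"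
proof -
  assume *: "zmod X" "Ob Y" "module_iso S X Y"
  then obtain f where f: "f : lhom S X Y" "f ` car X = car Y" unfolding module_iso_def bij_betw_def by blast
  interpret f: lhom_loc S X Y f using * f hom_loc by blast
  show ?thesis using *(1,2) f(2) f.zero by auto
qed

lemma Filt_iso:
  assumes "Filt C Y" "Ob Y'" "module_iso S Y Y'" shows "Filt C Y'"
  using assms(1)
proof cases
  case Filt_zero
  thus ?thesis using zmod_iso assms Filt.Filt_zero by blast
next
  case (Filt_step X Z)
  thus ?thesis using Ses_iso_mid assms Filt.Filt_step by blast
qed

lemma Filt_single: "C Z ==> Ob Z ==> Filt C Z"
proof -
  assume "C Z" "Ob Z"
  obtain Z0 where "zmod Z0" using zmod_ex by blast
  thus ?thesis using Ses_of_iso(1)[OF _ `Ob Z` `Ob Z` module_iso_refl] `C Z` Filt.intros by blast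
qed

text \<open>Induction along the filtration of the quotient \<open>Z\<close>, whose steps are pulled
  back to \<open>Y\<close>.\<close>

lemma Filt_ext:
  assumes "Filt C Z" "Filt C X" "Ses X Y Z" shows "Filt C Y"
  using assms
proof (induction arbitrary: X Y rule: Filt.induct)
  case (Filt_zero Z)
  thus ?case using Ses_zero_right Filt_iso SesD by blast
next
  case (Filt_step Z1 Z Z2)
  obtain Y1 where "Ses X Y1 Z1" "Ses Y1 Y Z2" using Ses_preimage Filt_step by blast
  thus ?case using Filt_step Filt.Filt_step by blast
qed

lemma Filt_Ev_left:
  assumes "Filt C X" "Ob Y" "!!Z. C Z ==> Ev Z Y" shows "Ev X Y"
  using assms
proof (induction rule: Filt.induct)
  case (Filt_zero X) thus ?case using Ev_zero by blast
next
  case (Filt_step X' X Z)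
  thus ?case using Ev_ext_left unfolding Ses_def by metis
qed

lemma Filt_Ev_right:
  assumes "Filt C Y" "Ob X" "!!Z. C Z ==> Ev X Z" shows "Ev X Y"
  using assms
proof (induction rule: Filt.induct)
  case (Filt_zero X) thus ?case using Ev_zero by blast
next
  case (Filt_step X' X Z)
  thus ?case using Ev_ext_right unfolding Ses_def by metis
qed

definition hz :: "('k, 'a) umodule => ('k, 'a) umodule => bool" where
  "hz X Y <-> (ALL f:lhom S X Y. ALL x:car X. f x = 0[Y])"

lemma hzD: "hz X Y ==> f : lhom S X Y ==> x : car X ==> f x = 0[Y]"
  unfolding hz_def by blast

lemma hz_ext_left:
  assumes "ses X f Y g Z" "Ob W" "hz X W" "hz Z W" shows "hz Y W"
  unfolding hz_def
proof (intro ballI)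
  fix h y assume h: "h : lhom S Y W" and y: "y : car Y"
  note D = sesD[OF assms(1)]
  have "h (f x) = 0[W]" if "x : car X" for x
    by (rule hzD[OF assms(3) lhom_comp[OF D(4) h] that])
  then obtain k where k: "k : lhom S Z W" "ALL y:car Y. k (g y) = h y"
    using hom_factor_epi[OF assms(1,2) h] by metis
  have "k (g y) = 0[W]" using assms(4) k(1) lhom_closed[OF D(5) y] unfolding hz_def by blast
  thus "h y = 0[W]" using k(2) y by simp
qed

lemma hz_zero: "zmod Z ==> Ob W ==> hz Z W"
  unfolding hz_def
proof (intro ballI)
  fix f x assume "zmod Z" "Ob W" "f : lhom S Z W" "x : car Z"
  then interpret f: lhom_loc S Z W f using hom_loc by blast
  show "f x = 0[W]" using `zmod Z` `x : _` f.zero by auto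
qed

lemma Filt_hz:
  assumes "Filt C X" "Ob Y" "!!Z. C Z ==> hz Z Y" shows "hz X Y"
  using assms
proof (induction rule: Filt.induct)
  case (Filt_zero X) thus ?case using hz_zero by blast
next
  case (Filt_step X' X Z)
  thus ?case using hz_ext_left unfolding Ses_def by metis
qed

end

section \<open>Dimension count, dimension shift, horseshoe lemmas and resolutions\<close>

context fdalg
begin

lemma len_ses:
  assumes "ses X f Y g Z" shows "len Y = len X + len Z"
proof -
  note D = sesD[OF assms]
  interpret f: lhom_loc S X Y f by (rule D)
  interpret g: lhom_loc S Y Z g by (rule D)
  have ker: "{y : car Y. g y = 0[Z]} = f ` car X" using D(8,9) by auto
  have ker': "{x : car X. f x = 0[Y]} = {0[X]}" using D(6) f.inj_iff by auto
  have 0: "len (X(|carrier := {0[X]}|)) = 0"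
    by (subst len_zero_iff[OF Ob_sub[OF D(1) f.X.submod_zero]]) simp
  have "len Y = len Z + len (Y(|carrier := f ` car X|))"
    using len_surj[OF D(2,13,5)] unfolding D(7) ker by simp
  moreover have "len X = len (Y(|carrier := f ` car X|))"
    using len_surj[OF D(1,12,4)] unfolding ker' 0 by simp
  ultimately show ?thesis by simp
qed

lemma Ses_len: "Ses X Y Z ==> len Y = len X + len Z"
  unfolding Ses_def using len_ses by blast

lemma inj_len_eq_surj:
  fixes X Y :: "('k, 'a) umodule"
  assumes "Ob X" "Ob Y" "f : lhom S X Y" "inj_on f (car X)" "len Y <= len X"
  shows "bij_betw f (car X) (car Y)"
proof -
  obtain Z g where s: "ses X f Y g Z" using ses_coker[OF assms(1-4)] .
  have "len Z = 0" using len_ses[OF s] assms(5) by simp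
  hence "car Z = {0[Z]}" using len_zero_iff[OF sesD(3)[OF s]] by simp
  thus ?thesis by (rule ses_zero_right[OF s])
qed

lemma surj_len_eq_inj:
  fixes X Y :: "('k, 'a) umodule"
  assumes "Ob X" "Ob Y" "f : lhom S X Y" "f ` car X = car Y" "len X <= len Y"
  shows "bij_betw f (car X) (car Y)"
proof -
  note s = ses_ker[OF assms(1-4)]
  have "len (X(|carrier := {y : car X. f y = 0[Y]}|)) = 0" using len_ses[OF s] assms(5) by simp
  hence "car (X(|carrier := {y : car X. f y = 0[Y]}|)) = {0[X(|carrier := {y : car X. f y = 0[Y]}|)]}"
    using len_zero_iff[OF sesD(1)[OF s]] by simp
  thus ?thesis by (rule ses_zero_left[OF s])
qed

text \<open>Ext^1(W, Z) lies between Ext^1(W, X) = 0 and Ext^2(W, N), and the latter is Ext^1(K', N)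
  = 0 by dimension shift. On maps: K' -> Z lifts to \<open>X\<close>, extends to \<open>P\<close>,
  and is composed with \<open>g\<close>.\<close>

lemma Ev_coker:
  assumes s: "ses N f X g Z" and t: "ses K' i P p W" and P: "Proj K S P"
    and "Ev W X" "Ev K' N"
  shows "Ev W Z"
proof (rule Ev_from_extend[OF t Ev_projective[OF P sesD(3)[OF s]] sesD(3)[OF s]])
  fix h assume h: "h : lhom S K' Z"
  obtain h1 where h1: "h1 : lhom S K' X" "ALL x:car K'. g (h1 x) = h x"
    using Ev_lift[OF assms(5) s sesD(1)[OF t] h] by blast
  obtain h2 where h2: "h2 : lhom S P X" "ALL x:car K'. h2 (i x) = h1 x"
    using Ev_extend[OF assms(4) t sesD(2)[OF s] h1(1)] by blast
  show "EX k:lhom S P Z. ALL x:car K'. k (i x) = h x"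
    using h1 h2 lhom_comp[OF h2(1) sesD(5)[OF s]] by (intro bexI[of _ "%x. g (h2 x)"]) auto
qed

text \<open>Dual to \<open>Ev_coker\<close>: here Ext^2(N, W) is Ext^1(N, Q), shifted along the
  injective \<open>I\<close>.\<close>

lemma Ev_ker:
  assumes s: "ses Z f X g N" and t: "ses W i I p Q" and I: "Inj K S I"
    and "Ev X W" "Ev N Q"
  shows "Ev Z W"
proof (rule Ev_from_lift[OF t Ev_injective[OF I] sesD(1)[OF s]])
  fix h assume h: "h : lhom S Z Q"
  obtain h1 where h1: "h1 : lhom S X Q" "ALL x:car Z. h1 (f x) = h x"
    using Ev_extend[OF assms(5) s sesD(3)[OF t] h] by blast
  obtain h2 where h2: "h2 : lhom S X I" "ALL x:car X. p (h2 x) = h1 x"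
    using Ev_lift[OF assms(4) t sesD(2)[OF s] h1(1)] by blast
  show "EX k:lhom S Z I. ALL x:car Z. p (k x) = h x"
    using h1 h2 lhom_comp[OF sesD(4)[OF s] h2(1)] lhom_closed[OF sesD(4)[OF s]]
    by (intro bexI[of _ "%x. h2 (f x)"]) auto
qed

text \<open>The pushout of two embeddings of \<open>X\<close>. As in Schanuel's lemma it permits one
  embedding to be exchanged for the other.\<close>

lemma Ses_pushout:
  assumes "Ses X M Z" "Ses X M' Z'"
  shows "EX B. Ses M B Z' & Ses M' B Z"
proof -
  obtain f g f' g' where s: "ses X f M g Z" and s': "ses X f' M' g' Z'" using assms unfolding Ses_def by blast
  note D = sesD[OF s] and D' = sesD[OF s']
  interpret f: lhom_loc S X M f by (rule D)
  interpret f': lhom_loc S X M' f' by (rule D')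
  interpret g: lhom_loc S M Z g by (rule D)
  interpret g': lhom_loc S M' Z' g' by (rule D')
  obtain B a b where B': "po X f M f' M' B a b" using pushout[OF D(1,2) D'(2) D(4) D'(4) D(6)] .
  note B = poD[OF B']
  interpret a: lhom_loc S M B a by (rule hom_loc) fact+
  interpret b: lhom_loc S M' B b by (rule hom_loc) fact+
  obtain q where q: "q : lhom S B Z" "ALL y:car M. q (a y) = g y" "ALL w:car M'. q (b w) = 0[Z]"
    using B(7)[OF D(3) D(5) lhom_zero[OF D(13)]] D(8) by auto
  obtain q' where q': "q' : lhom S B Z'" "ALL y:car M. q' (a y) = 0[Z']" "ALL w:car M'. q' (b w) = g' w"
    using B(7)[OF D'(3) lhom_zero[OF D'(13)] D'(5)] D'(8) by auto
  interpret q: lhom_loc S B Z q by (rule hom_loc) fact+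
  interpret q': lhom_loc S B Z' q' by (rule hom_loc) fact+
  have "ses M a B q' Z'"
  proof (rule sesI)
    show "y = 0[M]" if y: "y : car M" "a y = 0[B]" for y
    proof -
      obtain x where x: "x : car X" "y = f x" "0[M'] = f' x" using B(6)[of y "0[M']"] y by auto
      hence "x = 0[X]" using f'.inj_iff D'(6) by metis
      thus ?thesis using x by simp
    qed
    show "EX y:car B. q' y = z" if z: "z : car Z'" for z
      using D'(10)[OF z] q'(3) b.closed by metis
    show "EX x:car M. a x = y" if y: "y : car B" "q' y = 0[Z']" for y
    proof -
      obtain m w where yw: "m : car M" "w : car M'" "y = a m +[B] b w" using B(5)[OF y(1)] by blast
      hence "g' w = 0[Z']" using y q' by simp
      then obtain x where x: "x : car X" "f' x = w" using D'(9)[OF yw(2)] by blast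
      have "y = a (m +[M] f x)" using yw x B(4)[OF x(1)] by simp
      thus ?thesis using yw x by blast
    qed
  qed (use B q' D D' in auto)
  moreover have "ses M' b B q Z"
  proof (rule sesI)
    show "y = 0[M']" if y: "y : car M'" "b y = 0[B]" for y
    proof -
      obtain x where x: "x : car X" "0[M] = f x" "y = f' x" using B(6)[of "0[M]" y] y by auto
      hence "x = 0[X]" using f.inj_iff D(6) by metis
      thus ?thesis using x by simp
    qed
    show "EX y:car B. q y = z" if z: "z : car Z" for z
      using D(10)[OF z] q(2) a.closed by metis
    show "EX x:car M'. b x = y" if y: "y : car B" "q y = 0[Z]" for y
    proof -
      obtain m w where yw: "m : car M" "w : car M'" "y = a m +[B] b w" using B(5)[OF y(1)] by blast
      hence "g m = 0[Z]" using y q by simp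
      then obtain x where x: "x : car X" "f x = m" using D(9)[OF yw(1)] by blast
      have "y = b (f' x +[M'] w)" using yw x B(4)[OF x(1)] by simp
      thus ?thesis using yw x by blast
    qed
  qed (use B q D D' in auto)
  ultimately show ?thesis unfolding Ses_def by blast
qed

lemma Ses_pullback:
  assumes "Ses Y N X" "Ses Y' N' X"
  shows "EX B. Ses Y' B N & Ses Y B N'"
proof -
  obtain f g f' g' where s: "ses Y f N g X" and s': "ses Y' f' N' g' X" using assms unfolding Ses_def by blast
  note D = sesD[OF s] and D' = sesD[OF s']
  interpret f: lhom_loc S Y N f by (rule D)
  interpret f': lhom_loc S Y' N' f' by (rule D')
  interpret g: lhom_loc S N X g by (rule D)
  interpret g': lhom_loc S N' X g' by (rule D')
  obtain B a b where B': "pb N g N' g' B a b" using pullback[OF D(2) D'(2) D(3) D(5) D'(5)] .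
  note B = pbD[OF B']
  interpret a: lhom_loc S B N a by (rule hom_loc) fact+
  interpret b: lhom_loc S B N' b by (rule hom_loc) fact+
  obtain j where j: "j : lhom S Y B" "ALL x:car Y. a (j x) = f x & b (j x) = 0[N']"
    using B(7)[OF D(1) D(4) lhom_zero[OF D'(12)]] D(8) by auto
  obtain j' where j': "j' : lhom S Y' B" "ALL x:car Y'. a (j' x) = 0[N] & b (j' x) = f' x"
    using B(7)[OF D'(1) lhom_zero[OF D(12)] D'(4)] D'(8) by auto
  interpret j: lhom_loc S Y B j by (rule hom_loc[OF D(1) B(1)]) fact+
  interpret j': lhom_loc S Y' B j' by (rule hom_loc[OF D'(1) B(1)]) fact+
  have "ses Y' j' B a N"
  proof (rule sesI)
    show "y = 0[Y']" if y: "y : car Y'" "j' y = 0[B]" for y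
    proof -
      have "f' y = 0[N']" using j'(2) y b.zero by metis
      thus ?thesis using D'(6) f'.inj_iff y by blast
    qed
    show "EX y:car B. a y = z" if z: "z : car N" for z
    proof -
      obtain y where "y : car N'" "g' y = g z" using D'(10)[of "g z"] z by auto
      thus ?thesis using B(5)[of z y] z by auto
    qed
    show "EX y:car Y'. j' y = z" if z: "z : car B" "a z = 0[N]" for z
    proof -
      have "g' (b z) = 0[X]" using B(4)[OF z(1)] z(2) g.zero by metis
      then obtain y where y: "y : car Y'" "f' y = b z" using D'(9)[of "b z"] z by auto
      have "z -[B] j' y = 0[B]" by (rule B(6)) (use y z j'(2) in auto)
      thus ?thesis using y z by (intro bexI[of _ y]) auto
    qed
  qed (use B D D' j' in auto)
  moreover have "ses Y j B b N'"
  proof (rule sesI)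
    show "y = 0[Y]" if y: "y : car Y" "j y = 0[B]" for y
    proof -
      have "f y = 0[N]" using j(2) y a.zero by metis
      thus ?thesis using D(6) f.inj_iff y by blast
    qed
    show "EX y:car B. b y = z" if z: "z : car N'" for z
    proof -
      obtain y where "y : car N" "g y = g' z" using D(10)[of "g' z"] z by auto
      thus ?thesis using B(5)[of y z] z by auto
    qed
    show "EX y:car Y. j y = z" if z: "z : car B" "b z = 0[N']" for z
    proof -
      have "g (a z) = 0[X]" using B(4)[OF z(1)] z(2) g'.zero by metis
      then obtain y where y: "y : car Y" "f y = a z" using D(9)[of "a z"] z by auto
      have "z -[B] j y = 0[B]" by (rule B(6)) (use y z j(2) in auto)
      thus ?thesis using y z by (intro bexI[of _ y]) auto
    qed
  qed (use B D D' j in auto)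
  ultimately show ?thesis unfolding Ses_def by blast
qed

text \<open>The lift of T2 -> X2 to \<open>X\<close> comes from Ext^1(T2, X1) = 0. In this form the
  lemma serves projective \<open>T2\<close> as well as tilting \<open>T2\<close> over costandardly
  filtered \<open>X1\<close>.\<close>

lemma horseshoe_left:
  assumes s: "ses X1 a X b X2" and s1: "ses Y1 i1 T1 p1 X1" and s2: "ses Y2 i2 T2 p2 X2" and E: "Ev T2 X1"
  shows "EX B i j p q Y. biprod T1 T2 B i j p q & Ses Y B X & Ses Y1 Y Y2"
proof -
  note D = sesD[OF s] and D1 = sesD[OF s1] and D2 = sesD[OF s2]
  interpret a: lhom_loc S X1 X a by (rule D)
  interpret b: lhom_loc S X X2 b by (rule D)
  interpret i1: lhom_loc S Y1 T1 i1 by (rule D1)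
  interpret p1: lhom_loc S T1 X1 p1 by (rule D1)
  interpret i2: lhom_loc S Y2 T2 i2 by (rule D2)
  interpret p2: lhom_loc S T2 X2 p2 by (rule D2)
  obtain l where l: "l : lhom S T2 X" "ALL x:car T2. b (l x) = p2 x"
    using Ev_lift[OF E s D2(2) D2(5)] by blast
  interpret l: lhom_loc S T2 X l by (rule hom_loc) fact+
  obtain B i j p q where B': "biprod T1 T2 B i j p q" using biproduct[OF D1(2) D2(2)] .
  note B = biprodD[OF B']
  interpret i: lhom_loc S T1 B i by (rule hom_loc) fact+
  interpret j: lhom_loc S T2 B j by (rule hom_loc) fact+
  interpret p: lhom_loc S B T1 p by (rule hom_loc) fact+
  interpret q: lhom_loc S B T2 q by (rule hom_loc) fact+
  define t where "t x = a (p1 (p x)) +[X] l (q x)" for x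
  have t: "t : lhom S B X" unfolding t_def
    by (intro lhom_plus D(12) lhom_comp[OF B(5) l(1)] lhom_comp[OF lhom_comp[OF B(4) D1(5)] D(4)])
  interpret t: lhom_loc S B X t by (rule hom_loc) fact+
  have bt: "b (t x) = p2 (q x)" if "x : car B" for x
    using that D(8) l(2) by (simp add: t_def)
  have "t ` car B = car X"
  proof -
    have "x : t ` car B" if x: "x : car X" for x
    proof -
      obtain t2 where t2: "t2 : car T2" "p2 t2 = b x" using D2(10)[of "b x"] x by auto
      have "b (x -[X] l t2) = 0[X2]" using x t2 l(2) by simp
      then obtain x1 where x1: "x1 : car X1" "a x1 = x -[X] l t2" using D(9)[of "x -[X] l t2"] x t2 by auto
      obtain t1 where t1: "t1 : car T1" "p1 t1 = x1" using D1(10)[OF x1(1)] by blast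
      have "t (i t1 +[B] j t2) = x"
        using t1 t2 x1 x a.Y.minus_add_cancel[of x "l t2"] by (simp add: t_def B(6-9))
      thus ?thesis using t1 t2 i.Y.M.a_closed[of "i t1" "j t2"] by (intro image_eqI[of _ t "i t1 +[B] j t2"]) auto
    qed
    thus ?thesis using t.closed by blast
  qed
  from ses_ker[OF B(1) D(2) t this] obtain Y y where Y: "ses Y y B t X" by blast
  note DY = sesD[OF Y]
  interpret y: lhom_loc S Y B y by (rule DY)
  have ti: "t (i (i1 x)) = 0[X]" if "x : car Y1" for x
    using that D1(8) by (simp add: t_def B(6-9))
  obtain u where u: "u : lhom S Y1 Y" "ALL x:car Y1. y (u x) = i (i1 x)"
    using hom_factor_mono[OF Y D1(1) lhom_comp[OF D1(4) B(2)]] ti by blast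
  have "p2 (q (y x)) = 0[X2]" if "x : car Y" for x
    using bt[of "y x"] DY(8)[OF that] that by simp
  then obtain v where v: "v : lhom S Y Y2" "ALL x:car Y. i2 (v x) = q (y x)"
    using hom_factor_mono[OF s2 DY(1) lhom_comp[OF DY(4) B(5)]] by blast
  interpret u: lhom_loc S Y1 Y u by (rule hom_loc) fact+
  interpret v: lhom_loc S Y Y2 v by (rule hom_loc) fact+
  have "ses Y1 u Y v Y2"
  proof (rule sesI)
    show "x = 0[Y1]" if x: "x : car Y1" "u x = 0[Y]" for x
    proof -
      have "i (i1 x) = 0[B]" using u(2) x y.zero by metis
      hence "i1 x = 0[T1]" using B(6)[of "i1 x"] x by auto
      thus ?thesis using D1(6) i1.inj_iff x by blast
    qed
    show "EX x:car Y. v x = z" if z: "z : car Y2" for z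
    proof -
      have "b (l (i2 z)) = 0[X2]" using l(2) D2(8) z by simp
      then obtain x1 where x1: "x1 : car X1" "a x1 = l (i2 z)" using D(9)[of "l (i2 z)"] z by auto
      obtain t1 where t1: "t1 : car T1" "p1 t1 = x1" using D1(10)[OF x1(1)] by blast
      \<comment> \<open>An element over \<open>z\<close> has to lie in the kernel of
        \<open>t\<close>; the first component \<open>-t1\<close> cancels
        \<open>l (i2 z)\<close>.\<close>
      define w where "w = j (i2 z) -[B] i t1"
      have w: "w : car B" "p w = -[T1] t1" "q w = i2 z" using z t1 by (auto simp: w_def B(6-9) a_minus_def)
      have "t w = 0[X]" unfolding t_def using w t1 x1 z by (simp add: a.Y.M.l_neg)
      then obtain x where x: "x : car Y" "y x = w" using DY(9)[OF w(1)] by blast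
      hence "i2 (v x) = i2 z" using v(2) w by simp
      hence "v x = z" using D2(6) x z by (simp add: inj_on_def)
      thus ?thesis using x by blast
    qed
    show "v (u x) = 0[Y2]" if x: "x : car Y1" for x
    proof -
      have "i2 (v (u x)) = 0[T2]" using v(2) u(2) x B(7) by simp
      thus ?thesis using D2(6) i2.inj_iff x by blast
    qed
    show "EX x:car Y1. u x = z" if z: "z : car Y" "v z = 0[Y2]" for z
    proof -
      have q0: "q (y z) = 0[T2]" using v(2) z i2.zero by metis
      have "t (y z) = 0[X]" using DY(8) z by blast
      hence "a (p1 (p (y z))) = 0[X]" using q0 z by (simp add: t_def)
      hence "p1 (p (y z)) = 0[X1]" using D(6) a.inj_iff z by blast
      then obtain x where x: "x : car Y1" "i1 x = p (y z)" using D1(9)[of "p (y z)"] z by auto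
      have "y (u x) = y z" using u(2) x B(10)[of "y z"] q0 z by simp
      hence "u x = z" using DY(6) x z by (simp add: inj_on_def)
      thus ?thesis using x by blast
    qed
  qed (use DY D1 D2 u v in auto)
  thus ?thesis using B' Y unfolding Ses_def by blast
qed

text \<open>Dual to \<open>horseshoe_left\<close>, with the extension of M -> I to \<open>X\<close>
  coming from Ext^1(Z1, I) = 0.\<close>

lemma horseshoe_right:
  assumes s: "ses M a X b Z1" and s1: "ses M i I p Q" and s2: "ses Z1 c N d Z2" and E: "Ev Z1 I"
  shows "EX B W. Ses I B N & Ses X B W & Ses Q W Z2"
proof -
  note D = sesD[OF s] and D1 = sesD[OF s1] and D2 = sesD[OF s2]
  interpret a: lhom_loc S M X a by (rule D)
  interpret b: lhom_loc S X Z1 b by (rule D)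
  interpret i: lhom_loc S M I i by (rule D1)
  interpret p: lhom_loc S I Q p by (rule D1)
  interpret c: lhom_loc S Z1 N c by (rule D2)
  interpret d: lhom_loc S N Z2 d by (rule D2)
  obtain e where e: "e : lhom S X I" "ALL x:car M. e (a x) = i x"
    using Ev_extend[OF E s D1(2) D1(4)] by blast
  interpret e: lhom_loc S X I e by (rule hom_loc) fact+
  obtain B i' j' p' q' where B': "biprod I N B i' j' p' q'" using biproduct[OF D1(2) D2(2)] .
  note B = biprodD[OF B']
  interpret i': lhom_loc S I B i' by (rule hom_loc) fact+
  interpret j': lhom_loc S N B j' by (rule hom_loc) fact+
  interpret p': lhom_loc S B I p' by (rule hom_loc) fact+
  interpret q': lhom_loc S B N q' by (rule hom_loc) fact+
  define t where "t x = i' (e x) +[B] j' (c (b x))" for x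
  have t: "t : lhom S X B" unfolding t_def
    by (intro lhom_plus ObD(1)[OF B(1)] lhom_comp[OF e(1) B(2)] lhom_comp[OF lhom_comp[OF D(5) D2(4)] B(3)])
  interpret t: lhom_loc S X B t by (rule hom_loc) fact+
  have pt: "p' (t x) = e x" "q' (t x) = c (b x)" if "x : car X" for x
    using that by (simp_all add: t_def B(6-9))
  have "inj_on t (car X)" unfolding t.inj_iff
  proof (intro ballI impI)
    fix x assume x: "x : car X" "t x = 0[B]"
    hence "e x = 0[I]" "c (b x) = 0[N]" using pt[OF x(1)] by auto
    hence "b x = 0[Z1]" using D2(6) c.inj_iff x by blast
    then obtain m where m: "m : car M" "a m = x" using D(9) x by blast
    hence "i m = 0[I]" using e(2) `e x = _` by metis
    hence "m = 0[M]" using D1(6) i.inj_iff m by blast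
    thus "x = 0[X]" using m by simp
  qed
  from ses_coker[OF D(2) B(1) t this] obtain W w where W: "ses X t B w W" by blast
  note DW = sesD[OF W]
  interpret w: lhom_loc S B W w by (rule DW)
  have ti: "t (a m) = i' (i m)" if "m : car M" for m
    using that e(2) D(8) by (simp add: t_def)
  hence "w (i' (i m)) = 0[W]" if "m : car M" for m using DW(8)[of "a m"] that by simp
  then obtain u where u: "u : lhom S Q W" "ALL x:car I. u (p x) = w (i' x)"
    using hom_factor_epi[OF s1 DW(3) lhom_comp[OF B(2) DW(5)]] by blast
  have "d (q' (t x)) = 0[Z2]" if "x : car X" for x using pt that D2(8) by simp
  then obtain v where v: "v : lhom S W Z2" "ALL x:car B. v (w x) = d (q' x)"
    using hom_factor_epi[OF W D2(3) lhom_comp[OF B(5) D2(5)]] by blast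
  interpret u: lhom_loc S Q W u by (rule hom_loc) fact+
  interpret v: lhom_loc S W Z2 v by (rule hom_loc) fact+
  have "ses Q u W v Z2"
  proof (rule sesI)
    show "z = 0[Q]" if z: "z : car Q" "u z = 0[W]" for z
    proof -
      obtain x where x: "x : car I" "p x = z" using D1(10)[OF z(1)] by blast
      hence "w (i' x) = 0[W]" using u(2) z by metis
      then obtain y where y: "y : car X" "t y = i' x" using DW(9)[of "i' x"] x by auto
      hence "e y = x" "c (b y) = 0[N]" using pt[OF y(1)] x B(6,7) by auto
      hence "b y = 0[Z1]" using D2(6) c.inj_iff y by blast
      then obtain m where m: "m : car M" "a m = y" using D(9) y by blast
      hence "x = i m" using e(2) `e y = x` by metis
      thus ?thesis using x D1(8) m by simp
    qed
    show "EX x:car W. v x = z" if z: "z : car Z2" for z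
    proof -
      obtain n where n: "n : car N" "d n = z" using D2(10)[OF z] by blast
      hence "v (w (j' n)) = z" using v(2) B(8) by simp
      thus ?thesis using n by blast
    qed
    show "v (u z) = 0[Z2]" if z: "z : car Q" for z
    proof -
      obtain x where x: "x : car I" "p x = z" using D1(10)[OF z] by blast
      hence "u z = w (i' x)" using u(2) by metis
      thus ?thesis using v(2) x B(7) by simp
    qed
    show "EX x:car Q. u x = z" if z: "z : car W" "v z = 0[Z2]" for z
    proof -
      obtain y where y: "y : car B" "w y = z" using DW(10)[OF z(1)] by blast
      hence "d (q' y) = 0[Z2]" using v(2) z by metis
      then obtain z1 where z1: "z1 : car Z1" "c z1 = q' y" using D2(9)[of "q' y"] y by auto
      obtain x where x: "x : car X" "b x = z1" using D(10)[OF z1(1)] by blast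
      define y' where "y' = y -[B] t x"
      have y': "y' : car B" "q' y' = 0[N]" "w y' = z"
        using y x z1 DW(8)[OF x(1)] pt[OF x(1)] z by (auto simp: y'_def a_minus_def i'.Y.M.r_neg c.Y.M.r_neg)
      hence "i' (p' y') = y'" using B(10)[OF y'(1)] by simp
      hence "u (p (p' y')) = z" using u(2) y' by simp
      thus ?thesis using y' by blast
    qed
  qed (use DW D1 D2 u v in auto)
  moreover have "Ses I B N" using ses_biprod[OF B' D1(2) D2(2)] unfolding Ses_def by blast
  ultimately show ?thesis using W unfolding Ses_def by blast
qed

section \<open>Resolutions by short exact sequences\<close>

text \<open>A resolution 0 -> N_d -> ... -> N_0 -> X -> 0 with terms in \<open>C\<close>, cut into
  its syzygy sequences; comparison of lengths then goes by induction on \<open>d\<close>.\<close>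

fun Rs :: "(('k, 'a) umodule => bool) => nat => ('k, 'a) umodule => bool" where
  "Rs C 0 X <-> C X"
| "Rs C (Suc d) X <-> (EX Y N. Ses Y N X & C N & Rs C d Y)"

fun cRs :: "(('k, 'a) umodule => bool) => nat => ('k, 'a) umodule => bool" where
  "cRs C 0 X <-> C X"
| "cRs C (Suc d) X <-> (EX N Y. Ses X N Y & C N & cRs C d Y)"

lemma Rs_mono: "Rs C d X ==> (!!X. C X ==> D X) ==> Rs D d X"
  by (induction d arbitrary: X) auto

text \<open>The equation \<open>C X = C Y\<close> packs closure under extensions in one direction
  and closure under kernels of epimorphisms in the other.\<close>

definition resolving :: "(('k, 'a) umodule => bool) => bool" where
  "resolving C <-> (ALL X Y Z. Ses X Y Z --> C Z --> C X = C Y) & (ALL P. Proj K S P --> C P)"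

definition coresolving :: "(('k, 'a) umodule => bool) => bool" where
  "coresolving C <-> (ALL X Y Z. Ses X Y Z --> C X --> C Y = C Z) & (ALL I. Inj K S I --> C I)"

end

locale fdalg_enough = fdalg K S for K :: "'k ring" and S :: "('k, 'a) module" +
  assumes enough_proj: "!!X :: ('k, 'a) umodule. Ob X ==> EX P Y. Proj K S P & Ses Y P X"
    and enough_inj: "!!X :: ('k, 'a) umodule. Ob X ==> EX I Y. Inj K S I & Ses X I Y"
begin

text \<open>\<open>M\<close> is embedded into an injective \<open>I\<close>. The horseshoe gives an
  embedding of \<open>X\<close> into an extension \<open>B\<close> of \<open>N\<close> by
  \<open>I\<close>, and its cokernel \<open>W\<close> is again an extension of a coresolved module
  by a member of \<open>C\<close>.\<close>

lemma cRs_ext: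
  assumes C: "coresolving C"
  shows "Ses M X Z ==> C M ==> cRs C d Z ==> cRs C d X"
proof (induction d arbitrary: M X Z)
  case 0
  thus ?case using C unfolding coresolving_def by auto
next
  case (Suc d)
  obtain N Z2 where N: "Ses Z N Z2" "C N" "cRs C d Z2" using Suc.prems by auto
  obtain I Q where I: "Inj K S I" "Ses M I Q" using enough_inj SesD(1)[OF Suc.prems(1)] by blast
  have CI: "C I" using C I(1) unfolding coresolving_def by blast
  have "C Q" using C CI I(2) Suc.prems(2) unfolding coresolving_def by blast
  obtain a b i p c d0 where "ses M a X b Z" "ses M i I p Q" "ses Z c N d0 Z2"
    using Suc.prems(1) I(2) N(1) unfolding Ses_def by blast
  from horseshoe_right[OF this Ev_injective[OF I(1)]]
  obtain B W where B: "Ses I B N" "Ses X B W" "Ses Q W Z2" by blast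
  have "C B" using C B(1) CI N(2) unfolding coresolving_def by blast
  moreover have "cRs C d W" by (rule Suc.IH[OF B(3) `C Q` N(3)])
  ultimately show ?case using B(2) by auto
qed

text \<open>The first term \<open>N\<close> is replaced by its quotient by \<open>M\<close>, which
  stays in \<open>C\<close>; the tail of the coresolution is untouched.\<close>

lemma cRs_quotient:
  assumes C: "coresolving C"
  shows "Ses M X Z ==> C M ==> cRs C d X ==> cRs C d Z"
proof (cases d)
  case 0
  thus "Ses M X Z ==> C M ==> cRs C d X ==> cRs C d Z" using C unfolding coresolving_def by auto
next
  case (Suc d')
  assume *: "Ses M X Z" "C M" "cRs C d X"
  then obtain N X1 where N: "Ses X N X1" "C N" "cRs C d' X1" using Suc by auto
  obtain N' where N': "Ses M N N'" "Ses Z N' X1" using Ses_quotient[OF N(1) *(1)] by blast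
  hence "C N'" using C *(2) N(2) unfolding coresolving_def by blast
  thus "cRs C d Z" using N' N Suc by auto
qed

text \<open>The length that remains does not depend on the embedding chosen for the first step. The
  given embedding and the one from the coresolution are compared through their pushout.\<close>

lemma cRs_shift:
  assumes C: "coresolving C" and "Ses X M Z" "C M" "cRs C (Suc d) X"
  shows "cRs C d Z"
proof -
  obtain M' Z' where M': "Ses X M' Z'" "C M'" "cRs C d Z'" using assms(4) by auto
  obtain B where "Ses M B Z'" "Ses M' B Z" using Ses_pushout[OF assms(2) M'(1)] by blast
  thus ?thesis using cRs_ext[OF C _ assms(3) M'(3)] cRs_quotient[OF C _ M'(2)] by blast
qed

lemma Rs_ext:
  assumes C: "resolving C"
  shows "Ses Y X M ==> C M ==> Rs C d Y ==> Rs C d X"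
proof (induction d arbitrary: M X Y)
  case 0
  thus ?case using C unfolding resolving_def by auto
next
  case (Suc d)
  obtain N Y2 where N: "Ses Y2 N Y" "C N" "Rs C d Y2" using Suc.prems by auto
  obtain P Q where P: "Proj K S P" "Ses Q P M" using enough_proj SesD(3)[OF Suc.prems(1)] by blast
  have CP: "C P" using C P(1) unfolding resolving_def by blast
  have "C Q" using C CP P(2) Suc.prems(2) unfolding resolving_def by blast
  obtain a b i p c d0 where s: "ses Y a X b M" "ses Y2 i N p Y" "ses Q c P d0 M"
    using Suc.prems(1) P(2) N(1) unfolding Ses_def by blast
  from horseshoe_left[OF s Ev_projective[OF P(1) sesD(1)[OF s(1)]]]
  obtain B i j p q W where B: "biprod N P B i j p q" "Ses W B X" "Ses Y2 W Q" by blast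
  have "Ses N B P" using ses_biprod[OF B(1)] sesD[OF s(2)] sesD[OF s(3)] unfolding Ses_def by blast
  hence "C B" using C CP N(2) unfolding resolving_def by blast
  moreover have "Rs C d W" by (rule Suc.IH[OF B(3) `C Q` N(3)])
  ultimately show ?case using B(2) by auto
qed

lemma Rs_sub:
  assumes C: "resolving C"
  shows "Ses Z X M ==> C M ==> Rs C d X ==> Rs C d Z"
proof (cases d)
  case 0
  thus "Ses Z X M ==> C M ==> Rs C d X ==> Rs C d Z" using C unfolding resolving_def by auto
next
  case (Suc d')
  assume *: "Ses Z X M" "C M" "Rs C d X"
  then obtain N X1 where N: "Ses X1 N X" "C N" "Rs C d' X1" using Suc by auto
  obtain N' where N': "Ses X1 N' Z" "Ses N' N M" using Ses_preimage[OF N(1) *(1)] by blast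
  hence "C N'" using C *(2) N(2) unfolding resolving_def by blast
  thus "Rs C d Z" using N' N Suc by auto
qed

lemma Rs_shift:
  assumes C: "resolving C" and "Ses Z M X" "C M" "Rs C (Suc d) X"
  shows "Rs C d Z"
proof -
  obtain M' Z' where M': "Ses Z' M' X" "C M'" "Rs C d Z'" using assms(4) by auto
  obtain B where "Ses Z' B M" "Ses Z B M'" using Ses_pullback[OF assms(2) M'(1)] by blast
  thus ?thesis using Rs_ext[OF C _ assms(3) M'(3)] Rs_sub[OF C _ M'(2)] by blast
qed

end

section \<open>Simple modules, projective covers and injective hulls\<close>

context fdalg
begin

lemma projective_iff_Ev:
  "Proj K S P <-> Ob P & (ALL Y. Ob Y --> Ev P Y)" for P :: "('k, 'a) umodule"
proof
  assume "Proj K S P"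
  thus "Ob P & (ALL Y. Ob Y --> Ev P Y)" using Ev_projective unfolding projective_module_def by blast
next
  assume P: "Ob P & (ALL Y. Ob Y --> Ev P Y)"
  show "Proj K S P" unfolding projective_module_def
  proof (intro conjI allI impI)
    fix M N :: "('k, 'a) umodule" and g h
    assume *: "Ob M & Ob N & g : lhom S M N & g ` car M = car N & h : lhom S P N"
    hence s: "ses (M(|carrier := {y : car M. g y = 0[N]}|)) (%x. x) M g N" using ses_ker by blast
    show "EX h':lhom S P M. ALL x:car P. g (h' x) = h x"
      by (rule Ev_lift[OF _ s]) (use P * sesD(1)[OF s] in auto)
  qed (use P in blast)
qed

lemma injective_iff_Ev:
  "Inj K S I <-> Ob I & (ALL X. Ob X --> Ev X I)" for I :: "('k, 'a) umodule"
proof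
  assume "Inj K S I"
  thus "Ob I & (ALL X. Ob X --> Ev X I)" using Ev_injective unfolding injective_module_def by blast
next
  assume I: "Ob I & (ALL X. Ob X --> Ev X I)"
  show "Inj K S I" unfolding injective_module_def
  proof (intro conjI allI impI)
    fix M N :: "('k, 'a) umodule" and g h
    assume *: "Ob M & Ob N & g : lhom S M N & inj_on g (car M) & h : lhom S M I"
    then obtain Z q where s: "ses M g N q Z" using ses_coker[of M N g] by blast
    show "EX h':lhom S N I. ALL x:car M. h' (g x) = h x"
      by (rule Ev_extend[OF _ s]) (use I * sesD(3)[OF s] in auto)
  qed (use I in blast)
qed

lemma projective_ext: "Ses X Y Z ==> Proj K S X ==> Proj K S Z ==> Proj K S Y"
  unfolding projective_iff_Ev Ses_def using Ev_ext_left sesD(2) by metis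

lemma injective_ext: "Ses X Y Z ==> Inj K S X ==> Inj K S Z ==> Inj K S Y"
  unfolding injective_iff_Ev Ses_def using Ev_ext_right sesD(2) by metis

lemma projective_zero: "zmod Z ==> Proj K S Z"
  unfolding projective_iff_Ev using Ev_zero by blast

lemma injective_zero: "zmod Z ==> Inj K S Z"
  unfolding injective_iff_Ev using Ev_zero by blast

lemma Ev_retract_right:
  assumes "Ev X Y" "Ob X" "Ob Y" "Ob Y'" "f : lhom S Y' Y" "g : lhom S Y Y'" "!!y. y : car Y' ==> g (f y) = y"
  shows "Ev X Y'"
  unfolding Ev_def
proof (intro allI impI)
  fix B i p assume s: "ses Y' i B p X"
  obtain k where k: "k : lhom S B Y" "ALL y:car Y'. k (i y) = f y"
    using Ev_extend[OF assms(1) s assms(3,5)] by blast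
  show "EX r:lhom S B Y'. ALL y:car Y'. r (i y) = y"
    using lhom_comp[OF k(1) assms(6)] k(2) assms(7) by (intro bexI[of _ "%x. g (k x)"]) auto
qed

lemma Ev_retract_left:
  assumes "Ev X Y" "Ob X" "Ob X'" "f : lhom S X' X" "g : lhom S X X'" "!!y. y : car X' ==> g (f y) = y"
  shows "Ev X' Y"
proof (rule EvI_section)
  fix B i p assume s: "ses Y i B p X'"
  obtain k where k: "k : lhom S X B" "ALL x:car X. p (k x) = g x"
    using Ev_lift[OF assms(1) s assms(2,5)] by blast
  show "EX k:lhom S X' B. ALL x:car X'. p (k x) = x"
    using lhom_comp[OF assms(4) k(1)] k(2) assms(6) lhom_closed[OF assms(4)]
    by (intro bexI[of _ "%x. k (f x)"]) auto
qed

lemma hz_iso_left: "hz X Y ==> module_iso S X X' ==> hz X' Y"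
proof -
  assume *: "hz X Y" "module_iso S X X'"
  then obtain f where f: "f : lhom S X X'" "f ` car X = car X'" unfolding module_iso_def bij_betw_def by blast
  show "hz X' Y" unfolding hz_def
  proof (intro ballI)
    fix h x assume h: "h : lhom S X' Y" "x : car X'"
    then obtain y where "y : car X" "f y = x" using f(2) by force
    thus "h x = 0[Y]" using hzD[OF *(1) lhom_comp[OF f(1) h(1)], of y] by simp
  qed
qed

lemma hz_iso_right:
  assumes "hz X Y" "module_iso S Y Y'" "Ob X" "Ob Y" "Ob Y'" shows "hz X Y'"
proof -
  obtain f where f: "f : lhom S Y Y'" "bij_betw f (car Y) (car Y')" using assms(2) unfolding module_iso_def by blast
  obtain g where g: "g : lhom S Y' Y" "ALL y:car Y'. f (g y) = y"
    using lhom_inverse_ex[OF ObD(1)[OF assms(4)] ObD(1)[OF assms(5)] f] by blast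
  interpret f: lhom_loc S Y Y' f by (rule hom_loc[OF assms(4,5) f(1)])
  show ?thesis unfolding hz_def
  proof (intro ballI)
    fix h x assume h: "h : lhom S X Y'" "x : car X"
    have "g (h x) = 0[Y]" using hzD[OF assms(1) lhom_comp[OF h(1) g(1)] h(2)] .
    thus "h x = 0[Y']" using g(2) lhom_closed[OF h] f.zero by metis
  qed
qed

lemma hz_surj:
  assumes "hz X Y" "f : lhom S X X'" "f ` car X = car X'" shows "hz X' Y"
  unfolding hz_def
proof (intro ballI)
  fix h x assume h: "h : lhom S X' Y" "x : car X'"
  then obtain y where "y : car X" "f y = x" using assms(3) by force
  thus "h x = 0[Y]" using hzD[OF assms(1) lhom_comp[OF assms(2) h(1)], of y] by simp
qed

end

locale simp_data = fdalg K S for K :: "'k ring" and S :: "('k, 'a) module" +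
  fixes La :: "'l set" and L P I :: "'l => ('k, 'a) umodule"
    and p0 i0 :: "'l => (nat => 'k) => (nat => 'k)"
  assumes fin: "finite La"
    and L_Ob: "l : La ==> Ob (L l)"
    and L_nz: "l : La ==> EX x:car (L l). x ~= 0[L l]"
    and L_surj: "!!(X :: ('k, 'a) umodule) f. l : La ==> Ob X ==> f : lhom S X (L l) ==> EX x:car X. f x ~= 0[L l] ==>
      f ` car X = car (L l)"
    and L_inj: "!!(X :: ('k, 'a) umodule) f. l : La ==> Ob X ==> f : lhom S (L l) X ==> EX x:car (L l). f x ~= 0[X] ==>
      inj_on f (car (L l))"
    and L_iso: "l : La ==> mu : La ==> ~ hz (L l) (L mu) ==> l = mu"
    and P_proj: "l : La ==> Proj K S (P l)"
    and p0: "l : La ==> p0 l : lhom S (P l) (L l)"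
    and p0_surj: "l : La ==> p0 l ` car (P l) = car (L l)"
    and P_sup: "!!(X :: ('k, 'a) umodule) f. l : La ==> Ob X ==> f : lhom S X (P l) ==>
      (%x. p0 l (f x)) ` car X = car (L l) ==> f ` car X = car (P l)"
    and I_inj: "l : La ==> Inj K S (I l)"
    and i0: "l : La ==> i0 l : lhom S (L l) (I l)"
    and i0_inj: "l : La ==> inj_on (i0 l) (car (L l))"
    and I_ess: "!!(X :: ('k, 'a) umodule) f. l : La ==> Ob X ==> f : lhom S (I l) X ==>
      inj_on (%x. f (i0 l x)) (car (L l)) ==> inj_on f (car (I l))"
    and top_ex: "Ob X ==> car X ~= {0[X]} ==> EX l:La. ~ hz X (L l)"
    and soc_ex: "Ob X ==> car X ~= {0[X]} ==> EX l:La. ~ hz (L l) X"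
begin

lemma P_Ob: "l : La ==> Ob (P l)" using P_proj unfolding projective_module_def by blast
lemma I_Ob: "l : La ==> Ob (I l)" using I_inj unfolding injective_module_def by blast

text \<open>If the kernel of \<open>f\<close> were not contained in that of \<open>p0\<close>, it
  would map onto the simple \<open>L l\<close>, hence be all of \<open>P l\<close>.\<close>

lemma P_top:
  fixes X :: "('k, 'a) umodule"
  assumes l: "l : La" and X: "Ob X" and f: "f : lhom S (P l) X" and nz: "EX x:car (P l). f x ~= 0[X]"
    and x: "x : car (P l)" "f x = 0[X]"
  shows "p0 l x = 0[L l]"
proof (rule ccontr)
  assume n: "p0 l x ~= 0[L l]"
  interpret f: lhom_loc S "P l" X f by (rule hom_loc[OF P_Ob[OF l] X f])
  let ?N = "(P l)(|carrier := {x : car (P l). f x = 0[X]}|)"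
  have N: "Ob ?N" "(%x. x) : lhom S ?N (P l)"
    using Ob_sub[OF P_Ob[OF l] f.submod_kernel] incl_left_hom[OF f.submod_kernel f.X.left_module_axioms] by auto
  have "p0 l ` car ?N = car (L l)"
    by (rule L_surj[OF l N(1)]) (use lhom_comp[OF N(2) p0[OF l]] x n in auto)
  hence "(%x. x) ` car ?N = car (P l)" by (intro P_sup[OF l N]) simp
  thus False using nz by auto
qed

lemma P_top':
  fixes X :: "('k, 'a) umodule"
  assumes l: "l : La" and X: "Ob X" and f: "f : lhom S (P l) X" and nz: "EX x:car (P l). f x ~= 0[X]"
  shows "EX h:lhom S (X(|carrier := f ` car (P l)|)) (L l). ALL x:car (P l). h (f x) = p0 l x"
proof -
  note W = img_factor[OF P_Ob[OF l] X f]
  show ?thesis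
    by (rule factor_epi[OF ObD(1)[OF P_Ob[OF l]] ObD(1)[OF W(1)] ObD(1)[OF L_Ob[OF l]] W(2) _ p0[OF l]])
      (use P_top[OF l X f nz] in auto)
qed

text \<open>Otherwise \<open>L l\<close> would embed into the cokernel of \<open>f\<close>; then I l
  -> C would be injective by essentiality, although it kills the nonzero image of
  \<open>f\<close>.\<close>

lemma I_soc:
  fixes X :: "('k, 'a) umodule"
  assumes l: "l : La" and X: "Ob X" and f: "f : lhom S X (I l)" and nz: "EX x:car X. f x ~= 0[I l]"
    and y: "y : car (L l)"
  shows "i0 l y : f ` car X"
proof -
  interpret f: lhom_loc S X "I l" f by (rule hom_loc[OF X I_Ob[OF l] f])
  note W = img_factor[OF X I_Ob[OF l] f]
  obtain C c where s: "ses ((I l)(|carrier := f ` car X|)) (%x. x) (I l) c C"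
    using ses_coker[OF W(1) I_Ob[OF l] W(3) inj_on_id2] .
  note D = sesD[OF s]
  interpret c: lhom_loc S "I l" C c by (rule D)
  have ci: "(%x. c (i0 l x)) : lhom S (L l) C" by (rule lhom_comp[OF i0[OF l] D(5)])
  have "c (i0 l y) = 0[C]"
  proof (rule ccontr)
    assume "c (i0 l y) ~= 0[C]"
    hence "inj_on (%x. c (i0 l x)) (car (L l))" using L_inj[OF l D(3) ci] y by blast
    hence "inj_on c (car (I l))" by (rule I_ess[OF l D(3,5)])
    moreover obtain x where "x : car X" "f x ~= 0[I l]" using nz by blast
    ultimately show False using D(8)[of "f x"] c.inj_iff by auto
  qed
  thus ?thesis using D(9)[OF lhom_closed[OF i0[OF l] y]] by auto
qed

text \<open>The multiplicity of L mu in X is positive iff Hom(P mu, X) is nonzero.\<close>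

definition cf :: "('k, 'a) umodule => 'l => bool" where "cf X mu <-> ~ hz (P mu) X"

lemma cf_ses:
  assumes "ses X f Y g Z" "mu : La"
  shows "cf Y mu <-> cf X mu | cf Z mu"
proof -
  note D = sesD[OF assms(1)]
  interpret f: lhom_loc S X Y f by (rule D)
  interpret g: lhom_loc S Y Z g by (rule D)
  have "hz (P mu) Y" if "hz (P mu) X" "hz (P mu) Z"
    unfolding hz_def
  proof (intro ballI)
    fix h x assume h: "h : lhom S (P mu) Y" and x: "x : car (P mu)"
    have "g (h y) = 0[Z]" if "y : car (P mu)" for y
      using hzD[OF `hz (P mu) Z` lhom_comp[OF h D(5)] that] .
    then obtain k where k: "k : lhom S (P mu) X" "ALL w:car (P mu). f (k w) = h w"
      using hom_factor_mono[OF assms(1) P_Ob[OF assms(2)] h] by blast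
    thus "h x = 0[Y]" using hzD[OF `hz (P mu) X` k(1) x] x f.zero by metis
  qed
  moreover have "hz (P mu) X" if "hz (P mu) Y"
    unfolding hz_def
  proof (intro ballI)
    fix h x assume h: "h : lhom S (P mu) X" and x: "x : car (P mu)"
    have "f (h x) = 0[Y]" using hzD[OF that lhom_comp[OF h D(4)] x] .
    thus "h x = 0[X]" using f.inj_iff D(6) lhom_closed[OF h x] by blast
  qed
  moreover have "hz (P mu) Z" if hY: "hz (P mu) Y"
    unfolding hz_def
  proof (intro ballI)
    fix h x assume h: "h : lhom S (P mu) Z" and x: "x : car (P mu)"
    obtain k where k: "k : lhom S (P mu) Y" "ALL x:car (P mu). g (k x) = h x"
      using projective_lift[OF P_proj[OF assms(2)] D(2,3,5,7) h] by blast
    show "h x = 0[Z]" using hzD[OF hY k(1) x] k(2) x g.zero by metis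
  qed
  ultimately show ?thesis unfolding cf_def by blast
qed

lemma cf_Ses: "Ses X Y Z ==> mu : La ==> cf Y mu <-> cf X mu | cf Z mu"
  unfolding Ses_def using cf_ses by blast

lemma cf_iso:
  assumes "module_iso S X Y" "Ob X" "Ob Y" "mu : La" shows "cf X mu <-> cf Y mu"
proof -
  have "module_iso S Y X" by (rule module_iso_sym[OF ObD(1)[OF assms(2)] ObD(1)[OF assms(3)] assms(1)])
  thus ?thesis unfolding cf_def using hz_iso_right[OF _ _ P_Ob[OF assms(4)]] assms by blast
qed

lemma cf_sub:
  assumes "Ob X" "Ob Y" "f : lhom S X Y" "inj_on f (car X)" "cf X mu" "mu : La" shows "cf Y mu"
proof -
  obtain Z g where "ses X f Y g Z" using ses_coker[OF assms(1-4)] .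
  thus ?thesis using cf_ses[OF _ assms(6)] assms(5) by blast
qed

lemma cf_quot:
  assumes "Ob X" "Ob Y" "f : lhom S X Y" "f ` car X = car Y" "cf Y mu" "mu : La" shows "cf X mu"
  using cf_ses[OF ses_ker[OF assms(1-4)] assms(6)] assms(5) by blast

lemma cf_img:
  fixes X Y :: "('k, 'a) umodule"
  assumes "Ob X" "Ob Y" "f : lhom S X Y" "cf (Y(|carrier := f ` car X|)) mu" "mu : La" shows "cf X mu" "cf Y mu"
proof -
  note W = img_factor[OF assms(1-3)]
  show "cf X mu" by (rule cf_quot[OF assms(1) W(1,2) _ assms(4,5)]) simp
  show "cf Y mu" by (rule cf_sub[OF W(1) assms(2) W(3) _ assms(4,5)]) simp
qed

lemma p0_nz: "l : La ==> EX x:car (P l). p0 l x ~= 0[L l]"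
  using L_nz[of l] p0_surj[of l] by (metis imageE)

lemma cf_L_self: "l : La ==> cf (L l) l"
  unfolding cf_def hz_def using p0_nz p0 by blast

lemma cf_L: "l : La ==> mu : La ==> cf (L l) mu ==> mu = l"
proof -
  assume l: "l : La" and mu: "mu : La" and c: "cf (L l) mu"
  then obtain f where f: "f : lhom S (P mu) (L l)" "EX x:car (P mu). f x ~= 0[L l]" unfolding cf_def hz_def by blast
  have im: "f ` car (P mu) = car (L l)" by (rule L_surj[OF l P_Ob[OF mu] f])
  obtain h where h: "h : lhom S (L l) (L mu)" "ALL x:car (P mu). h (f x) = p0 mu x"
    using P_top'[OF mu L_Ob[OF l] f] unfolding im by auto
  obtain x where x: "x : car (P mu)" "p0 mu x ~= 0[L mu]" using p0_nz[OF mu] by blast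
  hence "h (f x) ~= 0[L mu]" "f x : car (L l)" using h(2) lhom_closed[OF f(1)] by auto
  hence "~ hz (L l) (L mu)" unfolding hz_def using h(1) by blast
  thus "mu = l" using L_iso l mu by blast
qed

lemma cf_of_top: "l : La ==> Ob X ==> ~ hz X (L l) ==> cf X l"
proof -
  assume l: "l : La" and X: "Ob X" and "~ hz X (L l)"
  then obtain f where f: "f : lhom S X (L l)" "EX x:car X. f x ~= 0[L l]" unfolding hz_def by blast
  show ?thesis by (rule cf_quot[OF X L_Ob[OF l] f(1) L_surj[OF l X f] cf_L_self l]) fact
qed

lemma cf_of_soc: "l : La ==> Ob X ==> ~ hz (L l) X ==> cf X l"
proof -
  assume l: "l : La" and X: "Ob X" and "~ hz (L l) X"
  then obtain f where f: "f : lhom S (L l) X" "EX x:car (L l). f x ~= 0[X]" unfolding hz_def by blast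
  show ?thesis by (rule cf_sub[OF L_Ob[OF l] X f(1) L_inj[OF l X f] cf_L_self l]) fact
qed

text \<open>The composite P(l) -> L(l) -> I(l) is a detector for \<open>L l\<close>. It factors
  through every nonzero map X -> I(l) (\<open>ip_through\<close>) and every nonzero map P(l) -> X
  (\<open>ip_extend\<close>), which ties Hom(P(l), X) to Hom(X, I(l)).\<close>

definition ip :: "'l => (nat => 'k) => nat => 'k" where "ip l x = i0 l (p0 l x)"

lemma ip: "l : La ==> ip l : lhom S (P l) (I l)"
  unfolding ip_def by (rule lhom_comp[OF p0 i0])

lemma ip_nz: assumes "l : La" shows "EX x:car (P l). ip l x ~= 0[I l]"
proof -
  interpret lhom_loc S "L l" "I l" "i0 l" by (rule hom_loc[OF L_Ob[OF assms] I_Ob[OF assms] i0[OF assms]])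
  show ?thesis using p0_nz[OF assms] inj_iff i0_inj[OF assms] lhom_closed[OF p0[OF assms]] unfolding ip_def by metis
qed

lemma ip_through:
  fixes X :: "('k, 'a) umodule"
  assumes l: "l : La" and X: "Ob X" and f: "f : lhom S X (I l)" and nz: "EX x:car X. f x ~= 0[I l]"
  shows "EX g:lhom S (P l) X. ALL x:car (P l). f (g x) = ip l x"
proof -
  note W = img_factor[OF X I_Ob[OF l] f]
  have im: "ip l x : f ` car X" if "x : car (P l)" for x
    unfolding ip_def by (rule I_soc[OF l X f nz lhom_closed[OF p0[OF l] that]])
  have "ip l : lhom S (P l) ((I l)(|carrier := f ` car X|))"
    by (rule left_homI) (use im left_homD[OF ip[OF l]] in auto)
  from projective_lift[OF P_proj[OF l] X W(1,2) _ this] show ?thesis by simp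
qed

lemma ip_extend:
  fixes X :: "('k, 'a) umodule"
  assumes l: "l : La" and X: "Ob X" and f: "f : lhom S (P l) X" and nz: "EX x:car (P l). f x ~= 0[X]"
  shows "EX g:lhom S X (I l). ALL x:car (P l). g (f x) = ip l x"
proof -
  note W = img_factor[OF P_Ob[OF l] X f]
  obtain h where h: "h : lhom S (X(|carrier := f ` car (P l)|)) (L l)" "ALL x:car (P l). h (f x) = p0 l x"
    using P_top'[OF l X f nz] by blast
  obtain g where g: "g : lhom S X (I l)" "ALL x:f ` car (P l). g x = i0 l (h x)"
    using injective_extend[OF I_inj[OF l] W(1) X W(3) _ lhom_comp[OF h(1) i0[OF l]]] by auto
  show ?thesis by (rule bexI[OF _ g(1)]) (use g(2) h(2) in "auto simp: ip_def")
qed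

lemma cf_iff_I: "l : La ==> Ob X ==> cf X l <-> ~ hz X (I l)"
proof
  assume l: "l : La" and X: "Ob X"
  obtain z where z: "z : car (P l)" "ip l z ~= 0[I l]" using ip_nz[OF l] by blast
  show "~ hz X (I l)" if "cf X l"
  proof -
    obtain f where f: "f : lhom S (P l) X" "EX x:car (P l). f x ~= 0[X]" using `cf X l` unfolding cf_def hz_def by blast
    obtain g where g: "g : lhom S X (I l)" "ALL x:car (P l). g (f x) = ip l x" using ip_extend[OF l X f] by blast
    have "g (f z) ~= 0[I l]" using g(2) z by simp
    thus ?thesis using g(1) lhom_closed[OF f(1) z(1)] unfolding hz_def by blast
  qed
  show "cf X l" if "~ hz X (I l)"
  proof -
    obtain f where f: "f : lhom S X (I l)" "EX x:car X. f x ~= 0[I l]" using `~ hz X (I l)` unfolding hz_def by blast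
    obtain g where g: "g : lhom S (P l) X" "ALL x:car (P l). f (g x) = ip l x" using ip_through[OF l X f] by blast
    interpret f: lhom_loc S X "I l" f by (rule hom_loc[OF X I_Ob[OF l] f(1)])
    have "g z ~= 0[X]" using g(2) z f.zero by metis
    thus ?thesis using g(1) z(1) unfolding cf_def hz_def by blast
  qed
qed

lemma cf_zmod: "zmod X ==> ~ cf X mu"
  unfolding cf_def hz_def using lhom_closed by fastforce

lemma ses_top:
  assumes "Ob X" "l : La" "~ hz X (L l)"
  obtains X1 where "Ses X1 X (L l)"
proof -
  obtain f where f: "f : lhom S X (L l)" "EX x:car X. f x ~= 0[L l]" using assms unfolding hz_def by blast
  show thesis by (rule that[OF SesI[OF ses_ker[OF assms(1) L_Ob[OF assms(2)] f(1) L_surj[OF assms(2,1) f]]]])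
qed

lemma ses_soc:
  assumes "Ob X" "l : La" "~ hz (L l) X"
  obtains X2 where "Ses (L l) X X2"
proof -
  obtain f where f: "f : lhom S (L l) X" "EX x:car (L l). f x ~= 0[X]" using assms unfolding hz_def by blast
  obtain X2 g where "ses (L l) f X g X2" using ses_coker[OF L_Ob[OF assms(2)] assms(1) f(1) L_inj[OF assms(2,1) f]] .
  thus thesis by (rule that[OF SesI])
qed

lemma L_len: "l : La ==> len (L l) > 0"
  using len_zero_iff[OF L_Ob] L_nz by fastforce

text \<open>Induction on the dimension, with a simple top split off at each step.\<close>

lemma Ev_by_factors:
  assumes Y: "Ob Y"
  shows "Ob Z ==> (!!tau. tau : La ==> cf Z tau ==> Ev (L tau) Y) ==> Ev Z Y"
proof (induction "len Z" arbitrary: Z rule: less_induct)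
  case less
  show ?case
  proof (cases "car Z = {0[Z]}")
    case True
    thus ?thesis using Ev_zero Y less.prems by blast
  next
    case False
    then obtain l where l: "l : La" "~ hz Z (L l)" using top_ex less.prems by blast
    obtain X1 where X1: "Ses X1 Z (L l)" using ses_top[OF less.prems(1) l] .
    have "len X1 < len Z" using Ses_len[OF X1] L_len[OF l(1)] by simp
    moreover have "Ev (L tau) Y" if "tau : La" "cf X1 tau" for tau using less.prems(2) cf_Ses[OF X1] that by blast
    ultimately have "Ev X1 Y" using less.hyps SesD(1)[OF X1] by blast
    moreover have "Ev (L l) Y" using less.prems(2)[OF l(1)] cf_of_top[OF l(1) less.prems(1) l(2)] by blast
    ultimately show ?thesis using Ev_ext_left X1 Y unfolding Ses_def by blast
  qed
qed

text \<open>Projective presentations are assembled along a composition series: the horseshoe lemma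
  adds one \<open>P l\<close> for each simple top.\<close>

lemma enough_proj': "Ob X ==> EX Q Y. Proj K S Q & Ses Y Q X"
proof (induction "len X" arbitrary: X rule: less_induct)
  case less
  show ?case
  proof (cases "car X = {0[X]}")
    case True
    hence "zmod X" using less.prems by blast
    thus ?thesis using projective_zero Ses_of_iso(1)[OF _ _ _ module_iso_refl] by blast
  next
    case False
    then obtain l where l: "l : La" "~ hz X (L l)" using top_ex less.prems by blast
    obtain X1 where X1: "Ses X1 X (L l)" using ses_top[OF less.prems(1) l] .
    have "len X1 < len X" using Ses_len[OF X1] L_len[OF l(1)] by simp
    then obtain Q1 Y1 where Q1: "Proj K S Q1" "Ses Y1 Q1 X1" using less.hyps SesD(1)[OF X1] by blast
    obtain a b i1 p1 where s: "ses X1 a X b (L l)" "ses Y1 i1 Q1 p1 X1" using X1 Q1(2) unfolding Ses_def by blast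
    note t = ses_ker[OF P_Ob[OF l(1)] L_Ob[OF l(1)] p0[OF l(1)] p0_surj[OF l(1)]]
    from horseshoe_left[OF s t Ev_projective[OF P_proj[OF l(1)] sesD(1)[OF s(1)]]]
    obtain B i j p q Y where B: "biprod Q1 (P l) B i j p q" "Ses Y B X" by blast
    have "Ses Q1 B (P l)" using ses_biprod[OF B(1) sesD(2)[OF s(2)] sesD(2)[OF t]] SesI by blast
    hence "Proj K S B" using projective_ext Q1(1) P_proj[OF l(1)] by blast
    thus ?thesis using B(2) by blast
  qed
qed

lemma enough_inj': "Ob X ==> EX Q Y. Inj K S Q & Ses X Q Y"
proof (induction "len X" arbitrary: X rule: less_induct)
  case less
  show ?case
  proof (cases "car X = {0[X]}")
    case True
    hence "zmod X" using less.prems by blast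
    thus ?thesis using injective_zero Ses_of_iso(2)[OF _ _ _ module_iso_refl] by blast
  next
    case False
    then obtain l where l: "l : La" "~ hz (L l) X" using soc_ex less.prems by blast
    obtain X2 where X2: "Ses (L l) X X2" using ses_soc[OF less.prems(1) l] .
    have "len X2 < len X" using Ses_len[OF X2] L_len[OF l(1)] by simp
    then obtain Q2 Z2 where Q2: "Inj K S Q2" "Ses X2 Q2 Z2" using less.hyps SesD(3)[OF X2] by blast
    obtain a b c d where s: "ses (L l) a X b X2" "ses X2 c Q2 d Z2" using X2 Q2(2) unfolding Ses_def by blast
    obtain C e where t: "ses (L l) (i0 l) (I l) e C"
      using ses_coker[OF L_Ob[OF l(1)] I_Ob[OF l(1)] i0[OF l(1)] i0_inj[OF l(1)]] .
    from horseshoe_right[OF s(1) t s(2) Ev_injective[OF I_inj[OF l(1)]]]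
    obtain B W where B: "Ses (I l) B Q2" "Ses X B W" by blast
    hence "Inj K S B" using injective_ext Q2(1) I_inj[OF l(1)] by blast
    thus ?thesis using B(2) by blast
  qed
qed

end

sublocale simp_data \<subseteq> fdalg_enough
  by unfold_locales (rule enough_proj' enough_inj', assumption)+

section \<open>Standard and costandard modules\<close>

context fdalg
begin

definition cls :: "('l => ('k, 'a) umodule) => 'l set => ('k, 'a) umodule => bool" where
  "cls D M Z <-> Ob Z & (EX mu:M. module_iso S Z (D mu))"

lemma Ses_split_swap:
  assumes "Ses A B C" "Ev C A" shows "Ses C B A"
proof -
  obtain i p where s: "ses A i B p C" using assms(1) unfolding Ses_def by blast
  note D = sesD[OF s]
  obtain r where r: "r : lhom S B A" "!!y. y : car A ==> r (i y) = y" using EvD[OF assms(2) s] by blast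
  obtain k where k: "k : lhom S C B" "ALL x:car C. p (k x) = x" "ALL x:car C. r (k x) = 0[A]"
    "ALL b:car B. i (r b) +[B] k (p b) = b" using section_of_retraction[OF s r] .
  interpret p: lhom_loc S B C p by (rule D)
  interpret i: lhom_loc S A B i by (rule D)
  interpret k: lhom_loc S C B k by (rule hom_loc[OF D(3,2) k(1)])
  have "ses C k B r A"
  proof (rule sesI)
    show "x = 0[C]" if "x : car C" "k x = 0[B]" for x using k(2) that p.zero by metis
    show "EX y:car B. r y = z" if "z : car A" for z using r(2) that i.closed by blast
    show "EX x:car C. k x = y" if "y : car B" "r y = 0[A]" for y
    proof (rule bexI[of _ "p y"])
      have "0[B] +[B] k (p y) = y" using k(4) that i.zero by metis
      thus "k (p y) = y" using that by simp
    qed (use that in auto)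
  qed (use D r k in auto)
  thus ?thesis by (rule SesI)
qed

end

context simp_data
begin

text \<open>Stands for: L l occurs at most once in Y. Over a field that is not algebraically closed
  Hom(P l, Y) may still have dimension greater than one, hence the formulation with endomorphisms of P l.\<close>

definition mult1 :: "'l => ('k, 'a) umodule => bool" where
  "mult1 l Y <-> (ALL f:lhom S (P l) Y. ALL g:lhom S (P l) Y. (EX x:car (P l). f x ~= 0[Y]) -->
     (EX e:lhom S (P l) (P l). ALL x:car (P l). g x = f (e x)))"

lemma mult1D: "mult1 l Y ==> f : lhom S (P l) Y ==> g : lhom S (P l) Y ==> EX x:car (P l). f x ~= 0[Y] ==>
    EX e:lhom S (P l) (P l). ALL x:car (P l). g x = f (e x)"
  unfolding mult1_def by blast

text \<open>A nonzero map P(l) -> X gives a nonzero map to \<open>Y\<close> through which every map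
  P(l) -> Y factors. So all of them land in \<open>X\<close>, and nothing is left for
  \<open>Z\<close>.\<close>

lemma mult1_ses:
  assumes l: "l : La" and m: "mult1 l Y" and s: "Ses X Y Z" and c: "cf X l"
  shows "~ cf Z l"
proof
  assume "cf Z l"
  obtain f g where s: "ses X f Y g Z" using s unfolding Ses_def by blast
  note D = sesD[OF s]
  obtain u where u: "u : lhom S (P l) X" "EX x:car (P l). u x ~= 0[X]" using c unfolding cf_def hz_def by blast
  interpret f: lhom_loc S X Y f by (rule D)
  interpret g: lhom_loc S Y Z g by (rule D)
  have fu: "(%x. f (u x)) : lhom S (P l) Y" by (rule lhom_comp[OF u(1) D(4)])
  have nz: "EX x:car (P l). f (u x) ~= 0[Y]"
    using u D(6) f.inj_iff lhom_closed[OF u(1)] by blast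
  have "hz (P l) Z" unfolding hz_def
  proof (intro ballI)
    fix h x assume h: "h : lhom S (P l) Z" and x: "x : car (P l)"
    show "h x = 0[Z]"
    proof -
      obtain k where k: "k : lhom S (P l) Y" "ALL x:car (P l). g (k x) = h x"
        using projective_lift[OF P_proj[OF l] D(2,3,5,7) h] by blast
      obtain e where e: "e : lhom S (P l) (P l)" "ALL x:car (P l). k x = f (u (e x))"
        using mult1D[OF m fu k(1) nz] by blast
      have "h x = g (f (u (e x)))" using k(2) e(2) x by simp
      also have "... = 0[Z]" by (rule D(8)[OF lhom_closed[OF u(1) lhom_closed[OF e(1) x]]])
      finally show ?thesis .
    qed
  qed
  thus False using `cf Z l` unfolding cf_def by blast
qed

end

text \<open>The hom-theoretic content of quasi-heredity: \<open>D_univ\<close> and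
  \<open>N_univ\<close> make \<open>D l\<close> the largest quotient of \<open>P l\<close>, and
  \<open>N l\<close> the largest submodule of \<open>I l\<close>, with factors below
  \<open>l\<close>; \<open>D_mult\<close> and \<open>K_filt\<close> are conditions (i) and (ii). How
  \<open>D\<close> and \<open>N\<close> were obtained is left open, so F Nabla can take the place of
  \<open>D\<close> later.\<close>

locale hw = simp_data K S La L P I p0 i0
  for K :: "'k ring" and S :: "('k, 'a) module" and La :: "'l set" and L P I p0 i0 +
  fixes le :: "'l rel" and D N :: "'l => ('k, 'a) umodule" and pD iN :: "'l => (nat => 'k) => (nat => 'k)"
  assumes le_refl: "l : La ==> (l, l) : le"
    and le_trans: "(l, mu) : le ==> (mu, tau) : le ==> (l, tau) : le"
    and le_antisym: "(l, mu) : le ==> (mu, l) : le ==> l = mu"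
    and D_Ob: "l : La ==> Ob (D l)" and N_Ob: "l : La ==> Ob (N l)"
    and pD: "l : La ==> pD l : lhom S (P l) (D l)"
    and pD_surj: "l : La ==> pD l ` car (P l) = car (D l)"
    and cf_D: "l : La ==> mu : La ==> cf (D l) mu ==> (mu, l) : le"
    and D_univ: "!!(X :: ('k, 'a) umodule) f x. l : La ==> Ob X ==> f : lhom S (P l) X ==>
      (!!mu. mu : La ==> cf X mu ==> (mu, l) : le) ==> x : car (P l) ==> pD l x = 0[D l] ==> f x = 0[X]"
    and iN: "l : La ==> iN l : lhom S (N l) (I l)"
    and iN_inj: "l : La ==> inj_on (iN l) (car (N l))"
    and cf_N: "l : La ==> mu : La ==> cf (N l) mu ==> (mu, l) : le"
    and N_univ: "!!(X :: ('k, 'a) umodule) f x. l : La ==> Ob X ==> f : lhom S X (I l) ==>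
      (!!mu. mu : La ==> cf X mu ==> (mu, l) : le) ==> x : car X ==> f x : iN l ` car (N l)"
    and K_filt: "l : La ==> EX Y. Ses Y (P l) (D l) & Filt (cls D {tau : La. (l, tau) : le & tau ~= l}) Y"
    and D_mult: "l : La ==> mult1 l (D l)"
begin

abbreviation FD :: "('k, 'a) umodule => bool" where "FD == Filt (cls D La)"
abbreviation FN :: "('k, 'a) umodule => bool" where "FN == Filt (cls N La)"
abbreviation below :: "('k, 'a) umodule => 'l => bool" where "below X l == (ALL mu:La. cf X mu --> (mu, l) : le)"

lemma FN_N: "l : La ==> FN (N l)"
  by (rule Filt_single) (auto simp: cls_def intro: module_iso_refl N_Ob)

text \<open>\<open>N l\<close> is injective among the modules with all factors below
  \<open>l\<close>: the extension is still such a module, so by \<open>N_univ\<close> its map to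
  \<open>I l\<close> lands in \<open>N l\<close>.\<close>

lemma Ev_N_below:
  assumes l: "l : La" and X: "Ob X" and b: "below X l" shows "Ev X (N l)"
  unfolding Ev_def
proof (intro allI impI)
  fix B i p assume s: "ses (N l) i B p X"
  note B = sesD[OF s]
  obtain k where k: "k : lhom S B (I l)" "ALL y:car (N l). k (i y) = iN l y"
    using injective_extend[OF I_inj[OF l] B(1,2,4,6) iN[OF l]] by blast
  have "below B l" using b cf_ses[OF s] cf_N[OF l] by blast
  hence "k x : iN l ` car (N l)" if "x : car B" for x
    using N_univ[OF l B(2) k(1) _ that] by blast
  then obtain r where r: "r : lhom S B (N l)" "ALL x:car B. iN l (r x) = k x"
    using factor_mono[OF ObD(1)[OF N_Ob[OF l]] ObD(1)[OF I_Ob[OF l]] iN[OF l] iN_inj[OF l] k(1) ObD(1)[OF B(2)]] by blast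
  have "r (i y) = y" if y: "y : car (N l)" for y
  proof -
    have "iN l (r (i y)) = iN l y" using r(2) k(2) y lhom_closed[OF B(4)] by simp
    thus ?thesis using iN_inj[OF l] y lhom_closed[OF r(1)] lhom_closed[OF B(4)] by (simp add: inj_on_def)
  qed
  thus "EX r:lhom S B (N l). ALL y:car (N l). r (i y) = y" using r(1) by blast
qed

lemma hz_D: "l : La ==> ~ cf X l ==> hz (D l) X"
  unfolding cf_def using hz_surj[OF _ pD pD_surj] by blast

text \<open>For \<open>l\<close> below \<open>mu\<close> this is relative injectivity of
  \<open>N mu\<close>. Otherwise the kernel of P(l) -> D(l) has sections \<open>D tau\<close> with
  \<open>tau\<close> above \<open>l\<close>; no such \<open>tau\<close> is below \<open>mu\<close>,
  so the kernel has no map to \<open>N mu\<close> that would need extending.\<close>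

lemma Ev_D_N:
  assumes "l : La" "mu : La" shows "Ev (D l) (N mu)"
proof (cases "(l, mu) : le")
  case True
  thus ?thesis using Ev_N_below[OF assms(2) D_Ob[OF assms(1)]] cf_D[OF assms(1)] le_trans by blast
next
  case False
  obtain Y where Y: "Ses Y (P l) (D l)" "Filt (cls D {tau : La. (l, tau) : le & tau ~= l}) Y" using K_filt[OF assms(1)] by blast
  have "hz Y (N mu)"
  proof (rule Filt_hz[OF Y(2) N_Ob[OF assms(2)]])
    fix Z assume "cls D {tau : La. (l, tau) : le & tau ~= l} Z"
    then obtain tau where tau: "Ob Z" "tau : La" "(l, tau) : le" "module_iso S Z (D tau)" unfolding cls_def by blast
    have "~ cf (N mu) tau" using cf_N[OF assms(2) tau(2)] tau(3) False le_trans by blast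
    hence "hz (D tau) (N mu)" by (rule hz_D[OF tau(2)])
    thus "hz Z (N mu)"
      by (rule hz_iso_left[OF _ module_iso_sym[OF ObD(1)[OF tau(1)] ObD(1)[OF D_Ob[OF tau(2)]] tau(4)]])
  qed
  moreover obtain i p where s: "ses Y i (P l) p (D l)" using Y(1) unfolding Ses_def by blast
  ultimately have ext: "EX k:lhom S (P l) (N mu). ALL x:car Y. k (i x) = h x" if "h : lhom S Y (N mu)" for h
    using lhom_zero[OF ObD(1)[OF N_Ob[OF assms(2)]]] hzD[OF _ that] by (intro bexI[of _ "%_. 0[N mu]"]) auto
  show ?thesis by (rule Ev_from_extend[OF s Ev_projective[OF P_proj[OF assms(1)]] N_Ob[OF assms(2)] ext]) (rule N_Ob[OF assms(2)])
qed

lemma Ev_D_FN: "l : La ==> FN Y ==> Ev (D l) Y"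
proof (erule Filt_Ev_right[OF _ D_Ob])
  fix Z assume l: "l : La" and "cls N La Z"
  then obtain mu where mu: "Ob Z" "mu : La" "module_iso S Z (N mu)" unfolding cls_def by blast
  have "module_iso S (N mu) Z" by (rule module_iso_sym[OF ObD(1)[OF mu(1)] ObD(1)[OF N_Ob[OF mu(2)]] mu(3)])
  thus "Ev (D l) Z" using Ev_iso_right[OF Ev_D_N[OF l mu(2)] _ N_Ob[OF mu(2)] mu(1)] by blast
qed

lemma Ev_FD_FN: "FD X ==> FN Y ==> Ev X Y"
proof (erule Filt_Ev_left)
  assume Y: "FN Y"
  thus "Ob Y" by (rule Filt_Ob)
  fix Z assume "cls D La Z"
  then obtain mu where mu: "Ob Z" "mu : La" "module_iso S Z (D mu)" unfolding cls_def by blast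
  have "module_iso S (D mu) Z" by (rule module_iso_sym[OF ObD(1)[OF mu(1)] ObD(1)[OF D_Ob[OF mu(2)]] mu(3)])
  thus "Ev Z Y" using Ev_iso_left[OF Ev_D_FN[OF mu(2) Y] _ D_Ob[OF mu(2)] mu(1)] by blast
qed

text \<open>If \<open>L l\<close> occurred in the radical, \<open>D_mult\<close> would factor the
  surjection \<open>pD l\<close> through the radical.\<close>

lemma D_rad:
  assumes l: "l : La"
  shows "EX R. Ses R (D l) (L l) & ~ cf R l"
proof -
  have "p0 l x = 0[L l]" if "x : car (P l)" "pD l x = 0[D l]" for x
    by (rule D_univ[OF l L_Ob[OF l] p0[OF l] _ that]) (use cf_L l le_refl in blast)
  then obtain t where t: "t : lhom S (D l) (L l)" "ALL x:car (P l). t (pD l x) = p0 l x"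
    using factor_epi[OF ObD(1)[OF P_Ob[OF l]] ObD(1)[OF D_Ob[OF l]] ObD(1)[OF L_Ob[OF l]] pD[OF l] pD_surj[OF l] p0[OF l]]
    by blast
  obtain x0 where x0: "x0 : car (P l)" "p0 l x0 ~= 0[L l]" using p0_nz[OF l] by blast
  have "EX x:car (D l). t x ~= 0[L l]" using x0 t(2) lhom_closed[OF pD[OF l] x0(1)] by (intro bexI[of _ "pD l x0"]) auto
  from L_surj[OF l D_Ob[OF l] t(1) this]
  obtain R i where R: "ses R i (D l) t (L l)" using ses_ker[OF D_Ob[OF l] L_Ob[OF l] t(1)] by blast
  note R' = sesD[OF R]
  interpret i: lhom_loc S R "D l" i by (rule R')
  have "~ cf R l"
  proof
    assume "cf R l"
    then obtain f where f: "f : lhom S (P l) R" "EX x:car (P l). f x ~= 0[R]" unfolding cf_def hz_def by blast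
    have "EX x:car (P l). i (f x) ~= 0[D l]" using f i.inj_iff R'(6) lhom_closed[OF f(1)] by blast
    from mult1D[OF D_mult[OF l] lhom_comp[OF f(1) R'(4)] pD[OF l] this]
    obtain e where e: "e : lhom S (P l) (P l)" "ALL x:car (P l). pD l x = i (f (e x))" by blast
    have "t (pD l x0) = 0[L l]" using e x0(1) R'(8) lhom_closed[OF f(1)] lhom_closed[OF e(1)] by simp
    thus False using t(2) x0 by simp
  qed
  thus ?thesis using R SesI by blast
qed

lemma N_soc:
  assumes l: "l : La"
  shows "EX s. s : lhom S (L l) (N l) & (ALL x:car (L l). iN l (s x) = i0 l x) & inj_on s (car (L l))"
proof -
  have "i0 l x : iN l ` car (N l)" if "x : car (L l)" for x
    by (rule N_univ[OF l L_Ob[OF l] i0[OF l] _ that]) (use cf_L l le_refl in blast)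
  then obtain s where s: "s : lhom S (L l) (N l)" "ALL x:car (L l). iN l (s x) = i0 l x"
    using factor_mono[OF ObD(1)[OF N_Ob[OF l]] ObD(1)[OF I_Ob[OF l]] iN[OF l] iN_inj[OF l] i0[OF l] ObD(1)[OF L_Ob[OF l]]]
    by blast
  have "inj_on s (car (L l))"
    by (rule inj_onI) (metis i0_inj[OF l] inj_onD s(2))
  with s show ?thesis by blast
qed

text \<open>Multiplicity one on the costandard side is inherited from \<open>D_mult\<close>. A map
  P(l) -> N(l) factors over \<open>D l\<close>; comparison with \<open>ip\<close> and an
  endomorphism \<open>e\<close> of \<open>P l\<close> rewrites it as \<open>ip\<close> after
  \<open>e\<close>, so its image lies in the socle and dies in \<open>Z\<close>.\<close>

lemma N_quot:
  assumes l: "l : La" and s: "s : lhom S (L l) (N l)" "ALL x:car (L l). iN l (s x) = i0 l x"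
    and t: "ses (L l) s (N l) c Z"
  shows "~ cf Z l"
proof
  assume "cf Z l"
  note C = sesD[OF t]
  interpret c: lhom_loc S "N l" Z c by (rule C)
  interpret n: lhom_loc S "N l" "I l" "iN l" by (rule hom_loc[OF N_Ob[OF l] I_Ob[OF l] iN[OF l]])
  from `cf Z l` obtain g x1 where g: "g : lhom S (P l) Z" "x1 : car (P l)" "g x1 ~= 0[Z]" unfolding cf_def hz_def by blast
  obtain g1 where g1: "g1 : lhom S (P l) (N l)" "ALL x:car (P l). c (g1 x) = g x"
    using projective_lift[OF P_proj[OF l] C(2,3,5,7) g(1)] by blast
  have "g1 x = 0[N l]" if "x : car (P l)" "pD l x = 0[D l]" for x
    by (rule D_univ[OF l N_Ob[OF l] g1(1) _ that]) (rule cf_N[OF l])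
  then obtain g2 where g2: "g2 : lhom S (D l) (N l)" "ALL x:car (P l). g2 (pD l x) = g1 x"
    using factor_epi[OF ObD(1)[OF P_Ob[OF l]] ObD(1)[OF D_Ob[OF l]] ObD(1)[OF N_Ob[OF l]] pD[OF l] pD_surj[OF l] g1(1)]
    by blast
  interpret g2: lhom_loc S "D l" "N l" g2 by (rule hom_loc[OF D_Ob[OF l] N_Ob[OF l] g2(1)])
  have ng: "(%x. iN l (g2 x)) : lhom S (D l) (I l)" by (rule lhom_comp[OF g2(1) iN[OF l]])
  have "g2 (pD l x1) ~= 0[N l]" using g1(2) g2(2) g c.zero by metis
  hence nz: "EX x:car (D l). iN l (g2 x) ~= 0[I l]"
    using n.inj_iff iN_inj[OF l] lhom_closed[OF pD[OF l] g(2)] g2.closed by blast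
  obtain u where u: "u : lhom S (P l) (D l)" "ALL x:car (P l). iN l (g2 (u x)) = ip l x"
    using ip_through[OF l D_Ob[OF l] ng nz] by blast
  have "EX x:car (P l). u x ~= 0[D l]" using ip_nz[OF l] u(2) g2.zero n.zero by metis
  from mult1D[OF D_mult[OF l] u(1) pD[OF l] this]
  obtain e where e: "e : lhom S (P l) (P l)" "ALL x:car (P l). pD l x = u (e x)" by blast
  have ec: "e x1 : car (P l)" using lhom_closed[OF e(1) g(2)] .
  have pc: "p0 l (e x1) : car (L l)" using lhom_closed[OF p0[OF l] ec] .
  have "iN l (g1 x1) = ip l (e x1)" using g2(2) e(2) u(2) ec g(2) by metis
  also have "... = iN l (s (p0 l (e x1)))" using s(2) pc by (simp add: ip_def)
  finally have "g1 x1 = s (p0 l (e x1))"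
    using iN_inj[OF l] lhom_closed[OF g1(1) g(2)] lhom_closed[OF s(1) pc] by (simp add: inj_on_def)
  hence "c (g1 x1) = 0[Z]" using C(8)[OF pc] by simp
  thus False using g1(2) g by simp
qed

text \<open>The radical of \<open>D l\<close> has factors strictly below \<open>l\<close> only. A
  nonzero map from it to \<open>X\<close> would put one of these into the socle of \<open>X\<close>,
  contrary to \<open>lo\<close>. So Hom(rad D(l), X) = 0, and Ext^1(L(l), X) embeds into Ext^1(D(l),
  X).\<close>

lemma Ev_D_L:
  assumes l: "l : La" and X: "Ob X" and E: "Ev (D l) X"
    and lo: "!!tau. tau : La ==> (tau, l) : le ==> tau ~= l ==> hz (L tau) X"
  shows "Ev (L l) X"
proof -
  obtain R where R: "Ses R (D l) (L l)" "~ cf R l" using D_rad[OF l] by blast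
  obtain i t where s: "ses R i (D l) t (L l)" using R(1) unfolding Ses_def by blast
  have hzR: "hz R X" unfolding hz_def
  proof (intro ballI, rule ccontr)
    fix f x assume f: "f : lhom S R X" "x : car R" "f x ~= 0[X]"
    note W = img_factor[OF sesD(1)[OF s] X f(1)]
    have "car (X(|carrier := f ` car R|)) ~= {0[X(|carrier := f ` car R|)]}" using f by auto
    then obtain tau where tau: "tau : La" "~ hz (L tau) (X(|carrier := f ` car R|))" using soc_ex[OF W(1)] by blast
    have cR: "cf R tau" by (rule cf_img(1)[OF sesD(1)[OF s] X f(1) cf_of_soc[OF tau(1) W(1) tau(2)] tau(1)])
    have "(tau, l) : le" "tau ~= l" using cf_D[OF l tau(1)] cf_ses[OF s tau(1)] cR R(2) by auto
    hence "hz (L tau) X" by (rule lo[OF tau(1)])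
    hence "hz (L tau) (X(|carrier := f ` car R|))" unfolding hz_def using lhom_comp[OF _ W(3)] by fastforce
    thus False using tau(2) by blast
  qed
  have ext: "EX k:lhom S (D l) X. ALL x:car R. k (i x) = h x" if "h : lhom S R X" for h
    using lhom_zero[OF ObD(1)[OF X]] hzD[OF hzR that] by (intro bexI[of _ "%_. 0[X]"]) auto
  show ?thesis by (rule Ev_from_extend[OF s E X ext])
qed

lemma le_minimal:
  assumes "A <= La" "A ~= {}"
  shows "EX m:A. ALL tau:A. (tau, m) : le --> tau = m"
proof -
  have "finite A" using assms(1) fin finite_subset by blast
  thus ?thesis using assms(2)
  proof (induction rule: finite_ne_induct)
    case (singleton x) thus ?case by blast
  next
    case (insert x F)
    then obtain m where m: "m : F" "ALL tau:F. (tau, m) : le --> tau = m" by blast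
    show ?case
    proof (cases "(x, m) : le")
      case True
      have "tau = x" if "tau : insert x F" "(tau, x) : le" for tau
        using that m True le_trans le_antisym by (metis insertE)
      thus ?thesis by blast
    next
      case False
      thus ?thesis using m by blast
    qed
  qed
qed

text \<open>Induction on the dimension: a copy of some \<open>N l\<close> is found inside
  \<open>X\<close>, and the quotient satisfies the same Ext condition.\<close>

theorem FN_criterion:
  "Ob X ==> (!!sigma. sigma : La ==> Ev (D sigma) X) ==> FN X"
proof (induction "len X" arbitrary: X rule: less_induct)
  case less
  show ?case
  proof (cases "car X = {0[X]}")
    case True
    thus ?thesis using Filt_zero less.prems by blast
  next
    case False
    \<comment> \<open>A minimal label \<open>l\<close> in the socle is taken. The factors of
      \<open>N l\<close> other than its socle are strictly below \<open>l\<close>, so no label below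
      one of them occurs in the socle of \<open>X\<close>, and \<open>Ev_D_L\<close>
      applies.\<close>
    define A where "A = {l : La. ~ hz (L l) X}"
    have "A ~= {}" using soc_ex[OF less.prems(1) False] unfolding A_def by blast
    then obtain l where lA: "l : A" "!!tau. tau : A ==> (tau, l) : le ==> tau = l"
      using le_minimal[of A] unfolding A_def by blast
    hence l: "l : La" "~ hz (L l) X" unfolding A_def by auto
    obtain j where j: "j : lhom S (L l) X" "EX x:car (L l). j x ~= 0[X]" using l(2) unfolding hz_def by blast
    have j_inj: "inj_on j (car (L l))" by (rule L_inj[OF l(1) less.prems(1) j])
    obtain s where s: "s : lhom S (L l) (N l)" "ALL x:car (L l). iN l (s x) = i0 l x" "inj_on s (car (L l))"
      using N_soc[OF l(1)] by blast
    obtain Z c where Z: "ses (L l) s (N l) c Z" using ses_coker[OF L_Ob[OF l(1)] N_Ob[OF l(1)] s(1,3)] .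
    have "Ev Z X"
    proof (rule Ev_by_factors[OF less.prems(1) sesD(3)[OF Z]])
      fix tau assume tau: "tau : La" "cf Z tau"
      have "(tau, l) : le" "tau ~= l" using cf_N[OF l(1) tau(1)] cf_ses[OF Z tau(1)] tau(2) N_quot[OF l(1) s(1,2) Z] by auto
      show "Ev (L tau) X"
      proof (rule Ev_D_L[OF tau(1) less.prems(1) less.prems(2)[OF tau(1)]])
        fix sigma assume sigma: "sigma : La" "(sigma, tau) : le" "sigma ~= tau"
        show "hz (L sigma) X"
        proof (rule ccontr)
          assume "~ hz (L sigma) X"
          hence "sigma : A" using sigma(1) unfolding A_def by blast
          hence "sigma = l" using lA(2) le_trans[OF sigma(2) `(tau, l) : le`] by blast
          thus False using sigma `(tau, l) : le` le_antisym by blast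
        qed
      qed
    qed
    from Ev_extend[OF this Z less.prems(1) j(1)]
    obtain f where f: "f : lhom S (N l) X" "ALL x:car (L l). f (s x) = j x" by blast
    interpret f: lhom_loc S "N l" X f by (rule hom_loc[OF N_Ob[OF l(1)] less.prems(1) f(1)])
    interpret n: lhom_loc S "N l" "I l" "iN l" by (rule hom_loc[OF N_Ob[OF l(1)] I_Ob[OF l(1)] iN[OF l(1)]])
    interpret j: lhom_loc S "L l" X j by (rule hom_loc[OF L_Ob[OF l(1)] less.prems(1) j(1)])
    \<comment> \<open>A nonzero kernel would contain the socle of \<open>N l\<close>, on which
      \<open>f\<close> is the nonzero map \<open>j\<close>.\<close>
    have "inj_on f (car (N l))"
    proof (rule ccontr)
      assume ni: "~ inj_on f (car (N l))"
      define U where "U = (N l)(|carrier := {x : car (N l). f x = 0[X]}|)"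
      have U: "Ob U" "(%x. x) : lhom S U (N l)" unfolding U_def
        using Ob_sub[OF N_Ob[OF l(1)] f.submod_kernel] incl_left_hom[OF f.submod_kernel f.X.left_module_axioms] by auto
      obtain x where "x : car U" "iN l x ~= 0[I l]" using ni f.inj_iff n.inj_iff iN_inj[OF l(1)] unfolding U_def by auto
      hence nz: "EX x:car U. iN l x ~= 0[I l]" by blast
      obtain y where y: "y : car (L l)" "j y ~= 0[X]" using j(2) by blast
      have "i0 l y : iN l ` car U"
        by (rule I_soc[OF l(1) U(1) lhom_comp[OF U(2) iN[OF l(1)]] nz y(1)])
      then obtain x where x: "x : car U" "iN l x = iN l (s y)" using s(2) y(1) by auto
      hence "x = s y" using iN_inj[OF l(1)] lhom_closed[OF s(1) y(1)] unfolding U_def inj_on_def by auto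
      thus False using x(1) f(2) y unfolding U_def by auto
    qed
    from ses_coker[OF N_Ob[OF l(1)] less.prems(1) f(1) this] obtain X' g where X': "ses (N l) f X g X'" .
    have "len (N l) > 0" using len_ses[OF Z] L_len[OF l(1)] by simp
    hence "len X' < len X" using len_ses[OF X'] by simp
    \<comment> \<open>Here Ext^2(D(sigma), N(l)) = 0 is at work: the kernel of P(sigma) -> D(sigma)
      is filtered by standard modules.\<close>
    moreover have "Ev (D sigma) X'" if sigma: "sigma : La" for sigma
    proof -
      obtain Y where Y: "Ses Y (P sigma) (D sigma)" "Filt (cls D {tau : La. (sigma, tau) : le & tau ~= sigma}) Y" using K_filt[OF sigma] by blast
      have "FD Y" by (rule Filt_mono[OF Y(2)]) (auto simp: cls_def)
      hence "Ev Y (N l)" using Ev_FD_FN FN_N[OF l(1)] by blast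
      moreover obtain i p where "ses Y i (P sigma) p (D sigma)" using Y(1) unfolding Ses_def by blast
      ultimately show ?thesis using Ev_coker[OF X' _ P_proj[OF sigma] less.prems(2)[OF sigma]] by blast
    qed
    ultimately have "FN X'" using less.hyps sesD(3)[OF X'] by blast
    thus ?thesis using Filt_ext[OF _ FN_N[OF l(1)] SesI[OF X']] by blast
  qed
qed

lemma FN_iff: "FN X <-> Ob X & (ALL sigma:La. Ev (D sigma) X)"
  using FN_criterion Ev_D_FN Filt_Ob by blast

lemma FN_injective: "Inj K S X ==> FN X"
  unfolding FN_iff injective_iff_Ev using D_Ob by blast

lemma FN_retract:
  assumes "FN Y" "Ob Y'" "f : lhom S Y' Y" "g : lhom S Y Y'" "!!y. y : car Y' ==> g (f y) = y"
  shows "FN Y'"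
  using assms Ev_retract_right[OF _ D_Ob _ assms(2-5)] unfolding FN_iff by blast

text \<open>As in the criterion, the obstruction Ext^2(D(sigma), X) is shifted to Ext^1 of a kernel
  filtered by standard modules.\<close>

lemma FN_coker: assumes "Ses X Y Z" "FN X" "FN Y" shows "FN Z"
  unfolding FN_iff
proof (intro conjI ballI)
  show "Ob Z" using SesD assms by blast
  fix sigma assume sigma: "sigma : La"
  obtain Y' where Y: "Ses Y' (P sigma) (D sigma)" "Filt (cls D {tau : La. (sigma, tau) : le & tau ~= sigma}) Y'" using K_filt[OF sigma] by blast
  have "FD Y'" by (rule Filt_mono[OF Y(2)]) (auto simp: cls_def)
  hence "Ev Y' X" using Ev_FD_FN assms(2) by blast
  thus "Ev (D sigma) Z" using Ev_coker P_proj[OF sigma] Y(1) assms(1) Ev_D_FN[OF sigma assms(3)] unfolding Ses_def by metis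
qed

lemma FN_coresolving: "coresolving FN"
  unfolding coresolving_def using FN_injective FN_coker Filt_ext by blast

lemma FN_cf: "FN Y ==> Filt (cls N {mu : La. cf Y mu}) Y"
proof (induction rule: Filt.induct)
  case (Filt_zero X)
  thus ?case by (rule Filt.Filt_zero)
next
  case (Filt_step X Y Z)
  obtain mu where mu: "Ob Z" "mu : La" "module_iso S Z (N mu)" using Filt_step(3) unfolding cls_def by blast
  obtain s where s: "s : lhom S (L mu) (N mu)" "inj_on s (car (L mu))" using N_soc[OF mu(2)] by blast
  have "cf (N mu) mu" by (rule cf_sub[OF L_Ob[OF mu(2)] N_Ob[OF mu(2)] s cf_L_self mu(2)]) fact
  hence "cf Y mu" using cf_iso[OF mu(3,1) N_Ob[OF mu(2)] mu(2)] cf_Ses[OF Filt_step(1) mu(2)] by blast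
  hence "cls N {mu : La. cf Y mu} Z" using mu unfolding cls_def by blast
  moreover have "Filt (cls N {mu : La. cf Y mu}) X"
    by (rule Filt_mono[OF Filt_step.IH]) (use cf_Ses[OF Filt_step(1)] in "auto simp: cls_def")
  ultimately show ?case using Filt_step(1) Filt.Filt_step by blast
qed

text \<open>When \<open>l\<close> bounds all factors, a section \<open>N l\<close> can be moved up
  past every other section, since \<open>N l\<close> is injective relative to modules below
  \<open>l\<close>.\<close>

lemma FN_top:
  assumes l: "l : La"
  shows "FN X ==> below X l ==> cf X l ==> EX Y. Ses Y X (N l) & FN Y"
proof (induction rule: Filt.induct)
  case (Filt_zero X)
  thus ?case using cf_zmod by blast
next
  case (Filt_step X' X Z)
  obtain mu where mu: "Ob Z" "mu : La" "module_iso S Z (N mu)" using Filt_step(3) unfolding cls_def by blast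
  have bX': "below X' l" and bZ: "below Z l" using Filt_step.prems(1) cf_Ses[OF Filt_step(1)] by blast+
  show ?case
  proof (cases "cf X' l")
    case True
    then obtain Y' where Y': "Ses Y' X' (N l)" "FN Y'" using Filt_step.IH bX' by blast
    obtain X'' where X'': "Ses Y' X X''" "Ses (N l) X'' Z" using Ses_quotient[OF Filt_step(1) Y'(1)] by blast
    \<comment> \<open>Ext^1(Z, N(l)) = 0 splits the extension, which allows the two adjacent
      sections to change places.\<close>
    have "Ses Z X'' (N l)" by (rule Ses_split_swap[OF X''(2) Ev_N_below[OF l mu(1) bZ]])
    then obtain Y where Y: "Ses Y' Y Z" "Ses Y X (N l)" using Ses_preimage[OF X''(1)] by blast
    hence "FN Y" using Y'(2) Filt_step(3) Filt.Filt_step by blast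
    thus ?thesis using Y(2) by blast
  next
    case False
    obtain s where s: "s : lhom S (L mu) (N mu)" "inj_on s (car (L mu))" using N_soc[OF mu(2)] by blast
    have "cf (N mu) mu" by (rule cf_sub[OF L_Ob[OF mu(2)] N_Ob[OF mu(2)] s cf_L_self mu(2)]) fact
    hence 1: "(mu, l) : le" using cf_iso[OF mu(3,1) N_Ob[OF mu(2)] mu(2)] bZ mu(2) by blast
    have "cf Z l" using False Filt_step.prems(2) cf_Ses[OF Filt_step(1) l] by blast
    hence "(l, mu) : le" using cf_iso[OF mu(3,1) N_Ob[OF mu(2)] l] cf_N[OF mu(2) l] by blast
    hence "mu = l" using 1 le_antisym by blast
    hence "Ses X' X (N l)" using Ses_iso_right[OF Filt_step(1) N_Ob[OF l]] mu(3) by blast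
    thus ?thesis using Filt_step(2) by blast
  qed
qed

end

section \<open>Endomorphisms\<close>

context fdalg
begin

lemma endo_pow: "e : lhom S X X ==> (e ^^ n) : lhom S X X"
proof (induction n)
  case 0
  thus ?case using lhom_id[of S X] by (simp add: id_def)
next
  case (Suc n)
  thus ?case using lhom_comp[of "e ^^ n" S X X e X] by (simp add: comp_def)
qed

text \<open>Fitting's lemma. For \<open>n > 0\<close> with the image of \<open>e ^^ n\<close> of
  least dimension, \<open>e ^^ n\<close> maps this image bijectively onto that of
  \<open>e ^^ (n + n)\<close>.\<close>

lemma fitting:
  fixes X :: "('k, 'a) umodule"
  assumes X: "Ob X" and e: "e : lhom S X X"
  shows "EX n>0. ALL x:car X. (e ^^ n) ((e ^^ n) x) = 0[X] --> (e ^^ n) x = 0[X]"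
proof -
  define im where "im n = X(|carrier := (e ^^ n) ` car X|)" for n :: nat
  define n where "n = (ARG_MIN (%n. len (im n)) n. n > 0)"
  have n: "n > 0" "!!m. m > 0 ==> len (im n) <= len (im m)"
    unfolding n_def using arg_min_nat_lemma[of "%n. n > 0" 1 "%n. len (im n)"] by auto
  note W = img_factor[OF X X endo_pow[OF e]]
  interpret X: left_module S X by (rule ObD[OF X])
  have en: "(e ^^ n) : lhom S (im n) (im (n + n))"
    by (intro left_homI) (auto simp: im_def funpow_add lhom_add[OF endo_pow[OF e]] lhom_smult[OF endo_pow[OF e]]
      lhom_closed[OF endo_pow[OF e]])
  have "(e ^^ n) ` car (im n) = car (im (n + n))"
    by (simp add: im_def funpow_add image_comp)
  from surj_len_eq_inj[OF _ _ en this] have bij: "bij_betw (e ^^ n) (car (im n)) (car (im (n + n)))"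
    using W(1)[of n] W(1)[of "n + n"] n(2)[of "n + n"] n(1) unfolding im_def by simp
  interpret en: lhom_loc S "im n" "im (n + n)" "e ^^ n"
    by (rule hom_loc[OF _ _ en]) (use W(1) in "auto simp: im_def")
  have "ALL y:car (im n). (e ^^ n) y = 0[im (n + n)] --> y = 0[im n]"
    using bij en.inj_iff by (simp add: bij_betw_def)
  hence "ALL x:car X. (e ^^ n) ((e ^^ n) x) = 0[X] --> (e ^^ n) x = 0[X]"
    by (simp add: im_def)
  with n(1) show ?thesis by blast
qed

text \<open>Stands for a local endomorphism ring, in the elementary form in which Fitting's lemma
  provides it.\<close>

definition local_endo :: "('k, 'a) umodule => bool" where
  "local_endo X <-> (ALL e:lhom S X X. bij_betw e (car X) (car X) | (EX n. ALL x:car X. (e ^^ n) x = 0[X]))"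

lemma module_isoI: "f : lhom S X Y ==> bij_betw f (car X) (car Y) ==> module_iso S X Y"
  unfolding module_iso_def by blast

lemma bij_of_inverse:
  assumes "f : lhom S X Y" "g : lhom S Y X" "!!x. x : car X ==> g (f x) = x" "!!y. y : car Y ==> f (g y) = y"
  shows "bij_betw f (car X) (car Y)"
  by (rule bij_betw_byWitness[where f' = g]) (use assms lhom_closed[OF assms(1)] lhom_closed[OF assms(2)] in auto)

lemma projective_iso:
  fixes X Y :: "('k, 'a) umodule"
  assumes "Proj K S X" "Ob Y" "module_iso S X Y" shows "Proj K S Y"
  using assms Ev_iso_left unfolding projective_iff_Ev by blast

lemma projective_retract:
  fixes X Y :: "('k, 'a) umodule"
  assumes "Proj K S X" "Ob Y" "f : lhom S Y X" "g : lhom S X Y" "!!y. y : car Y ==> g (f y) = y"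
  shows "Proj K S Y"
  using assms Ev_retract_left[OF _ _ assms(2-5)] unfolding projective_iff_Ev by blast

lemma injective_retract:
  fixes X Y :: "('k, 'a) umodule"
  assumes "Inj K S X" "Ob Y" "f : lhom S Y X" "g : lhom S X Y" "!!y. y : car Y ==> g (f y) = y"
  shows "Inj K S Y"
  using assms Ev_retract_right[OF _ _ _ assms(2-5)] unfolding injective_iff_Ev by blast

lemma split_ses:
  assumes X: "Ob X" and Y: "Ob Y" and a: "a : lhom S X Y" and b: "b : lhom S Y X" and ab: "!!y. y : car Y ==> a (b y) = y"
  obtains U i r where "ses U i X a Y" "r : lhom S X U" "!!u. u : car U ==> r (i u) = u"
proof -
  have surj: "a ` car X = car Y" using ab lhom_closed[OF a] lhom_closed[OF b] by force
  note s = ses_ker[OF X Y a surj]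
  obtain r where r: "r : lhom S X (X(|carrier := {x : car X. a x = 0[Y]}|))"
     "ALL y:car (X(|carrier := {x : car X. a x = 0[Y]}|)). r y = y" using retraction_of_section[OF s b ab] .
  show thesis by (rule that[OF s r(1)]) (use r(2) in blast)
qed

lemma projective_resolving: "resolving (Proj K S)"
  unfolding resolving_def
proof (intro conjI allI impI)
  fix X Y Z assume s: "Ses X Y Z" and Z: "Proj K S Z"
  obtain f g where s': "ses X f Y g Z" using s unfolding Ses_def by blast
  note D = sesD[OF s']
  have "Proj K S X" if Y: "Proj K S Y"
  proof -
    have "Ev Z X" by (rule Ev_projective[OF Z D(1)])
    from EvD[OF this s'] obtain r where "r : lhom S Y X" "ALL x:car X. r (f x) = x" by blast
    thus ?thesis using projective_retract[OF Y D(1,4)] by blast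
  qed
  thus "Proj K S X = Proj K S Y" using projective_ext[OF s _ Z] by blast
qed

end

context simp_data
begin

text \<open>An endomorphism that is not injective kills the socle. Were its power from Fitting's
  lemma nonzero, the image of that power would contain the socle, whose elements would then be
  killed by a further application.\<close>

lemma I_local: assumes l: "l : La" shows "local_endo (I l)"
  unfolding local_endo_def
proof (intro ballI)
  fix e assume e: "e : lhom S (I l) (I l)"
  interpret e: lhom_loc S "I l" "I l" e by (rule hom_loc[OF I_Ob[OF l] I_Ob[OF l] e])
  show "bij_betw e (car (I l)) (car (I l)) | (EX n. ALL x:car (I l). (e ^^ n) x = 0[I l])"
  proof (cases "inj_on e (car (I l))")
    case True
    thus ?thesis using inj_len_eq_surj[OF I_Ob[OF l] I_Ob[OF l] e] by simp
  next
    case False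
    obtain n where n: "n > 0" "ALL x:car (I l). (e ^^ n) ((e ^^ n) x) = 0[I l] --> (e ^^ n) x = 0[I l]"
      using fitting[OF I_Ob[OF l] e] by blast
    have e0: "e (i0 l y) = 0[I l]" if y: "y : car (L l)" for y
    proof (rule ccontr)
      assume "e (i0 l y) ~= 0[I l]"
      hence "inj_on (%x. e (i0 l x)) (car (L l))"
        using L_inj[OF l I_Ob[OF l] lhom_comp[OF i0[OF l] e]] y by blast
      thus False using I_ess[OF l I_Ob[OF l] e] False by blast
    qed
    interpret en: lhom_loc S "I l" "I l" "e ^^ n" by (rule hom_loc[OF I_Ob[OF l] I_Ob[OF l] endo_pow[OF e]])
    have "(e ^^ n) x = 0[I l]" if x: "x : car (I l)" for x
    proof (rule ccontr)
      assume "(e ^^ n) x ~= 0[I l]"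
      hence nz: "EX x:car (I l). (e ^^ n) x ~= 0[I l]" using x by blast
      obtain y where y: "y : car (L l)" "y ~= 0[L l]" using L_nz[OF l] by blast
      obtain z where z: "z : car (I l)" "(e ^^ n) z = i0 l y"
        using I_soc[OF l I_Ob[OF l] endo_pow[OF e] nz y(1)] by force
      obtain m where m: "n = Suc m" using n(1) by (cases n) auto
      have em: "(e ^^ m) 0[I l] = 0[I l]"
        using lhom_loc.zero[OF hom_loc[OF I_Ob[OF l] I_Ob[OF l] endo_pow[OF e]]] .
      have "(e ^^ n) ((e ^^ n) z) = (e ^^ m) (e (i0 l y))" unfolding z(2) unfolding m by (simp only: funpow_Suc_right comp_def)
      hence "(e ^^ n) ((e ^^ n) z) = 0[I l]" using e0[OF y(1)] em by simp
      hence "i0 l y = 0[I l]" using n(2) z by metis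
      thus False using lhom_loc.inj_iff[OF hom_loc[OF L_Ob[OF l] I_Ob[OF l] i0[OF l]]] i0_inj[OF l] y by blast
    qed
    thus ?thesis by blast
  qed
qed

end

section \<open>Ringel duality\<close>

text \<open>A \<open>K\<close>-linear functor. Homomorphisms are bare functions that matter only on
  carriers, so \<open>F_cong\<close> has to state that \<open>FA\<close> respects this.\<close>

locale lin_functor = A: fdalg K S + B: fdalg K S'
  for K :: "'k ring" and S :: "('k, 'a) module" and S' :: "('k, 'c) module" +
  fixes FO :: "('k, 'a) umodule => ('k, 'c) umodule"
    and FA :: "('k, 'a) umodule => ('k, 'a) umodule => ((nat => 'k) => (nat => 'k)) => (nat => 'k) => (nat => 'k)"
  assumes F_Ob: "A.Ob X ==> B.Ob (FO X)"
    and F_hom: "A.Ob X ==> A.Ob Y ==> f : lhom S X Y ==> FA X Y f : lhom S' (FO X) (FO Y)"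
    and F_comp: "A.Ob X ==> A.Ob Y ==> A.Ob Z ==> f : lhom S X Y ==> g : lhom S Y Z ==> x : car (FO X) ==>
      FA X Z (%x. g (f x)) x = FA Y Z g (FA X Y f x)"
    and F_id: "A.Ob X ==> x : car (FO X) ==> FA X X (%x. x) x = x"
    and F_add: "A.Ob X ==> A.Ob Y ==> f : lhom S X Y ==> g : lhom S X Y ==> x : car (FO X) ==>
      FA X Y (%x. f x +[Y] g x) x = FA X Y f x +[FO Y] FA X Y g x"
    and F_zero: "A.Ob X ==> A.Ob Y ==> x : car (FO X) ==> FA X Y (%x. 0[Y]) x = 0[FO Y]"
    and F_cong: "A.Ob X ==> A.Ob Y ==> f : lhom S X Y ==> g : lhom S X Y ==> (!!x. x : car X ==> f x = g x) ==>
      x : car (FO X) ==> FA X Y f x = FA X Y g x"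
    and F_scal: "A.Ob X ==> c : car K ==> x : car (FO X) ==>
      FA X X (%x. (sc S c) *[X] x) x = (sc S' c) *[FO X] x"

text \<open>The functor stays abstract because the locale is interpreted twice: for Hom(T, -) from
  \<open>S\<close> to \<open>S'\<close>, and for Hom(F(DS), -) from \<open>S'\<close> back to
  \<open>S\<close>. Fullness and faithfulness are postulated only out of the modules
  \<open>T l\<close>, exactness only for kernels in F(Nabla); \<open>N'\<close> is given by its
  universal property for the reversed order.\<close>

locale ringel =
  A: hw K S La L P I p0 i0 le D N pD iN + B: simp_data K S' La L' P' I' p0' i0' +
  lin_functor K S S' FO FA
  for K :: "'k ring" and S :: "('k, 'a) module" and La :: "'l set" and L P I p0 i0 le D N pD iN
    and S' :: "('k, 'c) module" and L' P' I' p0' i0' FO FA +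
  fixes T :: "'l => ('k, 'a) umodule" and N' :: "'l => ('k, 'c) umodule" and iN' :: "'l => (nat => 'k) => (nat => 'k)"
  assumes T_FD: "l : La ==> A.FD (T l)" and T_FN: "l : La ==> A.FN (T l)"
    and T_below: "l : La ==> A.below (T l) l" and T_cf: "l : La ==> A.cf (T l) l"
    and T_mult: "l : La ==> A.mult1 l (T l)" and T_local: "l : La ==> A.local_endo (T l)"
    and N'_Ob: "l : La ==> B.Ob (N' l)"
    and iN': "l : La ==> iN' l : lhom S' (N' l) (I' l)"
    and iN'_inj: "l : La ==> inj_on (iN' l) (car (N' l))"
    and cf_N': "l : La ==> mu : La ==> B.cf (N' l) mu ==> (l, mu) : le"
    and N'_univ: "!!(X :: ('k, 'c) umodule) f x. l : La ==> B.Ob X ==> f : lhom S' X (I' l) ==>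
      (!!mu. mu : La ==> B.cf X mu ==> (l, mu) : le) ==> x : car X ==> f x : iN' l ` car (N' l)"
    and F_exact: "A.ses X f Y g Z ==> A.FN X ==> B.ses (FO X) (FA X Y f) (FO Y) (FA Y Z g) (FO Z)"
    and F_full: "!!h. l : La ==> A.Ob X ==> h : lhom S' (FO (T l)) (FO X) ==>
      EX g:lhom S (T l) X. ALL x:car (FO (T l)). FA (T l) X g x = h x"
    and F_faithful: "!!g x. l : La ==> A.Ob X ==> g : lhom S (T l) X ==>
      (!!x. x : car (FO (T l)) ==> FA (T l) X g x = 0[FO X]) ==> x : car (T l) ==> g x = 0[X]"
    and F_P: "l : La ==> module_iso S' (P' l) (FO (T l))"
begin

lemma T_Ob: "l : La ==> A.Ob (T l)" using T_FN A.Filt_Ob by blast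

text \<open>Attached to the source \<open>X\<close>, with arbitrary targets: the property is known
  first for the \<open>T l\<close>, then for their sums, and spreads to F(Nabla) by
  presentations.\<close>

definition faith :: "('k, 'a) umodule => bool" where
  "faith X <-> (ALL Y. A.Ob Y --> (ALL g:lhom S X Y. (ALL x:car (FO X). FA X Y g x = 0[FO Y]) --> (ALL x:car X. g x = 0[Y])))"

definition full :: "('k, 'a) umodule => bool" where
  "full X <-> (ALL Y. A.Ob Y --> (ALL h:lhom S' (FO X) (FO Y). EX g:lhom S X Y. ALL x:car (FO X). FA X Y g x = h x))"

text \<open>Collects the properties of finite direct sums of the \<open>T l\<close> that the
  approximation argument needs.\<close>

definition TT :: "('k, 'a) umodule => bool" where
  "TT X <-> A.FN X & A.FD X & faith X & full X & Proj K S' (FO X)"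

lemma faithD: "faith X ==> A.Ob Y ==> g : lhom S X Y ==> (!!x. x : car (FO X) ==> FA X Y g x = 0[FO Y]) ==>
   x : car X ==> g x = 0[Y]"
  unfolding faith_def by blast

lemma fullD: "full X ==> A.Ob Y ==> h : lhom S' (FO X) (FO Y) ==> EX g:lhom S X Y. ALL x:car (FO X). FA X Y g x = h x"
  unfolding full_def by blast

text \<open>On a zero module the identity is the zero map, and \<open>F\<close> preserves
  both.\<close>

lemma F_zmod: "A.zmod X ==> B.zmod (FO X)"
proof -
  assume X: "A.zmod X"
  hence oX: "A.Ob X" by blast
  interpret X: left_module S X by (rule A.ObD[OF oX])
  interpret F: left_module S' "FO X" by (rule B.ObD[OF F_Ob[OF oX]])
  have "x = 0[FO X]" if x: "x : car (FO X)" for x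
  proof -
    have "x = FA X X (%x. x) x" using F_id[OF oX x] by simp
    also have "... = FA X X (%x. 0[X]) x"
      by (rule F_cong[OF oX oX lhom_id lhom_zero[OF X.left_module_axioms] _ x]) (use X in auto)
    finally show ?thesis using F_zero[OF oX oX x] by simp
  qed
  thus ?thesis using F_Ob[OF oX] F.M.zero_closed by blast
qed

lemma faith_eq:
  assumes X: "faith X" "A.Ob X" and Y: "A.Ob Y" and g: "g : lhom S X Y" "h : lhom S X Y"
    and eq: "!!x. x : car (FO X) ==> FA X Y g x = FA X Y h x" and x: "x : car X"
  shows "g x = h x"
proof -
  interpret Y: left_module S Y by (rule A.ObD[OF Y])
  interpret F: left_module S' "FO Y" by (rule B.ObD[OF F_Ob[OF Y]])
  define d where "d x = g x -[Y] h x" for x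
  have d: "d : lhom S X Y" unfolding d_def by (rule lhom_minus[OF Y.left_module_axioms g])
  have "FA X Y d x = 0[FO Y]" if x: "x : car (FO X)" for x
  proof -
    have "FA X Y (%x. d x +[Y] h x) x = FA X Y g x"
      by (rule F_cong[OF X(2) Y lhom_plus[OF Y.left_module_axioms d g(2)] g(1) _ x])
        (use lhom_closed[OF g(1)] lhom_closed[OF g(2)] in "simp add: d_def Y.minus_add_cancel")
    hence "FA X Y d x +[FO Y] FA X Y h x = FA X Y h x" using F_add[OF X(2) Y d g(2) x] eq[OF x] by simp
    thus ?thesis
      using lhom_closed[OF F_hom[OF X(2) Y d] x] lhom_closed[OF F_hom[OF X(2) Y g(2)] x] by (metis F.M.add.r_cancel_one')
  qed
  hence "d x = 0[Y]" using faithD[OF X(1) Y d _ x] by blast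
  thus ?thesis using lhom_closed[OF g(1) x] lhom_closed[OF g(2) x] by (simp add: d_def)
qed

lemma TT_zero: "A.zmod X ==> TT X"
proof -
  assume X: "A.zmod X"
  hence oX: "A.Ob X" by blast
  have "faith X" unfolding faith_def
  proof (intro allI impI ballI)
    fix Y :: "('k, 'a) umodule" and g x assume Y: "A.Ob Y" "g : lhom S X Y" "x : car X"
    show "g x = 0[Y]" by (rule A.hzD[OF A.hz_zero[OF X Y(1)] Y(2,3)])
  qed
  moreover have "full X" unfolding full_def
  proof (intro allI impI ballI)
    fix Y h assume Y: "A.Ob Y" and h: "h : lhom S' (FO X) (FO Y)"
    show "EX g:lhom S X Y. ALL x:car (FO X). FA X Y g x = h x"
      using B.hzD[OF B.hz_zero[OF F_zmod[OF X] F_Ob[OF Y]] h] F_zero[OF oX Y] lhom_zero[OF A.ObD(1)[OF Y]]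
      by (intro bexI[of _ "%_. 0[Y]"]) auto
  qed
  ultimately show ?thesis unfolding TT_def using X A.Filt_zero B.projective_zero[OF F_zmod[OF X]] by blast
qed

lemma TT_T: "l : La ==> TT (T l)"
proof -
  assume l: "l : La"
  have "faith (T l)" unfolding faith_def using F_faithful[OF l] by blast
  moreover have "full (T l)" unfolding full_def using F_full[OF l] by blast
  ultimately show ?thesis unfolding TT_def
    using T_FD[OF l] T_FN[OF l] B.projective_iso[OF B.P_proj[OF l] F_Ob[OF T_Ob[OF l]] F_P[OF l]] by blast
qed

lemma TT_biprod:
  assumes X: "TT X" and Y: "TT Y" and b: "A.biprod X Y C i j p q"
  shows "TT C"
proof -
  have oX: "A.Ob X" and oY: "A.Ob Y" using X Y A.Filt_Ob unfolding TT_def by auto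
  note C = A.biprodD[OF b]
  note s = A.ses_biprod[OF b oX oY]
  interpret C: left_module S C by (rule A.ObD[OF C(1)])
  have FXY: "faith X" "faith Y" "full X" "full Y" using X Y unfolding TT_def by auto
  note Fi = F_hom[OF oX C(1) C(2)] and Fj = F_hom[OF oY C(1) C(3)] and Fp = F_hom[OF C(1) oX C(4)] and Fq = F_hom[OF C(1) oY C(5)]
  have ip: "(%c. i (p c)) : lhom S C C" and jq: "(%c. j (q c)) : lhom S C C"
    by (rule lhom_comp[OF C(4,2)], rule lhom_comp[OF C(5,3)])
  have dec: "FA X C i (FA C X p x) +[FO C] FA Y C j (FA C Y q x) = x" if x: "x : car (FO C)" for x
  proof -
    have "x = FA C C (%x. i (p x) +[C] j (q x)) x"
      using F_id[OF C(1) x] F_cong[OF C(1) C(1) lhom_id lhom_plus[OF C.left_module_axioms ip jq] _ x] C(10) by simp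
    also have "... = FA C C (%x. i (p x)) x +[FO C] FA C C (%x. j (q x)) x" by (rule F_add[OF C(1) C(1) ip jq x])
    also have "... = FA X C i (FA C X p x) +[FO C] FA Y C j (FA C Y q x)"
      using F_comp[OF C(1) oX C(1) C(4,2) x] F_comp[OF C(1) oY C(1) C(5,3) x] by simp
    finally show ?thesis by simp
  qed
  have "faith C" unfolding faith_def
  proof (intro allI impI ballI)
    fix Z g x assume Z: "A.Ob Z" and g: "g : lhom S C Z" and 0: "ALL x:car (FO C). FA C Z g x = 0[FO Z]" and x: "x : car C"
    interpret g: lhom_loc S C Z g by (rule A.hom_loc[OF C(1) Z g])
    have 1: "g (i y) = 0[Z]" if "y : car X" for y
      by (rule faithD[OF FXY(1) Z lhom_comp[OF C(2) g] _ that])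
        (use F_comp[OF oX C(1) Z C(2) g] 0 lhom_closed[OF Fi] in simp)
    have 2: "g (j y) = 0[Z]" if "y : car Y" for y
      by (rule faithD[OF FXY(2) Z lhom_comp[OF C(3) g] _ that])
        (use F_comp[OF oY C(1) Z C(3) g] 0 lhom_closed[OF Fj] in simp)
    have c: "p x : car X" "q x : car Y" using lhom_closed[OF C(4) x] lhom_closed[OF C(5) x] .
    have "g (i (p x) +[C] j (q x)) = g (i (p x)) +[Z] g (j (q x))"
      by (rule g.add) (use c lhom_closed[OF C(2)] lhom_closed[OF C(3)] in auto)
    thus "g x = 0[Z]" using C(10)[OF x] 1[OF c(1)] 2[OF c(2)] by simp
  qed
  moreover have "full C" unfolding full_def
  proof (intro allI impI ballI)
    fix Z h assume Z: "A.Ob Z" and h: "h : lhom S' (FO C) (FO Z)"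
    interpret Z: left_module S Z by (rule A.ObD[OF Z])
    interpret h: lhom_loc S' "FO C" "FO Z" h by (rule B.hom_loc[OF F_Ob[OF C(1)] F_Ob[OF Z] h])
    obtain g1 where g1: "g1 : lhom S X Z" "ALL x:car (FO X). FA X Z g1 x = h (FA X C i x)"
      using fullD[OF FXY(3) Z lhom_comp[OF Fi h]] by blast
    obtain g2 where g2: "g2 : lhom S Y Z" "ALL x:car (FO Y). FA Y Z g2 x = h (FA Y C j x)"
      using fullD[OF FXY(4) Z lhom_comp[OF Fj h]] by blast
    define g where "g x = g1 (p x) +[Z] g2 (q x)" for x
    have gp: "(%x. g1 (p x)) : lhom S C Z" and gq: "(%x. g2 (q x)) : lhom S C Z"
      by (rule lhom_comp[OF C(4) g1(1)], rule lhom_comp[OF C(5) g2(1)])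
    have g: "g : lhom S C Z" unfolding g_def by (rule lhom_plus[OF Z.left_module_axioms gp gq])
    have "FA C Z g x = h x" if x: "x : car (FO C)" for x
    proof -
      have c: "FA C X p x : car (FO X)" "FA C Y q x : car (FO Y)" using lhom_closed[OF Fp x] lhom_closed[OF Fq x] .
      have "FA C Z g x = FA C Z (%x. g1 (p x)) x +[FO Z] FA C Z (%x. g2 (q x)) x"
        unfolding g_def by (rule F_add[OF C(1) Z gp gq x])
      also have "... = h (FA X C i (FA C X p x)) +[FO Z] h (FA Y C j (FA C Y q x))"
        using F_comp[OF C(1) oX Z C(4) g1(1) x] F_comp[OF C(1) oY Z C(5) g2(1) x] g1(2) g2(2) c by simp
      also have "... = h (FA X C i (FA C X p x) +[FO C] FA Y C j (FA C Y q x))"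
        by (rule h.add[symmetric]) (use c lhom_closed[OF Fi] lhom_closed[OF Fj] in auto)
      finally show ?thesis using dec[OF x] by simp
    qed
    thus "EX g:lhom S C Z. ALL x:car (FO C). FA C Z g x = h x" using g by blast
  qed
  moreover have "B.Ses (FO X) (FO C) (FO Y)" using B.SesI[OF F_exact[OF s]] X unfolding TT_def by blast
  ultimately show ?thesis
    using X Y B.projective_ext A.Filt_ext[OF _ _ A.SesI[OF s]] unfolding TT_def by blast
qed

lemma T_ses:
  assumes l: "l : La"
  shows "EX Y. A.Ses Y (T l) (N l) & A.FN Y"
  by (rule A.FN_top[OF l T_FN[OF l] T_below[OF l] T_cf[OF l]])

text \<open>Induction along the filtration: approximations T1 -> X' and T(mu) -> N(mu) are joined by
  the horseshoe lemma, where the lift exists because Ext^1(T(mu), X') = 0.\<close>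

lemma approx: "A.FN X ==> EX Y T0. A.Ses Y T0 X & TT T0 & A.FN Y"
proof (induction rule: A.Filt.induct)
  case (Filt_zero X)
  hence "A.Ses X X X" using A.Ses_of_iso(1)[OF Filt_zero _ _ module_iso_refl] by blast
  thus ?case using TT_zero[OF Filt_zero] unfolding TT_def by blast
next
  case (Filt_step X' X Z)
  obtain mu where mu: "A.Ob Z" "mu : La" "module_iso S Z (N mu)" using Filt_step(3) unfolding A.cls_def by blast
  obtain Y1 T1 where 1: "A.Ses Y1 T1 X'" "TT T1" "A.FN Y1" using Filt_step.IH by blast
  obtain Y2 where 2: "A.Ses Y2 (T mu) (N mu)" "A.FN Y2" using T_ses[OF mu(2)] by blast
  have "module_iso S (N mu) Z" by (rule module_iso_sym[OF A.ObD(1)[OF mu(1)] A.ObD(1)[OF A.N_Ob[OF mu(2)]] mu(3)])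
  hence "A.Ses Y2 (T mu) Z" using A.Ses_iso_right[OF 2(1) mu(1)] by blast
  then obtain a b i1 p1 i2 p2 where s: "A.ses X' a X b Z" "A.ses Y1 i1 T1 p1 X'" "A.ses Y2 i2 (T mu) p2 Z"
    using Filt_step(1) 1(1) unfolding A.Ses_def by blast
  from A.horseshoe_left[OF s A.Ev_FD_FN[OF T_FD[OF mu(2)] Filt_step(2)]]
  obtain C i j p q Y where C: "A.biprod T1 (T mu) C i j p q" "A.Ses Y C X" "A.Ses Y1 Y Y2" by blast
  have "TT C" by (rule TT_biprod[OF 1(2) TT_T[OF mu(2)] C(1)])
  moreover have "A.FN Y" by (rule A.Filt_ext[OF 2(2) 1(3) C(3)])
  ultimately show ?case using C(2) by blast
qed

lemma faith_FN: assumes "A.FN X" shows "faith X"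
  unfolding faith_def
proof (intro allI impI ballI)
  fix Z g x assume Z: "A.Ob Z" and g: "g : lhom S X Z" and 0: "ALL x:car (FO X). FA X Z g x = 0[FO Z]" and x: "x : car X"
  obtain Y T0 i q where T0: "A.ses Y i T0 q X" "TT T0" using approx[OF assms] unfolding A.Ses_def by blast
  note C = A.sesD[OF T0(1)]
  have "g (q t) = 0[Z]" if "t : car T0" for t
    by (rule faithD[OF _ Z lhom_comp[OF C(5) g] _ that])
      (use T0(2) F_comp[OF C(2,3) Z C(5) g] 0 lhom_closed[OF F_hom[OF C(2,3,5)]] in "auto simp: TT_def")
  thus "g x = 0[Z]" using C(10)[OF x] by blast
qed

text \<open>Presentation argument: fullness on \<open>T0\<close> turns \<open>h\<close> into a map
  T0 -> Z; faithfulness on the kernel \<open>Y\<close> shows that this map kills \<open>Y\<close>,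
  so it descends to \<open>X\<close>.\<close>

lemma full_FN: assumes X: "A.FN X" shows "full X"
  unfolding full_def
proof (intro allI impI ballI)
  fix Z h assume Z: "A.Ob Z" and h: "h : lhom S' (FO X) (FO Z)"
  obtain Y T0 i q where T0: "A.ses Y i T0 q X" "TT T0" "A.FN Y" using approx[OF X] unfolding A.Ses_def by blast
  note C = A.sesD[OF T0(1)]
  note FC = B.sesD[OF F_exact[OF T0(1,3)]]
  interpret h: lhom_loc S' "FO X" "FO Z" h by (rule B.hom_loc[OF FC(3) F_Ob[OF Z] h])
  obtain g where g: "g : lhom S T0 Z" "ALL x:car (FO T0). FA T0 Z g x = h (FA T0 X q x)"
    using fullD[OF _ Z lhom_comp[OF FC(5) h]] T0(2) unfolding TT_def by blast
  have "g (i y) = 0[Z]" if "y : car Y" for y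
  proof (rule faithD[OF faith_FN[OF T0(3)] Z lhom_comp[OF C(4) g(1)] _ that])
    fix x assume x: "x : car (FO Y)"
    have "FA Y Z (%x. g (i x)) x = h (FA T0 X q (FA Y T0 i x))"
      using F_comp[OF C(1,2) Z C(4) g(1) x] g(2) lhom_closed[OF FC(4) x] by simp
    thus "FA Y Z (%x. g (i x)) x = 0[FO Z]" using FC(8)[OF x] by simp
  qed
  then obtain k where k: "k : lhom S X Z" "ALL t:car T0. k (q t) = g t"
    using A.hom_factor_epi[OF T0(1) Z g(1)] by blast
  have "FA X Z k x = h x" if x: "x : car (FO X)" for x
  proof -
    obtain t where t: "t : car (FO T0)" "FA T0 X q t = x" using FC(10)[OF x] by blast
    have "FA X Z k x = FA T0 Z (%t. k (q t)) t" using F_comp[OF C(2,3) Z C(5) k(1) t(1)] t(2) by simp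
    also have "... = FA T0 Z g t" by (rule F_cong[OF C(2) Z lhom_comp[OF C(5) k(1)] g(1) _ t(1)]) (use k(2) in blast)
    finally show ?thesis using g(2) t by simp
  qed
  thus "EX g:lhom S X Z. ALL x:car (FO X). FA X Z g x = h x" using k(1) by blast
qed

lemma F_Ses: "A.Ses X Y Z ==> A.FN X ==> B.Ses (FO X) (FO Y) (FO Z)"
  unfolding A.Ses_def B.Ses_def using F_exact by blast

lemma F_retract:
  assumes "A.Ob X" "A.Ob Y" "f : lhom S Y X" "g : lhom S X Y" "!!y. y : car Y ==> g (f y) = y" and x: "x : car (FO Y)"
  shows "FA X Y g (FA Y X f x) = x"
proof -
  have "FA X Y g (FA Y X f x) = FA Y Y (%y. g (f y)) x" using F_comp[OF assms(2,1,2,3,4) x] by simp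
  also have "... = FA Y Y (%y. y) x"
    by (rule F_cong[OF assms(2,2) lhom_comp[OF assms(3,4)] lhom_id _ x]) (use assms(5) in blast)
  finally show ?thesis using F_id[OF assms(2) x] by simp
qed

lemma F_iso: assumes "module_iso S X Y" "A.Ob X" "A.Ob Y" shows "module_iso S' (FO X) (FO Y)"
proof -
  obtain f where f: "f : lhom S X Y" "bij_betw f (car X) (car Y)" using assms(1) unfolding module_iso_def by blast
  obtain g where g: "g : lhom S Y X" "ALL x:car X. g (f x) = x" "ALL y:car Y. f (g y) = y"
    using lhom_inverse_ex[OF A.ObD(1)[OF assms(2)] A.ObD(1)[OF assms(3)] f] by blast
  show ?thesis
    by (rule B.module_isoI[OF F_hom[OF assms(2,3) f(1)] B.bij_of_inverse[OF F_hom[OF assms(2,3) f(1)] F_hom[OF assms(3,2) g(1)]]])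
      (use F_retract[OF assms(3,2) f(1) g(1)] F_retract[OF assms(2,3) g(1) f(1)] g in auto)
qed

lemma F_Filt:
  assumes "A.Filt (A.cls N M) X" "M <= La" shows "B.Filt (B.cls (%l. FO (N l)) M) (FO X)"
  using assms(1)
proof (induction rule: A.Filt.induct)
  case (Filt_zero X)
  thus ?case using B.Filt_zero F_zmod by blast
next
  case (Filt_step X Y Z)
  have "A.FN X" by (rule A.Filt_mono[OF Filt_step(2)]) (use assms(2) in "auto simp: A.cls_def")
  moreover have "B.cls (%l. FO (N l)) M (FO Z)"
    using Filt_step(3) F_iso A.N_Ob F_Ob assms(2) unfolding A.cls_def B.cls_def by blast
  ultimately show ?case using F_Ses[OF Filt_step(1)] Filt_step.IH B.Filt_step by blast
qed

lemma cf'_iff: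
  assumes mu: "mu : La" and X: "B.Ob X" shows "B.cf X mu <-> ~ B.hz (FO (T mu)) X"
proof -
  have "module_iso S' (FO (T mu)) (P' mu)"
    by (rule module_iso_sym[OF B.ObD(1)[OF B.P_Ob[OF mu]] B.ObD(1)[OF F_Ob[OF T_Ob[OF mu]]] F_P[OF mu]])
  thus ?thesis using B.hz_iso_left[OF _ F_P[OF mu]] B.hz_iso_left unfolding B.cf_def by blast
qed

lemma cf'_F:
  assumes mu: "mu : La" and X: "A.Ob X" shows "B.cf (FO X) mu <-> ~ A.hz (T mu) X"
proof -
  have "B.hz (FO (T mu)) (FO X) <-> A.hz (T mu) X"
  proof
    assume h: "B.hz (FO (T mu)) (FO X)"
    show "A.hz (T mu) X" unfolding A.hz_def
      using F_faithful[OF mu X] B.hzD[OF h F_hom[OF T_Ob[OF mu] X]] by blast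
  next
    assume h: "A.hz (T mu) X"
    show "B.hz (FO (T mu)) (FO X)" unfolding B.hz_def
    proof (intro ballI)
      fix f x assume f: "f : lhom S' (FO (T mu)) (FO X)" and x: "x : car (FO (T mu))"
      obtain g where g: "g : lhom S (T mu) X" "ALL x:car (FO (T mu)). FA (T mu) X g x = f x" using F_full[OF mu X f] by blast
      have "FA (T mu) X g x = FA (T mu) X (%x. 0[X]) x"
        by (rule F_cong[OF T_Ob[OF mu] X g(1) lhom_zero[OF A.ObD(1)[OF X]] A.hzD[OF h g(1)] x])
      thus "f x = 0[FO X]" using F_zero[OF T_Ob[OF mu] X x] g(2) x by simp
    qed
  qed
  thus ?thesis using cf'_iff[OF mu F_Ob[OF X]] by blast
qed

text \<open>The order reverses here: \<open>L' mu\<close> occurs in F I(l) iff Hom(T(mu), I(l)) is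
  nonzero, that is, iff \<open>L l\<close> occurs in \<open>T mu\<close>, which forces
  \<open>l\<close> below \<open>mu\<close>.\<close>

lemma cf'_below_I: "l : La ==> mu : La ==> B.cf (FO (I l)) mu ==> (l, mu) : le"
  using cf'_F A.I_Ob A.cf_iff_I[OF _ T_Ob] T_below by blast

lemma cf'_below_N: assumes l: "l : La" "mu : La" "B.cf (FO (N l)) mu" shows "(l, mu) : le"
proof -
  obtain f x where f: "f : lhom S (T mu) (N l)" "x : car (T mu)" "f x ~= 0[N l]"
    using cf'_F[OF l(2) A.N_Ob[OF l(1)]] l(3) unfolding A.hz_def by blast
  have "iN l (f x) ~= 0[I l]"
    using lhom_loc.inj_iff[OF A.hom_loc[OF A.N_Ob[OF l(1)] A.I_Ob[OF l(1)] A.iN[OF l(1)]]] A.iN_inj[OF l(1)]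
      lhom_closed[OF f(1,2)] f(3) by blast
  hence "~ A.hz (T mu) (I l)" using A.hzD[OF _ lhom_comp[OF f(1) A.iN[OF l(1)]] f(2)] by blast
  thus ?thesis using A.cf_iff_I[OF l(1) T_Ob[OF l(2)]] T_below l by blast
qed

end

section \<open>The highest weight structure of the Ringel dual, and the comparison theorems\<close>

context ringel
begin

definition tP :: "'l => (nat => 'k) => nat => 'k" where
  "tP l = (SOME t. t : lhom S' (P' l) (FO (T l)) & bij_betw t (car (P' l)) (car (FO (T l))))"

lemma tP:
  assumes "l : La"
  shows "tP l : lhom S' (P' l) (FO (T l))" "bij_betw (tP l) (car (P' l)) (car (FO (T l)))"
proof -
  have "EX t. t : lhom S' (P' l) (FO (T l)) & bij_betw t (car (P' l)) (car (FO (T l)))"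
    using F_P[OF assms] unfolding module_iso_def by blast
  from someI_ex[OF this] show "tP l : lhom S' (P' l) (FO (T l))" "bij_betw (tP l) (car (P' l)) (car (FO (T l)))"
    unfolding tP_def by auto
qed

lemma tP_inv:
  assumes "l : La"
  shows "EX s:lhom S' (FO (T l)) (P' l). (ALL x:car (P' l). s (tP l x) = x) & (ALL y:car (FO (T l)). tP l (s y) = y)"
  using lhom_inverse_ex[OF B.ObD(1)[OF B.P_Ob[OF assms]] B.ObD(1)[OF F_Ob[OF T_Ob[OF assms]]] tP[OF assms]] by blast

definition piN :: "'l => (nat => 'k) => nat => 'k" where
  "piN l = (SOME f. EX Y i. A.ses Y i (T l) f (N l) & A.FN Y)"

lemma piN: "l : La ==> EX Y i. A.ses Y i (T l) (piN l) (N l) & A.FN Y"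
proof -
  assume "l : La"
  hence "EX f Y i. A.ses Y i (T l) f (N l) & A.FN Y" using T_ses unfolding A.Ses_def by blast
  from someI_ex[OF this] show ?thesis unfolding piN_def .
qed

lemma N_cf: assumes "l : La" shows "A.cf (N l) l"
proof -
  obtain s where "s : lhom S (L l) (N l)" "inj_on s (car (L l))" using A.N_soc[OF assms] by blast
  from A.cf_sub[OF A.L_Ob[OF assms] A.N_Ob[OF assms] this A.cf_L_self[OF assms] assms] show ?thesis .
qed

text \<open>The one occurrence of \<open>L l\<close> in \<open>T l\<close> is used up by the
  quotient \<open>N l\<close>, so all sections of the kernel have labels strictly below
  \<open>l\<close>.\<close>

lemma piN_filt:
  assumes l: "l : La" and s: "A.ses Y i (T l) f (N l)" and Y: "A.FN Y"
  shows "A.Filt (A.cls N {mu : La. (mu, l) : le & mu ~= l}) Y"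
proof (rule A.Filt_mono[OF A.FN_cf[OF Y]])
  have n: "~ A.cf Y l" using A.mult1_ses[OF l T_mult[OF l] A.SesI[OF s]] N_cf[OF l] by blast
  fix Z assume "A.cls N {mu : La. A.cf Y mu} Z"
  thus "A.cls N {mu : La. (mu, l) : le & mu ~= l} Z"
    using n A.cf_ses[OF s] T_below[OF l] unfolding A.cls_def by blast
qed

definition pD' :: "'l => (nat => 'k) => nat => 'k" where
  "pD' l x = FA (T l) (N l) (piN l) (tP l x)"

abbreviation D' :: "'l => ('k, 'c) umodule" where "D' == %l. FO (N l)"

lemma D'_Ob: "l : La ==> B.Ob (D' l)" by (rule F_Ob[OF A.N_Ob])

lemma Fpi: "l : La ==> EX Y i. A.ses Y i (T l) (piN l) (N l) & A.FN Y &
    B.ses (FO Y) (FA Y (T l) i) (FO (T l)) (FA (T l) (N l) (piN l)) (D' l)"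
  using piN F_exact by blast

lemma pD':
  assumes l: "l : La"
  shows "pD' l : lhom S' (P' l) (D' l)" "pD' l ` car (P' l) = car (D' l)"
proof -
  obtain Y i where s: "B.ses (FO Y) (FA Y (T l) i) (FO (T l)) (FA (T l) (N l) (piN l)) (D' l)" using Fpi[OF l] by blast
  note D = B.sesD[OF s]
  show "pD' l : lhom S' (P' l) (D' l)" unfolding pD'_def by (rule lhom_comp[OF tP(1)[OF l] D(5)])
  have "pD' l ` car (P' l) = FA (T l) (N l) (piN l) ` (tP l ` car (P' l))"
    unfolding image_image pD'_def ..
  thus "pD' l ` car (P' l) = car (D' l)" using tP(2)[OF l] D(7) by (simp add: bij_betw_def)
qed

lemma hz_D': "l : La ==> ~ B.cf X l ==> B.hz (D' l) X"
  unfolding B.cf_def using B.hz_surj[OF _ pD'] by blast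

text \<open>The kernel of P'(l) -> F N(l) is filtered by modules F N(mu) with \<open>mu\<close>
  strictly below \<open>l\<close>. By hypothesis no such \<open>L' mu\<close> occurs in
  \<open>X\<close>, so the kernel maps to \<open>X\<close> by zero only.\<close>

lemma D'_univ:
  fixes X :: "('k, 'c) umodule"
  assumes l: "l : La" and X: "B.Ob X" and f: "f : lhom S' (P' l) X" and b: "!!mu. mu : La ==> B.cf X mu ==> (l, mu) : le"
    and x: "x : car (P' l)" "pD' l x = 0[D' l]"
  shows "f x = 0[X]"
proof -
  obtain Y i where s: "A.ses Y i (T l) (piN l) (N l)" "A.FN Y"
    "B.ses (FO Y) (FA Y (T l) i) (FO (T l)) (FA (T l) (N l) (piN l)) (D' l)" using Fpi[OF l] by blast
  note D = B.sesD[OF s(3)]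
  obtain t where t: "t : lhom S' (FO (T l)) (P' l)" "ALL x:car (P' l). t (tP l x) = x" using tP_inv[OF l] by blast
  have "B.hz (FO Y) X"
  proof (rule B.Filt_hz[OF F_Filt[OF piN_filt[OF l s(1,2)]] X])
    fix Z assume "B.cls D' {mu : La. (mu, l) : le & mu ~= l} Z"
    then obtain mu where mu: "B.Ob Z" "mu : La" "(mu, l) : le" "mu ~= l" "module_iso S' Z (D' mu)" unfolding B.cls_def by blast
    hence "~ B.cf X mu" using b A.le_antisym by blast
    hence "B.hz (D' mu) X" by (rule hz_D'[OF mu(2)])
    thus "B.hz Z X"
      by (rule B.hz_iso_left[OF _ module_iso_sym[OF B.ObD(1)[OF mu(1)] B.ObD(1)[OF D'_Ob[OF mu(2)]] mu(5)]])
  qed auto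
  moreover have tx: "tP l x : car (FO (T l))" by (rule lhom_closed[OF tP(1)[OF l] x(1)])
  then obtain y where y: "y : car (FO Y)" "FA Y (T l) i y = tP l x" using D(9)[OF tx] x(2) unfolding pD'_def by blast
  ultimately have "f (t (FA Y (T l) i y)) = 0[X]"
    using B.hzD[OF _ lhom_comp[OF D(4) lhom_comp[OF t(1) f]] y(1)] by blast
  thus ?thesis using t(2) x(1) y(2) by simp
qed

lemma K'_filt:
  assumes l: "l : La"
  shows "EX Y. B.Ses Y (P' l) (D' l) & B.Filt (B.cls D' {tau : La. (tau, l) : le & tau ~= l}) Y"
proof -
  obtain Y i where s: "A.ses Y i (T l) (piN l) (N l)" "A.FN Y"
    "B.ses (FO Y) (FA Y (T l) i) (FO (T l)) (FA (T l) (N l) (piN l)) (D' l)" using Fpi[OF l] by blast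
  have "module_iso S' (FO (T l)) (P' l)"
    by (rule module_iso_sym[OF B.ObD(1)[OF B.P_Ob[OF l]] B.ObD(1)[OF F_Ob[OF T_Ob[OF l]]] F_P[OF l]])
  hence "B.Ses (FO Y) (P' l) (D' l)" by (rule B.Ses_iso_mid[OF B.SesI[OF s(3)] B.P_Ob[OF l]])
  moreover have "B.Filt (B.cls D' {tau : La. (tau, l) : le & tau ~= l}) (FO Y)"
    by (rule F_Filt[OF piN_filt[OF l s(1,2)]]) auto
  ultimately show ?thesis by blast
qed

text \<open>This is \<open>mult1\<close> for F N(l) before \<open>F\<close> is applied. Both maps
  lift through \<open>piN\<close> to endomorphisms \<open>a\<close>, \<open>b\<close> of
  \<open>T l\<close>; once \<open>a\<close> is known to be bijective, its inverse after
  \<open>b\<close> is the required \<open>e\<close>.\<close>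

lemma T_N_mult:
  assumes l: "l : La" and f: "f : lhom S (T l) (N l)" "EX x:car (T l). f x ~= 0[N l]" and g: "g : lhom S (T l) (N l)"
  shows "EX e:lhom S (T l) (T l). ALL x:car (T l). g x = f (e x)"
proof -
  obtain Y i where s: "A.ses Y i (T l) (piN l) (N l)" "A.FN Y" using piN[OF l] by blast
  note C = A.sesD[OF s(1)]
  have E: "A.Ev (T l) Y" by (rule A.Ev_FD_FN[OF T_FD[OF l] s(2)])
  obtain a where a: "a : lhom S (T l) (T l)" "ALL x:car (T l). piN l (a x) = f x" using A.Ev_lift[OF E s(1) C(2) f(1)] by blast
  obtain b where b: "b : lhom S (T l) (T l)" "ALL x:car (T l). piN l (b x) = g x" using A.Ev_lift[OF E s(1) C(2) g] by blast
  interpret n: lhom_loc S "N l" "I l" "iN l" by (rule A.hom_loc[OF A.N_Ob[OF l] A.I_Ob[OF l] A.iN[OF l]])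
  interpret pi: lhom_loc S "T l" "N l" "piN l" by (rule C)
  interpret a: lhom_loc S "T l" "T l" a by (rule A.hom_loc[OF C(2,2) a(1)])
  have nz: "EX x:car (T l). iN l (f x) ~= 0[I l]"
    using f n.inj_iff A.iN_inj[OF l] lhom_closed[OF f(1)] by blast
  obtain u where u: "u : lhom S (P l) (T l)" "ALL x:car (P l). iN l (f (u x)) = A.ip l x"
    using A.ip_through[OF l C(2) lhom_comp[OF f(1) A.iN[OF l]] nz] by blast
  obtain z where z: "z : car (P l)" "A.ip l z ~= 0[I l]" using A.ip_nz[OF l] by blast
  have uz: "u z : car (T l)" by (rule lhom_closed[OF u(1) z(1)])
  have au: "a (u z) ~= 0[T l]"
  proof
    assume "a (u z) = 0[T l]"
    hence "f (u z) = 0[N l]" using a(2) uz pi.zero by metis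
    thus False using u(2) z n.zero by metis
  qed
  hence uz0: "u z ~= 0[T l]" using a.zero by auto
  obtain c where c: "c : lhom S (P l) (P l)" "ALL x:car (P l). u x = a (u (c x))"
    using A.mult1D[OF T_mult[OF l] lhom_comp[OF u(1) a(1)] u(1)] au z(1) by blast
  \<comment> \<open>Iterating \<open>u = a u c\<close> puts the nonzero \<open>u z\<close> into the
    image of every power of \<open>a\<close>. So \<open>a\<close> is not nilpotent, and by
    \<open>T_local\<close> it is bijective.\<close>
  have it: "EX y:car (P l). u x = (a ^^ n) (u y)" if "x : car (P l)" for n x
    using that
  proof (induction n arbitrary: x)
    case 0
    thus ?case by auto
  next
    case (Suc n)
    have "c x : car (P l)" by (rule lhom_closed[OF c(1) Suc.prems])
    then obtain y where "y : car (P l)" "u (c x) = (a ^^ n) (u y)" using Suc.IH by blast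
    thus ?case using c(2) Suc.prems by (intro bexI[of _ y]) auto
  qed
  have "~ (EX n. ALL x:car (T l). (a ^^ n) x = 0[T l])"
    using it[OF z(1)] uz0 lhom_closed[OF u(1)] by metis
  hence "bij_betw a (car (T l)) (car (T l))" using T_local[OF l] a(1) unfolding A.local_endo_def by blast
  then obtain j where j: "j : lhom S (T l) (T l)" "ALL y:car (T l). a (j y) = y"
    using lhom_inverse_ex[OF C(12,12) a(1)] by blast
  have "g x = f (j (b x))" if x: "x : car (T l)" for x
  proof -
    have bx: "b x : car (T l)" by (rule lhom_closed[OF b(1) x])
    have "f (j (b x)) = piN l (a (j (b x)))" using a(2) lhom_closed[OF j(1) bx] by simp
    thus ?thesis using j(2) bx b(2) x by simp
  qed
  thus ?thesis using lhom_comp[OF b(1) j(1)] by (intro bexI[of _ "%x. j (b x)"]) auto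
qed

lemma mult1'_F:
  assumes l: "l : La" and X: "A.Ob X"
    and m: "!!f g. f : lhom S (T l) X ==> EX x:car (T l). f x ~= 0[X] ==> g : lhom S (T l) X ==>
      EX e:lhom S (T l) (T l). ALL x:car (T l). g x = f (e x)"
  shows "B.mult1 l (FO X)"
  unfolding B.mult1_def
proof (intro ballI impI)
  fix f g assume f: "f : lhom S' (P' l) (FO X)" and g: "g : lhom S' (P' l) (FO X)" and nz: "EX x:car (P' l). f x ~= 0[FO X]"
  note T = T_Ob[OF l]
  obtain t where t: "t : lhom S' (FO (T l)) (P' l)" "ALL x:car (P' l). t (tP l x) = x" using tP_inv[OF l] by blast
  obtain f0 where f0: "f0 : lhom S (T l) X" "ALL x:car (FO (T l)). FA (T l) X f0 x = f (t x)"
    using F_full[OF l X lhom_comp[OF t(1) f]] by blast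
  obtain g0 where g0: "g0 : lhom S (T l) X" "ALL x:car (FO (T l)). FA (T l) X g0 x = g (t x)"
    using F_full[OF l X lhom_comp[OF t(1) g]] by blast
  note tc = lhom_closed[OF tP(1)[OF l]]
  have "EX x:car (T l). f0 x ~= 0[X]"
  proof (rule ccontr)
    assume n: "~ (EX x:car (T l). f0 x ~= 0[X])"
    obtain x where x: "x : car (P' l)" "f x ~= 0[FO X]" using nz by blast
    have "FA (T l) X f0 (tP l x) = FA (T l) X (%_. 0[X]) (tP l x)"
      by (rule F_cong[OF T X f0(1) lhom_zero[OF A.ObD(1)[OF X]] _ tc[OF x(1)]]) (use n in blast)
    thus False using F_zero[OF T X tc[OF x(1)]] f0(2) tc[OF x(1)] t(2) x by simp
  qed
  from m[OF f0(1) this g0(1)] obtain e where e: "e : lhom S (T l) (T l)" "ALL x:car (T l). g0 x = f0 (e x)" by blast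
  define e' where "e' x = t (FA (T l) (T l) e (tP l x))" for x
  have e': "e' : lhom S' (P' l) (P' l)" unfolding e'_def
    by (rule lhom_comp[OF lhom_comp[OF tP(1)[OF l] F_hom[OF T T e(1)]] t(1)])
  have "g x = f (e' x)" if x: "x : car (P' l)" for x
  proof -
    have y: "tP l x : car (FO (T l))" by (rule tc[OF x])
    have "g x = FA (T l) X g0 (tP l x)" using g0(2) y t(2) x by simp
    also have "... = FA (T l) X (%x. f0 (e x)) (tP l x)"
      by (rule F_cong[OF T X g0(1) lhom_comp[OF e(1) f0(1)] _ y]) (use e(2) in blast)
    also have "... = FA (T l) X f0 (FA (T l) (T l) e (tP l x))" by (rule F_comp[OF T T X e(1) f0(1) y])
    also have "... = f (e' x)" using f0(2) lhom_closed[OF F_hom[OF T T e(1)] y] by (simp add: e'_def)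
    finally show ?thesis .
  qed
  thus "EX e:lhom S' (P' l) (P' l). ALL x:car (P' l). g x = f (e x)" using e' by blast
qed

lemma hw': "hw K S' La L' P' I' p0' i0' (le^-1) D' N' pD' iN'"
proof
  fix l assume l: "l : La"
  show "(l, l) : le^-1" using A.le_refl[OF l] by simp
  show "B.Ob (D' l)" by (rule D'_Ob[OF l])
  show "B.Ob (N' l)" by (rule N'_Ob[OF l])
  show "pD' l : lhom S' (P' l) (D' l)" "pD' l ` car (P' l) = car (D' l)" by (rule pD'[OF l])+
  show "(mu, l) : le^-1" if "mu : La" "B.cf (D' l) mu" for mu using cf'_below_N[OF l that] by simp
  show "iN' l : lhom S' (N' l) (I' l)" "inj_on (iN' l) (car (N' l))" by (rule iN'[OF l] iN'_inj[OF l])+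
  show "(mu, l) : le^-1" if "mu : La" "B.cf (N' l) mu" for mu using cf_N'[OF l that] by simp
  show "EX Y. B.Ses Y (P' l) (D' l) & B.Filt (B.cls D' {tau : La. (l, tau) : le^-1 & tau ~= l}) Y" using K'_filt[OF l] by simp
  show "B.mult1 l (D' l)" by (rule mult1'_F[OF l A.N_Ob[OF l] T_N_mult[OF l]])
  show "f x = 0[X]" if "B.Ob X" "f : lhom S' (P' l) X" "!!mu. mu : La ==> B.cf X mu ==> (mu, l) : le^-1"
    "x : car (P' l)" "pD' l x = 0[D' l]" for X :: "('k, 'c) umodule" and f x
    by (rule D'_univ[OF l that(1,2) _ that(4,5)]) (use that(3) in auto)
  show "f x : iN' l ` car (N' l)" if "B.Ob X" "f : lhom S' X (I' l)" "!!mu. mu : La ==> B.cf X mu ==> (mu, l) : le^-1"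
    "x : car X" for X :: "('k, 'c) umodule" and f x
    by (rule N'_univ[OF l that(1,2) _ that(4)]) (use that(3) in auto)
qed (use A.le_trans A.le_antisym in blast)+

sublocale B': hw K S' La L' P' I' p0' i0' "le^-1" D' N' pD' iN' by (rule hw')

section \<open>Comparison of dimensions\<close>

lemma FD_F: "A.FN X ==> B'.FD (FO X)"
  using F_Filt[of La X] by simp

text \<open>The left Ext-orthogonal of F(Nabla). It stands in for F(Delta) in the length comparison:
  it contains F(Delta) and is visibly resolving, and \<open>Rs_iff\<close> closes the circle FD, LC,
  projective image, FD.\<close>

definition LC :: "('k, 'a) umodule => bool" where
  "LC X <-> A.Ob X & (ALL Y. A.FN Y --> A.Ev X Y)"

lemma LC_resolving: "A.resolving LC"
  unfolding A.resolving_def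
proof (intro conjI allI impI)
  show "LC Q" if "Proj K S Q" for Q
    using that A.Filt_Ob unfolding LC_def A.projective_iff_Ev by blast
  fix X Y Z assume s: "A.Ses X Y Z" and Z: "LC Z"
  obtain f g where s': "A.ses X f Y g Z" using s unfolding A.Ses_def by blast
  show "LC X = LC Y"
  proof
    show "LC Y" if X: "LC X"
      using X Z A.Ev_ext_left[OF s'] A.Filt_Ob A.sesD(2)[OF s'] unfolding LC_def by blast
    show "LC X" if Y: "LC Y" unfolding LC_def
    proof (intro conjI allI impI)
      show "A.Ob X" by (rule A.sesD[OF s'])
      fix W assume W: "A.FN W"
      obtain Q C where Q: "Inj K S Q" "A.Ses W Q C" using A.enough_inj[OF A.Filt_Ob[OF W]] by blast
      have "A.FN C" by (rule A.FN_coker[OF Q(2) W A.FN_injective[OF Q(1)]])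
      hence "A.Ev Z C" using Z unfolding LC_def by blast
      moreover obtain i p where "A.ses W i Q p C" using Q(2) unfolding A.Ses_def by blast
      ultimately show "A.Ev X W" using A.Ev_ker[OF s' _ Q(1)] Y W unfolding LC_def by blast
    qed
  qed
qed

lemma FD_LC: "A.FD X ==> LC X"
  unfolding LC_def using A.Ev_FD_FN A.Filt_Ob by blast

text \<open>In length 0 the approximation T0 -> X splits, as its kernel is in F(Nabla); so F X is a
  summand of a projective. Longer resolutions may be taken to begin with \<open>T0\<close> by
  \<open>Rs_shift\<close>.\<close>

lemma proj_of_FD:
  "A.FN X ==> A.Rs LC d X ==> B.Rs (Proj K S') d (FO X)"
proof (induction d arbitrary: X)
  case 0
  obtain Y T0 where T0: "A.Ses Y T0 X" "TT T0" "A.FN Y" using approx[OF 0(1)] by blast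
  obtain i q where s: "A.ses Y i T0 q X" using T0(1) unfolding A.Ses_def by blast
  note C = A.sesD[OF s]
  have "A.Ev X Y" using 0(2) T0(3) unfolding LC_def by simp
  from A.Ev_section[OF this s] obtain k where k: "k : lhom S X T0" "ALL x:car X. q (k x) = x" by blast
  have "Proj K S' (FO X)"
    by (rule B.projective_retract[OF _ F_Ob[OF C(3)] F_hom[OF C(3,2) k(1)] F_hom[OF C(2,3,5)] F_retract[OF C(2,3) k(1) C(5)]])
      (use T0(2) k(2) in "auto simp: TT_def")
  thus ?case by simp
next
  case (Suc d)
  obtain Y T0 where T0: "A.Ses Y T0 X" "TT T0" "A.FN Y" using approx[OF Suc(2)] by blast
  have "LC T0" using T0(2) FD_LC unfolding TT_def by blast
  hence "A.Rs LC d Y" by (rule A.Rs_shift[OF LC_resolving T0(1) _ Suc(3)])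
  hence "B.Rs (Proj K S') d (FO Y)" by (rule Suc.IH[OF T0(3)])
  thus ?case using F_Ses[OF T0(1,3)] T0(2) unfolding TT_def by auto
qed

text \<open>A simple quotient \<open>L' l\<close> of the projective F X makes P'(l), that is F T(l),
  a direct summand. Fullness and faithfulness bring the splitting back to \<open>X\<close>, and the
  complement of \<open>T l\<close> has smaller dimension.\<close>

lemma FD_of_projective: "A.FN X ==> Proj K S' (FO X) ==> A.FD X"
proof (induction "A.len X" arbitrary: X rule: less_induct)
  case less
  have X: "A.Ob X" by (rule A.Filt_Ob[OF less.prems(1)])
  interpret X: left_module S X by (rule A.ObD[OF X])
  show ?case
  proof (cases "car X = {0[X]}")
    case True
    thus ?thesis using A.Filt_zero X by blast
  next
    case False
    have "car (FO X) ~= {0[FO X]}"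
    proof
      assume z: "car (FO X) = {0[FO X]}"
      have "x = 0[X]" if "x : car X" for x
        by (rule faithD[OF faith_FN[OF less.prems(1)] X lhom_id _ that]) (use F_id[OF X] z in auto)
      thus False using False X.M.zero_closed by blast
    qed
    then obtain l where l: "l : La" "~ B.hz (FO X) (L' l)" using B.top_ex[OF F_Ob[OF X]] by blast
    then obtain f where f: "f : lhom S' (FO X) (L' l)" "EX x:car (FO X). f x ~= 0[L' l]" unfolding B.hz_def by blast
    have fs: "f ` car (FO X) = car (L' l)" by (rule B.L_surj[OF l(1) F_Ob[OF X] f])
    obtain h where h: "h : lhom S' (FO X) (P' l)" "ALL x:car (FO X). p0' l (h x) = f x"
      using B.projective_lift[OF less.prems(2) B.P_Ob[OF l(1)] B.L_Ob[OF l(1)] B.p0[OF l(1)] B.p0_surj[OF l(1)] f(1)] by blast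
    have "(%x. p0' l (h x)) ` car (FO X) = car (L' l)" using h(2) fs by (metis (no_types, lifting) image_cong)
    hence hs: "h ` car (FO X) = car (P' l)" by (rule B.P_sup[OF l(1) F_Ob[OF X] h(1)])
    note T = T_Ob[OF l(1)]
    have th: "(%x. tP l (h x)) : lhom S' (FO X) (FO (T l))" by (rule lhom_comp[OF h(1) tP(1)[OF l(1)]])
    have "(%x. tP l (h x)) ` car (FO X) = tP l ` (h ` car (FO X))" by (simp add: image_image)
    hence ths: "(%x. tP l (h x)) ` car (FO X) = car (FO (T l))" using hs tP(2)[OF l(1)] by (simp add: bij_betw_def)
    have PT: "Proj K S' (FO (T l))" using TT_T[OF l(1)] unfolding TT_def by blast
    obtain k where k: "k : lhom S' (FO (T l)) (FO X)" "ALL x:car (FO (T l)). tP l (h (k x)) = x"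
      using B.projective_lift[OF PT F_Ob[OF X] F_Ob[OF T] th ths lhom_id] by blast
    obtain a where a: "a : lhom S X (T l)" "ALL x:car (FO X). FA X (T l) a x = tP l (h x)"
      using fullD[OF full_FN[OF less.prems(1)] T th] by blast
    obtain b where b: "b : lhom S (T l) X" "ALL x:car (FO (T l)). FA (T l) X b x = k x"
      using F_full[OF l(1) X k(1)] by blast
    have ab: "a (b y) = y" if "y : car (T l)" for y
    proof (rule faith_eq[OF faith_FN[OF T_FN[OF l(1)]] T T lhom_comp[OF b(1) a(1)] lhom_id _ that])
      fix x assume x: "x : car (FO (T l))"
      have "FA (T l) (T l) (%x. a (b x)) x = FA X (T l) a (FA (T l) X b x)" by (rule F_comp[OF T X T b(1) a(1) x])
      also have "... = x" using a(2) b(2) k(2) x lhom_closed[OF k(1) x] by simp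
      finally show "FA (T l) (T l) (%x. a (b x)) x = FA (T l) (T l) (%x. x) x" using F_id[OF T x] by simp
    qed
    obtain U i r where U: "A.ses U i X a (T l)" "r : lhom S X U" "!!u. u : car U ==> r (i u) = u"
      using A.split_ses[OF X T a(1) b(1) ab] by metis
    note C = A.sesD[OF U(1)]
    have "A.len (T l) > 0" using T_cf[OF l(1)] A.cf_zmod A.len_zero_iff[OF T] T by blast
    hence "A.len U < A.len X" using A.len_ses[OF U(1)] by simp
    moreover have "A.FN U" by (rule A.FN_retract[OF less.prems(1) C(1,4) U(2,3)])
    moreover have "Proj K S' (FO U)"
      by (rule B.projective_retract[OF less.prems(2) F_Ob[OF C(1)] F_hom[OF C(1,2,4)] F_hom[OF C(2,1) U(2)] F_retract[OF C(2,1,4) U(2,3)]])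
    ultimately have "A.FD U" using less.hyps by blast
    thus ?thesis by (rule A.Filt_ext[OF T_FD[OF l(1)] _ A.SesI[OF U(1)]])
  qed
qed

lemma FD_of_proj:
  "A.FN X ==> B.Rs (Proj K S') d (FO X) ==> A.Rs A.FD d X"
proof (induction d arbitrary: X)
  case 0
  thus ?case using FD_of_projective by simp
next
  case (Suc d)
  obtain Y T0 where T0: "A.Ses Y T0 X" "TT T0" "A.FN Y" using approx[OF Suc(2)] by blast
  have "B.Rs (Proj K S') d (FO Y)"
    by (rule B.Rs_shift[OF B.projective_resolving F_Ses[OF T0(1,3)] _ Suc(3)]) (use T0(2) in "simp add: TT_def")
  hence "A.Rs A.FD d Y" by (rule Suc.IH[OF T0(3)])
  thus ?case using T0 unfolding TT_def by auto
qed

theorem Rs_iff: "A.FN X ==> A.Rs A.FD d X <-> B.Rs (Proj K S') d (FO X)"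
  using proj_of_FD FD_of_proj A.Rs_mono[of A.FD d X LC] FD_LC by blast

text \<open>With the presentation 0 -> Z -> T0 -> X -> 0, Ext^1(F X, F Y) is the obstruction to
  extending maps F Z -> F Y over the projective F T0. Such maps come from Z -> Y, and these extend
  over \<open>T0\<close>.\<close>

lemma Ev_F:
  assumes X: "A.FN X" and Y: "A.FN Y" and E: "A.Ev X Y" shows "B.Ev (FO X) (FO Y)"
proof -
  obtain Z T0 where T0: "A.Ses Z T0 X" "TT T0" "A.FN Z" using approx[OF X] by blast
  obtain i q where s: "A.ses Z i T0 q X" using T0(1) unfolding A.Ses_def by blast
  note C = A.sesD[OF s]
  have oY: "A.Ob Y" by (rule A.Filt_Ob[OF Y])
  show ?thesis
  proof (rule B.Ev_from_extend[OF F_exact[OF s T0(3)] B.Ev_projective[OF _ F_Ob[OF oY]] F_Ob[OF oY]])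
    show "Proj K S' (FO T0)" using T0(2) unfolding TT_def by blast
    fix h assume h: "h : lhom S' (FO Z) (FO Y)"
    obtain g where g: "g : lhom S Z Y" "ALL x:car (FO Z). FA Z Y g x = h x" using fullD[OF full_FN[OF T0(3)] oY h] by blast
    obtain k where k: "k : lhom S T0 Y" "ALL x:car Z. k (i x) = g x" using A.Ev_extend[OF E s oY g(1)] by blast
    have "FA T0 Y k (FA Z T0 i x) = h x" if x: "x : car (FO Z)" for x
    proof -
      have "FA T0 Y k (FA Z T0 i x) = FA Z Y (%x. k (i x)) x" using F_comp[OF C(1,2) oY C(4) k(1) x] by simp
      also have "... = FA Z Y g x" by (rule F_cong[OF C(1) oY lhom_comp[OF C(4) k(1)] g(1) _ x]) (use k(2) in blast)
      finally show ?thesis using g(2) x by simp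
    qed
    thus "EX k:lhom S' (FO T0) (FO Y). ALL x:car (FO Z). k (FA Z T0 i x) = h x"
      using F_hom[OF C(2) oY k(1)] by blast
  qed
qed

lemma FN'_F_injective: assumes "Inj K S X" shows "B'.FN (FO X)"
proof -
  have X: "A.FN X" by (rule A.FN_injective[OF assms])
  have "B.Ev (D' sigma) (FO X)" if "sigma : La" for sigma
    by (rule Ev_F[OF A.FN_N[OF that] X A.Ev_injective[OF assms]])
  thus ?thesis unfolding B'.FN_iff using F_Ob[OF A.Filt_Ob[OF X]] by blast
qed

lemma FN'_of_inj:
  "A.FN X ==> A.cRs (Inj K S) d X ==> B.cRs B'.FN d (FO X)"
proof (induction d arbitrary: X)
  case 0
  thus ?case using FN'_F_injective by simp
next
  case (Suc d)
  obtain Q Z where Q: "A.Ses X Q Z" "Inj K S Q" "A.cRs (Inj K S) d Z" using Suc.prems(2) by auto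
  have "A.FN Z" by (rule A.FN_coker[OF Q(1) Suc.prems(1) A.FN_injective[OF Q(2)]])
  thus ?case using Suc.IH Q(3) F_Ses[OF Q(1) Suc.prems(1)] FN'_F_injective[OF Q(2)] by auto
qed

text \<open>In length 0, F X is filtered by costandard and F Z by standard modules, so the image of
  X -> Q -> Z splits. The retraction comes from a map Q -> X, and \<open>X\<close> is a summand of
  an injective.\<close>

lemma inj_of_FN':
  "A.FN X ==> B.cRs B'.FN d (FO X) ==> A.cRs (Inj K S) d X"
proof (induction d arbitrary: X)
  case 0
  have X: "A.Ob X" by (rule A.Filt_Ob[OF 0(1)])
  obtain Q Z where Q: "Inj K S Q" "A.Ses X Q Z" using A.enough_inj[OF X] by blast
  obtain i q where s: "A.ses X i Q q Z" using Q(2) unfolding A.Ses_def by blast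
  note C = A.sesD[OF s]
  have "A.FN Z" by (rule A.FN_coker[OF Q(2) 0(1) A.FN_injective[OF Q(1)]])
  hence "B.Ev (FO Z) (FO X)" using B'.Ev_FD_FN[OF FD_F] 0(2) by simp
  from B.EvD[OF this F_exact[OF s 0(1)]]
  obtain r' where r': "r' : lhom S' (FO Q) (FO X)" "ALL y:car (FO X). r' (FA X Q i y) = y" by blast
  obtain r where r: "r : lhom S Q X" "ALL y:car (FO Q). FA Q X r y = r' y"
    using fullD[OF full_FN[OF A.FN_injective[OF Q(1)]] X r'(1)] by blast
  have "r (i x) = x" if "x : car X" for x
  proof (rule faith_eq[OF faith_FN[OF 0(1)] X X lhom_comp[OF C(4) r(1)] lhom_id _ that])
    fix y assume y: "y : car (FO X)"
    have "FA X X (%x. r (i x)) y = FA Q X r (FA X Q i y)" by (rule F_comp[OF C(1,2,1,4) r(1) y])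
    thus "FA X X (%x. r (i x)) y = FA X X (%x. x) y"
      using r(2) r'(2) y lhom_closed[OF F_hom[OF C(1,2,4)] y] F_id[OF X y] by simp
  qed
  thus ?case using A.injective_retract[OF Q(1) X C(4) r(1)] by simp
next
  case (Suc d)
  obtain Q Z where Q: "Inj K S Q" "A.Ses X Q Z" using A.enough_inj[OF A.Filt_Ob[OF Suc(2)]] by blast
  have Z: "A.FN Z" by (rule A.FN_coker[OF Q(2) Suc(2) A.FN_injective[OF Q(1)]])
  have "B.cRs B'.FN d (FO Z)"
    by (rule B.cRs_shift[OF B'.FN_coresolving F_Ses[OF Q(2) Suc(2)] FN'_F_injective[OF Q(1)] Suc(3)])
  hence "A.cRs (Inj K S) d Z" by (rule Suc.IH[OF Z])
  thus ?case using Q by auto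
qed

theorem cRs_iff: "A.FN X ==> A.cRs (Inj K S) d X <-> B.cRs B'.FN d (FO X)"
  using FN'_of_inj inj_of_FN' by blast

text \<open>So the images of the indecomposable injectives are the tilting modules over the Ringel dual.\<close>

lemma FI_data:
  assumes l: "l : La"
  shows "B'.FD (FO (I l))" "B'.FN (FO (I l))" "B'.below (FO (I l)) l" "B.cf (FO (I l)) l"
    "B.mult1 l (FO (I l))" "B.local_endo (FO (I l))"
proof -
  note I = A.I_Ob[OF l]
  have FNI: "A.FN (I l)" by (rule A.FN_injective[OF A.I_inj[OF l]])
  show "B'.FD (FO (I l))" by (rule FD_F[OF FNI])
  show "B'.FN (FO (I l))" by (rule FN'_F_injective[OF A.I_inj[OF l]])
  show "B'.below (FO (I l)) l" using cf'_below_I[OF l] by simp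
  show "B.cf (FO (I l)) l" using cf'_F[OF l I] A.cf_iff_I[OF l T_Ob[OF l]] T_cf[OF l] by blast
  show "B.mult1 l (FO (I l))"
  proof (rule mult1'_F[OF l I])
    fix f g assume f: "f : lhom S (T l) (I l)" "EX x:car (T l). f x ~= 0[I l]" and g: "g : lhom S (T l) (I l)"
    interpret n: lhom_loc S "N l" "I l" "iN l" by (rule A.hom_loc[OF A.N_Ob[OF l] I A.iN[OF l]])
    \<comment> \<open>All factors of \<open>T l\<close> are below \<open>l\<close>, so maps T(l) ->
      I(l) factor over \<open>N l\<close> and \<open>T_N_mult\<close> applies.\<close>
    have fac: "EX h1:lhom S (T l) (N l). ALL x:car (T l). iN l (h1 x) = h x" if h: "h : lhom S (T l) (I l)" for h
      by (rule factor_mono[OF A.ObD(1)[OF A.N_Ob[OF l]] A.ObD(1)[OF I] A.iN[OF l] A.iN_inj[OF l] h A.ObD(1)[OF T_Ob[OF l]]])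
        (use A.N_univ[OF l T_Ob[OF l] h] T_below[OF l] in blast)
    obtain f1 where f1: "f1 : lhom S (T l) (N l)" "ALL x:car (T l). iN l (f1 x) = f x" using fac[OF f(1)] by blast
    obtain g1 where g1: "g1 : lhom S (T l) (N l)" "ALL x:car (T l). iN l (g1 x) = g x" using fac[OF g(1)] by blast
    have "EX x:car (T l). f1 x ~= 0[N l]" using f(2) f1(2) n.zero by metis
    from T_N_mult[OF l f1(1) this g1(1)]
    obtain e where e: "e : lhom S (T l) (T l)" "ALL x:car (T l). g1 x = f1 (e x)" by blast
    have "g x = f (e x)" if x: "x : car (T l)" for x
      using e(2) f1(2) g1(2) x lhom_closed[OF e(1) x] by metis
    thus "EX e:lhom S (T l) (T l). ALL x:car (T l). g x = f (e x)" using e(1) by blast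
  qed
  show "B.local_endo (FO (I l))" unfolding B.local_endo_def
  proof (intro ballI)
    fix e assume e: "e : lhom S' (FO (I l)) (FO (I l))"
    obtain e0 where e0: "e0 : lhom S (I l) (I l)" "ALL x:car (FO (I l)). FA (I l) (I l) e0 x = e x"
      using fullD[OF full_FN[OF FNI] I e] by blast
    have pow: "FA (I l) (I l) (e0 ^^ n) x = (e ^^ n) x" if x: "x : car (FO (I l))" for x n
    proof (induction n)
      case 0
      thus ?case using F_id[OF I x] by (simp add: id_def)
    next
      case (Suc n)
      have "FA (I l) (I l) (%y. e0 ((e0 ^^ n) y)) x = FA (I l) (I l) e0 (FA (I l) (I l) (e0 ^^ n) x)"
        by (rule F_comp[OF I I I A.endo_pow[OF e0(1)] e0(1) x])
      thus ?case using Suc e0(2) lhom_closed[OF B.endo_pow[OF e] x] by (simp add: comp_def)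
    qed
    from A.I_local[OF l] e0(1) consider "bij_betw e0 (car (I l)) (car (I l))" | n where "ALL x:car (I l). (e0 ^^ n) x = 0[I l]"
      unfolding A.local_endo_def by blast
    thus "bij_betw e (car (FO (I l))) (car (FO (I l))) | (EX n. ALL x:car (FO (I l)). (e ^^ n) x = 0[FO (I l)])"
    proof cases
      case 1
      obtain g where g: "g : lhom S (I l) (I l)" "ALL x:car (I l). g (e0 x) = x" "ALL y:car (I l). e0 (g y) = y"
        using lhom_inverse_ex[OF A.ObD(1)[OF I] A.ObD(1)[OF I] e0(1) 1] by blast
      have "bij_betw e (car (FO (I l))) (car (FO (I l)))"
        by (rule B.bij_of_inverse[OF e F_hom[OF I I g(1)]])
          (use F_retract[OF I I e0(1) g(1)] F_retract[OF I I g(1) e0(1)] g e0(2) lhom_closed[OF F_hom[OF I I g(1)]] in force)+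
      thus ?thesis by blast
    next
      case 2
      have "(e ^^ n) x = 0[FO (I l)]" if x: "x : car (FO (I l))" for x
      proof -
        have "FA (I l) (I l) (e0 ^^ n) x = FA (I l) (I l) (%_. 0[I l]) x"
          by (rule F_cong[OF I I A.endo_pow[OF e0(1)] lhom_zero[OF A.ObD(1)[OF I]] _ x]) (use 2 in blast)
        thus ?thesis using pow[OF x] F_zero[OF I I x] by simp
      qed
      thus ?thesis by blast
    qed
  qed
qed

end

section \<open>Functors represented by a bimodule\<close>

text \<open>Hom(M, X), with scalars acting by precomposition through \<open>rho\<close>. Three
  instances occur: \<open>Hom_module\<close>, the linear dual of \<open>S\<close>, and the functor
  back from \<open>S'\<close> to \<open>S\<close>. Precomposition reverses products, whence the
  order in the axiom \<open>rho_mult\<close>.\<close>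

definition hom_mod :: "('k, 'a) module => ('a, 'm) module => ('c => 'm => 'm) => ('a, 'n) module => ('c, 'm => 'n) module" where
  "hom_mod R M rho X =
     (|carrier = lhom R M X Int extensional (car M),
      mult = (%f g. \<lambda>x\<in>car M. 0[X]),
      one = (\<lambda>x\<in>car M. 0[X]),
      zero = (\<lambda>x\<in>car M. 0[X]),
      add = (%f g. \<lambda>x\<in>car M. f x +[X] g x),
      smult = (%a h. compose (car M) h (rho a))|)"

lemma Hom_module_eq: "Hom_module S T X = hom_mod S T (%f. f) X"
  by (simp add: Hom_module_def hom_mod_def)

lemma hom_mod_simps [simp]:
  "car (hom_mod R M rho X) = lhom R M X Int extensional (car M)"
  "0[hom_mod R M rho X] = (\<lambda>x\<in>car M. 0[X])"
  "f +[hom_mod R M rho X] g = (\<lambda>x\<in>car M. f x +[X] g x)"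
  "a *[hom_mod R M rho X] h = compose (car M) h (rho a)"
  by (simp_all add: hom_mod_def)

lemma lhom_restrict:
  assumes "left_module R M" shows "restrict f (car M) : lhom R M X <-> f : lhom R M X"
  using lhom_cong[OF _ assms, of f "restrict f (car M)" X] lhom_cong[OF _ assms, of "restrict f (car M)" f X] by auto

lemma (in fdalg) scal_comm:
  assumes "c : car K" "a : car S" shows "(sc S c) **[S] a = c *[S] a" "a **[S] (sc S c) = c *[S] a"
  using assms by (simp_all add: smult_mult mult_smult)

lemma (in fdalg) scal_hom:
  assumes "left_module S X" "c : car K" shows "(%x. (sc S c) *[X] x) : lhom S X X"
proof -
  interpret X: left_module S X by fact
  show ?thesis
    by (rule left_homI) (use assms(2) scal_closed[OF assms(2)] scal_comm[OF assms(2)] in "simp_all add: X.smult_closed X.smult_r_distr X.smult_assoc[symmetric]")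
qed

locale homf = R: fdalg K R + R': fdalg K R'
  for K :: "'k ring" and R :: "('k, 'a) module" and R' :: "('k, 'c) module" +
  fixes M :: "('a, 'm) module" and rho :: "'c => 'm => 'm"
  assumes M: "fd_module K R M"
    and rho: "a : car R' ==> rho a : lhom R M M"
    and rho_add: "a : car R' ==> b : car R' ==> x : car M ==> rho (a +[R'] b) x = rho a x +[M] rho b x"
    and rho_mult: "a : car R' ==> b : car R' ==> x : car M ==> rho (a **[R'] b) x = rho b (rho a x)"
    and rho_one: "x : car M ==> rho 1[R'] x = x"
    and rho_smult: "c : car K ==> x : car M ==> rho (sc R' c) x = (sc R c) *[M] x"
begin

lemma M_mod: "left_module R M" by (rule R.ObD[OF M])

sublocale M: left_module R M by (rule M_mod)

abbreviation H :: "('a, 'n) module => ('c, 'm => 'n) module" where "H X == hom_mod R M rho X"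

lemma H_in: "f : lhom R M X ==> restrict f (car M) : car (H X)"
  by (simp add: lhom_restrict[OF M_mod])

lemma H_eqI: "f : car (H X) ==> g : car (H X) ==> (!!x. x : car M ==> f x = g x) ==> f = g"
  by (auto intro: extensionalityI)

lemma rho_closed: "a : car R' ==> x : car M ==> rho a x : car M"
  using lhom_closed[OF rho] .

lemma H_left_module:
  assumes "left_module R X" shows "left_module R' (H X)"
proof -
  interpret X: left_module R X by fact
  have c: "h : car (H X) ==> x : car M ==> h x : car X" for h x
    using lhom_closed by auto
  have smult_in: "a *[H X] h : car (H X)" if "a : car R'" "h : car (H X)" for a h
  proof -
    have "h : lhom R M X" using that by simp
    from H_in[OF lhom_comp[OF rho[OF that(1)] this]] show ?thesis by (simp add: compose_def)
  qed
  show ?thesis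
  proof (rule left_moduleI)
    show "ring R'" by (rule R'.ring_S)
    show "f +[H X] g : car (H X)" if "f : car (H X)" "g : car (H X)" for f g
      using H_in[OF lhom_plus[OF assms, of f M g]] that by simp
    show "0[H X] : car (H X)" using H_in[OF lhom_zero[OF assms]] by simp
    show "(f +[H X] g) +[H X] h = f +[H X] (g +[H X] h)" if "f : car (H X)" "g : car (H X)" "h : car (H X)" for f g h
      using that[THEN c] by (auto simp: X.M.a_assoc intro!: restrict_ext)
    show "f +[H X] g = g +[H X] f" if "f : car (H X)" "g : car (H X)" for f g
      using that[THEN c] by (auto simp: X.M.a_comm intro!: restrict_ext)
    show "0[H X] +[H X] f = f" if f: "f : car (H X)" for f
    proof (rule extensionalityI[of _ "car M"])
      show "(0[H X] +[H X] f) x = f x" if "x : car M" for x using c[OF f that] that by simp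
    qed (use f in auto)
    show "EX g:car (H X). g +[H X] f = 0[H X]" if f: "f : car (H X)" for f
      using H_in[OF lhom_uminus[OF assms, of f M]] f c[OF f]
      by (intro bexI[of _ "\<lambda>x\<in>car M. -[X] f x"]) (auto simp: X.M.l_neg intro!: restrict_ext)
    show "a *[H X] h : car (H X)" if "a : car R'" "h : car (H X)" for a h
      by (rule smult_in[OF that])
    show "(a +[R'] b) *[H X] h = a *[H X] h +[H X] b *[H X] h" if "a : car R'" "b : car R'" "h : car (H X)" for a b h
      using that by (auto simp: compose_def rho_add rho_closed lhom_add intro!: restrict_ext)
    show "a *[H X] (f +[H X] g) = a *[H X] f +[H X] a *[H X] g" if "a : car R'" "f : car (H X)" "g : car (H X)" for a f g
      using that by (auto simp: compose_def rho_closed intro!: restrict_ext)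
    show "(a **[R'] b) *[H X] h = a *[H X] (b *[H X] h)" if "a : car R'" "b : car R'" "h : car (H X)" for a b h
      using that by (auto simp: compose_def rho_mult rho_closed intro!: restrict_ext)
    show "1[R'] *[H X] h = h" if h: "h : car (H X)" for h
    proof (rule extensionalityI[of _ "car M"])
      show "(1[R'] *[H X] h) x = h x" if "x : car M" for x using that by (simp add: compose_def rho_one)
      show "h : extensional (car M)" using h by auto
      show "1[R'] *[H X] h : extensional (car M)" by (simp add: compose_def)
    qed
  qed
qed

lemma H_scal: "c : car K ==> h : car (H X) ==> x : car M ==>
    ((sc R' c) *[H X] h) x = (sc R c) *[X] h x"
  by (simp add: compose_def rho_smult lhom_smult[of h R M X] R.scal_closed)

text \<open>A map is determined by its values on a finite generating set \<open>A\<close> of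
  \<open>M\<close>. \<open>Z C\<close> consists of the maps that vanish on \<open>C\<close>, so
  \<open>Z A\<close> is zero, and vanishing conditions are dropped one generator at a time.\<close>

lemma H_fd:
  assumes X: "fd_module K R X" shows "fd_module K R' (H X)"
proof -
  interpret X: left_module R X by (rule R.ObD[OF X])
  note HX = H_left_module[OF X.left_module_axioms]
  interpret HX: left_module R' "H X" by (rule HX)
  let ?V = "us R' (H X)"
  interpret V: vectorspace K ?V by (rule R'.us_vs[OF HX])
  interpret VL: left_module K ?V by (rule V.left_module)
  interpret W: vectorspace K "us R X" by (rule R.us_vs) (rule X.left_module_axioms)
  interpret WL: left_module K "us R X" by (rule W.left_module)
  interpret MV: vectorspace K "us R M" by (rule R.us_vs[OF M_mod])
  obtain A where A: "finite A" "A <= car M" "!!U. sbm K (us R M) U ==> A <= U ==> U = car M"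
    using R.ObD(2)[OF M] unfolding MV.fin_dim_iff by auto
  define Z where "Z C = {h : car (H X). ALL m:C. h m = 0[X]}" for C
  have Z: "sbm K ?V (Z C)" if "C <= car M" for C
  proof (rule VL.submodI)
    show "Z C <= car ?V" by (auto simp: Z_def)
    show "0[?V] : Z C" using HX.M.zero_closed that by (auto simp: Z_def)
    show "x +[?V] y : Z C" if "x : Z C" "y : Z C" for x y
      using HX.M.a_closed[of x y] that `C <= car M` by (auto simp: Z_def)
    show "a *[?V] x : Z C" if "a : car K" "x : Z C" for a x
    proof -
      have x: "x : car (H X)" using `x : Z C` by (auto simp: Z_def)
      have "((sc R' a) *[H X] x) m = 0[X]" if "m : C" for m
        using H_scal[OF `a : _` x, of m] that `x : Z C` `C <= _` `a : _` by (auto simp: Z_def)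
      thus ?thesis using HX.smult_closed[OF R'.scal_closed[OF `a : _`] x] unfolding Z_def by simp
    qed
  qed
  have zero: "Z A = {0[?V]}"
  proof -
    have "h = 0[?V]" if h: "h : Z A" for h
    proof -
      have hh: "h : lhom R M X" using h by (auto simp: Z_def)
      interpret h: lhom_loc R M X h by (rule lhom_locI[OF M_mod X.left_module_axioms hh])
      have "{x : car M. h x = 0[X]} = car M"
        by (rule A(3)[OF R.us_submod[OF M_mod h.submod_kernel]]) (use h A(2) in "auto simp: Z_def")
      hence h0: "h x = 0[X]" if "x : car M" for x using that by blast
      have "h : car (H X)" using h unfolding Z_def by blast
      hence "h = 0[H X]" by (rule H_eqI[OF _ HX.M.zero_closed]) (simp add: h0)
      thus ?thesis by simp
    qed
    moreover have "0[?V] : Z A" using VL.submodD(2)[OF Z[OF A(2)]] .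
    ultimately show ?thesis by blast
  qed
  \<comment> \<open>When \<open>m\<close> joins \<open>B\<close>, evaluation at \<open>m\<close> has
    the previous space as kernel and its image inside \<open>X\<close>.\<close>
  have "vectorspace.fin_dim K (?V(|carrier := Z (A - B)|))" if "finite B" "B <= A" for B
    using that
  proof (induction rule: finite_induct)
    case empty
    interpret ZA: vectorspace K "?V(|carrier := Z (A - {})|)" by (rule V.sub_vectorspace[OF Z]) (use A in auto)
    interpret ZAL: left_module K "?V(|carrier := Z (A - {})|)" by (rule ZA.left_module)
    have "ALL U. sbm K (?V(|carrier := Z (A - {})|)) U --> U = Z (A - {})"
      using ZAL.submodD(1,2) zero by fastforce
    thus ?case unfolding ZA.fin_dim_iff by (intro exI[of _ "{}"]) auto
  next
    case (insert m B)
    let ?C = "A - insert m B"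
    have m: "m : A" "m : car M" using insert A by auto
    have C: "?C <= car M" using A by auto
    interpret U: vectorspace K "?V(|carrier := Z ?C|)" by (rule V.sub_vectorspace[OF Z[OF C]])
    have ev: "(%h. h m) : lhom K (?V(|carrier := Z ?C|)) (us R X)"
    proof (rule left_homI)
      fix a h assume a: "a : car K" and h: "h : car (?V(|carrier := Z ?C|))"
      hence "h : car (H X)" by (auto simp: Z_def)
      from H_scal[OF a this m(2)] show "(a *[?V(|carrier := Z ?C|)] h) m = a *[us R X] h m" by simp
    qed (use m(2) in "auto simp: Z_def lhom_closed")
    interpret T: vs_hom K "?V(|carrier := Z ?C|)" "us R X" "%h. h m"
      by (intro vs_hom.intro vs_hom_axioms.intro U.vectorspace_axioms W.vectorspace_axioms ev)
    show ?case
    proof (rule T.fin_dim_ext)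
      have "{h : car (?V(|carrier := Z ?C|)). h m = 0[us R X]} = Z (A - B)"
        using insert(2,4) m by (auto simp: Z_def)
      thus "vectorspace.fin_dim K ((?V(|carrier := Z ?C|))(|carrier := {h : car (?V(|carrier := Z ?C|)). h m = 0[us R X]}|))"
        using insert by simp
      show "vectorspace.fin_dim K ((us R X)(|carrier := (%h. h m) ` car (?V(|carrier := Z ?C|))|))"
        by (rule W.fin_dim_sub[OF R.ObD(2)[OF X] T.submod_image[OF T.X.submod_carrier]])
    qed
  qed
  from this[of A] have "vectorspace.fin_dim K (?V(|carrier := Z {}|))" using A(1) by simp
  moreover have "?V(|carrier := Z {}|) = ?V" by (simp add: Z_def hom_mod_def underlying_space_def Int_def)
  ultimately show ?thesis using HX by (simp add: fd_module_def)
qed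

lemma H_comp: "f : lhom R X Y ==> h : car (H X) ==> compose (car M) f h : car (H Y)"
  using H_in[OF lhom_comp[of h R M X f Y]] by (simp add: compose_def)

lemma H_map:
  assumes "f : lhom R X Y"
  shows "compose (car M) f : lhom R' (H X) (H Y)"
proof (rule left_homI)
  show "compose (car M) f h : car (H Y)" if "h : car (H X)" for h by (rule H_comp[OF assms that])
  show "compose (car M) f (g +[H X] h) = compose (car M) f g +[H Y] compose (car M) f h"
    if "g : car (H X)" "h : car (H X)" for g h
    using that by (auto simp: compose_def lhom_add[OF assms] lhom_closed intro!: restrict_ext)
  show "compose (car M) f (a *[H X] h) = a *[H Y] compose (car M) f h" if "a : car R'" "h : car (H X)" for a h
    using that by (auto simp: compose_def rho_closed intro!: restrict_ext)
qed

definition FO :: "('a, 'n) module => ('k, 'c) umodule" where "FO X = R'.um (H X)"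

text \<open>Reads an element of the relocated module \<open>FO X\<close> as the homomorphism M -> X
  that it encodes.\<close>

definition FI :: "('a, 'n) module => (nat => 'k) => 'm => 'n" where
  "FI X = inv_into (car (H X)) (R'.uemb (H X))"

definition FA :: "('a, 'n) module => ('a, 'p) module => ('n => 'p) => (nat => 'k) => (nat => 'k)" where
  "FA X Y f x = R'.uemb (H Y) (compose (car M) f (FI X x))"

lemma FO: "R.Ob X ==> R'.Ob (FO X)"
  unfolding FO_def by (rule R'.um[OF H_fd])

lemma FE:
  assumes "R.Ob X"
  shows "R'.uemb (H X) : lhom R' (H X) (FO X)" "bij_betw (R'.uemb (H X)) (car (H X)) (car (FO X))"
    "FI X : lhom R' (FO X) (H X)" "!!h. h : car (H X) ==> FI X (R'.uemb (H X) h) = h"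
    "!!x. x : car (FO X) ==> R'.uemb (H X) (FI X x) = x"
proof -
  note u = R'.um[OF H_fd[OF assms]]
  show 1: "R'.uemb (H X) : lhom R' (H X) (FO X)" and 2: "bij_betw (R'.uemb (H X)) (car (H X)) (car (FO X))"
    unfolding FO_def by (rule u)+
  obtain g where g: "g : lhom R' (FO X) (H X)" "ALL x:car (H X). g (R'.uemb (H X) x) = x" "ALL y:car (FO X). R'.uemb (H X) (g y) = y"
    using lhom_inverse_ex[OF H_left_module[OF R.ObD(1)[OF assms]] R'.ObD(1)[OF FO[OF assms]] 1 2] by blast
  have inj: "inj_on (R'.uemb (H X)) (car (H X))" and im: "R'.uemb (H X) ` car (H X) = car (FO X)"
    using 2 unfolding bij_betw_def by auto
  show 4: "FI X (R'.uemb (H X) h) = h" if "h : car (H X)" for h unfolding FI_def by (rule inv_into_f_f[OF inj that])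
  show 5: "R'.uemb (H X) (FI X x) = x" if "x : car (FO X)" for x unfolding FI_def
    by (rule f_inv_into_f[of _ _ "car (H X)"]) (simp only: im that)
  show "FI X : lhom R' (FO X) (H X)"
  proof (rule lhom_cong[OF _ R'.ObD(1)[OF FO[OF assms]] g(1)])
    fix x assume x: "x : car (FO X)"
    have "g x : car (H X)" by (rule lhom_closed[OF g(1) x])
    from 4[OF this] show "g x = FI X x" using g(3) x by simp
  qed
qed

lemma FI_closed: "R.Ob X ==> x : car (FO X) ==> FI X x : car (H X)"
  by (rule lhom_closed[OF FE(3)])

lemma FI_FA:
  assumes "R.Ob X" "R.Ob Y" "f : lhom R X Y" "x : car (FO X)"
  shows "FI Y (FA X Y f x) = compose (car M) f (FI X x)"
  unfolding FA_def by (rule FE(4)[OF assms(2) H_comp[OF assms(3) FI_closed[OF assms(1,4)]]])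

lemma FI_inj:
  assumes "R.Ob X" "x : car (FO X)" "y : car (FO X)" "!!m. m : car M ==> FI X x m = FI X y m"
  shows "x = y"
proof -
  have "FI X x = FI X y" by (rule H_eqI[OF FI_closed[OF assms(1,2)] FI_closed[OF assms(1,3)] assms(4)])
  thus ?thesis using FE(5)[OF assms(1)] assms(2,3) by metis
qed

lemma FA_hom: "R.Ob X ==> R.Ob Y ==> f : lhom R X Y ==> FA X Y f : lhom R' (FO X) (FO Y)"
  unfolding FA_def by (rule lhom_comp[OF lhom_comp[OF FE(3) H_map] FE(1)])

lemma FI_FA_app:
  "R.Ob X ==> R.Ob Y ==> f : lhom R X Y ==> x : car (FO X) ==> m : car M ==> FI Y (FA X Y f x) m = f (FI X x m)"
  by (simp only: FI_FA compose_eq)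

lemma FI_app_closed: "R.Ob X ==> x : car (FO X) ==> m : car M ==> FI X x m : car X"
  using FI_closed[of X x] lhom_closed[of "FI X x" R M X m] by auto

lemma FI_zero: "R.Ob X ==> m : car M ==> FI X 0[FO X] m = 0[X]"
proof -
  assume X: "R.Ob X" and m: "m : car M"
  interpret lhom_loc R' "FO X" "H X" "FI X"
    by (rule lhom_locI[OF R'.ObD(1)[OF FO[OF X]] H_left_module[OF R.ObD(1)[OF X]] FE(3)[OF X]])
  show ?thesis using zero m by simp
qed

lemma FI_add: "R.Ob X ==> x : car (FO X) ==> y : car (FO X) ==> m : car M ==> FI X (x +[FO X] y) m = FI X x m +[X] FI X y m"
  by (simp add: lhom_add[OF FE(3)])

lemma FI_smult: "R.Ob X ==> a : car R' ==> x : car (FO X) ==> m : car M ==> FI X (a *[FO X] x) m = FI X x (rho a m)"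
  by (simp add: lhom_smult[OF FE(3)] compose_eq)

lemma FI_surj: "R.Ob X ==> h : lhom R M X ==> EX x:car (FO X). ALL m:car M. FI X x m = h m"
proof -
  assume X: "R.Ob X" and h: "h : lhom R M X"
  note r = H_in[OF h]
  show ?thesis
    by (rule bexI[of _ "R'.uemb (H X) (restrict h (car M))"]) (use FE(4)[OF X r] lhom_closed[OF FE(1)[OF X] r] in auto)
qed

lemma FI_lhom: "R.Ob X ==> x : car (FO X) ==> FI X x : lhom R M X"
  using FI_closed by auto

lemma FA_comp:
  assumes "R.Ob X" "R.Ob Y" "R.Ob Z" "f : lhom R X Y" "g : lhom R Y Z" "x : car (FO X)"
  shows "FA X Z (%x. g (f x)) x = FA Y Z g (FA X Y f x)"
  by (rule FI_inj[OF assms(3)])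
    (simp_all add: assms FI_FA_app lhom_comp[OF assms(4,5)] lhom_closed[OF FA_hom])

lemma FA_id: assumes "R.Ob X" "x : car (FO X)" shows "FA X X (%x. x) x = x"
  by (rule FI_inj[OF assms(1) lhom_closed[OF FA_hom[OF assms(1,1) lhom_id] assms(2)] assms(2)])
    (rule FI_FA_app[OF assms(1,1) lhom_id assms(2)])

lemma FA_add:
  assumes "R.Ob X" "R.Ob Y" "f : lhom R X Y" "g : lhom R X Y" "x : car (FO X)"
  shows "FA X Y (%x. f x +[Y] g x) x = FA X Y f x +[FO Y] FA X Y g x"
proof (rule FI_inj[OF assms(2)])
  interpret Y: left_module R' "FO Y" by (rule R'.ObD[OF FO[OF assms(2)]])
  note p = lhom_plus[OF R.ObD(1)[OF assms(2)] assms(3,4)]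
  note c = lhom_closed[OF FA_hom[OF assms(1,2,3)] assms(5)] lhom_closed[OF FA_hom[OF assms(1,2,4)] assms(5)]
  show "FA X Y (%x. f x +[Y] g x) x : car (FO Y)" by (rule lhom_closed[OF FA_hom[OF assms(1,2) p] assms(5)])
  show "FA X Y f x +[FO Y] FA X Y g x : car (FO Y)" using c by simp
  show "FI Y (FA X Y (%x. f x +[Y] g x) x) m = FI Y (FA X Y f x +[FO Y] FA X Y g x) m" if "m : car M" for m
    using FI_FA_app[OF assms(1,2) p assms(5) that] FI_add[OF assms(2) c that]
      FI_FA_app[OF assms(1,2,3,5) that] FI_FA_app[OF assms(1,2,4,5) that] by simp
qed

lemma FA_zero:
  assumes "R.Ob X" "R.Ob Y" "x : car (FO X)" shows "FA X Y (%x. 0[Y]) x = 0[FO Y]"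
proof (rule FI_inj[OF assms(2)])
  interpret Y: left_module R' "FO Y" by (rule R'.ObD[OF FO[OF assms(2)]])
  note z = lhom_zero[OF R.ObD(1)[OF assms(2)]]
  show "FA X Y (%x. 0[Y]) x : car (FO Y)" by (rule lhom_closed[OF FA_hom[OF assms(1,2) z] assms(3)])
  show "0[FO Y] : car (FO Y)" by simp
  show "FI Y (FA X Y (%x. 0[Y]) x) m = FI Y 0[FO Y] m" if "m : car M" for m
    using FI_FA_app[OF assms(1,2) z assms(3) that] FI_zero[OF assms(2) that] by simp
qed

lemma FA_cong:
  assumes "R.Ob X" "R.Ob Y" "f : lhom R X Y" "g : lhom R X Y" "!!x. x : car X ==> f x = g x" "x : car (FO X)"
  shows "FA X Y f x = FA X Y g x"
  by (rule FI_inj[OF assms(2) lhom_closed[OF FA_hom[OF assms(1,2,3)] assms(6)] lhom_closed[OF FA_hom[OF assms(1,2,4)] assms(6)]])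
    (use FI_FA_app[OF assms(1,2,3,6)] FI_FA_app[OF assms(1,2,4,6)] assms(5) FI_app_closed[OF assms(1,6)] in simp)

lemma FA_scal:
  assumes "R.Ob X" "c : car K" "x : car (FO X)"
  shows "FA X X (%x. (sc R c) *[X] x) x = (sc R' c) *[FO X] x"
proof (rule FI_inj[OF assms(1)])
  interpret Y: left_module R' "FO X" by (rule R'.ObD[OF FO[OF assms(1)]])
  note p = R.scal_hom[OF R.ObD(1)[OF assms(1)] assms(2)]
  show "FA X X (%x. (sc R c) *[X] x) x : car (FO X)" by (rule lhom_closed[OF FA_hom[OF assms(1,1) p] assms(3)])
  show "(sc R' c) *[FO X] x : car (FO X)" by (rule Y.smult_closed[OF R'.scal_closed[OF assms(2)] assms(3)])
  show "FI X (FA X X (%x. (sc R c) *[X] x) x) m = FI X ((sc R' c) *[FO X] x) m" if "m : car M" for m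
    using FI_FA_app[OF assms(1,1) p assms(3) that] FI_smult[OF assms(1) R'.scal_closed[OF assms(2)] assms(3) that]
      rho_smult[OF assms(2) that] lhom_smult[OF FI_lhom[OF assms(1,3)] R.scal_closed[OF assms(2)] that] by simp
qed

lemma lin_functor: "lin_functor K R R' FO FA"
  by (intro lin_functor.intro lin_functor_axioms.intro R.fdalg_axioms R'.fdalg_axioms)
    (rule FO FA_hom FA_comp FA_id FA_add FA_zero FA_cong FA_scal; assumption)+

lemma FA_exact:
  assumes s: "R.ses X f Y g Z" and lift: "!!h. h : lhom R M Z ==> EX k:lhom R M Y. ALL m:car M. g (k m) = h m"
  shows "R'.ses (FO X) (FA X Y f) (FO Y) (FA Y Z g) (FO Z)"
proof -
  note D = R.sesD[OF s]
  interpret f: lhom_loc R X Y f by (rule D)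
  interpret g: lhom_loc R Y Z g by (rule D)
  note hf = FA_hom[OF D(1,2,4)] and hg = FA_hom[OF D(2,3,5)]
  interpret FX: left_module R' "FO X" by (rule R'.ObD[OF FO[OF D(1)]])
  interpret FY: left_module R' "FO Y" by (rule R'.ObD[OF FO[OF D(2)]])
  interpret FZ: left_module R' "FO Z" by (rule R'.ObD[OF FO[OF D(3)]])
  show ?thesis
  proof (rule R'.sesI[OF FO[OF D(1)] FO[OF D(2)] FO[OF D(3)] hf hg])
    show "x = 0[FO X]" if x: "x : car (FO X)" "FA X Y f x = 0[FO Y]" for x
    proof (rule FI_inj[OF D(1) x(1) FX.M.zero_closed])
      fix m assume m: "m : car M"
      have "f (FI X x m) = 0[Y]" using FI_FA_app[OF D(1,2,4) x(1) m] x(2) FI_zero[OF D(2) m] by simp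
      thus "FI X x m = FI X 0[FO X] m"
        using f.inj_iff D(6) FI_app_closed[OF D(1) x(1) m] FI_zero[OF D(1) m] by metis
    qed
    show "EX y:car (FO Y). FA Y Z g y = z" if z: "z : car (FO Z)" for z
    proof -
      obtain k where k: "k : lhom R M Y" "ALL m:car M. g (k m) = FI Z z m" using lift[OF FI_lhom[OF D(3) z]] by blast
      obtain y where y: "y : car (FO Y)" "ALL m:car M. FI Y y m = k m" using FI_surj[OF D(2) k(1)] by blast
      have "FA Y Z g y = z"
        by (rule FI_inj[OF D(3) lhom_closed[OF hg y(1)] z]) (use FI_FA_app[OF D(2,3,5) y(1)] y(2) k(2) in simp)
      thus ?thesis using y(1) by blast
    qed
    show "FA Y Z g (FA X Y f x) = 0[FO Z]" if x: "x : car (FO X)" for x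
      by (rule FI_inj[OF D(3) lhom_closed[OF hg lhom_closed[OF hf x]] FZ.M.zero_closed])
        (use FI_FA_app[OF D(2,3,5) lhom_closed[OF hf x]] FI_FA_app[OF D(1,2,4) x] D(8) FI_app_closed[OF D(1) x] FI_zero[OF D(3)] in simp)
    show "EX x:car (FO X). FA X Y f x = y" if y: "y : car (FO Y)" "FA Y Z g y = 0[FO Z]" for y
    proof -
      have gz: "g (FI Y y m) = 0[Z]" if m: "m : car M" for m
        using FI_FA_app[OF D(2,3,5) y(1) m] y(2) FI_zero[OF D(3) m] by simp
      hence im: "FI Y y m : f ` car X" if "m : car M" for m
        using D(9)[OF FI_app_closed[OF D(2) y(1) that] gz[OF that]] by (elim bexE) (rule image_eqI, rule sym)
      obtain k where k: "k : lhom R M X" "ALL m:car M. f (k m) = FI Y y m"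
        using factor_mono[OF D(11,12,4,6) FI_lhom[OF D(2) y(1)] M_mod im] by blast
      obtain x where x: "x : car (FO X)" "ALL m:car M. FI X x m = k m" using FI_surj[OF D(1) k(1)] by blast
      have "FA X Y f x = y"
        by (rule FI_inj[OF D(2) lhom_closed[OF hf x(1)] y(1)]) (use FI_FA_app[OF D(1,2,4) x(1)] x(2) k(2) in simp)
      thus ?thesis using x(1) by blast
    qed
  qed
qed

lemma FA_faithful:
  assumes T: "R.Ob T" and r: "r : lhom R M T" "r ` car M = car T" and X: "R.Ob X"
    and g: "g : lhom R T X" and 0: "!!x. x : car (FO T) ==> FA T X g x = 0[FO X]" and x: "x : car T"
  shows "g x = 0[X]"
proof -
  obtain y where y: "y : car (FO T)" "ALL m:car M. FI T y m = r m" using FI_surj[OF T r(1)] by blast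
  obtain m where m: "m : car M" "r m = x" using x unfolding r(2)[symmetric] by blast
  have "g x = FI X (FA T X g y) m" using FI_FA_app[OF T X g y(1) m(1)] y(2) m by simp
  thus ?thesis using 0[OF y(1)] FI_zero[OF X m(1)] by simp
qed

text \<open>A Yoneda argument. If \<open>y\<close> encodes the retraction \<open>r\<close>, every
  \<open>x\<close> of \<open>FO T\<close> equals \<open>a y\<close> with \<open>rho a\<close> the
  composite of \<open>x\<close> and \<open>i\<close>. So \<open>h\<close> is determined by
  \<open>h y\<close>, which restricted along \<open>i\<close> is the required
  \<open>g\<close>.\<close>

lemma FA_full:
  assumes T: "R.Ob T" and r: "r : lhom R M T" and i: "i : lhom R T M" and ri: "!!x. x : car T ==> r (i x) = x" and X: "R.Ob X"
    and rho_surj: "!!e. e : lhom R M M ==> EX a:car R'. ALL x:car M. rho a x = e x"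
    and h: "h : lhom R' (FO T) (FO X)"
  shows "EX g:lhom R T X. ALL x:car (FO T). FA T X g x = h x"
proof -
  obtain y where y: "y : car (FO T)" "ALL m:car M. FI T y m = r m" using FI_surj[OF T r] by blast
  have hy: "h y : car (FO X)" by (rule lhom_closed[OF h y(1)])
  define g where "g x = FI X (h y) (i x)" for x
  have g: "g : lhom R T X" unfolding g_def by (rule lhom_comp[OF i FI_lhom[OF X hy]])
  have "FA T X g x = h x" if x: "x : car (FO T)" for x
  proof -
    obtain a where a: "a : car R'" "ALL m:car M. rho a m = i (FI T x m)"
      using rho_surj[OF lhom_comp[OF FI_lhom[OF T x] i]] by blast
    interpret FT: left_module R' "FO T" by (rule R'.ObD[OF FO[OF T]])
    have "x = a *[FO T] y"
    proof (rule FI_inj[OF T x FT.smult_closed[OF a(1) y(1)]])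
      fix m assume m: "m : car M"
      have "FI T (a *[FO T] y) m = r (i (FI T x m))"
        using lhom_smult[OF FE(3)[OF T] a(1) y(1)] m a(2) y(2) rho_closed[OF a(1) m] by (simp add: compose_eq)
      thus "FI T x m = FI T (a *[FO T] y) m" using ri FI_app_closed[OF T x m] by simp
    qed
    hence hx: "h x = a *[FO X] h y" using lhom_smult[OF h a(1) y(1)] by simp
    show ?thesis
    proof (rule FI_inj[OF X lhom_closed[OF FA_hom[OF T X g] x] lhom_closed[OF h x]])
      fix m assume m: "m : car M"
      have "FI X (h x) m = FI X (h y) (rho a m)"
        unfolding hx using lhom_smult[OF FE(3)[OF X] a(1) hy] m by (simp add: compose_eq)
      thus "FI X (FA T X g x) m = FI X (h x) m" using FI_FA_app[OF T X g x m] a(2) m by (simp add: g_def)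
    qed
  qed
  thus ?thesis using g by blast
qed

end

section \<open>Linear functionals\<close>

text \<open>The field as a one-dimensional space and, at the same time, as an algebra over itself;
  thus vector spaces fall under the theory of modules.\<close>

definition base :: "'k ring => ('k, 'k) module" where
  "base K = (|carrier = car K, mult = mult K, one = one K, zero = zero K, add = add K, smult = mult K|)"

lemma base_simps [simp]:
  "car (base K) = car K" "0[base K] = 0[K]" "x +[base K] y = x +[K] y" "x **[base K] y = x **[K] y"
  "1[base K] = 1[K]" "c *[base K] x = c **[K] x"
  by (simp_all add: base_def)

lemma (in lhom_loc) hom_finsum:
  assumes "finite B" "g : B \<rightarrow> car X"
  shows "f (\<Oplus>\<^bsub>X\<^esub>b\<in>B. g b) = (\<Oplus>\<^bsub>Y\<^esub>b\<in>B. f (g b))"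
  using assms
proof (induction rule: finite_induct)
  case (insert b B)
  hence "g : B \<rightarrow> car X" "g b : car X" "(%b. f (g b)) : B \<rightarrow> car Y" "f (g b) : car Y" by auto
  with insert show ?case by simp
qed simp

lemma ring_base:
  assumes "field K" shows "ring (base K)"
proof -
  interpret K: field K by fact
  show ?thesis
  proof (intro ringI abelian_groupI monoidI)
    show "EX y:car (base K). y +[base K] x = 0[base K]" if "x : car (base K)" for x
      using that by (intro bexI[of _ "-[K] x"]) (auto simp: K.l_neg)
  qed (auto simp: K.a_ac K.m_assoc K.l_distr K.r_distr)
qed

lemma left_module_base_iff:
  assumes "field K" shows "left_module (base K) V <-> left_module K V"
proof -
  interpret K: field K by fact
  show ?thesis unfolding left_module_def left_module_axioms_def using ring_base[OF assms] K.ring_axioms by simp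
qed

lemma base_vectorspace: assumes "field K" shows "vectorspace K (base K)"
proof (rule vectorspaceI[OF assms])
  interpret K: field K by fact
  show "left_module K (base K)"
  proof (rule left_moduleI)
    show "EX y:car (base K). y +[base K] x = 0[base K]" if "x : car (base K)" for x
      using that by (intro bexI[of _ "-[K] x"]) (auto simp: K.l_neg)
  qed (auto simp: K.a_ac K.m_assoc K.l_distr K.r_distr K.ring_axioms)
qed

lemma base_fin_dim: assumes "field K" shows "vectorspace.fin_dim K (base K)"
proof -
  interpret K: field K by fact
  interpret V: vectorspace K "base K" by (rule base_vectorspace[OF assms])
  interpret V': left_module K "base K" by (rule V.left_module)
  have "U = car K" if U: "sbm K (base K) U" "{1[K]} <= U" for U
  proof -
    have "x : U" if "x : car K" for x using V'.submodD(4)[OF U(1), of x "1[K]"] U(2) that by simp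
    thus ?thesis using V'.submodD(1)[OF U(1)] by auto
  qed
  thus ?thesis unfolding V.fin_dim_iff by (intro exI[of _ "{1[K]}"]) auto
qed

lemma base_fd_algebra: assumes "field K" shows "fd_algebra K (base K)"
proof -
  interpret K: field K by fact
  show ?thesis unfolding fd_algebra_def
    using base_vectorspace[OF assms] base_fin_dim[OF assms] ring_base[OF assms] by (simp add: K.m_ac)
qed

lemma base_fd_module:
  assumes V: "vectorspace K V" "vectorspace.fin_dim K V" shows "fd_module K (base K) V"
proof -
  interpret V: vectorspace K V by fact
  interpret B: fdalg K "base K" by unfold_locales (rule base_fd_algebra[OF V.field.field_axioms])
  have lm: "left_module (base K) V" unfolding left_module_base_iff[OF V.field.field_axioms] by (rule V.left_module)
  interpret VL: left_module K V by (rule V.left_module)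
  have id: "(%x. x) : lhom K V (us (base K) V)"
  proof (rule left_homI)
    fix c x assume "c : car K" "x : car V"
    thus "c *[V] x = c *[us (base K) V] x" by (simp add: underlying_space_def)
  qed (simp_all add: underlying_space_def)
  have "vectorspace.fin_dim K (us (base K) V)"
    by (rule vs_hom.fin_dim_image[OF vs_hom.intro[OF V(1) B.us_vs[OF lm] vs_hom_axioms.intro[OF id]] V(2)])
      (simp add: underlying_space_def)
  with lm show ?thesis by (simp add: fd_module_def)
qed

lemma lhom_base: "lhom (base K) V W = lhom K V W"
  by (simp add: LinearCombinations.module_hom_def)

locale lin_space = vectorspace K V for K :: "'k ring" and V :: "('k, 'c) module"
begin

abbreviation lfun :: "('c => 'k) set" where "lfun == lhom K V (base K)"

lemma lfun_basis:
  assumes "fin_dim"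
  shows "EX B beta. finite B & B <= car V & (ALL b:B. beta b : lfun) & (ALL x:car V. x = (\<Oplus>\<^bsub>V\<^esub>b\<in>B. beta b x *[V] b))"
proof -
  obtain B beta where B: "finite B" "B <= car V" "!!b. b : B ==> beta b : car V \<rightarrow> car K"
    "!!b x y. b : B ==> x : car V ==> y : car V ==> beta b (x +[V] y) = beta b x +[K] beta b y"
    "!!b c x. b : B ==> c : car K ==> x : car V ==> beta b (c *[V] x) = c **[K] beta b x"
    "!!x. x : car V ==> x = (\<Oplus>\<^bsub>V\<^esub>b\<in>B. beta b x *[V] b)"
    by (rule dual_basis[OF assms]) (rule that)
  have "beta b : lfun" if "b : B" for b
    by (rule left_homI) (use B(3-5)[OF that] in auto)
  thus ?thesis using B(1,2,6) by blast
qed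

lemma lfun_separates:
  assumes "fin_dim" "x : car V" "x ~= 0[V]"
  shows "EX eta:lfun. eta x ~= 0[K]"
proof (rule ccontr)
  assume n: "~ (EX eta:lfun. eta x ~= 0[K])"
  interpret VL: left_module K V by (rule left_module)
  obtain B beta where B: "finite B" "B <= car V" "ALL b:B. beta b : lfun" "ALL x:car V. x = (\<Oplus>\<^bsub>V\<^esub>b\<in>B. beta b x *[V] b)"
    using lfun_basis[OF assms(1)] by blast
  have "(\<Oplus>\<^bsub>V\<^esub>b\<in>B. beta b x *[V] b) = (\<Oplus>\<^bsub>V\<^esub>b\<in>B. 0[V])"
  proof (rule M.finsum_cong')
    fix b assume b: "b : B"
    hence "beta b x = 0[K]" "b : car V" using n B by auto
    thus "beta b x *[V] b = 0[V]" by simp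
  qed auto
  also have "... = 0[V]" by simp
  finally show False using B(4) assms(2,3) by metis
qed

lemma base_left: "left_module K (base K)"
  by (rule vectorspace.left_module[OF base_vectorspace[OF field.field_axioms]])

lemma lfun_scale: "c : car K ==> eta : lfun ==> (%x. c **[K] eta x) : lfun"
  by (rule left_homI) (auto simp: lhom_closed[of eta K V "base K", simplified] lhom_add[of eta K V "base K", simplified]
    lhom_smult[of eta K V "base K", simplified] R.r_distr R.m_lcomm)

lemma lfun_zero: "(%x. 0[K]) : lfun"
  using lhom_zero[OF base_left] by simp

lemma lfun_add: "eta : lfun ==> theta : lfun ==> (%x. eta x +[K] theta x) : lfun"
  using lhom_plus[OF base_left] by simp

text \<open>Reflexivity of a finite-dimensional space: \<open>Phi\<close> is evaluation at the
  vector with coordinates \<open>Phi (beta b)\<close>. \<open>cong\<close> is there because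
  functionals are bare functions whose values off the carrier must not matter.\<close>

lemma lfun_reflexive:
  assumes fd: "fin_dim"
    and Phi: "!!eta. eta : lfun ==> Phi eta : car K"
    and add: "!!eta theta. eta : lfun ==> theta : lfun ==> Phi (%x. eta x +[K] theta x) = Phi eta +[K] Phi theta"
    and scale: "!!c eta. c : car K ==> eta : lfun ==> Phi (%x. c **[K] eta x) = c **[K] Phi eta"
    and cong: "!!eta theta. eta : lfun ==> theta : lfun ==> (!!x. x : car V ==> eta x = theta x) ==> Phi eta = Phi theta"
  shows "EX v:car V. ALL eta:lfun. eta v = Phi eta"
proof -
  interpret VL: left_module K V by (rule left_module)
  obtain B beta where B: "finite B" "B <= car V" "ALL b:B. beta b : lfun" "ALL x:car V. x = (\<Oplus>\<^bsub>V\<^esub>b\<in>B. beta b x *[V] b)"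
    using lfun_basis[OF assms(1)] by blast
  have Bc: "b : car V" if "b : B" for b using that B(2) by auto
  define v where "v = (\<Oplus>\<^bsub>V\<^esub>b\<in>B. Phi (beta b) *[V] b)"
  have v: "v : car V" unfolding v_def by (rule M.finsum_closed) (use Phi B Bc in auto)
  have "eta v = Phi eta" if eta: "eta : lfun" for eta
  proof -
    interpret eta: lhom_loc K V "base K" eta by (rule lhom_locI[OF left_module base_left eta])
    have etac: "eta x : car K" if "x : car V" for x using eta.closed[OF that] by simp
    have betac: "beta b x : car K" if "b : B" "x : car V" for b x using lhom_closed[of "beta b" K V "base K" x] B(3) that by simp
    \<comment> \<open>Additivity of \<open>Phi\<close> is given for two summands, so the finite sum
      is built up by induction, together with the fact that partial sums are functionals.\<close>
    have sum: "(%x. \<Oplus>\<^bsub>K\<^esub>b\<in>C. eta b **[K] beta b x) : lfun &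
        Phi (%x. \<Oplus>\<^bsub>K\<^esub>b\<in>C. eta b **[K] beta b x) = (\<Oplus>\<^bsub>K\<^esub>b\<in>C. eta b **[K] Phi (beta b))" if "finite C" "C <= B" for C
      using that
    proof (induction rule: finite_induct)
      case empty
      have "Phi (%x. 0[K]) = Phi (%x. 0[K] **[K] 0[K])" by simp
      also have "... = 0[K] **[K] Phi (%x. 0[K])" by (rule scale[OF _ lfun_zero]) simp
      also have "... = 0[K]" using Phi[OF lfun_zero] by simp
      finally show ?case using lfun_zero by simp
    next
      case (insert b C)
      have b: "b : B" "C <= B" using insert by auto
      define gamma where "gamma x = (\<Oplus>\<^bsub>K\<^esub>b\<in>C. eta b **[K] beta b x)" for x
      have IH: "gamma : lfun" "Phi gamma = (\<Oplus>\<^bsub>K\<^esub>b\<in>C. eta b **[K] Phi (beta b))" using insert.IH[OF b(2)] unfolding gamma_def by auto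
      define delta where "delta x = eta b **[K] beta b x" for x
      have delta: "delta : lfun" unfolding delta_def by (rule lfun_scale) (use etac Bc b B(3) in auto)
      define eps where "eps x = (\<Oplus>\<^bsub>K\<^esub>b\<in>insert b C. eta b **[K] beta b x)" for x
      have eq: "delta x +[K] gamma x = eps x" if "x : car V" for x
      proof -
        have "(%b. eta b **[K] beta b x) : C \<rightarrow> car K" "eta b **[K] beta b x : car K" using b that betac etac Bc by auto
        thus ?thesis unfolding delta_def gamma_def eps_def using R.finsum_insert[OF insert(1,2)] by simp
      qed
      have eps: "eps : lfun" by (rule lhom_cong[OF eq left_module lfun_add[OF delta IH(1)]])
      have "Phi eps = Phi (%x. delta x +[K] gamma x)" by (rule cong[OF eps lfun_add[OF delta IH(1)]]) (use eq in simp)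
      also have "... = Phi delta +[K] Phi gamma" by (rule add[OF delta IH(1)])
      also have "Phi delta = eta b **[K] Phi (beta b)" unfolding delta_def by (rule scale) (use etac Bc b B(3) in auto)
      also have "eta b **[K] Phi (beta b) +[K] Phi gamma = (\<Oplus>\<^bsub>K\<^esub>b\<in>insert b C. eta b **[K] Phi (beta b))"
      proof -
        have "(%b. eta b **[K] Phi (beta b)) : C \<rightarrow> car K" "eta b **[K] Phi (beta b) : car K" using b Phi B(3) etac Bc by auto
        thus ?thesis unfolding IH(2) using R.finsum_insert[OF insert(1,2)] by simp
      qed
      finally show ?case using eps unfolding eps_def by blast
    qed
    note s = sum[OF B(1) subset_refl]
    have "Phi eta = Phi (%x. \<Oplus>\<^bsub>K\<^esub>b\<in>B. eta b **[K] beta b x)"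
    proof (rule cong[OF eta conjunct1[OF s]])
      fix x assume x: "x : car V"
      have "eta x = eta (\<Oplus>\<^bsub>V\<^esub>b\<in>B. beta b x *[V] b)" using B(4) x by metis
      also have "... = (\<Oplus>\<^bsub>base K\<^esub>b\<in>B. eta (beta b x *[V] b))" by (rule eta.hom_finsum[OF B(1)]) (use betac x Bc in auto)
      also have "... = (\<Oplus>\<^bsub>base K\<^esub>b\<in>B. eta b **[K] beta b x)"
        by (rule eta.Y.M.finsum_cong') (use betac x Bc etac in "auto simp: R.m_comm")
      finally show "eta x = (\<Oplus>\<^bsub>K\<^esub>b\<in>B. eta b **[K] beta b x)" by (simp add: finsum_def base_def finprod_def)
    qed
    also have "... = (\<Oplus>\<^bsub>K\<^esub>b\<in>B. eta b **[K] Phi (beta b))" using s by blast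
    also have "... = (\<Oplus>\<^bsub>base K\<^esub>b\<in>B. eta b **[K] Phi (beta b))" by (simp add: finsum_def base_def finprod_def)
    also have "... = (\<Oplus>\<^bsub>base K\<^esub>b\<in>B. eta (Phi (beta b) *[V] b))"
      by (rule eta.Y.M.finsum_cong') (use Bc etac Phi B(3) in "auto simp: R.m_comm")
    also have "... = eta v" unfolding v_def by (rule eta.hom_finsum[OF B(1), symmetric]) (use Phi B Bc in auto)
    finally show ?thesis by simp
  qed
  with v show ?thesis by blast
qed

end

text \<open>Extensions of vector spaces split: preimages of a finite spanning family are combined
  with its coordinate functionals.\<close>

lemma base_Ev:
  assumes K: "field K" and X: "fd_module K (base K) X"
  shows "fdalg.Ev K (base K) X Y"
proof -
  interpret B: fdalg K "base K" by unfold_locales (rule base_fd_algebra[OF K])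
  interpret V: lin_space K "us (base K) X" by (rule lin_space.intro[OF B.us_vs[OF B.ObD(1)[OF X]]])
  show ?thesis
  proof (rule B.EvI_section)
    fix C i p assume s: "B.ses Y i C p X"
    note D = B.sesD[OF s]
    interpret p: lhom_loc "base K" C X p by (rule D)
    obtain B beta where Bb: "finite B" "B <= car X" "ALL b:B. beta b : V.lfun"
      "ALL x:car X. x = (\<Oplus>\<^bsub>us (base K) X\<^esub>b\<in>B. beta b x *[us (base K) X] b)"
      using V.lfun_basis[OF B.ObD(2)[OF X]] by auto
    have "ALL b:B. EX y:car C. p y = b" using D(10) Bb(2) by blast
    then obtain c where c: "!!b. b : B ==> c b : car C & p (c b) = b" by metis
    have betac: "beta b x : car K" if "b : B" "x : car X" for b x
      using lhom_closed[of "beta b" K "us (base K) X" "base K" x] Bb(3) that by simp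
    define k where "k x = (\<Oplus>\<^bsub>C\<^esub>b\<in>B. beta b x *[C] c b)" for x
    have cl: "(%b. beta b x *[C] c b) : B \<rightarrow> car C" if "x : car X" for x
      using betac c that p.X.smult_closed by auto
    have k: "k : lhom (base K) X C"
    proof (rule left_homI)
      show "k x : car C" if "x : car X" for x unfolding k_def by (rule p.X.M.finsum_closed[OF cl[OF that]])
      show "k (x +[X] y) = k x +[C] k y" if "x : car X" "y : car X" for x y
      proof -
        have "k (x +[X] y) = (\<Oplus>\<^bsub>C\<^esub>b\<in>B. beta b x *[C] c b +[C] beta b y *[C] c b)" unfolding k_def
        proof (rule p.X.M.finsum_cong')
          fix b assume b: "b : B"
          have "beta b (x +[X] y) = beta b x +[K] beta b y"
            using lhom_add[of "beta b" K "us (base K) X" "base K" x y] Bb(3) b that by simp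
          thus "beta b (x +[X] y) *[C] c b = beta b x *[C] c b +[C] beta b y *[C] c b"
            using p.X.smult_l_distr[of "beta b x" "beta b y" "c b"] betac b c that by simp
        qed (use cl that in auto)
        also have "... = k x +[C] k y" unfolding k_def by (rule p.X.M.finsum_addf[OF cl[OF that(1)] cl[OF that(2)]])
        finally show ?thesis .
      qed
      show "k (a *[X] x) = a *[C] k x" if "a : car (base K)" "x : car X" for a x
      proof -
        have ac: "(%y. a *[C] y) : lhom (base K) C C"
          by (rule left_homI) (use that p.X.smult_closed p.X.smult_r_distr p.X.smult_assoc[symmetric] comm_monoid.m_comm[OF cring.axioms(2)[OF domain.axioms(1)[OF field.axioms(1)[OF K]]]] in auto)
        interpret a: lhom_loc "base K" C C "%y. a *[C] y" by (rule lhom_locI[OF D(12,12) ac])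
        have "k (a *[X] x) = (\<Oplus>\<^bsub>C\<^esub>b\<in>B. a *[C] (beta b x *[C] c b))" unfolding k_def
        proof (rule p.X.M.finsum_cong')
          fix b assume b: "b : B"
          have "beta b (a *[X] x) = a **[K] beta b x"
            using lhom_smult[of "beta b" K "us (base K) X" "base K" a x] Bb(3) b that by simp
          thus "beta b (a *[X] x) *[C] c b = a *[C] (beta b x *[C] c b)"
            using p.X.smult_assoc[of a "beta b x" "c b"] betac b c that by simp
        qed (use cl that a.closed in auto)
        also have "... = a *[C] k x" unfolding k_def by (rule a.hom_finsum[OF Bb(1) cl[OF that(2)], symmetric])
        finally show ?thesis .
      qed
    qed
    have "p (k x) = x" if x: "x : car X" for x
    proof -
      have "p (k x) = (\<Oplus>\<^bsub>X\<^esub>b\<in>B. p (beta b x *[C] c b))" unfolding k_def by (rule p.hom_finsum[OF Bb(1) cl[OF x]])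
      also have "... = (\<Oplus>\<^bsub>X\<^esub>b\<in>B. beta b x *[us (base K) X] b)"
        by (rule p.Y.M.finsum_cong') (use betac c x Bb(2) p.Y.smult_closed in auto)
      also have "... = (\<Oplus>\<^bsub>us (base K) X\<^esub>b\<in>B. beta b x *[us (base K) X] b)"
        by (simp add: finsum_def finprod_def underlying_space_def)
      also note Bb(4)[rule_format, OF x, symmetric]
      finally show ?thesis .
    qed
    with k show "EX k:lhom (base K) X C. ALL x:car X. p (k x) = x" by blast
  qed
qed

section \<open>The dual of the regular module\<close>

locale dual_alg = fdalg K S for K :: "'k ring" and S :: "('k, 'a) module"
begin

lemma dual_homf: "homf K (base K) S S (%a s. s **[S] a)"
proof -
  interpret B: fdalg K "base K" by unfold_locales (rule base_fd_algebra[OF field_K])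
  show ?thesis
  proof (intro homf.intro homf_axioms.intro B.fdalg_axioms fdalg_axioms base_fd_module vs_S fin_dim_S)
    fix a assume a: "a : car S"
    show "(%s. s **[S] a) : lhom (base K) S S"
      by (rule left_homI) (use a in "simp_all add: S.l_distr smult_mult")
    show "s **[S] (a +[S] b) = s **[S] a +[S] s **[S] b" if "b : car S" "s : car S" for b s
      using a that by (rule S.r_distr)
    show "s **[S] (a **[S] b) = s **[S] a **[S] b" if "b : car S" "s : car S" for b s
      using a that by (simp add: S.m_assoc)
  next
    show "s **[S] 1[S] = s" if "s : car S" for s using that by simp
  next
    fix c s assume c: "c : car K" and s: "s : car S"
    interpret F: field K by (rule field_K)
    show "s **[S] (sc S c) = (sc (base K) c) *[S] s"
      using scal_comm(2)[OF c s] c by simp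
  qed
qed

sublocale co: homf K "base K" S S "%a s. s **[S] a" by (rule dual_homf)

lemma base_Ob: "fd_module K (base K) (base K)"
  by (rule base_fd_module[OF base_vectorspace[OF field_K] base_fin_dim[OF field_K]])

text \<open>The dual DS of the regular module: linear functionals on \<open>S\<close> with
  \<open>(a f)(s) = f(s a)\<close>, moved to the common carrier type. \<open>fl\<close> reads its
  elements as functionals again.\<close>

definition J :: "('k, 'a) umodule" where "J = co.FO (base K)"

definition fl :: "(nat => 'k) => 'a => 'k" where "fl = co.FI (base K)"

lemma J_Ob: "Ob J" unfolding J_def by (rule co.FO[OF base_Ob])

lemma fl_closed: "x : car J ==> s : car S ==> fl x s : car K"
  using co.FI_app_closed[OF base_Ob] unfolding J_def fl_def by simp

lemma fl_add: "x : car J ==> y : car J ==> s : car S ==> fl (x +[J] y) s = fl x s +[K] fl y s"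
  using co.FI_add[OF base_Ob] unfolding J_def fl_def by simp

lemma fl_smult: "a : car S ==> x : car J ==> s : car S ==> fl (a *[J] x) s = fl x (s **[S] a)"
  using co.FI_smult[OF base_Ob] unfolding J_def fl_def by simp

lemma fl_inj: "x : car J ==> y : car J ==> (!!s. s : car S ==> fl x s = fl y s) ==> x = y"
  unfolding J_def fl_def by (rule co.FI_inj[OF base_Ob])

lemma fl_zero: "s : car S ==> fl 0[J] s = 0[K]"
  using co.FI_zero[OF base_Ob] unfolding J_def fl_def by simp

lemma fl_lhom: "x : car J ==> fl x : lhom K S (base K)"
  using co.FI_lhom[OF base_Ob, of x] unfolding J_def fl_def lhom_base .

lemma fl_surj: "h : lhom K S (base K) ==> EX x:car J. ALL s:car S. fl x s = h s"
  using co.FI_surj[OF base_Ob, of h] unfolding J_def fl_def lhom_base .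

abbreviation fun_on :: "('a, 'm) module => ('m => 'k) set" where
  "fun_on X == lhom K (us S X) (base K)"

text \<open>The bijection between functionals on \<open>X\<close> and homomorphisms X -> DS:
  \<open>eta\<close> goes to the map that sends \<open>x\<close> to the functional with value
  \<open>eta(s x)\<close> at \<open>s\<close>. The inverse, in \<open>fun_of_hom\<close>, evaluates
  at 1.\<close>

definition coi :: "('a, 'm) module => ('m => 'k) => 'm => nat => 'k" where
  "coi X eta x = (SOME z. z : car J & (ALL s:car S. fl z s = eta (s *[X] x)))"

lemma coi:
  assumes X: "left_module S X" and eta: "eta : fun_on X"
  shows "coi X eta : lhom S X J" "!!x s. x : car X ==> s : car S ==> fl (coi X eta x) s = eta (s *[X] x)"
proof -
  interpret X: left_module S X by (rule X)
  interpret J: left_module S J by (rule ObD[OF J_Ob])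
  have add: "eta (x +[X] y) = eta x +[K] eta y" if "x : car X" "y : car X" for x y using lhom_add[OF eta, of x y] that by simp
  have sm: "eta ((sc S c) *[X] x) = c **[K] eta x" if "c : car K" "x : car X" for c x using lhom_smult[OF eta, of c x] that by simp
  have ex: "EX z. z : car J & (ALL s:car S. fl z s = eta (s *[X] x))" if x: "x : car X" for x
  proof -
    have "(%s. eta (s *[X] x)) : lhom K S (base K)"
    proof (rule left_homI)
      show "eta (s *[X] x) : car (base K)" if "s : car S" for s by (rule lhom_closed[OF eta]) (simp add: X.smult_closed that x)
      show "eta ((s +[S] t) *[X] x) = eta (s *[X] x) +[base K] eta (t *[X] x)" if "s : car S" "t : car S" for s t
        using that x by (simp add: X.smult_l_distr add X.smult_closed)
      show "eta ((c *[S] s) *[X] x) = c *[base K] eta (s *[X] x)" if "c : car K" "s : car S" for c s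
        using that x sm[of c "s *[X] x"] scal_comm(1)[OF that] scal_closed[OF that(1)] by (simp add: X.smult_assoc[symmetric] X.smult_closed)
    qed
    from fl_surj[OF this] show ?thesis by blast
  qed
  have c: "coi X eta x : car J" "s : car S ==> fl (coi X eta x) s = eta (s *[X] x)" if "x : car X" for x s
    using someI_ex[OF ex[OF that]] unfolding coi_def[symmetric] by blast+
  show "!!x s. x : car X ==> s : car S ==> fl (coi X eta x) s = eta (s *[X] x)" by (rule c(2))
  show "coi X eta : lhom S X J"
  proof (rule left_homI)
    show "coi X eta x : car J" if "x : car X" for x by (rule c(1)[OF that])
    show "coi X eta (x +[X] y) = coi X eta x +[J] coi X eta y" if "x : car X" "y : car X" for x y
      by (rule fl_inj) (use that in "simp_all add: c fl_add add X.smult_r_distr X.smult_closed")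
    show "coi X eta (a *[X] x) = a *[J] coi X eta x" if "a : car S" "x : car X" for a x
      by (rule fl_inj) (use that in "simp_all add: c fl_smult X.smult_assoc X.smult_closed J.smult_closed")
  qed
qed

lemma fun_of_hom:
  assumes X: "left_module S X" and h: "h : lhom S X J"
  shows "(%x. fl (h x) 1[S]) : fun_on X" "!!x s. x : car X ==> s : car S ==> fl (h x) s = fl (h (s *[X] x)) 1[S]"
proof -
  interpret h: lhom_loc S X J h by (rule lhom_locI[OF X ObD(1)[OF J_Ob] h])
  show *: "fl (h x) s = fl (h (s *[X] x)) 1[S]" if "x : car X" "s : car S" for x s
    using that by (simp add: fl_smult h.closed h.smult)
  show "(%x. fl (h x) 1[S]) : fun_on X"
  proof (rule left_homI)
    fix c x assume c: "c : car K" and "x : car (us S X)"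
    hence x: "x : car X" by simp
    have "fl (h ((sc S c) *[X] x)) 1[S] = fl (h x) (sc S c)" by (rule *[OF x scal_closed[OF c], symmetric])
    also have "... = c **[K] fl (h x) 1[S]" using lhom_smult[OF fl_lhom[OF h.closed[OF x]] c] by simp
    finally show "fl (h (c *[us S X] x)) 1[S] = c *[base K] fl (h x) 1[S]" by simp
  qed (simp_all add: fl_closed fl_add h.closed h.add)
qed

lemma fun_extend:
  fixes X Y :: "('k, 'a) umodule"
  assumes "Ob X" "Ob Y" and g: "g : lhom S X Y" "inj_on g (car X)" and eta: "eta : fun_on X"
  shows "EX theta:fun_on Y. ALL x:car X. theta (g x) = eta x"
proof -
  have ob: "fd_module K (base K) (us S X)" "fd_module K (base K) (us S Y)"
    by (rule base_fd_module[OF us_vs[OF ObD(1)] ObD(2)], fact, fact)+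
  have gh: "g : lhom (base K) (us S X) (us S Y)" unfolding lhom_base by (rule us_hom[OF g(1)])
  have gi: "inj_on g (car (us S X))" using g(2) by simp
  obtain C p where s: "co.R.ses (us S X) g (us S Y) p C"
    using co.R.ses_coker[OF ob gh gi] .
  obtain r where r: "r : lhom (base K) (us S Y) (us S X)" "ALL x:car (us S X). r (g x) = x"
    using co.R.EvD[OF base_Ev[OF field_K co.R.sesD(3)[OF s]] s] by blast
  have "(%y. eta (r y)) : fun_on Y" using lhom_comp[OF r(1) eta[folded lhom_base]] unfolding lhom_base .
  with r(2) show ?thesis by (intro bexI[of _ "%y. eta (r y)"]) simp_all
qed

text \<open>By \<open>coi\<close>, an extension problem into DS is the extension of a functional,
  which \<open>fun_extend\<close> solves over the field.\<close>

lemma J_injective: "Inj K S J"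
  unfolding injective_module_def
proof (intro conjI J_Ob allI impI, elim conjE)
  fix X Y :: "('k, 'a) umodule" and g h
  assume X: "Ob X" and Y: "Ob Y" and g: "g : lhom S X Y" "inj_on g (car X)" and h: "h : lhom S X J"
  note f = fun_of_hom[OF ObD(1)[OF X] h]
  obtain theta where theta: "theta : fun_on Y" "ALL x:car X. theta (g x) = fl (h x) 1[S]" using fun_extend[OF X Y g f(1)] by blast
  interpret X: left_module S X by (rule ObD[OF X])
  note c = coi[OF ObD(1)[OF Y] theta(1)]
  have "coi Y theta (g x) = h x" if x: "x : car X" for x
  proof (rule fl_inj)
    fix s assume s: "s : car S"
    have "fl (coi Y theta (g x)) s = theta (g (s *[X] x))" using c(2)[OF lhom_closed[OF g(1) x] s] lhom_smult[OF g(1) s x] by simp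
    thus "fl (coi Y theta (g x)) s = fl (h x) s" using theta(2) f(2)[OF x s] X.smult_closed[OF s x] by simp
  qed (use x in "simp_all add: lhom_closed[OF c(1)] lhom_closed[OF g(1)] lhom_closed[OF h]")
  thus "EX h':lhom S Y J. ALL x:car X. h' (g x) = h x" using c(1) by blast
qed

text \<open>The transpose of left multiplication by \<open>a\<close>, that is,
  \<open>fl (rt a x) s = fl x (a s)\<close>. It commutes with the module action, which comes from
  right multiplication.\<close>

definition rt :: "'a => (nat => 'k) => nat => 'k" where "rt a = coi J (%x. fl x a)"

lemma rt:
  assumes a: "a : car S"
  shows "rt a : lhom S J J" "!!x s. x : car J ==> s : car S ==> fl (rt a x) s = fl x (a **[S] s)"
proof -
  interpret J: left_module S J by (rule ObD[OF J_Ob])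
  have "(%x. fl x a) : fun_on J"
  proof (rule left_homI)
    fix c x assume c: "c : car K" and "x : car (us S J)"
    hence x: "x : car J" by simp
    show "fl (c *[us S J] x) a = c *[base K] fl x a"
      using fl_smult[OF scal_closed[OF c] x a] scal_comm(2)[OF c a] lhom_smult[OF fl_lhom[OF x] c a] by simp
  qed (simp_all add: fl_closed fl_add a)
  note c = coi[OF ObD(1)[OF J_Ob] this]
  show "rt a : lhom S J J" unfolding rt_def by (rule c(1))
  show "fl (rt a x) s = fl x (a **[S] s)" if "x : car J" "s : car S" for x s
    using c(2)[OF that] fl_smult[OF that(2,1) a] unfolding rt_def by simp
qed

lemma rt_closed: "a : car S ==> x : car J ==> rt a x : car J"
  by (rule lhom_closed[OF rt(1)])

lemma rt_add:
  assumes "a : car S" "b : car S" "x : car J" shows "rt (a +[S] b) x = rt a x +[J] rt b x"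
proof (rule fl_inj)
  interpret J: left_module S J by (rule ObD[OF J_Ob])
  show "rt (a +[S] b) x : car J" "rt a x +[J] rt b x : car J" using assms by (simp_all add: rt_closed)
  show "fl (rt (a +[S] b) x) s = fl (rt a x +[J] rt b x) s" if "s : car S" for s
    using lhom_add[OF fl_lhom[OF assms(3)], of "a **[S] s" "b **[S] s"] assms that by (simp add: rt(2) fl_add rt_closed S.l_distr)
qed

lemma rt_mult: "a : car S ==> b : car S ==> x : car J ==> rt (a **[S] b) x = rt b (rt a x)"
  by (rule fl_inj) (simp_all add: rt(2) rt_closed S.m_assoc)

lemma rt_one: "x : car J ==> rt 1[S] x = x"
  by (rule fl_inj) (simp_all add: rt(2) rt_closed)

lemma rt_scal:
  assumes "c : car K" "x : car J" shows "rt (sc S c) x = (sc S c) *[J] x"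
proof (rule fl_inj)
  interpret J: left_module S J by (rule ObD[OF J_Ob])
  note c = scal_closed[OF assms(1)]
  show "rt (sc S c) x : car J" "(sc S c) *[J] x : car J" using c assms(2) by (simp_all add: rt_closed J.smult_closed)
  show "fl (rt (sc S c) x) s = fl ((sc S c) *[J] x) s" if "s : car S" for s
    using rt(2)[OF c assms(2) that] fl_smult[OF c assms(2) that] scal_comm[OF assms(1) that] by simp
qed

text \<open>An endomorphism \<open>f\<close> gives the linear form on functionals that evaluates the
  image at 1. By reflexivity this is evaluation at some \<open>a\<close>, and then \<open>f\<close>
  is \<open>rt a\<close>.\<close>

lemma J_endo:
  assumes f: "f : lhom S J J"
  shows "EX a:car S. ALL x:car J. rt a x = f x"
proof -
  interpret V: lin_space K S by (rule lin_space.intro[OF vs_S])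
  interpret J: left_module S J by (rule ObD[OF J_Ob])
  interpret F: field K by (rule field_K)
  define x where "x eta = (SOME x. x : car J & (ALL s:car S. fl x s = eta s))" for eta
  have x: "x eta : car J" "!!s. s : car S ==> fl (x eta) s = eta s" if "eta : V.lfun" for eta
    using someI_ex[of "%x. x : car J & (ALL s:car S. fl x s = eta s)"] fl_surj[OF that] unfolding x_def[symmetric] by blast+
  have fx: "f (x eta) : car J" if "eta : V.lfun" for eta by (rule lhom_closed[OF f x(1)[OF that]])
  have "EX a:car S. ALL eta:V.lfun. eta a = fl (f (x eta)) 1[S]"
  proof (rule V.lfun_reflexive[OF fin_dim_S])
    show "fl (f (x eta)) 1[S] : car K" if "eta : V.lfun" for eta by (rule fl_closed[OF fx[OF that]]) simp
    show "fl (f (x (%s. eta s +[K] theta s))) 1[S] = fl (f (x eta)) 1[S] +[K] fl (f (x theta)) 1[S]" if "eta : V.lfun" "theta : V.lfun" for eta theta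
    proof -
      have "x (%s. eta s +[K] theta s) = x eta +[J] x theta"
        by (rule fl_inj) (use x[OF V.lfun_add[OF that]] x[OF that(1)] x[OF that(2)] in "simp_all add: fl_add")
      thus ?thesis using lhom_add[OF f x(1)[OF that(1)] x(1)[OF that(2)]] fl_add[OF fx[OF that(1)] fx[OF that(2)]] by simp
    qed
    show "fl (f (x (%s. c **[K] eta s))) 1[S] = c **[K] fl (f (x eta)) 1[S]" if "c : car K" "eta : V.lfun" for c eta
    proof -
      note cc = scal_closed[OF that(1)]
      have "x (%s. c **[K] eta s) = (sc S c) *[J] x eta"
      proof (rule fl_inj)
        show "fl (x (%s. c **[K] eta s)) s = fl ((sc S c) *[J] x eta) s" if s: "s : car S" for s
          using x(2)[OF V.lfun_scale[OF `c : _` `eta : _`] s] fl_smult[OF cc x(1)[OF `eta : _`] s] scal_comm(2)[OF `c : _` s]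
            x(2)[OF `eta : _`, of "c *[S] s"] lhom_smult[OF `eta : _` `c : _` s] `c : _` s by simp
      qed (use x(1)[OF V.lfun_scale[OF that]] x(1)[OF that(2)] cc in "simp_all add: J.smult_closed")
      thus ?thesis
        using lhom_smult[OF f cc x(1)[OF that(2)]] fl_smult[OF cc fx[OF that(2)], of "1[S]"]
          lhom_smult[OF fl_lhom[OF fx[OF that(2)]] that(1), of "1[S]"] that(1) cc by simp
    qed
    show "fl (f (x eta)) 1[S] = fl (f (x theta)) 1[S]" if "eta : V.lfun" "theta : V.lfun" "!!s. s : car S ==> eta s = theta s" for eta theta
    proof -
      have "x eta = x theta" by (rule fl_inj) (use x[OF that(1)] x[OF that(2)] that(3) in simp_all)
      thus ?thesis by simp
    qed
  qed
  then obtain a where a: "a : car S" "!!eta. eta : V.lfun ==> eta a = fl (f (x eta)) 1[S]" by blast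
  have "rt a y = f y" if y: "y : car J" for y
  proof (rule fl_inj)
    fix s assume s: "s : car S"
    have sy: "s *[J] y : car J" by (rule J.smult_closed[OF s y])
    have "x (fl (s *[J] y)) = s *[J] y" by (rule fl_inj[OF x(1)[OF fl_lhom[OF sy]] sy]) (rule x(2)[OF fl_lhom[OF sy]])
    hence "fl (s *[J] y) a = fl (f (s *[J] y)) 1[S]" using a(2)[OF fl_lhom[OF sy]] by simp
    thus "fl (rt a y) s = fl (f y) s"
      using rt(2)[OF a(1) y s] fl_smult[OF s y a(1)] lhom_smult[OF f s y] fl_smult[OF s lhom_closed[OF f y], of "1[S]"] s by simp
  qed (use y a in "simp_all add: rt_closed lhom_closed[OF f]")
  with a(1) show ?thesis by blast
qed

end

section \<open>The Nakayama correspondence\<close>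

context dual_alg
begin

lemma fun_on_eqI:
  assumes X: "Ob X" and x: "x : car X" and y: "y : car X" and eq: "!!eta. eta : fun_on X ==> eta x = eta y"
  shows "x = y"
proof (rule ccontr)
  assume n: "x ~= y"
  interpret X: left_module S X by (rule ObD[OF X])
  interpret V: lin_space K "us S X" by (rule lin_space.intro[OF us_vs[OF ObD(1)[OF X]]])
  have m: "x +[X] -[X] y : car X" using x y by simp
  have "x +[X] -[X] y ~= 0[X]" using X.minus_eq_zero[OF x y] n by (simp add: a_minus_def)
  then obtain eta where eta: "eta : fun_on X" "eta (x +[X] -[X] y) ~= 0[K]" using V.lfun_separates[OF ObD(2)[OF X]] m by auto
  interpret e: lhom_loc K "us S X" "base K" eta by (rule lhom_locI[OF V.left_module V.base_left eta(1)])
  have "eta x +[K] eta (-[X] y) = eta y +[K] eta (-[X] y)" using eq[OF eta(1)] by simp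
  hence "eta (x +[X] -[X] y) = eta (y +[X] -[X] y)" using e.add[of x "-[X] y"] e.add[of y "-[X] y"] x y by simp
  moreover have "y +[X] -[X] y = 0[X]" using y by (simp add: X.M.r_neg)
  ultimately show False using eta(2) e.zero by simp
qed

lemma fun_on_closed: "eta : fun_on X ==> x : car X ==> eta x : car K"
  using lhom_closed[of eta K "us S X" "base K" x] by simp

lemma fun_on_add: "eta : fun_on X ==> x : car X ==> y : car X ==> eta (x +[X] y) = eta x +[K] eta y"
  using lhom_add[of eta K "us S X" "base K" x y] by simp

lemma fun_on_scal: "eta : fun_on X ==> c : car K ==> x : car X ==> eta ((sc S c) *[X] x) = c **[K] eta x"
  using lhom_smult[of eta K "us S X" "base K" c x] by simp

lemma fun_on_comp: "f : lhom S X Y ==> eta : fun_on Y ==> (%x. eta (f x)) : fun_on X"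
  by (rule lhom_comp[OF us_hom])

end

locale simp_dual = simp_data K S La L P I p0 i0 + dual_alg K S
  for K :: "'k ring" and S :: "('k, 'a) module" and La :: "'l set" and L P I p0 i0
begin

text \<open>The clauses say that \<open>p\<close> induces an isomorphism of \<open>S\<close>-modules
  from Hom(DS, I(l)) to P(l), where \<open>a\<close> acts on the left by precomposition with
  \<open>rt a\<close>.\<close>

definition nak :: "'l => (((nat => 'k) => (nat => 'k)) => (nat => 'k)) => bool" where
  "nak l p <-> (ALL f:lhom S J (I l). p f : car (P l)) &
    (ALL f:lhom S J (I l). ALL g:lhom S J (I l). (ALL x:car J. f x = g x) --> p f = p g) &
    (ALL f:lhom S J (I l). ALL g:lhom S J (I l). p (%x. f x +[I l] g x) = p f +[P l] p g) &
    (ALL a:car S. ALL f:lhom S J (I l). p (%x. f (rt a x)) = a *[P l] p f) &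
    (ALL f:lhom S J (I l). p f = 0[P l] --> (ALL x:car J. f x = 0[I l])) &
    (ALL y:car (P l). EX f:lhom S J (I l). p f = y)"

lemma nakD:
  assumes "nak l p"
  shows "!!f. f : lhom S J (I l) ==> p f : car (P l)"
    "!!f g. f : lhom S J (I l) ==> g : lhom S J (I l) ==> (!!x. x : car J ==> f x = g x) ==> p f = p g"
    "!!f g. f : lhom S J (I l) ==> g : lhom S J (I l) ==> p (%x. f x +[I l] g x) = p f +[P l] p g"
    "!!a f. a : car S ==> f : lhom S J (I l) ==> p (%x. f (rt a x)) = a *[P l] p f"
    "!!f x. f : lhom S J (I l) ==> p f = 0[P l] ==> x : car J ==> f x = 0[I l]"
    "!!y. y : car (P l) ==> EX f:lhom S J (I l). p f = y"
  using assms unfolding nak_def by blast+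

text \<open>The isomorphism is built by hand from a functional \<open>psi\<close> on
  \<open>I l\<close> and an element \<open>x0\<close> of \<open>P l\<close>: \<open>p f\<close> is
  the vector on which each \<open>eta\<close> takes the value \<open>psi (f (c eta))\<close>, with
  \<open>c eta\<close> in DS the functional sending \<open>s\<close> to
  \<open>eta(s x0)\<close>.\<close>

lemma nakayama:
  assumes l: "l : La" shows "EX p. nak l p"
proof -
  \<comment> \<open>\<open>x0\<close> is mapped by \<open>ip\<close> to a nonzero element of the
    socle of \<open>I l\<close>, and \<open>psi\<close> is chosen not to vanish there; injectivity
    and surjectivity both rest on \<open>psi (ip l x0)\<close> being nonzero.\<close>
  obtain x0 where x0: "x0 : car (P l)" "ip l x0 ~= 0[I l]" using ip_nz[OF l] by blast
  note PO = P_Ob[OF l] and IO = I_Ob[OF l]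
  interpret P: left_module S "P l" by (rule ObD[OF PO])
  interpret I: left_module S "I l" by (rule ObD[OF IO])
  interpret J: left_module S J by (rule ObD[OF J_Ob])
  interpret VI: lin_space K "us S (I l)" by (rule lin_space.intro[OF us_vs[OF ObD(1)[OF IO]]])
  interpret VP: lin_space K "us S (P l)" by (rule lin_space.intro[OF us_vs[OF ObD(1)[OF PO]]])
  interpret F: field K by (rule field_K)
  have ipc: "ip l x0 : car (I l)" by (rule lhom_closed[OF ip[OF l] x0(1)])
  obtain psi where psi: "psi : fun_on (I l)" "psi (ip l x0) ~= 0[K]" using VI.lfun_separates[OF ObD(2)[OF IO]] ipc x0(2) by auto
  define c where "c eta = coi (P l) eta x0" for eta
  note co = coi[OF ObD(1)[OF PO]]
  have c: "c eta : car J" "!!s. s : car S ==> fl (c eta) s = eta (s *[P l] x0)" if "eta : fun_on (P l)" for eta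
    using lhom_closed[OF co(1)[OF that] x0(1)] co(2)[OF that x0(1)] unfolding c_def by blast+
  have sx: "s *[P l] x0 : car (P l)" if "s : car S" for s by (rule P.smult_closed[OF that x0(1)])
  have c_add: "c (%x. eta x +[K] theta x) = c eta +[J] c theta" if "eta : fun_on (P l)" "theta : fun_on (P l)" for eta theta
    by (rule fl_inj) (use c[OF VP.lfun_add[OF that]] c[OF that(1)] c[OF that(2)] in "simp_all add: fl_add")
  have c_scal: "c (%x. a **[K] eta x) = (sc S a) *[J] c eta" if a: "a : car K" and eta: "eta : fun_on (P l)" for a eta
  proof (rule fl_inj)
    note aa = scal_closed[OF a]
    show "c (%x. a **[K] eta x) : car J" by (rule c(1)[OF VP.lfun_scale[OF a eta]])
    show "(sc S a) *[J] c eta : car J" by (rule J.smult_closed[OF aa c(1)[OF eta]])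
    fix s assume s: "s : car S"
    have "fl ((sc S a) *[J] c eta) s = eta ((s **[S] (sc S a)) *[P l] x0)"
      using fl_smult[OF aa c(1)[OF eta] s] c(2)[OF eta] s aa by simp
    also have "s **[S] (sc S a) = (sc S a) **[S] s" using scal_comm[OF a s] by simp
    also have "eta (((sc S a) **[S] s) *[P l] x0) = a **[K] eta (s *[P l] x0)"
      using fun_on_scal[OF eta a sx[OF s]] P.smult_assoc[OF aa s x0(1)] by simp
    finally show "fl (c (%x. a **[K] eta x)) s = fl ((sc S a) *[J] c eta) s" using c(2)[OF VP.lfun_scale[OF a eta] s] by simp
  qed
  have c_cong: "c eta = c theta" if "eta : fun_on (P l)" "theta : fun_on (P l)" "!!x. x : car (P l) ==> eta x = theta x" for eta theta
    by (rule fl_inj) (use c[OF that(1)] c[OF that(2)] that(3) sx in simp_all)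
  \<comment> \<open>Vectors of \<open>P l\<close> are linear forms on functionals by reflexivity,
    and sending \<open>eta\<close> to \<open>psi (f (c eta))\<close> is such a form.\<close>
  define p where "p f = (SOME v. v : car (P l) & (ALL eta:fun_on (P l). eta v = psi (f (c eta))))" for f
  have p: "p f : car (P l)" "!!eta. eta : fun_on (P l) ==> eta (p f) = psi (f (c eta))" if f: "f : lhom S J (I l)" for f
  proof -
    note fc = lhom_closed[OF f]
    have "EX v:car (us S (P l)). ALL eta:fun_on (P l). eta v = psi (f (c eta))"
    proof (rule VP.lfun_reflexive[OF ObD(2)[OF PO]])
      show "psi (f (c eta)) : car K" if "eta : fun_on (P l)" for eta by (rule fun_on_closed[OF psi(1) fc[OF c(1)[OF that]]])
      show "psi (f (c (%x. eta x +[K] theta x))) = psi (f (c eta)) +[K] psi (f (c theta))" if "eta : fun_on (P l)" "theta : fun_on (P l)" for eta theta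
        unfolding c_add[OF that] lhom_add[OF f c(1)[OF that(1)] c(1)[OF that(2)]]
        by (rule fun_on_add[OF psi(1) fc[OF c(1)[OF that(1)]] fc[OF c(1)[OF that(2)]]])
      show "psi (f (c (%x. a **[K] eta x))) = a **[K] psi (f (c eta))" if "a : car K" "eta : fun_on (P l)" for a eta
        unfolding c_scal[OF that] lhom_smult[OF f scal_closed[OF that(1)] c(1)[OF that(2)]]
        by (rule fun_on_scal[OF psi(1) that(1) fc[OF c(1)[OF that(2)]]])
      show "psi (f (c eta)) = psi (f (c theta))" if "eta : fun_on (P l)" "theta : fun_on (P l)" "!!x. x : car (us S (P l)) ==> eta x = theta x" for eta theta
        using c_cong[OF that(1,2)] that(3) by simp
    qed
    hence "EX v. v : car (P l) & (ALL eta:fun_on (P l). eta v = psi (f (c eta)))" by auto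
    from someI_ex[OF this] show "p f : car (P l)" "!!eta. eta : fun_on (P l) ==> eta (p f) = psi (f (c eta))"
      unfolding p_def[symmetric] by blast+
  qed
  have cong: "p f = p g" if "f : lhom S J (I l)" "g : lhom S J (I l)" "ALL x:car J. f x = g x" for f g
    by (rule fun_on_eqI[OF PO p(1)[OF that(1)] p(1)[OF that(2)]]) (use p(2)[OF that(1)] p(2)[OF that(2)] that(3) c(1) in simp)
  have add: "p (%x. f x +[I l] g x) = p f +[P l] p g" if fg: "f : lhom S J (I l)" "g : lhom S J (I l)" for f g
  proof -
    note h = p[OF lhom_plus[OF I.left_module_axioms fg]]
    show ?thesis
    proof (rule fun_on_eqI[OF PO h(1)])
      show "p f +[P l] p g : car (P l)" using p(1)[OF fg(1)] p(1)[OF fg(2)] by simp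
      fix eta assume eta: "eta : fun_on (P l)"
      show "eta (p (%x. f x +[I l] g x)) = eta (p f +[P l] p g)"
        unfolding h(2)[OF eta] fun_on_add[OF eta p(1)[OF fg(1)] p(1)[OF fg(2)]] p(2)[OF fg(1) eta] p(2)[OF fg(2) eta]
        by (rule fun_on_add[OF psi(1) lhom_closed[OF fg(1) c(1)[OF eta]] lhom_closed[OF fg(2) c(1)[OF eta]]])
    qed
  qed
  have sm: "p (%x. f (rt a x)) = a *[P l] p f" if a: "a : car S" and f: "f : lhom S J (I l)" for a f
  proof -
    note h = p[OF lhom_comp[OF rt(1)[OF a] f]]
    show ?thesis
    proof (rule fun_on_eqI[OF PO h(1) P.smult_closed[OF a p(1)[OF f]]])
      fix eta assume eta: "eta : fun_on (P l)"
      define theta where "theta x = eta (a *[P l] x)" for x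
      have theta: "theta : fun_on (P l)"
      proof (rule left_homI)
        fix d x assume d: "d : car K" and "x : car (us S (P l))"
        hence x: "x : car (P l)" by simp
        have "theta ((sc S d) *[P l] x) = eta ((sc S d) *[P l] (a *[P l] x))"
          unfolding theta_def using P.smult_assoc[OF scal_closed[OF d] a x] P.smult_assoc[OF a scal_closed[OF d] x] scal_comm[OF d a] by simp
        thus "theta (d *[us S (P l)] x) = d *[base K] theta x"
          using fun_on_scal[OF eta d P.smult_closed[OF a x]] by (simp add: theta_def)
      qed (simp_all add: theta_def fun_on_closed[OF eta] fun_on_add[OF eta] P.smult_closed P.smult_r_distr a)
      have "rt a (c eta) = c theta"
        by (rule fl_inj) (use a c[OF eta] c[OF theta] in "simp_all add: rt_closed rt(2) theta_def P.smult_assoc x0")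
      thus "eta (p (%x. f (rt a x))) = eta (a *[P l] p f)"
        using h(2)[OF eta] p(2)[OF f theta] by (simp add: theta_def)
    qed
  qed
  \<comment> \<open>If \<open>f\<close> is nonzero, \<open>ip l\<close> factors through it by some
    g: P(l) -> DS. The functional \<open>eta\<close> read off from \<open>g\<close> has
    \<open>c eta = g x0\<close>, hence \<open>eta (p f) = psi (ip l x0)\<close>, which is
    nonzero.\<close>
  have zero: "f x = 0[I l]" if f: "f : lhom S J (I l)" and 0: "p f = 0[P l]" and x: "x : car J" for f x
  proof (rule ccontr)
    assume "f x ~= 0[I l]"
    then obtain g where g: "g : lhom S (P l) J" "ALL x:car (P l). f (g x) = ip l x" using ip_through[OF l J_Ob f] x by blast
    note e = fun_of_hom[OF ObD(1)[OF PO] g(1)]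
    define eta where "eta x = fl (g x) 1[S]" for x
    have eta: "eta : fun_on (P l)" using e(1) unfolding eta_def .
    have "c eta = g x0"
      by (rule fl_inj[OF c(1)[OF eta] lhom_closed[OF g(1) x0(1)]]) (use c(2)[OF eta] e(2)[OF x0(1)] in "simp add: eta_def")
    hence "eta (p f) = psi (ip l x0)" using p(2)[OF f eta] g(2) x0(1) by simp
    moreover have "eta (p f) = 0[K]"
    proof -
      interpret e: lhom_loc K "us S (P l)" "base K" eta by (rule lhom_locI[OF VP.left_module VP.base_left eta])
      show ?thesis using e.zero 0 by simp
    qed
    ultimately show False using psi(2) by simp
  qed
  \<comment> \<open>The image is a submodule, so by \<open>P_sup\<close> one element outside the
    kernel of \<open>p0\<close> is enough. A functional \<open>theta\<close> on \<open>L l\<close>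
    embeds \<open>L l\<close> into DS; extending \<open>i0\<close> along this embedding gives an
    \<open>f\<close> with \<open>theta (p0 l (p f)) = psi (ip l x0)\<close>.\<close>
  have surj: "EX f:lhom S J (I l). p f = y" if y: "y : car (P l)" for y
  proof -
    define U where "U = p ` lhom S J (I l)"
    have U: "sbm S (P l) U"
    proof (rule P.submodI)
      show "U <= car (P l)" using p(1) unfolding U_def by blast
      have z: "(%x. 0[I l]) : lhom S J (I l)" by (rule lhom_zero[OF I.left_module_axioms])
      have "p (%x. 0[I l] +[I l] 0[I l]) = p (%x. 0[I l]) +[P l] p (%x. 0[I l])" by (rule add[OF z z])
      hence "p (%x. 0[I l]) = 0[P l]" using p(1)[OF z] by simp
      thus "0[P l] : U" unfolding U_def by (rule image_eqI[OF sym z])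
      show "x +[P l] y : U" if xy: "x : U" "y : U" for x y
      proof -
        obtain f g where fg: "f : lhom S J (I l)" "g : lhom S J (I l)" "x = p f" "y = p g" using xy unfolding U_def by blast
        show ?thesis unfolding U_def fg(3,4) add[OF fg(1,2), symmetric] by (rule imageI[OF lhom_plus[OF I.left_module_axioms fg(1,2)]])
      qed
      show "a *[P l] x : U" if a: "a : car S" and x: "x : U" for a x
      proof -
        obtain f where f: "f : lhom S J (I l)" "x = p f" using x unfolding U_def by blast
        show ?thesis unfolding U_def f(2) sm[OF a f(1), symmetric] by (rule imageI[OF lhom_comp[OF rt(1)[OF a] f(1)]])
      qed
    qed
    have UO: "Ob ((P l)(|carrier := U|))" "(%x. x) : lhom S ((P l)(|carrier := U|)) (P l)"
      using Ob_sub[OF PO U] incl_left_hom[OF U P.left_module_axioms] by auto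
    note LO = L_Ob[OF l]
    interpret L: left_module S "L l" by (rule ObD[OF LO])
    interpret i: lhom_loc S "L l" "I l" "i0 l" by (rule hom_loc[OF LO IO i0[OF l]])
    interpret VL: lin_space K "us S (L l)" by (rule lin_space.intro[OF us_vs[OF ObD(1)[OF LO]]])
    have px: "p0 l x0 : car (L l)" by (rule lhom_closed[OF p0[OF l] x0(1)])
    have "p0 l x0 ~= 0[L l]"
    proof
      assume "p0 l x0 = 0[L l]"
      thus False using x0(2) i.zero by (simp add: ip_def)
    qed
    with px obtain theta where theta: "theta : fun_on (L l)" "theta (p0 l x0) ~= 0[K]" using VL.lfun_separates[OF ObD(2)[OF LO]] by auto
    note k = coi[OF ObD(1)[OF LO] theta(1)]
    have "fl (coi (L l) theta (p0 l x0)) 1[S] = theta (p0 l x0)" using k(2)[OF px, of "1[S]"] L.smult_one[OF px] by simp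
    hence "coi (L l) theta (p0 l x0) ~= 0[J]" using theta(2) fl_zero[of "1[S]"] by auto
    hence ki: "inj_on (coi (L l) theta) (car (L l))" using L_inj[OF l J_Ob k(1)] px by blast
    obtain f where f: "f : lhom S J (I l)" "ALL x:car (L l). f (coi (L l) theta x) = i0 l x"
      using injective_extend[OF I_inj[OF l] LO J_Ob k(1) ki i0[OF l]] by blast
    define eta where "eta x = theta (p0 l x)" for x
    have eta: "eta : fun_on (P l)" unfolding eta_def by (rule fun_on_comp[OF p0[OF l] theta(1)])
    have "c eta = coi (L l) theta (p0 l x0)"
      by (rule fl_inj[OF c(1)[OF eta] lhom_closed[OF k(1) px]])
        (use c(2)[OF eta] k(2)[OF px] lhom_smult[OF p0[OF l] _ x0(1)] in "simp add: eta_def")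
    hence "theta (p0 l (p f)) = psi (ip l x0)" using p(2)[OF f(1) eta] f(2) px by (simp add: eta_def ip_def)
    hence nz: "p0 l (p f) ~= 0[L l]"
    proof -
      interpret e: lhom_loc K "us S (L l)" "base K" theta by (rule lhom_locI[OF VL.left_module VL.base_left theta(1)])
      show ?thesis using e.zero `theta (p0 l (p f)) = psi (ip l x0)` psi(2) by auto
    qed
    have "p f : U" unfolding U_def by (rule imageI[OF f(1)])
    hence "EX x:car ((P l)(|carrier := U|)). p0 l x ~= 0[L l]" using nz by auto
    from L_surj[OF l UO(1) lhom_comp[OF UO(2) p0[OF l]] this]
    have "(%x. x) ` car ((P l)(|carrier := U|)) = car (P l)" by (rule P_sup[OF l UO])
    hence "y : U" using y by simp
    thus ?thesis unfolding U_def by blast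
  qed
  show ?thesis unfolding nak_def using p(1) cong add sm zero surj by blast
qed

text \<open>A functional that does not vanish on the socle of \<open>I l\<close> gives a map to DS
  that is injective on the socle, hence injective, and so splits.\<close>

lemma I_retract_J:
  assumes l: "l : La"
  shows "EX i:lhom S (I l) J. EX r:lhom S J (I l). ALL x:car (I l). r (i x) = x"
proof -
  obtain x0 where x0: "x0 : car (P l)" "ip l x0 ~= 0[I l]" using ip_nz[OF l] by blast
  note IO = I_Ob[OF l] and LO = L_Ob[OF l]
  interpret I: left_module S "I l" by (rule ObD[OF IO])
  interpret VI: lin_space K "us S (I l)" by (rule lin_space.intro[OF us_vs[OF ObD(1)[OF IO]]])
  have ipc: "ip l x0 : car (I l)" by (rule lhom_closed[OF ip[OF l] x0(1)])
  obtain psi where psi: "psi : fun_on (I l)" "psi (ip l x0) ~= 0[K]" using VI.lfun_separates[OF ObD(2)[OF IO]] ipc x0(2) by auto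
  note k = coi[OF ObD(1)[OF IO] psi(1)]
  have "fl (coi (I l) psi (ip l x0)) 1[S] = psi (ip l x0)" using k(2)[OF ipc, of "1[S]"] I.smult_one[OF ipc] by simp
  hence "coi (I l) psi (ip l x0) ~= 0[J]" using psi(2) fl_zero[of "1[S]"] by auto
  hence "EX x:car (L l). coi (I l) psi (i0 l x) ~= 0[J]"
    using lhom_closed[OF p0[OF l] x0(1)] unfolding ip_def by blast
  from L_inj[OF l J_Ob lhom_comp[OF i0[OF l] k(1)] this]
  have inj: "inj_on (coi (I l) psi) (car (I l))" by (rule I_ess[OF l J_Ob k(1)])
  obtain r where "r : lhom S J (I l)" "ALL x:car (I l). r (coi (I l) psi x) = x"
    using injective_extend[OF I_inj[OF l] IO J_Ob k(1) inj lhom_id] by blast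
  with k(1) show ?thesis by blast
qed

end

section \<open>The Ringel dual of the Ringel dual\<close>

context fdalg
begin

definition iclass :: "(('k, 'a) umodule => bool) => bool" where
  "iclass C <-> (ALL X. C X --> Ob X) & (ALL X Y. C X --> Ob Y --> module_iso S X Y --> C Y)"

lemma iclassD: "iclass C ==> C X ==> Ob X" "iclass C ==> C X ==> Ob Y ==> module_iso S X Y ==> C Y"
  unfolding iclass_def by blast+

lemma iclass_projective: "iclass (Proj K S)"
  unfolding iclass_def using projective_iso by (auto simp: projective_module_def)

lemma iclass_injective: "iclass (Inj K S)"
  unfolding iclass_def injective_iff_Ev using Ev_iso_right by blast

lemma iclass_Filt: "iclass (Filt C)"
  unfolding iclass_def using Filt_Ob Filt_iso by blast

lemma Rs_iso: "iclass C ==> Ob X' ==> module_iso S X X' ==> Rs C d X ==> Rs C d X'"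
  by (cases d) (auto intro: Ses_iso_right iclassD(2))

lemma cRs_iso: "iclass C ==> Ob X ==> Ob X' ==> module_iso S X X' ==> cRs C d X ==> cRs C d X'"
  using module_iso_sym[OF ObD(1)[of X] ObD(1)[of X']] by (cases d) (auto intro: Ses_iso_left iclassD(2))

lemma quot_iso_of_kernels:
  assumes m: "left_module S X" "left_module S Y" "left_module S Z"
    and f: "f : lhom S X Y" "f ` car X = car Y" and g: "g : lhom S X Z" "g ` car X = car Z"
    and k: "!!x. x : car X ==> f x = 0[Y] <-> g x = 0[Z]"
  shows "module_iso S Y Z"
proof -
  obtain h where h: "h : lhom S Y Z" "ALL x:car X. h (f x) = g x" using factor_epi[OF m f g(1)] k by blast
  obtain h' where h': "h' : lhom S Z Y" "ALL x:car X. h' (g x) = f x" using factor_epi[OF m(1,3,2) g f(1)] k by blast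
  have "h' (h y) = y" if "y : car Y" for y
  proof -
    obtain x where "x : car X" "y = f x" using `y : car Y` unfolding f(2)[symmetric] by blast
    thus ?thesis using h(2) h'(2) by simp
  qed
  moreover have "h (h' z) = z" if "z : car Z" for z
  proof -
    obtain x where "x : car X" "z = g x" using `z : car Z` unfolding g(2)[symmetric] by blast
    thus ?thesis using h(2) h'(2) by simp
  qed
  ultimately show ?thesis unfolding module_iso_def
    by (intro bexI[OF _ h(1)] bij_betw_byWitness[of _ h']) (use lhom_closed[OF h(1)] lhom_closed[OF h'(1)] in auto)
qed

end

locale ringel_dual = ringel
begin

sublocale U: simp_dual K S La L P I p0 i0
  by (intro simp_dual.intro A.simp_data_axioms dual_alg.intro A.fdalg_axioms)

abbreviation J where "J == U.J"

lemma J_Ob: "A.Ob J" by (rule U.J_Ob)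
lemma J_FN: "A.FN J" by (rule A.FN_injective[OF U.J_injective])

text \<open>\<open>S\<close> acts on F(DS) by functoriality, through the images of the endomorphisms
  \<open>rt a\<close>; this makes Hom(F(DS), -) a functor to modules over \<open>S\<close>
  itself.\<close>

lemma dual_homf: "homf K S' S (FO J) (%a. FA J J (U.rt a))"
proof (intro homf.intro homf_axioms.intro B.fdalg_axioms A.fdalg_axioms F_Ob J_Ob)
  interpret J: left_module S J by (rule A.ObD[OF J_Ob])
  fix a assume a: "a : car S"
  show "FA J J (U.rt a) : lhom S' (FO J) (FO J)" by (rule F_hom[OF J_Ob J_Ob U.rt(1)[OF a]])
  fix b x assume b: "b : car S" and x: "x : car (FO J)"
  note r = U.rt(1)[OF a] U.rt(1)[OF b]
  have "FA J J (U.rt (a +[S] b)) x = FA J J (%x. U.rt a x +[J] U.rt b x) x"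
    by (rule F_cong[OF J_Ob J_Ob U.rt(1) lhom_plus[OF J.left_module_axioms r] _ x]) (use a b U.rt_add in auto)
  thus "FA J J (U.rt (a +[S] b)) x = FA J J (U.rt a) x +[FO J] FA J J (U.rt b) x"
    using F_add[OF J_Ob J_Ob r x] by simp
  have "FA J J (U.rt (a **[S] b)) x = FA J J (%x. U.rt b (U.rt a x)) x"
    by (rule F_cong[OF J_Ob J_Ob U.rt(1) lhom_comp[OF r] _ x]) (use a b U.rt_mult in auto)
  thus "FA J J (U.rt (a **[S] b)) x = FA J J (U.rt b) (FA J J (U.rt a) x)"
    using F_comp[OF J_Ob J_Ob J_Ob r x] by simp
next
  fix x assume x: "x : car (FO J)"
  have "FA J J (U.rt 1[S]) x = FA J J (%x. x) x"
    by (rule F_cong[OF J_Ob J_Ob U.rt(1) lhom_id _ x]) (use U.rt_one in auto)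
  thus "FA J J (U.rt 1[S]) x = x" using F_id[OF J_Ob x] by simp
  fix c assume c: "c : car K"
  have "FA J J (U.rt (sc S c)) x = FA J J (%x. (sc S c) *[J] x) x"
    by (rule F_cong[OF J_Ob J_Ob U.rt(1)[OF A.scal_closed[OF c]] A.scal_hom[OF A.ObD(1)[OF J_Ob] c] _ x]) (use U.rt_scal[OF c] in auto)
  thus "FA J J (U.rt (sc S c)) x = (sc S' c) *[FO J] x" using F_scal[OF J_Ob c x] by simp
qed

sublocale G: homf K S' S "FO J" "%a. FA J J (U.rt a)" by (rule dual_homf)

text \<open>Endomorphisms of F(DS) come from endomorphisms of DS by fullness, and those are the
  \<open>rt a\<close>.\<close>

lemma rho_surj:
  assumes e: "e : lhom S' (FO J) (FO J)"
  shows "EX a:car S. ALL x:car (FO J). FA J J (U.rt a) x = e x"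
proof -
  obtain g where g: "g : lhom S J J" "ALL x:car (FO J). FA J J g x = e x" using fullD[OF full_FN[OF J_FN] J_Ob e] by blast
  obtain a where a: "a : car S" "ALL x:car J. U.rt a x = g x" using U.J_endo[OF g(1)] by blast
  have "FA J J (U.rt a) x = e x" if "x : car (FO J)" for x
    using F_cong[OF J_Ob J_Ob U.rt(1)[OF a(1)] g(1) _ that] a(2) g(2) that by simp
  with a(1) show ?thesis by blast
qed

lemma FI_retract:
  assumes l: "l : La"
  obtains i r where "i : lhom S' (FO (I l)) (FO J)" "r : lhom S' (FO J) (FO (I l))" "!!x. x : car (FO (I l)) ==> r (i x) = x"
proof -
  obtain i r where ir: "i : lhom S (I l) J" "r : lhom S J (I l)" "ALL x:car (I l). r (i x) = x" using U.I_retract_J[OF l] by blast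
  note IO = A.I_Ob[OF l]
  show thesis by (rule that[OF F_hom[OF IO J_Ob ir(1)] F_hom[OF J_Ob IO ir(2)] F_retract[OF J_Ob IO ir(1,2)]]) (use ir(3) in auto)
qed

lemma G_P:
  assumes l: "l : La" shows "module_iso S (P l) (G.FO (FO (I l)))"
proof -
  obtain p where p: "U.nak l p" using U.nakayama[OF l] by blast
  note n = U.nakD[OF p]
  note IO = A.I_Ob[OF l] and PO = A.P_Ob[OF l]
  note FIO = F_Ob[OF IO]
  note GO = G.FO[OF FIO]
  let ?G = "G.FO (FO (I l))"
  interpret P: left_module S "P l" by (rule A.ObD[OF PO])
  interpret I: left_module S "I l" by (rule A.ObD[OF IO])
  interpret G: left_module S ?G by (rule A.ObD[OF GO])
  interpret FI: left_module S' "FO (I l)" by (rule B.ObD[OF FIO])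
  \<comment> \<open>\<open>f y\<close> is the map DS -> I(l) whose image under \<open>F\<close> is
    encoded by \<open>y\<close>; it is unique on the carrier by faithfulness, which is what
    \<open>fe\<close> expresses.\<close>
  define f where "f y = (SOME f. f : lhom S J (I l) & (ALL x:car (FO J). FA J (I l) f x = G.FI (FO (I l)) y x))" for y
  have f: "f y : lhom S J (I l)" "!!x. x : car (FO J) ==> FA J (I l) (f y) x = G.FI (FO (I l)) y x" if y: "y : car ?G" for y
  proof -
    have "EX f. f : lhom S J (I l) & (ALL x:car (FO J). FA J (I l) f x = G.FI (FO (I l)) y x)"
      using fullD[OF full_FN[OF J_FN] IO G.FI_lhom[OF FIO y]] by blast
    from someI_ex[OF this] show "f y : lhom S J (I l)" "!!x. x : car (FO J) ==> FA J (I l) (f y) x = G.FI (FO (I l)) y x"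
      unfolding f_def[symmetric] by blast+
  qed
  have fe: "f y x = g x" if "y : car ?G" "g : lhom S J (I l)" "!!x. x : car (FO J) ==> FA J (I l) g x = G.FI (FO (I l)) y x" "x : car J" for y g x
    by (rule faith_eq[OF faith_FN[OF J_FN] J_Ob IO f(1)[OF that(1)] that(2) _ that(4)]) (simp add: f(2)[OF that(1)] that(3))
  have hom: "(%y. p (f y)) : lhom S ?G (P l)"
  proof (rule left_homI)
    show "p (f y) : car (P l)" if "y : car ?G" for y by (rule n(1)[OF f(1)[OF that]])
    show "p (f (y +[?G] z)) = p (f y) +[P l] p (f z)" if y: "y : car ?G" and z: "z : car ?G" for y z
    proof -
      have yz: "y +[?G] z : car ?G" using y z by simp
      note h = lhom_plus[OF I.left_module_axioms f(1)[OF y] f(1)[OF z]]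
      have "p (f (y +[?G] z)) = p (%x. f y x +[I l] f z x)"
      proof (rule n(2)[OF f(1)[OF yz] h])
        show "f (y +[?G] z) x = f y x +[I l] f z x" if "x : car J" for x
        proof (rule fe[OF yz h _ that])
          fix m assume m: "m : car (FO J)"
          show "FA J (I l) (%x. f y x +[I l] f z x) m = G.FI (FO (I l)) (y +[?G] z) m"
            using F_add[OF J_Ob IO f(1)[OF y] f(1)[OF z] m] f(2)[OF y m] f(2)[OF z m] G.FI_add[OF FIO y z m] by simp
        qed
      qed
      thus ?thesis using n(3)[OF f(1)[OF y] f(1)[OF z]] by simp
    qed
    show "p (f (a *[?G] y)) = a *[P l] p (f y)" if a: "a : car S" and y: "y : car ?G" for a y
    proof -
      have ay: "a *[?G] y : car ?G" by (rule G.smult_closed[OF a y])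
      note h = lhom_comp[OF U.rt(1)[OF a] f(1)[OF y]]
      have "p (f (a *[?G] y)) = p (%x. f y (U.rt a x))"
      proof (rule n(2)[OF f(1)[OF ay] h])
        show "f (a *[?G] y) x = f y (U.rt a x)" if "x : car J" for x
        proof (rule fe[OF ay h _ that])
          fix m assume m: "m : car (FO J)"
          show "FA J (I l) (%x. f y (U.rt a x)) m = G.FI (FO (I l)) (a *[?G] y) m"
            using F_comp[OF J_Ob J_Ob IO U.rt(1)[OF a] f(1)[OF y] m] f(2)[OF y G.rho_closed[OF a m]] G.FI_smult[OF FIO a y m] by simp
        qed
      qed
      thus ?thesis using n(4)[OF a f(1)[OF y]] by simp
    qed
  qed
  interpret h: lhom_loc S ?G "P l" "%y. p (f y)" by (rule A.hom_loc[OF GO PO hom])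
  have "inj_on (%y. p (f y)) (car ?G)"
    unfolding h.inj_iff
  proof (intro ballI impI)
    fix y assume y: "y : car ?G" and 0: "p (f y) = 0[P l]"
    show "y = 0[?G]"
    proof (rule G.FI_inj[OF FIO y G.M.zero_closed])
      fix m assume m: "m : car (FO J)"
      have "FA J (I l) (f y) m = FA J (I l) (%x. 0[I l]) m"
        by (rule F_cong[OF J_Ob IO f(1)[OF y] lhom_zero[OF I.left_module_axioms] _ m]) (rule n(5)[OF f(1)[OF y] 0])
      thus "G.FI (FO (I l)) y m = G.FI (FO (I l)) 0[?G] m"
        using f(2)[OF y m] F_zero[OF J_Ob IO m] G.FI_zero[OF FIO m] by simp
    qed
  qed
  moreover have "(%y. p (f y)) ` car ?G = car (P l)"
  proof (intro equalityI subsetI)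
    fix q assume "q : car (P l)"
    then obtain g where g: "g : lhom S J (I l)" "p g = q" using n(6) by blast
    obtain y where y: "y : car ?G" "ALL m:car (FO J). G.FI (FO (I l)) y m = FA J (I l) g m"
      using G.FI_surj[OF FIO F_hom[OF J_Ob IO g(1)]] by blast
    have "p (f y) = p g"
      by (rule n(2)[OF f(1)[OF y(1)] g(1) fe[OF y(1) g(1)]]) (use y(2) in auto)
    thus "q : (%y. p (f y)) ` car ?G" using y(1) g(2) by (intro image_eqI[of _ _ y]) auto
  qed (use h.closed in auto)
  ultimately have "module_iso S ?G (P l)" unfolding module_iso_def bij_betw_def using hom by blast
  thus ?thesis by (rule module_iso_sym[OF A.ObD(1)[OF GO] A.ObD(1)[OF PO]])
qed

text \<open>The theory applied to \<open>S'\<close> with order \<open>le^-1\<close> and tilting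
  modules F I(l). The target is \<open>S\<close> with its original simples, covers and hulls, and
  the role of \<open>N'\<close> is played by \<open>N\<close>, since the order is reversed
  twice.\<close>

lemma bidual: "ringel K S' La L' P' I' p0' i0' (le^-1) D' N' pD' iN' S L P I p0 i0 G.FO G.FA (%l. FO (I l)) N iN"
proof (intro ringel.intro ringel_axioms.intro B'.hw_axioms A.simp_data_axioms G.lin_functor)
  fix l assume l: "l : La"
  note FI = FI_data[OF l]
  show "B'.FD (FO (I l))" "B'.FN (FO (I l))" "B'.below (FO (I l)) l" "B.cf (FO (I l)) l" "B.mult1 l (FO (I l))" "B.local_endo (FO (I l))"
    by (rule FI)+
  show "A.Ob (N l)" by (rule A.N_Ob[OF l])
  show "iN l : lhom S (N l) (I l)" by (rule A.iN[OF l])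
  show "inj_on (iN l) (car (N l))" by (rule A.iN_inj[OF l])
  show "(l, mu) : le^-1" if "mu : La" "A.cf (N l) mu" for mu using A.cf_N[OF l that] by simp
  show "f x : iN l ` car (N l)" if "A.Ob X" "f : lhom S X (I l)" "!!mu. mu : La ==> A.cf X mu ==> (l, mu) : le^-1" "x : car X" for X f x
    by (rule A.N_univ[OF l that(1,2) _ that(4)]) (use that(3) in auto)
  obtain i r where ir: "i : lhom S' (FO (I l)) (FO J)" "r : lhom S' (FO J) (FO (I l))" "!!x. x : car (FO (I l)) ==> r (i x) = x"
    by (rule FI_retract[OF l]) (rule that)
  note FIO = F_Ob[OF A.I_Ob[OF l]]
  show "EX g:lhom S' (FO (I l)) X. ALL x:car (G.FO (FO (I l))). G.FA (FO (I l)) X g x = h x"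
    if "B.Ob X" "h : lhom S (G.FO (FO (I l))) (G.FO X)" for X h
    by (rule G.FA_full[OF FIO ir(2,1) ir(3) that(1) rho_surj that(2)])
  have rs: "r ` car (FO J) = car (FO (I l))"
  proof (intro equalityI subsetI)
    fix x assume "x : car (FO (I l))"
    thus "x : r ` car (FO J)" using ir(3) lhom_closed[OF ir(1)] by (intro image_eqI[of _ _ "i x"]) auto
  qed (use lhom_closed[OF ir(2)] in auto)
  show "g x = 0[X]" if "B.Ob X" "g : lhom S' (FO (I l)) X"
    "!!x. x : car (G.FO (FO (I l))) ==> G.FA (FO (I l)) X g x = 0[G.FO X]" "x : car (FO (I l))" for X g x
    by (rule G.FA_faithful[OF FIO ir(2) rs that])
  show "module_iso S (P l) (G.FO (FO (I l)))" by (rule G_P[OF l])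
next
  show "A.ses (G.FO X) (G.FA X Y f) (G.FO Y) (G.FA Y Z g) (G.FO Z)" if s: "B.ses X f Y g Z" and "B'.FN X" for X f Y g Z
    by (rule G.FA_exact[OF s B.Ev_lift[OF B'.Ev_FD_FN[OF FD_F[OF J_FN] that(2)] s F_Ob[OF J_Ob]]])
qed

text \<open>The image of \<open>N' l\<close> and \<open>D l\<close> are both the largest quotient of
  \<open>P l\<close> with factors below \<open>l\<close>, so the two surjections from
  \<open>P l\<close> have the same kernel.\<close>

lemma bidual_D:
  assumes l: "l : La" shows "A.Ob (G.FO (N' l))" "module_iso S (G.FO (N' l)) (D l)"
proof -
  interpret R: ringel K S' La L' P' I' p0' i0' "le^-1" D' N' pD' iN' S L P I p0 i0 G.FO G.FA "%l. FO (I l)" N iN by (rule bidual)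
  show GO: "A.Ob (G.FO (N' l))" by (rule R.D'_Ob[OF l])
  note DO = A.D_Ob[OF l] and PO = A.P_Ob[OF l]
  show "module_iso S (G.FO (N' l)) (D l)"
  proof (rule A.quot_iso_of_kernels[OF PO[THEN A.ObD(1)] GO[THEN A.ObD(1)] DO[THEN A.ObD(1)] R.B'.pD[OF l] R.B'.pD_surj[OF l] A.pD[OF l] A.pD_surj[OF l]])
    fix x assume x: "x : car (P l)"
    show "R.pD' l x = 0[G.FO (N' l)] <-> pD l x = 0[D l]"
    proof
      show "pD l x = 0[D l]" if "R.pD' l x = 0[G.FO (N' l)]"
        by (rule R.B'.D_univ[OF l DO A.pD[OF l] _ x that]) (use A.cf_D[OF l] in simp)
      show "R.pD' l x = 0[G.FO (N' l)]" if "pD l x = 0[D l]"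
        by (rule A.D_univ[OF l GO R.B'.pD[OF l] _ x that]) (use R.B'.cf_D[OF l] in simp)
    qed
  qed
qed

text \<open>The first two equivalences are the comparison for \<open>F\<close> at
  \<open>N l\<close>. The last two are the comparison for the second functor at \<open>N' l\<close>,
  whose image is \<open>D l\<close> up to isomorphism.\<close>

theorem duality:
  assumes l: "l : La"
  shows "A.Rs A.FD d (N l) <-> B.Rs (Proj K S') d (D' l)"
    and "A.cRs (Inj K S) d (N l) <-> B.cRs B'.FN d (D' l)"
    and "A.Rs (Proj K S) d (D l) <-> B.Rs B'.FD d (N' l)"
    and "A.cRs A.FN d (D l) <-> B.cRs (Inj K S') d (N' l)"
proof -
  interpret R: ringel K S' La L' P' I' p0' i0' "le^-1" D' N' pD' iN' S L P I p0 i0 G.FO G.FA "%l. FO (I l)" N iN by (rule bidual)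
  show "A.Rs A.FD d (N l) <-> B.Rs (Proj K S') d (D' l)" by (rule Rs_iff[OF A.FN_N[OF l]])
  show "A.cRs (Inj K S) d (N l) <-> B.cRs B'.FN d (D' l)" by (rule cRs_iff[OF A.FN_N[OF l]])
  note bD = bidual_D[OF l] and DO = A.D_Ob[OF l]
  note bD' = module_iso_sym[OF A.ObD(1)[OF bD(1)] A.ObD(1)[OF DO] bD(2)]
  have "A.Rs (Proj K S) d (D l) <-> A.Rs (Proj K S) d (G.FO (N' l))"
    using A.Rs_iso[OF A.iclass_projective bD(1) bD'] A.Rs_iso[OF A.iclass_projective DO bD(2)] by blast
  thus "A.Rs (Proj K S) d (D l) <-> B.Rs B'.FD d (N' l)" using R.Rs_iff[OF B'.FN_N[OF l]] by simp
  have "A.cRs A.FN d (D l) <-> A.cRs A.FN d (G.FO (N' l))"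
    using A.cRs_iso[OF A.iclass_Filt DO bD(1) bD'] A.cRs_iso[OF A.iclass_Filt bD(1) DO bD(2)] by blast
  thus "A.cRs A.FN d (D l) <-> B.cRs (Inj K S') d (N' l)" using R.cRs_iff[OF B'.FN_N[OF l]] by simp
qed

end

section \<open>Filtrations and resolutions as chains of short exact sequences\<close>

context fdalg
begin

definition uinv :: "('a, 'm) module => (nat => 'k) => 'm" where "uinv X = inv_into (car X) (uemb X)"

lemma uinv:
  assumes "Ob X"
  shows "uinv X : lhom S (um X) X" "!!x. x : car X ==> uinv X (uemb X x) = x"
    "!!y. y : car (um X) ==> uemb X (uinv X y) = y"
proof -
  note u = um[OF assms]
  have inj: "inj_on (uemb X) (car X)" and im: "uemb X ` car X = car (um X)" using u(3) by (simp_all add: bij_betw_def)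
  show 1: "uinv X (uemb X x) = x" if "x : car X" for x unfolding uinv_def by (rule inv_into_f_f[OF inj that])
  show 2: "uemb X (uinv X y) = y" if "y : car (um X)" for y unfolding uinv_def
    by (rule f_inv_into_f[of _ _ "car X"]) (simp only: im that)
  obtain g where g: "g : lhom S (um X) X" "ALL y:car (um X). uemb X (g y) = y"
    using lhom_inverse_ex[OF ObD(1)[OF assms] ObD(1)[OF u(1)] u(2,3)] by blast
  have "g y = uinv X y" if "y : car (um X)" for y using 1[OF lhom_closed[OF g(1) that]] g(2) that by simp
  thus "uinv X : lhom S (um X) X" by (rule lhom_cong[OF _ ObD(1)[OF u(1)] g(1)])
qed

definition umap :: "('a, 'm) module => ('a, 'n) module => ('m => 'n) => (nat => 'k) => nat => 'k" where
  "umap X Y f = (%x. uemb Y (f (uinv X x)))"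

lemma umap: "Ob X ==> Ob Y ==> f : lhom S X Y ==> umap X Y f : lhom S (um X) (um Y)"
  unfolding umap_def by (rule lhom_comp[OF lhom_comp[OF uinv(1)] um(2)])

lemma uemb_zero: "Ob X ==> x : car X ==> uemb X x = 0[um X] <-> x = 0[X]"
proof -
  assume X: "Ob X" and x: "x : car X"
  interpret lhom_loc S X "um X" "uemb X" by (rule lhom_locI[OF ObD(1)[OF X] ObD(1)[OF um(1)[OF X]] um(2)[OF X]])
  show ?thesis using um(3)[OF X] inj_iff zero x by (auto simp: bij_betw_def)
qed

lemma uinv_closed: "Ob X ==> x : car (um X) ==> uinv X x : car X" by (rule lhom_closed[OF uinv(1)])
lemma uemb_closed: "Ob X ==> x : car X ==> uemb X x : car (um X)" by (rule lhom_closed[OF um(2)])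

lemma zero_um: assumes M: "Ob M" shows "car (um M) = {0[um M]} <-> car M = {0[M]}"
proof -
  interpret M: left_module S M by (rule ObD[OF M])
  have im: "uemb M ` car M = car (um M)" using um(3)[OF M] by (simp add: bij_betw_def)
  have z: "uemb M 0[M] = 0[um M]" using uemb_zero[OF M] by simp
  show ?thesis
  proof
    assume a: "car (um M) = {0[um M]}"
    have "x = 0[M]" if "x : car M" for x using uemb_closed[OF M that] uemb_zero[OF M that] unfolding a by blast
    thus "car M = {0[M]}" using M.M.zero_closed by blast
  next
    assume "car M = {0[M]}"
    thus "car (um M) = {0[um M]}" unfolding im[symmetric] by (simp add: z)
  qed
qed

lemma umap_zero:
  "Ob X ==> Ob Y ==> f : lhom S X Y ==> x : car (um X) ==> umap X Y f x = 0[um Y] <-> f (uinv X x) = 0[Y]"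
  unfolding umap_def by (simp add: uemb_zero lhom_closed uinv_closed)

lemma ses_um:
  assumes O: "Ob X" "Ob Y" "Ob Z" and f: "f : lhom S X Y" "inj_on f (car X)" and g: "g : lhom S Y Z" "g ` car Y = car Z"
    and ker: "{y : car Y. g y = 0[Z]} = f ` car X"
  shows "ses (um X) (umap X Y f) (um Y) (umap Y Z g) (um Z)"
proof (rule sesI[OF um(1)[OF O(1)] um(1)[OF O(2)] um(1)[OF O(3)] umap[OF O(1,2) f(1)] umap[OF O(2,3) g(1)]])
  interpret f: lhom_loc S X Y f by (rule lhom_locI[OF ObD(1)[OF O(1)] ObD(1)[OF O(2)] f(1)])
  show "x = 0[um X]" if x: "x : car (um X)" "umap X Y f x = 0[um Y]" for x
  proof -
    have "f (uinv X x) = 0[Y]" using x umap_zero[OF O(1,2) f(1)] by simp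
    hence "uinv X x = 0[X]" using f(2) f.inj_iff uinv_closed[OF O(1) x(1)] by blast
    thus ?thesis using uemb_zero[OF O(1) uinv_closed[OF O(1) x(1)]] uinv(3)[OF O(1) x(1)] by simp
  qed
  show "EX y:car (um Y). umap Y Z g y = z" if z: "z : car (um Z)" for z
  proof -
    have "uinv Z z : g ` car Y" unfolding g(2) by (rule uinv_closed[OF O(3) z])
    then obtain y where "y : car Y" "g y = uinv Z z" by force
    thus ?thesis using uemb_closed[OF O(2)] by (intro bexI[of _ "uemb Y y"]) (simp_all add: umap_def uinv O z)
  qed
  show "umap Y Z g (umap X Y f x) = 0[um Z]" if x: "x : car (um X)" for x
  proof -
    have "f (uinv X x) : {y : car Y. g y = 0[Z]}" unfolding ker by (rule imageI[OF uinv_closed[OF O(1) x]])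
    thus ?thesis using umap_zero[OF O(2,3) g(1) lhom_closed[OF umap[OF O(1,2) f(1)] x]] by (simp add: umap_def uinv(2)[OF O(2)])
  qed
  show "EX x:car (um X). umap X Y f x = y" if y: "y : car (um Y)" "umap Y Z g y = 0[um Z]" for y
  proof -
    have "uinv Y y : {y : car Y. g y = 0[Z]}" using y umap_zero[OF O(2,3) g(1)] uinv_closed[OF O(2)] by simp
    then obtain x where "x : car X" "f x = uinv Y y" unfolding ker by force
    thus ?thesis using uemb_closed[OF O(1)] by (intro bexI[of _ "uemb X x"]) (simp_all add: umap_def uinv O y)
  qed
qed

lemma ses_um_sub:
  assumes X: "Ob X" and U: "sbm S X U"
  shows "Ses (um (X(|carrier := U|))) (um X) (um (quot_module X U))"
proof -
  interpret X: left_module S X by (rule ObD[OF X])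
  note q = quot_left_module[OF X.left_module_axioms U]
  show ?thesis
    by (rule SesI[OF ses_um[OF Ob_sub[OF X U] X Ob_quot[OF X U] incl_left_hom[OF U X.left_module_axioms] _ q(2,3)]])
      (use q(4) X.submodD(1)[OF U] in auto)
qed

lemma um_cong_iso: "Ob X ==> Ob Y ==> module_iso S X Y ==> module_iso S (um X) (um Y)"
  by (rule module_iso_trans[OF um_iso(2) module_iso_trans[OF _ um_iso(1)]])

text \<open>\<open>Filt\<close> with the labels recorded, bottom section first, in the order used by
  \<open>has_filtration\<close>.\<close>

inductive LF :: "('l => ('k, 'a) umodule) => ('k, 'a) umodule => 'l list => bool" for D where
  LF_nil: "zmod X ==> LF D X []"
| LF_snoc: "Ses X Y Z ==> LF D X ls ==> module_iso S Z (D mu) ==> LF D Y (ls @ [mu])"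

lemma LF_iso: "LF D X ls ==> Ob Y ==> module_iso S X Y ==> LF D Y ls"
proof (erule LF.cases)
  assume *: "Ob Y" "module_iso S X Y"
  show "LF D Y ls" if "ls = []" "X = X'" "zmod X'" for X' using zmod_iso[OF _ *] that by (auto intro: LF.LF_nil)
  show "LF D Y ls" if "ls = ls' @ [mu]" "X = X'" "Ses W X' Z" "LF D W ls'" "module_iso S Z (D mu)" for ls' mu W X' Z
    unfolding that(1) by (rule LF_snoc[OF Ses_iso_mid[OF that(3) *(1)] that(4,5)]) (use * that(2) in simp)
qed

lemma LF_Filt: "LF D X ls ==> set ls <= M ==> Filt (cls D M) X"
proof (induction rule: LF.induct)
  case (LF_snoc X Y Z ls mu)
  thus ?case using SesD(3)[OF LF_snoc(1)] by (intro Filt_step[OF LF_snoc(1)]) (auto simp: cls_def)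
qed (rule Filt_zero)

lemma Filt_LF: "Filt (cls D M) X ==> EX ls. set ls <= M & LF D X ls"
proof (induction rule: Filt.induct)
  case (Filt_zero X)
  thus ?case by (intro exI[of _ "[]"]) (auto intro: LF.LF_nil)
next
  case (Filt_step X Y Z)
  then obtain ls mu where "set ls <= M" "LF D X ls" "mu : M" "module_iso S Z (D mu)" unfolding cls_def by blast
  thus ?case using LF_snoc[OF Filt_step(1)] by (intro exI[of _ "ls @ [mu]"]) auto
qed

lemma has_filtration_Nil: "Ob M ==> has_filtration S D M [] <-> car M = {0[M]}"
  unfolding has_filtration_def by (auto simp: left_module.submod_carrier[OF ObD(1)] intro!: exI[of _ "%_. car M"])

lemma has_filtration_snoc:
  assumes M: "Ob M"
  shows "has_filtration S D M (ls @ [mu]) <->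
    (EX U. sbm S M U & has_filtration S D (M(|carrier := U|)) ls & module_iso S (quot_module M U) (D mu))"
proof
  interpret M: left_module S M by (rule ObD[OF M])
  let ?n = "length ls"
  {
    assume "has_filtration S D M (ls @ [mu])"
    then obtain N where N: "N 0 = {0[M]}" "N (Suc ?n) = car M" "!!i. i <= Suc ?n ==> sbm S M (N i)"
      "!!i. i < Suc ?n ==> N i <= N (Suc i) & module_iso S (quot_module (M(|carrier := N (Suc i)|)) (N i)) (D ((ls @ [mu]) ! i))"
      unfolding has_filtration_def by auto
    have le: "N i <= N ?n" if "i <= ?n" for i
      using that
    proof (induction rule: inc_induct)
      case (step n)
      thus ?case using N(4)[of n] by auto
    qed simp
    show "EX U. sbm S M U & has_filtration S D (M(|carrier := U|)) ls & module_iso S (quot_module M U) (D mu)"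
    proof (intro exI conjI)
      show U: "sbm S M (N ?n)" by (rule N(3)) simp
      show "module_iso S (quot_module M (N ?n)) (D mu)" using N(4)[of ?n] N(2) by simp
      show "has_filtration S D (M(|carrier := N ?n|)) ls" unfolding has_filtration_def
      proof (intro exI[of _ N] conjI allI impI)
        show "sbm S (M(|carrier := N ?n|)) (N i)" if "i <= ?n" for i
          unfolding submod_of_submod[OF M.left_module_axioms U] using N(3)[of i] le that by simp
        show "N i <= N (Suc i)" if "i < ?n" for i using N(4)[of i] that by simp
        show "module_iso S (quot_module (M(|carrier := N ?n, carrier := N (Suc i)|)) (N i)) (D (ls ! i))" if "i < ?n" for i
          using N(4)[of i] that by (simp add: nth_append quot_module_def A_RCOSETS_def' a_r_coset_def' set_add_def')
      qed (simp_all add: N(1))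
    qed
  }
  {
    assume "EX U. sbm S M U & has_filtration S D (M(|carrier := U|)) ls & module_iso S (quot_module M U) (D mu)"
    then obtain U N where U: "sbm S M U" "module_iso S (quot_module M U) (D mu)" and N: "N 0 = {0[M]}" "N ?n = U"
      "!!i. i <= ?n ==> sbm S (M(|carrier := U|)) (N i)"
      "!!i. i < ?n ==> N i <= N (Suc i) & module_iso S (quot_module (M(|carrier := U, carrier := N (Suc i)|)) (N i)) (D (ls ! i))"
      unfolding has_filtration_def by auto
    define N' where "N' i = (if i <= ?n then N i else car M)" for i
    have s: "sbm S M (N i)" if "i <= ?n" for i using N(3)[OF that] unfolding submod_of_submod[OF M.left_module_axioms U(1)] by blast
    show "has_filtration S D M (ls @ [mu])" unfolding has_filtration_def
    proof (intro exI[of _ N'] conjI allI impI)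
      show "sbm S M (N' i)" if "i <= length (ls @ [mu])" for i using s M.submod_carrier by (simp add: N'_def)
      show "N' i <= N' (Suc i)" if "i < length (ls @ [mu])" for i
        using that N(4)[of i] M.submodD(1)[OF s[of i]] by (auto simp: N'_def)
      show "module_iso S (quot_module (M(|carrier := N' (Suc i)|)) (N' i)) (D ((ls @ [mu]) ! i))" if "i < length (ls @ [mu])" for i
      proof (cases "i < ?n")
        case True
        thus ?thesis using N(4)[of i] by (simp add: N'_def nth_append quot_module_def A_RCOSETS_def' a_r_coset_def' set_add_def')
      next
        case False
        hence "i = ?n" using that by simp
        thus ?thesis using U(2) N(2) by (simp add: N'_def)
      qed
    qed (simp_all add: N'_def N)
  }
qed

text \<open>Links chains of submodules with iterated extensions by removing the top section. From an
  abstract extension the submodule is recovered as the kernel of the map to the top section.\<close>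

lemma has_filtration_LF:
  "Ob M ==> (!!mu. mu : set ls ==> Ob (D mu)) ==> has_filtration S D M ls <-> LF (%mu. um (D mu)) (um M) ls"
proof (induction ls arbitrary: M rule: rev_induct)
  case Nil
  have "LF (%mu. um (D mu)) (um M) [] <-> zmod (um M)" by (auto intro: LF.LF_nil elim: LF.cases)
  also have "... <-> car M = {0[M]}" using um(1)[OF Nil(1)] zero_um[OF Nil(1)] by simp
  finally show ?case using has_filtration_Nil[OF Nil(1)] by simp
next
  case (snoc mu ls)
  interpret M: left_module S M by (rule ObD[OF snoc.prems(1)])
  have IH: "has_filtration S D N ls <-> LF (%mu. um (D mu)) (um N) ls" if "Ob N" for N :: "('a, 'b) module"
    using snoc.IH[OF that] snoc.prems(2) by simp
  have D: "Ob (D mu)" using snoc.prems(2) by simp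
  note M = snoc.prems(1)
  show ?case unfolding has_filtration_snoc[OF M]
  proof
    assume "EX U. sbm S M U & has_filtration S D (M(|carrier := U|)) ls & module_iso S (quot_module M U) (D mu)"
    then obtain U where U: "sbm S M U" "has_filtration S D (M(|carrier := U|)) ls" "module_iso S (quot_module M U) (D mu)" by blast
    show "LF (%mu. um (D mu)) (um M) (ls @ [mu])"
    proof (rule LF_snoc)
      show "Ses (um (M(|carrier := U|))) (um M) (um (quot_module M U))" by (rule ses_um_sub[OF M U(1)])
      show "LF (%mu. um (D mu)) (um (M(|carrier := U|))) ls" using U(2) IH[OF Ob_sub[OF M U(1)]] by blast
      show "module_iso S (um (quot_module M U)) (um (D mu))" by (rule um_cong_iso[OF Ob_quot[OF M U(1)] D U(3)])
    qed
  next
    assume "LF (%mu. um (D mu)) (um M) (ls @ [mu])"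
    then obtain X Z where XZ: "Ses X (um M) Z" "LF (%mu. um (D mu)) X ls" "module_iso S Z (um (D mu))" by (auto elim: LF.cases)
    then obtain f g where s: "ses X f (um M) g Z" unfolding Ses_def by blast
    note d = sesD[OF s]
    define h where "h x = g (uemb M x)" for x
    have h: "h : lhom S M Z" unfolding h_def by (rule lhom_comp[OF um(2)[OF M] d(5)])
    interpret h: lhom_loc S M Z h by (rule lhom_locI[OF M.left_module_axioms ObD(1)[OF d(3)] h])
    define U where "U = {x : car M. h x = 0[Z]}"
    have U: "sbm S M U" unfolding U_def by (rule h.submod_kernel)
    have hs: "h ` car M = car Z"
    proof (intro equalityI subsetI)
      fix z assume "z : car Z"
      then obtain y where "y : car (um M)" "g y = z" using d(10) by blast
      thus "z : h ` car M" using uinv_closed[OF M] uinv(3)[OF M] by (intro image_eqI[of _ _ "uinv M y"]) (simp_all add: h_def)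
    qed auto
    note q = quot_left_module[OF M.left_module_axioms U]
    have Uh: "x : U <-> h x = 0[Z]" if "x : car M" for x using that by (simp add: U_def)
    have "module_iso S (quot_module M U) Z"
      by (rule quot_iso_of_kernels[OF M.left_module_axioms q(1) ObD(1)[OF d(3)] q(2,3) h hs]) (simp add: q(4) Uh)
    hence 1: "module_iso S (quot_module M U) (D mu)" by (rule module_iso_trans[OF _ module_iso_trans[OF XZ(3) um_iso(2)[OF D]]])
    have "module_iso S X (M(|carrier := U|))"
    proof -
      define k where "k x = uinv M (f x)" for x
      have "k : lhom S X M" unfolding k_def by (rule lhom_comp[OF d(4) uinv(1)[OF M]])
      have e: "uemb M (k x) = f x" if "x : car X" for x
        unfolding k_def by (rule uinv(3)[OF M lhom_closed[OF d(4) that]])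
      hence kU: "k x : U" if "x : car X" for x
        using lhom_closed[OF `k : _`] d(8) that by (simp add: U_def h_def)
      have "k : lhom S X (M(|carrier := U|))"
        by (rule left_homI) (use kU lhom_add[OF `k : _`] lhom_smult[OF `k : _`] in auto)
      moreover have "inj_on k (car X)" using e d(6) unfolding inj_on_def by metis
      moreover have "u : k ` car X" if "u : U" for u
      proof -
        have u: "u : car M" "g (uemb M u) = 0[Z]" using that by (simp_all add: U_def h_def)
        then obtain x where "x : car X" "f x = uemb M u" using d(9) uemb_closed[OF M] by blast
        thus ?thesis using uinv(2)[OF M u(1)] by (intro image_eqI[of _ _ x]) (simp_all add: k_def)
      qed
      ultimately show ?thesis unfolding module_iso_def bij_betw_def using kU by (intro bexI[of _ k]) auto
    qed
    hence "module_iso S X (um (M(|carrier := U|)))" by (rule module_iso_trans[OF _ um_iso(1)[OF Ob_sub[OF M U]]])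
    hence "has_filtration S D (M(|carrier := U|)) ls"
      unfolding IH[OF Ob_sub[OF M U]] by (rule LF_iso[OF XZ(2) um(1)[OF Ob_sub[OF M U]]])
    with U 1 show "EX U. sbm S M U & has_filtration S D (M(|carrier := U|)) ls & module_iso S (quot_module M U) (D mu)" by blast
  qed
qed

lemma filtered_Filt:
  assumes "!!mu. mu : La ==> Ob (D mu)" "Ob M"
  shows "filtered K S La D M <-> Filt (cls (%mu. um (D mu)) La) (um M)"
proof -
  have *: "has_filtration S D M ls <-> LF (%mu. um (D mu)) (um M) ls" if "set ls <= La" for ls
    using has_filtration_LF[OF assms(2), of ls D] assms(1) that by blast
  show ?thesis unfolding filtered_def using assms(2) * LF_Filt Filt_LF by metis
qed

lemma filtered_Filt_u:
  fixes M :: "('k, 'a) umodule"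
  assumes "!!mu. mu : La ==> Ob (D mu)"
  shows "filtered K S La D M <-> Filt (cls (%mu. um (D mu)) La) M"
proof (cases "Ob M")
  case True
  have "Filt C (um M) <-> Filt C M" for C
    using Filt_iso[OF _ True um_iso(2)[OF True]] Filt_iso[OF _ um(1)[OF True] um_iso(1)[OF True]] by blast
  thus ?thesis using filtered_Filt[OF assms True] by simp
next
  case False
  thus ?thesis using Filt_Ob unfolding filtered_def by blast
qed

end

section \<open>Resolutions as infinite complexes versus iterated syzygy sequences\<close>

context fdalg
begin

lemma has_resolution_iso:
  assumes O: "left_module S X" "left_module S Y" and h: "h : lhom S X Y" "bij_betw h (car X) (car Y)" and r: "has_resolution S C X d"
  shows "has_resolution S C Y d"
proof -
  interpret h: lhom_loc S X Y h by (rule lhom_locI[OF O h(1)])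
  have h0: "h x = 0[Y] <-> x = 0[X]" if "x : car X" for x using h(2) h.inj_iff h.zero that by (auto simp: bij_betw_def)
  obtain N eps delta where r: "ALL i. left_module S (N i)" "ALL i<=d. C (N i)" "ALL i>d. car (N i) = {0[N i]}"
    "eps : lhom S (N 0) X" "ALL i. delta i : lhom S (N (Suc i)) (N i)" "eps ` car (N 0) = car X" "delta 0 ` car (N 1) = a_kernel (N 0) X eps"
    "ALL i. delta (Suc i) ` car (N (Suc (Suc i))) = a_kernel (N (Suc i)) (N i) (delta i)"
    using r unfolding has_resolution_def by metis
  have "a_kernel (N 0) Y (%x. h (eps x)) = a_kernel (N 0) X eps"
    unfolding a_kernel_def' using h0 lhom_closed[OF r(4)] by blast
  moreover have "(%x. h (eps x)) ` car (N 0) = car Y" using r(6) h(2) unfolding image_image[symmetric] by (simp add: bij_betw_def)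
  ultimately show ?thesis unfolding has_resolution_def
    by (intro exI[of _ N] exI[of _ "%x. h (eps x)"] exI[of _ delta]) (use r lhom_comp[OF r(4) h(1)] in simp)
qed

lemma has_coresolution_iso:
  assumes O: "left_module S X" "left_module S Y" and h: "h : lhom S Y X" "bij_betw h (car Y) (car X)" and r: "has_coresolution S C X d"
  shows "has_coresolution S C Y d"
proof -
  obtain N eps delta where r: "ALL i. left_module S (N i)" "ALL i<=d. C (N i)" "ALL i>d. car (N i) = {0[N i]}"
    "eps : lhom S X (N 0)" "ALL i. delta i : lhom S (N i) (N (Suc i))" "inj_on eps (car X)" "eps ` car X = a_kernel (N 0) (N 1) (delta 0)"
    "ALL i. delta i ` car (N i) = a_kernel (N (Suc i)) (N (Suc (Suc i))) (delta (Suc i))"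
    using r unfolding has_coresolution_def by metis
  have im: "h ` car Y = car X" and inj: "inj_on h (car Y)" using h(2) by (simp_all add: bij_betw_def)
  have "(%x. eps (h x)) ` car Y = eps ` car X" unfolding im[symmetric] image_image ..
  moreover have "inj_on (%x. eps (h x)) (car Y)" using comp_inj_on[OF inj, of eps] r(6) im by (simp add: comp_def)
  ultimately show ?thesis unfolding has_coresolution_def
    by (intro exI[of _ N] exI[of _ "%x. eps (h x)"] exI[of _ delta]) (use r lhom_comp[OF h(1) r(4)] in simp)
qed

text \<open>Induction on \<open>d\<close>, cutting the complex at its first syzygy or splicing one
  term on.\<close>

lemma has_resolution_u:
  fixes X :: "('k, 'a) umodule"
  assumes C: "iclass C"
  shows "Ob X ==> has_resolution S C X d <-> Rs C d X"
proof (induction d arbitrary: X)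
  case 0
  obtain Z where Z: "zmod Z" using zmod_ex by blast
  interpret X: left_module S X by (rule ObD[OF 0])
  interpret Z: left_module S Z by (rule ObD(1)) (use Z in blast)
  show ?case
  proof
    assume "has_resolution S C X 0"
    then obtain N eps delta where r': "ALL i. left_module S (N i)" "ALL i<=0. C (N i)" "ALL i>0. car (N i) = {0[N i]}"
      "eps : lhom S (N 0) X" "ALL i. delta i : lhom S (N (Suc i)) (N i)" "eps ` car (N 0) = car X" "delta 0 ` car (N 1) = a_kernel (N 0) X eps"
      unfolding has_resolution_def by metis
    note r = r'(1) r'(2)[rule_format, of 0, simplified] r'(3)[rule_format, of 1, simplified] r'(4) r'(5)[rule_format, of 0, folded One_nat_def] r'(6,7)
    interpret e: lhom_loc S "N 0" X eps by (rule lhom_locI) (use r X.left_module_axioms in auto)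
    interpret d: lhom_loc S "N 1" "N 0" "delta 0" by (rule lhom_locI) (use r in auto)
    have "a_kernel (N 0) X eps = {0[N 0]}" using r(7) r(3) d.zero by simp
    hence "inj_on eps (car (N 0))" unfolding e.inj_iff a_kernel_def' by blast
    hence "module_iso S (N 0) X" using r(4,6) unfolding module_iso_def bij_betw_def by blast
    thus "Rs C 0 X" using iclassD(2)[OF C r(2) 0] by simp
  next
    assume "Rs C 0 X"
    hence "C X" by simp
    \<comment> \<open>The definition asks for modules in all degrees, so the single term is
      continued by zero modules.\<close>
    define N where "N i = (if i = 0 then X else Z)" for i :: nat
    have N: "left_module S (N i)" for i using X.left_module_axioms Z.left_module_axioms by (simp add: N_def)
    show "has_resolution S C X 0" unfolding has_resolution_def
      by (intro exI[of _ N] exI[of _ "%x. x"] exI[of _ "%i x. 0[N i]"] conjI allI N lhom_zero[OF N])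
        (use `C X` Z in "auto simp: N_def a_kernel_def' lhom_id")
  qed
next
  case (Suc d)
  interpret X: left_module S X by (rule ObD[OF Suc.prems])
  show ?case
  proof
    assume "has_resolution S C X (Suc d)"
    then obtain N eps delta where r: "ALL i. left_module S (N i)" "ALL i<=Suc d. C (N i)" "ALL i>Suc d. car (N i) = {0[N i]}"
      "eps : lhom S (N 0) X" "ALL i. delta i : lhom S (N (Suc i)) (N i)" "eps ` car (N 0) = car X" "delta 0 ` car (N 1) = a_kernel (N 0) X eps"
      "ALL i. delta (Suc i) ` car (N (Suc (Suc i))) = a_kernel (N (Suc i)) (N i) (delta i)"
      unfolding has_resolution_def by metis
    have C0: "C (N 0)" "Ob (N 0)" using r(2) iclassD(1)[OF C] by auto
    let ?Y = "(N 0)(|carrier := {y : car (N 0). eps y = 0[X]}|)"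
    note s = ses_ker[OF C0(2) Suc.prems r(4,6)]
    have cY: "car ?Y = delta 0 ` car (N 1)" unfolding r(7) a_kernel_def' by simp
    have d0: "delta 0 : lhom S (N 1) ?Y"
      by (rule left_homI) (use cY r(5)[rule_format, of 0] lhom_add[OF r(5)[rule_format, of 0]] lhom_smult[OF r(5)[rule_format, of 0]] in auto)
    have "has_resolution S C ?Y d" unfolding has_resolution_def
    proof (intro exI[of _ "%i. N (Suc i)"] exI[of _ "delta 0"] exI[of _ "%i. delta (Suc i)"] conjI allI impI)
      show "delta 0 : lhom S (N (Suc 0)) ?Y" using d0 by simp
      show "delta 0 ` car (N (Suc 0)) = car ?Y" using cY by simp
      show "delta (Suc 0) ` car (N (Suc 1)) = a_kernel (N (Suc 0)) ?Y (delta 0)"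
        using r(8)[rule_format, of 0] by (simp add: a_kernel_def')
    qed (use r in simp_all)
    hence "Rs C d ?Y" using Suc.IH[OF sesD(1)[OF s]] by blast
    thus "Rs C (Suc d) X" using SesI[OF s] C0(1) by auto
  next
    assume "Rs C (Suc d) X"
    then obtain Y M where Y: "Ses Y M X" "C M" "Rs C d Y" by auto
    obtain f g where s: "ses Y f M g X" using Y(1) unfolding Ses_def by blast
    note D = sesD[OF s]
    interpret f: lhom_loc S Y M f by (rule D)
    have "has_resolution S C Y d" using Suc.IH[OF D(1)] Y(3) by blast
    then obtain N eps delta where r: "ALL i. left_module S (N i)" "ALL i<=d. C (N i)" "ALL i>d. car (N i) = {0[N i]}"
      "eps : lhom S (N 0) Y" "ALL i. delta i : lhom S (N (Suc i)) (N i)" "eps ` car (N 0) = car Y" "delta 0 ` car (N 1) = a_kernel (N 0) Y eps"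
      "ALL i. delta (Suc i) ` car (N (Suc (Suc i))) = a_kernel (N (Suc i)) (N i) (delta i)"
      unfolding has_resolution_def by metis
    have f0: "f x = 0[M] <-> x = 0[Y]" if "x : car Y" for x using D(6) f.inj_iff f.zero that by blast
    have k: "a_kernel (N 0) M (%x. f (eps x)) = a_kernel (N 0) Y eps" unfolding a_kernel_def' using f0 lhom_closed[OF r(4)] by blast
    have im: "(%x. f (eps x)) ` car (N 0) = a_kernel M X g"
      unfolding image_image[symmetric] r(6) a_kernel_def' using D(8,9) f.closed by blast
    \<comment> \<open>The resolution of the syzygy moves up by one degree; the new differential in
      degree 0 is its augmentation followed by the embedding into \<open>M\<close>.\<close>
    let ?N = "case_nat M N" and ?d = "case_nat (%x. f (eps x)) delta"
    show "has_resolution S C X (Suc d)" unfolding has_resolution_def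
    proof (intro exI[of _ ?N] exI[of _ g] exI[of _ ?d] conjI allI impI)
      show "left_module S (?N i)" for i using r(1) D(12) by (cases i) auto
      show "C (?N i)" if "i <= Suc d" for i using r(2) Y(2) that by (cases i) auto
      show "car (?N i) = {0[?N i]}" if "i > Suc d" for i using r(3) that by (cases i) auto
      show "?d i : lhom S (?N (Suc i)) (?N i)" for i using r(5) lhom_comp[OF r(4) D(4)] by (cases i) auto
      show "?d (Suc i) ` car (?N (Suc (Suc i))) = a_kernel (?N (Suc i)) (?N i) (?d i)" for i using r(7,8) k by (cases i) auto
    qed (use D im in auto)
  qed
qed

lemma has_coresolution_u:
  fixes X :: "('k, 'a) umodule"
  assumes C: "iclass C"
  shows "Ob X ==> has_coresolution S C X d <-> cRs C d X"
proof (induction d arbitrary: X)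
  case 0
  obtain Z where Z: "zmod Z" using zmod_ex by blast
  interpret X: left_module S X by (rule ObD[OF 0])
  interpret Z: left_module S Z by (rule ObD(1)) (use Z in blast)
  show ?case
  proof
    assume "has_coresolution S C X 0"
    then obtain N eps delta where r': "ALL i. left_module S (N i)" "ALL i<=0. C (N i)" "ALL i>0. car (N i) = {0[N i]}"
      "eps : lhom S X (N 0)" "ALL i. delta i : lhom S (N i) (N (Suc i))" "inj_on eps (car X)" "eps ` car X = a_kernel (N 0) (N 1) (delta 0)"
      unfolding has_coresolution_def by metis
    note r = r'(1) r'(2)[rule_format, of 0, simplified] r'(3)[rule_format, of 1, simplified] r'(4) r'(5)[rule_format, of 0, folded One_nat_def] r'(6,7)
    have "a_kernel (N 0) (N 1) (delta 0) = car (N 0)" unfolding a_kernel_def' using lhom_closed[OF r(5)] r(3) by auto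
    hence "module_iso S X (N 0)" using r(4,6,7) unfolding module_iso_def bij_betw_def by auto
    hence "module_iso S (N 0) X" using module_iso_sym[OF X.left_module_axioms] r(1) by blast
    thus "cRs C 0 X" using iclassD(2)[OF C r(2) 0] by simp
  next
    assume "cRs C 0 X"
    hence "C X" by simp
    define N where "N i = (if i = 0 then X else Z)" for i :: nat
    have N: "left_module S (N i)" for i using X.left_module_axioms Z.left_module_axioms by (simp add: N_def)
    show "has_coresolution S C X 0" unfolding has_coresolution_def
      by (intro exI[of _ N] exI[of _ "%x. x"] exI[of _ "%i x. 0[N (Suc i)]"] conjI allI N lhom_zero[OF N])
        (use `C X` Z in "auto simp: N_def a_kernel_def' lhom_id")
  qed
next
  case (Suc d)
  interpret X: left_module S X by (rule ObD[OF Suc.prems])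
  show ?case
  proof
    assume "has_coresolution S C X (Suc d)"
    then obtain N eps delta where r: "ALL i. left_module S (N i)" "ALL i<=Suc d. C (N i)" "ALL i>Suc d. car (N i) = {0[N i]}"
      "eps : lhom S X (N 0)" "ALL i. delta i : lhom S (N i) (N (Suc i))" "inj_on eps (car X)" "eps ` car X = a_kernel (N 0) (N 1) (delta 0)"
      "ALL i. delta i ` car (N i) = a_kernel (N (Suc i)) (N (Suc (Suc i))) (delta (Suc i))"
      unfolding has_coresolution_def by metis
    have C0: "C (N 0)" "Ob (N 0)" "Ob (N 1)" using r(2) iclassD(1)[OF C] by auto
    have d0: "delta 0 : lhom S (N 0) (N 1)" using r(5)[rule_format, of 0] by simp
    let ?Y = "(N 1)(|carrier := delta 0 ` car (N 0)|)"
    note W = img_factor[OF C0(2,3) d0]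
    have k: "EX x:car X. eps x = y" if "y : car (N 0)" "delta 0 y = 0[N 1]" for y
    proof -
      have "y : eps ` car X" unfolding r(7) a_kernel_def' using that by simp
      thus ?thesis by blast
    qed
    have s: "ses X eps (N 0) (delta 0) ?Y" unfolding ses_def
      using Suc.prems C0 W r(4,6) r(7) k unfolding a_kernel_def' by auto
    have "has_coresolution S C ?Y d" unfolding has_coresolution_def
    proof (intro exI[of _ "%i. N (Suc i)"] exI[of _ "%x. x"] exI[of _ "%i. delta (Suc i)"] conjI allI impI)
      show "(%x. x) : lhom S ?Y (N (Suc 0))" using W(3) by simp
      show "(%x. x) ` car ?Y = a_kernel (N (Suc 0)) (N (Suc 1)) (delta (Suc 0))" using r(8)[rule_format, of 0] by simp
    qed (use r in simp_all)
    hence "cRs C d ?Y" using Suc.IH[OF W(1)] by blast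
    thus "cRs C (Suc d) X" using SesI[OF s] C0(1) by auto
  next
    assume "cRs C (Suc d) X"
    then obtain M Y where Y: "Ses X M Y" "C M" "cRs C d Y" by auto
    obtain f g where s: "ses X f M g Y" using Y(1) unfolding Ses_def by blast
    note D = sesD[OF s]
    have "has_coresolution S C Y d" using Suc.IH[OF D(3)] Y(3) by blast
    then obtain N eps delta where r: "ALL i. left_module S (N i)" "ALL i<=d. C (N i)" "ALL i>d. car (N i) = {0[N i]}"
      "eps : lhom S Y (N 0)" "ALL i. delta i : lhom S (N i) (N (Suc i))" "inj_on eps (car Y)" "eps ` car Y = a_kernel (N 0) (N 1) (delta 0)"
      "ALL i. delta i ` car (N i) = a_kernel (N (Suc i)) (N (Suc (Suc i))) (delta (Suc i))"
      unfolding has_coresolution_def by metis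
    interpret e: lhom_loc S Y "N 0" eps by (rule lhom_locI[OF D(13) r(1)[rule_format] r(4)])
    have e0: "eps x = 0[N 0] <-> x = 0[Y]" if "x : car Y" for x using r(6) e.inj_iff e.zero that by blast
    have "a_kernel M (N 0) (%x. eps (g x)) = a_kernel M Y g" unfolding a_kernel_def' using e0 lhom_closed[OF D(5)] by blast
    also have "... = f ` car X" unfolding a_kernel_def' using D(8,9) lhom_closed[OF D(4)] by blast
    finally have k: "a_kernel M (N 0) (%x. eps (g x)) = f ` car X" .
    have im: "(%x. eps (g x)) ` car M = a_kernel (N 0) (N 1) (delta 0)" unfolding image_image[symmetric] D(7) by (rule r(7))
    let ?N = "case_nat M N" and ?d = "case_nat (%x. eps (g x)) delta"
    show "has_coresolution S C X (Suc d)" unfolding has_coresolution_def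
    proof (intro exI[of _ ?N] exI[of _ f] exI[of _ ?d] conjI allI impI)
      show "left_module S (?N i)" for i using r(1) D(12) by (cases i) auto
      show "C (?N i)" if "i <= Suc d" for i using r(2) Y(2) that by (cases i) auto
      show "car (?N i) = {0[?N i]}" if "i > Suc d" for i using r(3) that by (cases i) auto
      show "?d i : lhom S (?N i) (?N (Suc i))" for i using r(5) lhom_comp[OF D(5) r(4)] by (cases i) auto
      show "?d i ` car (?N i) = a_kernel (?N (Suc i)) (?N (Suc (Suc i))) (?d (Suc i))" for i using im r(8) by (cases i) auto
    qed (use D k in auto)
  qed
qed

text \<open>As an infimum over the set of possible lengths, the dimension is determined by that set;
  agreement for each \<open>d\<close> therefore settles the infinite case too.\<close>

lemma resolution_dim_Rs:
  assumes C: "iclass C" and X: "Ob X"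
  shows "resolution_dim S C X = (INF d \<in> {d. Rs C d (um X)}. enat d)"
    "coresolution_dim S C X = (INF d \<in> {d. cRs C d (um X)}. enat d)"
proof -
  note m = ObD(1)[OF X] ObD(1)[OF um(1)[OF X]]
  obtain g where g: "g : lhom S (um X) X" "bij_betw g (car (um X)) (car X)" using um_iso(2)[OF X] unfolding module_iso_def by blast
  have *: "has_resolution S C X d <-> Rs C d (um X)" for d
    using has_resolution_iso[OF m um(2,3)[OF X], of C d] has_resolution_iso[OF m(2,1) g, of C d] has_resolution_u[OF C um(1)[OF X]] by blast
  show "resolution_dim S C X = (INF d \<in> {d. Rs C d (um X)}. enat d)" unfolding resolution_dim_def * by (rule refl)
  have *: "has_coresolution S C X d <-> cRs C d (um X)" for d
    using has_coresolution_iso[OF m g, of C d] has_coresolution_iso[OF m(2,1) um(2,3)[OF X], of C d] has_coresolution_u[OF C um(1)[OF X]] by blast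
  show "coresolution_dim S C X = (INF d \<in> {d. cRs C d (um X)}. enat d)" unfolding coresolution_dim_def * by (rule refl)
qed

end

section \<open>Labelled simple modules\<close>

context fdalg
begin

lemma projective_um:
  assumes "Proj K S P" shows "Proj K S (um P)"
  unfolding projective_module_def
proof (intro conjI allI impI, goal_cases)
  have P: "Ob P" using assms by (simp add: projective_module_def)
  case 1 show ?case by (rule um(1)[OF P])
  case (2 M N g h)
  hence "(%x. h (uemb P x)) : lhom S P N" using lhom_comp[OF um(2)[OF P]] by blast
  then obtain k where k: "k : lhom S P M" "ALL x:car P. g (k x) = h (uemb P x)" using projective_lift[OF assms] 2 by metis
  show ?case
    by (rule bexI[OF _ lhom_comp[OF uinv(1)[OF P] k(1)]]) (use k(2) uinv(3)[OF P] uinv_closed[OF P] in simp)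
qed

lemma injective_um:
  assumes "Inj K S I" shows "Inj K S (um I)"
  unfolding injective_module_def
proof (intro conjI allI impI, goal_cases)
  have I: "Ob I" using assms by (simp add: injective_module_def)
  case 1 show ?case by (rule um(1)[OF I])
  case (2 M N g h)
  hence h: "h : lhom S M (um I)" by blast
  hence "(%x. uinv I (h x)) : lhom S M I" using lhom_comp[OF _ uinv(1)[OF I]] by blast
  then obtain k where k: "k : lhom S N I" "ALL x:car M. k (g x) = uinv I (h x)" using injective_extend[OF assms] 2 by metis
  show ?case
    by (rule bexI[OF _ lhom_comp[OF k(1) um(2)[OF I]]]) (use k(2) uinv(3)[OF I] lhom_closed[OF h] in simp)
qed

lemma simple_um:
  assumes M: "Ob M" "simple_module S M" and V: "sbm S (um M) V"
  shows "V = {0[um M]} | V = car (um M)"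
proof -
  interpret u: lhom_loc S M "um M" "uemb M" by (rule lhom_locI[OF ObD(1)[OF M(1)] ObD(1)[OF um(1)[OF M(1)]] um(2)[OF M(1)]])
  have e: "V = uemb M ` {x : car M. uemb M x : V}"
  proof (intro equalityI subsetI)
    fix v assume v: "v : V"
    hence "v : car (um M)" using u.Y.submodD(1)[OF V] by blast
    thus "v : uemb M ` {x : car M. uemb M x : V}"
      using uinv(3)[OF M(1)] uinv_closed[OF M(1)] v by (intro image_eqI[of _ _ "uinv M v"]) auto
  qed auto
  have "{x : car M. uemb M x : V} = {0[M]} | {x : car M. uemb M x : V} = car M"
    using M(2) u.submod_preimage[OF V] unfolding simple_module_def by blast
  thus ?thesis
  proof
    assume "{x : car M. uemb M x : V} = {0[M]}" from e[unfolded this] show ?thesis by simp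
  next
    assume "{x : car M. uemb M x : V} = car M" from e[unfolded this] show ?thesis using um(3)[OF M(1)] by (simp add: bij_betw_def)
  qed
qed

lemma simple_hom:
  fixes X :: "('k, 'a) umodule"
  assumes M: "Ob M" "simple_module S M" and X: "Ob X"
  shows "f : lhom S X (um M) ==> EX x:car X. f x ~= 0[um M] ==> f ` car X = car (um M)"
    "h : lhom S (um M) X ==> EX x:car (um M). h x ~= 0[X] ==> inj_on h (car (um M))"
proof -
  assume f: "f : lhom S X (um M)" "EX x:car X. f x ~= 0[um M]"
  interpret f: lhom_loc S X "um M" f by (rule hom_loc[OF X um(1)[OF M(1)] f(1)])
  show "f ` car X = car (um M)" using simple_um[OF M f.submod_image[OF f.X.submod_carrier]] f(2) by blast
next
  assume h: "h : lhom S (um M) X" "EX x:car (um M). h x ~= 0[X]"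
  interpret h: lhom_loc S "um M" X h by (rule hom_loc[OF um(1)[OF M(1)] X h(1)])
  show "inj_on h (car (um M))" unfolding h.inj_iff using simple_um[OF M h.submod_kernel] h(2) by blast
qed

end

locale labelled = fdalg K S for K :: "'k ring" and S :: "('k, 'a) module" +
  fixes La :: "'l set" and L :: "'l => ('a, 'b) module" and P :: "'l => ('a, 'c) module" and I :: "'l => ('a, 'd) module"
  assumes finite: "finite La" and lab: "labelled_simples K S La L P I"
begin

lemma LO: "l : La ==> Ob (L l)" and L_simple: "l : La ==> simple_module S (L l)"
  and L_eq: "l : La ==> mu : La ==> module_iso S (L l) (L mu) ==> l = mu"
  and L_all: "Ob X ==> simple_module S X ==> EX l:La. module_iso S X (L l)" for X :: "('k, 'a) umodule"
  using lab unfolding labelled_simples_def by blast+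

definition pc :: "'l => 'c => 'b" where
  "pc l = (SOME f. f : lhom S (P l) (L l) & f ` car (P l) = car (L l) &
    (ALL U. sbm S (P l) U & U <+>\<^bsub>P l\<^esub> a_kernel (P l) (L l) f = car (P l) --> U = car (P l)))"

definition ic :: "'l => 'b => 'd" where
  "ic l = (SOME f. f : lhom S (L l) (I l) & inj_on f (car (L l)) &
    (ALL U. sbm S (I l) U & U Int f ` car (L l) = {0[I l]} --> U = {0[I l]}))"

lemma pc:
  assumes "l : La"
  shows "Proj K S (P l)" "pc l : lhom S (P l) (L l)" "pc l ` car (P l) = car (L l)"
    "!!U. sbm S (P l) U ==> U <+>\<^bsub>P l\<^esub> a_kernel (P l) (L l) (pc l) = car (P l) ==> U = car (P l)"
proof -
  have c: "projective_cover K S (P l) (L l)" using lab assms unfolding labelled_simples_def by blast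
  thus "Proj K S (P l)" unfolding projective_cover_def by blast
  have "EX f. f : lhom S (P l) (L l) & f ` car (P l) = car (L l) &
    (ALL U. sbm S (P l) U & U <+>\<^bsub>P l\<^esub> a_kernel (P l) (L l) f = car (P l) --> U = car (P l))"
    using c unfolding projective_cover_def by blast
  from someI_ex[OF this] show "pc l : lhom S (P l) (L l)" "pc l ` car (P l) = car (L l)"
    "!!U. sbm S (P l) U ==> U <+>\<^bsub>P l\<^esub> a_kernel (P l) (L l) (pc l) = car (P l) ==> U = car (P l)"
    unfolding pc_def[symmetric] by blast+
qed

lemma ic:
  assumes "l : La"
  shows "Inj K S (I l)" "ic l : lhom S (L l) (I l)" "inj_on (ic l) (car (L l))"
    "!!U. sbm S (I l) U ==> U Int ic l ` car (L l) = {0[I l]} ==> U = {0[I l]}"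
proof -
  have c: "injective_hull K S (I l) (L l)" using lab assms unfolding labelled_simples_def by blast
  thus "Inj K S (I l)" unfolding injective_hull_def by blast
  have "EX f. f : lhom S (L l) (I l) & inj_on f (car (L l)) &
    (ALL U. sbm S (I l) U & U Int f ` car (L l) = {0[I l]} --> U = {0[I l]})"
    using c unfolding injective_hull_def by blast
  from someI_ex[OF this] show "ic l : lhom S (L l) (I l)" "inj_on (ic l) (car (L l))"
    "!!U. sbm S (I l) U ==> U Int ic l ` car (L l) = {0[I l]} ==> U = {0[I l]}"
    unfolding ic_def[symmetric] by blast+
qed

lemma PO: "l : La ==> Ob (P l)" using pc(1) unfolding projective_module_def by blast
lemma IO: "l : La ==> Ob (I l)" using ic(1) unfolding injective_module_def by blast

definition up :: "'l => (nat => 'k) => nat => 'k" where "up l = umap (P l) (L l) (pc l)"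
definition ui :: "'l => (nat => 'k) => nat => 'k" where "ui l = umap (L l) (I l) (ic l)"

text \<open>Both claims are proved in one induction on the dimension: a module that is not simple
  has a proper nonzero submodule and quotient, which supply a simple submodule and a simple
  quotient.\<close>

lemma top_simple: "Ob X ==> car X ~= {0[X]} ==> EX l:La. ~ hz X (um (L l))"
  and soc_simple: "Ob X ==> car X ~= {0[X]} ==> EX l:La. ~ hz (um (L l)) X"
proof -
  have "(EX l:La. ~ hz X (um (L l))) & (EX l:La. ~ hz (um (L l)) X)" if "Ob X" "car X ~= {0[X]}"
    using that
  proof (induction "len X" arbitrary: X rule: less_induct)
    case less
    interpret X: left_module S X by (rule ObD[OF less.prems(1)])
    show ?case
    proof (cases "simple_module S X")
      case True
      obtain l where l: "l : La" "module_iso S X (L l)" using L_all[OF less.prems(1) True] by blast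
      have "module_iso S X (um (L l))" by (rule module_iso_trans[OF l(2) um_iso(1)[OF LO[OF l(1)]]])
      then obtain f where f: "f : lhom S X (um (L l))" "bij_betw f (car X) (car (um (L l)))" unfolding module_iso_def by blast
      obtain g where g: "g : lhom S (um (L l)) X" "ALL x:car X. g (f x) = x"
        using lhom_inverse_ex[OF X.left_module_axioms ObD(1)[OF um(1)[OF LO[OF l(1)]]] f] by blast
      interpret g: lhom_loc S "um (L l)" X g by (rule hom_loc[OF um(1)[OF LO[OF l(1)]] less.prems(1) g(1)])
      obtain x where x: "x : car X" "x ~= 0[X]" using less.prems(2) X.M.zero_closed by blast
      have "f x ~= 0[um (L l)]" using g(2) x g.zero by force
      hence "~ hz X (um (L l))" using f(1) x(1) unfolding hz_def by blast
      moreover have "~ hz (um (L l)) X" using g lhom_closed[OF f(1)] x unfolding hz_def by metis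
      ultimately show ?thesis using l(1) by blast
    next
      case False
      then obtain U where U: "sbm S X U" "U ~= {0[X]}" "U ~= car X"
        using less.prems(2) X.left_module_axioms unfolding simple_module_def nonzero_module_def by blast
      let ?U = "X(|carrier := U|)"
      have iU: "(%x. x) : lhom S ?U X" by (rule incl_left_hom[OF U(1) X.left_module_axioms])
      have UX: "U <= car X" by (rule X.submodD(1)[OF U(1)])
      obtain Q q where s: "ses ?U (%x. x) X q Q"
        by (rule ses_coker[OF Ob_sub[OF less.prems(1) U(1)] less.prems(1) iU]) (use that in "auto simp: inj_on_def")
      note d = sesD[OF s]
      interpret q: lhom_loc S X Q q by (rule d)
      have nU: "car ?U ~= {0[?U]}" using U(2) by simp
      have nQ: "car Q ~= {0[Q]}"
      proof
        assume "car Q = {0[Q]}"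
        hence "x : U" if "x : car X" for x using d(9)[OF that] q.closed[OF that] by auto
        thus False using U(3) UX by blast
      qed
      have pos: "len ?U > 0" "len Q > 0" using len_zero_iff[OF d(1)] len_zero_iff[OF d(3)] nU nQ by auto
      hence lt: "len ?U < len X" "len Q < len X" using len_ses[OF s] by auto
      obtain l mu where l: "l : La" "~ hz Q (um (L l))" and mu: "mu : La" "~ hz (um (L mu)) ?U"
        using less.hyps[OF lt(2) d(3) nQ] less.hyps[OF lt(1) d(1) nU] by blast
      have 1: "~ hz X (um (L l))" using hz_surj[OF _ d(5,7)] l(2) by blast
      obtain f x where f: "f : lhom S (um (L mu)) ?U" "x : car (um (L mu))" "f x ~= 0[?U]" using mu(2) unfolding hz_def by blast
      have "~ hz (um (L mu)) X" using lhom_comp[OF f(1) iU] f(2,3) unfolding hz_def by auto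
      with 1 show ?thesis using l(1) mu(1) by blast
    qed
  qed
  thus "Ob X ==> car X ~= {0[X]} ==> EX l:La. ~ hz X (um (L l))"
    "Ob X ==> car X ~= {0[X]} ==> EX l:La. ~ hz (um (L l)) X" by blast+
qed

lemma simp_data: "simp_data K S La (%l. um (L l)) (%l. um (P l)) (%l. um (I l)) up ui"
proof unfold_locales
  show "finite La" by (rule finite)
  fix l assume l: "l : La"
  note lo = LO[OF l] and po = PO[OF l] and io = IO[OF l] and ls = L_simple[OF l]
  interpret P: left_module S "P l" by (rule ObD[OF po])
  interpret I: left_module S "I l" by (rule ObD[OF io])
  interpret uL: left_module S "um (L l)" by (rule ObD[OF um(1)[OF lo]])
  interpret pc: lhom_loc S "P l" "L l" "pc l" by (rule lhom_locI[OF P.left_module_axioms ObD(1)[OF lo] pc(2)[OF l]])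
  interpret ic: lhom_loc S "L l" "I l" "ic l" by (rule lhom_locI[OF ObD(1)[OF lo] I.left_module_axioms ic(2)[OF l]])
  show "Ob (um (L l))" by (rule um(1)[OF lo])
  have "car (um (L l)) ~= {0[um (L l)]}" using ls zero_um[OF lo] unfolding simple_module_def nonzero_module_def by blast
  thus "EX x:car (um (L l)). x ~= 0[um (L l)]" using uL.M.zero_closed by blast
  show "f ` car X = car (um (L l))" if "Ob X" "f : lhom S X (um (L l))" "EX x:car X. f x ~= 0[um (L l)]" for X :: "('k, 'a) umodule" and f
    by (rule simple_hom(1)[OF lo ls that])
  show "inj_on f (car (um (L l)))" if "Ob X" "f : lhom S (um (L l)) X" "EX x:car (um (L l)). f x ~= 0[X]" for X :: "('k, 'a) umodule" and f
    by (rule simple_hom(2)[OF lo ls that])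
  show "Proj K S (um (P l))" by (rule projective_um[OF pc(1)[OF l]])
  show "Inj K S (um (I l))" by (rule injective_um[OF ic(1)[OF l]])
  show up: "up l : lhom S (um (P l)) (um (L l))" unfolding up_def by (rule umap[OF po lo pc(2)[OF l]])
  show ui: "ui l : lhom S (um (L l)) (um (I l))" unfolding ui_def by (rule umap[OF lo io ic(2)[OF l]])
  show "up l ` car (um (P l)) = car (um (L l))"
  proof (intro equalityI subsetI)
    fix z assume z: "z : car (um (L l))"
    have "uinv (L l) z : pc l ` car (P l)" unfolding pc(3)[OF l] by (rule uinv_closed[OF lo z])
    then obtain x where "x : car (P l)" "uinv (L l) z = pc l x" by blast
    thus "z : up l ` car (um (P l))" using uemb_closed[OF po] uinv(2)[OF po] uinv(3)[OF lo z]
      by (intro image_eqI[of _ _ "uemb (P l) x"]) (simp_all add: up_def umap_def)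
  qed (use lhom_closed[OF up] in auto)
  show "inj_on (ui l) (car (um (L l)))"
  proof -
    interpret ui: lhom_loc S "um (L l)" "um (I l)" "ui l" by (rule hom_loc[OF um(1)[OF lo] um(1)[OF io] ui])
    show ?thesis unfolding ui.inj_iff
    proof (intro ballI impI)
      fix x assume x: "x : car (um (L l))" "ui l x = 0[um (I l)]"
      hence "ic l (uinv (L l) x) = 0[I l]" using umap_zero[OF lo io ic(2)[OF l]] by (simp add: ui_def)
      hence "uinv (L l) x = 0[L l]" using ic(3)[OF l] ic.inj_iff uinv_closed[OF lo x(1)] by blast
      thus "x = 0[um (L l)]" using uemb_zero[OF lo uinv_closed[OF lo x(1)]] uinv(3)[OF lo x(1)] by simp
    qed
  qed
  show "f ` car X = car (um (P l))" if X: "Ob X" and f: "f : lhom S X (um (P l))" and s: "(%x. up l (f x)) ` car X = car (um (L l))" for X :: "('k, 'a) umodule" and f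
  proof -
    have h: "(%x. uinv (P l) (f x)) : lhom S X (P l)" by (rule lhom_comp[OF f uinv(1)[OF po]])
    interpret h: lhom_loc S X "P l" "%x. uinv (P l) (f x)" by (rule lhom_locI[OF ObD(1)[OF X] P.left_module_axioms h])
    define U where "U = (%x. uinv (P l) (f x)) ` car X"
    have U: "sbm S (P l) U" unfolding U_def by (rule h.submod_image[OF h.X.submod_carrier])
    note Us = P.submodD(1)[OF U]
    \<comment> \<open>Modulo the kernel of \<open>pc l\<close>, each element agrees with one of the
      image \<open>U\<close>, because \<open>U\<close> maps onto the simple module. Superfluity of
      the kernel then gives \<open>U = P l\<close>.\<close>
    have "U <+>\<^bsub>P l\<^esub> a_kernel (P l) (L l) (pc l) = car (P l)"
    proof (intro equalityI subsetI)
      fix y assume y: "y : car (P l)"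
      have "uemb (L l) (pc l y) : (%x. up l (f x)) ` car X" unfolding s by (rule uemb_closed[OF lo pc.closed[OF y]])
      then obtain x where x: "x : car X" "uemb (L l) (pc l y) = up l (f x)" by blast
      define u where "u = uinv (P l) (f x)"
      have u: "u : U" "u : car (P l)" using x(1) Us unfolding U_def u_def by blast+
      have "uemb (L l) (pc l y) = uemb (L l) (pc l u)" using x(2) by (simp add: up_def umap_def u_def)
      hence "pc l y = pc l u" using um(3)[OF lo] pc.closed y u(2) unfolding bij_betw_def inj_on_def by blast
      hence k: "y -[P l] u : a_kernel (P l) (L l) (pc l)" using y u(2) by (simp add: a_kernel_def')
      have "y = u +[P l] (y -[P l] u)" using P.minus_add_cancel[OF y u(2)] y u(2) by (simp add: P.M.a_comm)
      thus "y : U <+>\<^bsub>P l\<^esub> a_kernel (P l) (L l) (pc l)" using u(1) k unfolding set_add_def' by blast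
    next
      fix y assume "y : U <+>\<^bsub>P l\<^esub> a_kernel (P l) (L l) (pc l)"
      thus "y : car (P l)" using Us unfolding set_add_def' a_kernel_def' by blast
    qed
    from pc(4)[OF l U this] have UP: "U = car (P l)" .
    show ?thesis
    proof (intro equalityI subsetI)
      fix y assume y: "y : car (um (P l))"
      have "uinv (P l) y : U" unfolding UP by (rule uinv_closed[OF po y])
      then obtain x where x: "x : car X" "uinv (P l) y = uinv (P l) (f x)" unfolding U_def by blast
      have "y = f x" using arg_cong[OF x(2), of "uemb (P l)"] unfolding uinv(3)[OF po y] uinv(3)[OF po lhom_closed[OF f x(1)]] .
      thus "y : f ` car X" using x(1) by blast
    qed (use lhom_closed[OF f] in auto)
  qed
  show "inj_on f (car (um (I l)))" if X: "Ob X" and f: "f : lhom S (um (I l)) X" and s: "inj_on (%x. f (ui l x)) (car (um (L l)))" for X :: "('k, 'a) umodule" and f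
  proof -
    have h: "(%x. f (uemb (I l) x)) : lhom S (I l) X" by (rule lhom_comp[OF um(2)[OF io] f])
    interpret h: lhom_loc S "I l" X "%x. f (uemb (I l) x)" by (rule lhom_locI[OF I.left_module_axioms ObD(1)[OF X] h])
    interpret f: lhom_loc S "um (I l)" X f by (rule hom_loc[OF um(1)[OF io] X f])
    interpret fi: lhom_loc S "um (L l)" X "%x. f (ui l x)" by (rule hom_loc[OF um(1)[OF lo] X lhom_comp[OF ui f]])
    let ?U = "{x : car (I l). f (uemb (I l) x) = 0[X]}"
    have "?U Int ic l ` car (L l) = {0[I l]}"
    proof (intro equalityI subsetI)
      fix y assume "y : ?U Int ic l ` car (L l)"
      then obtain z where z: "z : car (L l)" "y = ic l z" "f (uemb (I l) (ic l z)) = 0[X]" by blast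
      have "f (ui l (uemb (L l) z)) = 0[X]" using z uinv(2)[OF lo z(1)] by (simp add: ui_def umap_def)
      hence "uemb (L l) z = 0[um (L l)]" using s fi.inj_iff uemb_closed[OF lo z(1)] by blast
      thus "y : {0[I l]}" using uemb_zero[OF lo z(1)] ic.zero z(2) by simp
    next
      fix y assume "y : {0[I l]}"
      thus "y : ?U Int ic l ` car (L l)" using h.zero ic.zero pc.Y.M.zero_closed by force
    qed
    from ic(4)[OF l h.submod_kernel this] have U: "?U = {0[I l]}" .
    show ?thesis unfolding f.inj_iff
    proof (intro ballI impI)
      fix y assume y: "y : car (um (I l))" "f y = 0[X]"
      have "uinv (I l) y : ?U" using y uinv(3)[OF io y(1)] uinv_closed[OF io y(1)] by simp
      hence "uinv (I l) y = 0[I l]" unfolding U by blast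
      thus "y = 0[um (I l)]" using uemb_zero[OF io uinv_closed[OF io y(1)]] uinv(3)[OF io y(1)] by simp
    qed
  qed
  fix mu assume mu: "mu : La" and "~ hz (um (L l)) (um (L mu))"
  then obtain f where f: "f : lhom S (um (L l)) (um (L mu))" "EX x:car (um (L l)). f x ~= 0[um (L mu)]" unfolding hz_def by blast
  note mo = LO[OF mu]
  have "module_iso S (um (L l)) (um (L mu))" unfolding module_iso_def bij_betw_def
    using f simple_hom(2)[OF lo ls um(1)[OF mo] f] simple_hom(1)[OF mo L_simple[OF mu] um(1)[OF lo] f] by blast
  hence "module_iso S (L l) (L mu)" by (rule module_iso_trans[OF um_iso(1)[OF lo] module_iso_trans[OF _ um_iso(2)[OF mo]]])
  thus "l = mu" by (rule L_eq[OF l mu])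
next
  show "Ob X ==> car X ~= {0[X]} ==> EX l:La. ~ hz X (um (L l))" for X by (rule top_simple)
  show "Ob X ==> car X ~= {0[X]} ==> EX l:La. ~ hz (um (L l)) X" for X by (rule soc_simple)
qed

sublocale simp_data K S La "%l. um (L l)" "%l. um (P l)" "%l. um (I l)" up ui by (rule simp_data)

end

section \<open>Composition factors, multiplicity one, and universal properties of standard
  modules\<close>

context labelled
begin

abbreviation uL :: "'l => ('k, 'a) umodule" where "uL == %l. um (L l)"

lemma cfI: "f : lhom S (um (P mu)) X ==> x : car (um (P mu)) ==> f x ~= 0[X] ==> cf X mu"
  unfolding cf_def hz_def by blast

text \<open>Makes the set of labels independent of the composition series: it is the set of
  \<open>mu\<close> with Hom(P(mu), X) nonzero.\<close>

lemma cf_LF: "LF uL X ls ==> set ls <= La ==> mu : La ==> cf X mu <-> mu : set ls"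
proof (induction rule: LF.induct)
  case (LF_nil X)
  thus ?case using cf_zmod[of X mu] by simp
next
  case (LF_snoc X Y Z ls l)
  have l: "l : La" using LF_snoc.prems by simp
  have "cf Z mu <-> cf (uL l) mu" by (rule cf_iso[OF LF_snoc.hyps(3) SesD(3)[OF LF_snoc.hyps(1)] L_Ob[OF l] LF_snoc.prems(2)])
  hence "cf Z mu <-> mu = l" using cf_L[OF l LF_snoc.prems(2)] cf_L_self[OF l] by blast
  thus ?case using cf_Ses[OF LF_snoc.hyps(1) LF_snoc.prems(2)] LF_snoc by auto
qed

lemma LF_ex: "Ob X ==> EX ls. set ls <= La & LF uL X ls"
proof (induction "len X" arbitrary: X rule: less_induct)
  case less
  show ?case
  proof (cases "car X = {0[X]}")
    case True
    thus ?thesis using LF.LF_nil less.prems by (intro exI[of _ "[]"]) auto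
  next
    case False
    then obtain l where l: "l : La" "~ hz X (uL l)" using top_ex[OF less.prems] by blast
    obtain X1 where s: "Ses X1 X (uL l)" using ses_top[OF less.prems l] .
    hence "len X1 < len X" using len_ses L_len[OF l(1)] unfolding Ses_def by fastforce
    then obtain ls where "set ls <= La" "LF uL X1 ls" using less.hyps SesD(1)[OF s] by blast
    thus ?thesis using LF_snoc[where D = uL and mu = l, OF s _ module_iso_refl] l(1) by (intro exI[of _ "ls @ [l]"]) auto
  qed
qed

lemma comp_LF: "Ob M ==> composition_labels S La L M ls <-> set ls <= La & LF uL (um M) ls"
  unfolding composition_labels_def using has_filtration_LF[of M ls L] LO by blast

lemma factors_below_iff: "Ob M ==> factors_below S La r L l M <-> (ALL mu:La. cf (um M) mu --> (mu, l) : r)"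
proof -
  assume M: "Ob M"
  obtain ls0 where ls0: "set ls0 <= La" "LF uL (um M) ls0" using LF_ex[OF um(1)[OF M]] by blast
  show ?thesis unfolding factors_below_def comp_LF[OF M]
  proof
    assume "EX ls. (set ls <= La & LF uL (um M) ls) & (ALL mu:set ls. (mu, l) : r)"
    then obtain ls where "set ls <= La" "LF uL (um M) ls" "ALL mu:set ls. (mu, l) : r" by blast
    thus "ALL mu:La. cf (um M) mu --> (mu, l) : r" using cf_LF[of "um M" ls] by blast
  next
    assume "ALL mu:La. cf (um M) mu --> (mu, l) : r"
    hence "ALL mu:set ls0. (mu, l) : r" using cf_LF[OF ls0(2,1)] ls0(1) by blast
    thus "EX ls. (set ls <= La & LF uL (um M) ls) & (ALL mu:set ls. (mu, l) : r)" using ls0 by blast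
  qed
qed

text \<open>Induction from the top of the series. If the top section is not \<open>L l\<close>, all
  maps from \<open>P l\<close> land in the part below; if it is, the part below admits no nonzero
  map from \<open>P l\<close>, and maps are determined by their image in the top section.\<close>

lemma mult1_LF: "LF uL Y ls ==> set ls <= La ==> l : La ==> count_list ls l = 1 ==> mult1 l Y"
proof (induction rule: LF.induct)
  case (LF_snoc X Y Z ls mu)
  note l = `l : La`
  have mu: "mu : La" "set ls <= La" using LF_snoc.prems by auto
  obtain i q where s: "ses X i Y q Z" using LF_snoc.hyps(1) unfolding Ses_def by blast
  note D = sesD[OF s] and po = P_Ob[OF l]
  interpret i: lhom_loc S X Y i by (rule D)
  have cZ: "cf Z l <-> cf (uL mu) l" by (rule cf_iso[OF LF_snoc.hyps(3) D(3) L_Ob[OF mu(1)] l])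
  have factor: "EX k:lhom S (um (P l)) X. ALL x:car (um (P l)). i (k x) = f x"
    if f: "f : lhom S (um (P l)) Y" and z: "ALL x:car (um (P l)). q (f x) = 0[Z]" for f
    by (rule hom_factor_mono[OF s po f z[rule_format]]) blast+
  show ?case unfolding mult1_def
  proof (intro ballI impI)
    fix f g assume f: "f : lhom S (um (P l)) Y" and g: "g : lhom S (um (P l)) Y" and nz: "EX x:car (um (P l)). f x ~= 0[Y]"
    show "EX e:lhom S (um (P l)) (um (P l)). ALL x:car (um (P l)). g x = f (e x)"
    proof (cases "mu = l")
      case False
      hence "~ cf Z l" using cZ cf_L[OF mu(1) l] by blast
      hence hzZ: "hz (um (P l)) Z" unfolding cf_def by blast
      have z: "ALL x:car (um (P l)). q (f x) = 0[Z]" if "f : lhom S (um (P l)) Y" for f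
        using hzD[OF hzZ lhom_comp[OF that D(5)]] by blast
      obtain f1 where f1: "f1 : lhom S (um (P l)) X" "ALL x:car (um (P l)). i (f1 x) = f x" using factor[OF f z[OF f]] by blast
      obtain g1 where g1: "g1 : lhom S (um (P l)) X" "ALL x:car (um (P l)). i (g1 x) = g x" using factor[OF g z[OF g]] by blast
      have "mult1 l X" using LF_snoc.IH[OF mu(2) l] LF_snoc.prems(3) False by simp
      moreover have "EX x:car (um (P l)). f1 x ~= 0[X]" using nz f1(2) i.zero by force
      ultimately obtain e where e: "e : lhom S (um (P l)) (um (P l))" "ALL x:car (um (P l)). g1 x = f1 (e x)"
        using mult1D[OF _ f1(1) g1(1)] by blast
      have "g x = f (e x)" if "x : car (um (P l))" for x
        using g1(2)[rule_format, OF that] f1(2)[rule_format, OF lhom_closed[OF e(1) that]] e(2)[rule_format, OF that] by simp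
      thus ?thesis using e(1) by blast
    next
      case True
      hence "l ~: set ls" using LF_snoc.prems(3) by (simp add: count_list_0_iff)
      hence "~ cf X l" using cf_LF[OF LF_snoc.hyps(2) mu(2) l] by blast
      hence hzX: "hz (um (P l)) X" unfolding cf_def by blast
      have vanish: "f x = 0[Y]" if f: "f : lhom S (um (P l)) Y" and z: "ALL x:car (um (P l)). q (f x) = 0[Z]"
        and x: "x : car (um (P l))" for f x
      proof -
        obtain k where k: "k : lhom S (um (P l)) X" "ALL x:car (um (P l)). i (k x) = f x" using factor[OF f z] by blast
        show ?thesis using k(2)[rule_format, OF x] hzD[OF hzX k(1) x] i.zero by simp
      qed
      have qf: "(%x. q (f x)) : lhom S (um (P l)) Z" and qg: "(%x. q (g x)) : lhom S (um (P l)) Z" using lhom_comp[OF _ D(5)] f g by blast+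
      obtain phi where phi: "phi : lhom S Z (uL mu)" "bij_betw phi (car Z) (car (uL mu))" using LF_snoc.hyps(3) unfolding module_iso_def by blast
      interpret phi: lhom_loc S Z "uL mu" phi by (rule hom_loc[OF D(3) L_Ob[OF mu(1)] phi(1)])
      obtain x0 where x0: "x0 : car (um (P l))" "q (f x0) ~= 0[Z]" using vanish[OF f] nz by blast
      have "phi (q (f x0)) ~= 0[uL mu]" using phi(2) phi.inj_iff lhom_closed[OF qf x0(1)] x0(2) unfolding bij_betw_def by blast
      hence im: "(%x. phi (q (f x))) ` car (um (P l)) = car (uL mu)"
        using L_surj[OF mu(1) po lhom_comp[OF qf phi(1)]] x0(1) by blast
      \<comment> \<open>The composite of \<open>f\<close> with the simple section is onto, so that
        of \<open>g\<close> lifts through it over the projective \<open>P l\<close>. Then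
        \<open>g - f e\<close> vanishes in the top section, hence altogether.\<close>
      obtain e where e: "e : lhom S (um (P l)) (um (P l))" "ALL x:car (um (P l)). phi (q (f (e x))) = phi (q (g x))"
        using projective_lift[OF P_proj[OF l] po L_Ob[OF mu(1)] lhom_comp[OF qf phi(1)] im lhom_comp[OF qg phi(1)]] by blast
      have fe: "(%x. f (e x)) : lhom S (um (P l)) Y" by (rule lhom_comp[OF e(1) f])
      interpret q: lhom_loc S Y Z q by (rule D)
      have "g x -[Y] f (e x) = 0[Y]" if x: "x : car (um (P l))" for x
      proof (rule vanish[OF lhom_minus[OF D(12) g fe] _ x], intro ballI)
        fix x assume x: "x : car (um (P l))"
        have c: "g x : car Y" "f (e x) : car Y" using lhom_closed[OF g x] lhom_closed[OF fe x] .
        have "q (g x) = q (f (e x))" using e(2)[rule_format, OF x] phi(2) c q.closed unfolding bij_betw_def inj_on_def by metis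
        thus "q (g x -[Y] f (e x)) = 0[Z]" using c by simp
      qed
      hence "g x = f (e x)" if "x : car (um (P l))" for x using that lhom_closed[OF g] lhom_closed[OF fe] by simp
      thus ?thesis using e(1) by blast
    qed
  qed
qed simp

text \<open>The standard module is the quotient by the sum of the images of the maps from the forbidden projectives, and
  dually for the costandard module.\<close>

definition bad :: "'l rel => 'l => 'l set" where "bad r l = {mu : La. (mu, l) ~: r}"

definition okP :: "'l rel => 'l => 'c set => bool" where
  "okP r l U <-> sbm S (P l) U & (ALL mu:bad r l. ALL h:lhom S (um (P mu)) (P l). h ` car (um (P mu)) <= U)"

definition U0 :: "'l rel => 'l => 'c set" where "U0 r l = \<Inter>{U. okP r l U}"

definition V0 :: "'l rel => 'l => 'd set" where
  "V0 r l = {x : car (I l). ALL mu:bad r l. ALL h:lhom S (I l) (um (I mu)). h x = 0[um (I mu)]}"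

lemma U0: assumes l: "l : La" shows "okP r l (U0 r l)"
proof -
  interpret P: left_module S "P l" by (rule ObD[OF PO[OF l]])
  have "okP r l (car (P l))" unfolding okP_def using P.submod_carrier lhom_closed by fastforce
  hence s: "U0 r l <= car (P l)" unfolding U0_def by blast
  have "sbm S (P l) (U0 r l)"
  proof (rule P.submodI[OF s])
    have D: "sbm S (P l) U" if "okP r l U" for U using that unfolding okP_def by blast
    show "0[P l] : U0 r l" unfolding U0_def using P.submodD(2)[OF D] by blast
    show "x +[P l] y : U0 r l" if "x : U0 r l" "y : U0 r l" for x y using that P.submodD(3)[OF D] unfolding U0_def by blast
    show "a *[P l] x : U0 r l" if "a : car S" "x : U0 r l" for a x using that P.submodD(4)[OF D] unfolding U0_def by blast
  qed
  thus ?thesis unfolding okP_def by (auto simp: U0_def okP_def)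
qed

lemma V0: assumes l: "l : La" shows "sbm S (I l) (V0 r l)"
proof -
  interpret I: left_module S "I l" by (rule ObD[OF IO[OF l]])
  have h: "lhom_loc S (I l) (um (I mu)) h" if "mu : bad r l" "h : lhom S (I l) (um (I mu))" for mu h
    using that I_Ob by (intro lhom_locI[OF I.left_module_axioms ObD(1)]) (auto simp: bad_def)
  show ?thesis
  proof (rule I.submodI)
    show "0[I l] : V0 r l" using lhom_loc.zero[OF h] unfolding V0_def by blast
    show "x +[I l] y : V0 r l" if xy: "x : V0 r l" "y : V0 r l" for x y
    proof -
      have "g (x +[I l] y) = 0[um (I mu)]" if "mu : bad r l" "g : lhom S (I l) (um (I mu))" for mu g
      proof -
        interpret g: lhom_loc S "I l" "um (I mu)" g by (rule h[OF that])
        show ?thesis using xy that by (simp add: V0_def)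
      qed
      thus ?thesis using xy by (simp add: V0_def)
    qed
    show "a *[I l] x : V0 r l" if a: "a : car S" and x: "x : V0 r l" for a x
    proof -
      have "g (a *[I l] x) = 0[um (I mu)]" if "mu : bad r l" "g : lhom S (I l) (um (I mu))" for mu g
      proof -
        interpret g: lhom_loc S "I l" "um (I mu)" g by (rule h[OF that])
        show ?thesis using a x that by (simp add: V0_def)
      qed
      thus ?thesis using a x I.smult_closed by (simp add: V0_def)
    qed
  qed (auto simp: V0_def)
qed

lemma cf_quot_iff:
  assumes l: "l : La" "mu : La" and U: "sbm S (P l) U"
  shows "cf (um (quot_module (P l) U)) mu <-> (EX h:lhom S (um (P mu)) (P l). ~ h ` car (um (P mu)) <= U)"
proof -
  note po = PO[OF l(1)]
  let ?Q = "quot_module (P l) U"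
  interpret P: left_module S "P l" by (rule ObD[OF po])
  note q = quot_left_module[OF P.left_module_axioms U] and Q = Ob_quot[OF po U]
  have qz: "umap (P l) ?Q (%x. U +>\<^bsub>P l\<^esub> x) x = 0[um ?Q] <-> uinv (P l) x : U" if "x : car (um (P l))" for x
    using umap_zero[OF po Q q(2) that] q(4)[OF uinv_closed[OF po that]] by simp
  show ?thesis
  proof
    assume "cf (um ?Q) mu"
    then obtain f x where f: "f : lhom S (um (P mu)) (um ?Q)" "x : car (um (P mu))" "f x ~= 0[um ?Q]" unfolding cf_def hz_def by blast
    have s: "ses (um ((P l)(|carrier := U|))) (umap ((P l)(|carrier := U|)) (P l) (%x. x)) (um (P l)) (umap (P l) ?Q (%x. U +>\<^bsub>P l\<^esub> x)) (um ?Q)"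
      by (rule ses_um[OF Ob_sub[OF po U] po Q incl_left_hom[OF U P.left_module_axioms] _ q(2,3)]) (use q(4) P.submodD(1)[OF U] in auto)
    note d = sesD[OF s]
    obtain k where k: "k : lhom S (um (P mu)) (um (P l))" "ALL x:car (um (P mu)). umap (P l) ?Q (%x. U +>\<^bsub>P l\<^esub> x) (k x) = f x"
      using projective_lift[OF P_proj[OF l(2)] d(2,3,5,7) f(1)] by blast
    have "uinv (P l) (k x) ~: U" using qz[OF lhom_closed[OF k(1) f(2)]] k(2) f(2,3) by simp
    thus "EX h:lhom S (um (P mu)) (P l). ~ h ` car (um (P mu)) <= U"
      using f(2) by (intro bexI[OF _ lhom_comp[OF k(1) uinv(1)[OF po]]]) blast
  next
    assume "EX h:lhom S (um (P mu)) (P l). ~ h ` car (um (P mu)) <= U"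
    then obtain h x where h: "h : lhom S (um (P mu)) (P l)" "x : car (um (P mu))" "h x ~: U" by blast
    have "uemb ?Q (U +>\<^bsub>P l\<^esub> h x) ~= 0[um ?Q]"
      using uemb_zero[OF Q lhom_closed[OF q(2) lhom_closed[OF h(1,2)]]] q(4)[OF lhom_closed[OF h(1,2)]] h(3) by simp
    moreover have "(%x. uemb ?Q (U +>\<^bsub>P l\<^esub> h x)) : lhom S (um (P mu)) (um ?Q)" by (rule lhom_comp[OF lhom_comp[OF h(1) q(2)] um(2)[OF Q]])
    ultimately show "cf (um ?Q) mu" using cfI h(2) by blast
  qed
qed

lemma cf_sub_iff:
  assumes l: "l : La" "mu : La" and U: "sbm S (I l) U"
  shows "cf (um ((I l)(|carrier := U|))) mu <-> (EX h:lhom S (I l) (um (I mu)). EX x:U. h x ~= 0[um (I mu)])"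
proof -
  note io = IO[OF l(1)]
  let ?Q = "(I l)(|carrier := U|)"
  interpret I: left_module S "I l" by (rule ObD[OF io])
  note Q = Ob_sub[OF io U] and inc = incl_left_hom[OF U I.left_module_axioms]
  have UI: "U <= car (I l)" by (rule I.submodD(1)[OF U])
  show ?thesis unfolding cf_iff_I[OF l(2) um(1)[OF Q]]
  proof
    assume "~ hz (um ?Q) (um (I mu))"
    then obtain f x where f: "f : lhom S (um ?Q) (um (I mu))" "x : car (um ?Q)" "f x ~= 0[um (I mu)]" unfolding hz_def by blast
    let ?j = "umap ?Q (I l) (%x. x)"
    note j = umap[OF Q io inc]
    interpret j: lhom_loc S "um ?Q" "um (I l)" ?j by (rule hom_loc[OF um(1)[OF Q] um(1)[OF io] j])
    have inj: "inj_on ?j (car (um ?Q))" unfolding j.inj_iff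
    proof (intro ballI impI)
      fix y assume y: "y : car (um ?Q)" "?j y = 0[um (I l)]"
      hence "uinv ?Q y = 0[?Q]" using umap_zero[OF Q io inc y(1)] by simp
      thus "y = 0[um ?Q]" using uemb_zero[OF Q uinv_closed[OF Q y(1)]] uinv(3)[OF Q y(1)] by simp
    qed
    obtain k where k: "k : lhom S (um (I l)) (um (I mu))" "ALL x:car (um ?Q). k (?j x) = f x"
      using injective_extend[OF I_inj[OF l(2)] um(1)[OF Q] um(1)[OF io] j inj f(1)] by blast
    have "uinv ?Q x : U" using uinv_closed[OF Q f(2)] by simp
    moreover have "k (uemb (I l) (uinv ?Q x)) ~= 0[um (I mu)]" using k(2) f(2,3) by (simp add: umap_def)
    ultimately have "EX x:U. k (uemb (I l) x) ~= 0[um (I mu)]" by blast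
    thus "EX h:lhom S (I l) (um (I mu)). EX x:U. h x ~= 0[um (I mu)]" by (rule bexI[OF _ lhom_comp[OF um(2)[OF io] k(1)]])
  next
    assume "EX h:lhom S (I l) (um (I mu)). EX x:U. h x ~= 0[um (I mu)]"
    then obtain h x where h: "h : lhom S (I l) (um (I mu))" "x : U" "h x ~= 0[um (I mu)]" by blast
    hence x: "x : car ?Q" by simp
    show "~ hz (um ?Q) (um (I mu))" unfolding hz_def
      using lhom_comp[OF lhom_comp[OF uinv(1)[OF Q] inc] h(1)] uemb_closed[OF Q x] uinv(2)[OF Q x] h(3) by force
  qed
qed

text \<open>Having all factors of the quotient below \<open>l\<close> means that \<open>U\<close>
  contains all images of the forbidden projectives. This condition is stable under intersections, so
  the \<open>LEAST\<close> in the definition is attained.\<close>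

lemma standard_eq: assumes l: "l : La" shows "standard S La r L P l = quot_module (P l) (U0 r l)"
proof -
  have "(sbm S (P l) U & factors_below S La r L l (quot_module (P l) U)) <-> okP r l U" for U
    using factors_below_iff[OF Ob_quot[OF PO[OF l]], of U r l] cf_quot_iff[OF l, of _ U] unfolding okP_def bad_def by blast
  moreover have "(LEAST U. okP r l U) = U0 r l" by (rule Least_equality[of "okP r l", OF U0[OF l]]) (auto simp: U0_def)
  ultimately show ?thesis unfolding standard_def by simp
qed

text \<open>Dually, having all factors below \<open>l\<close> means that \<open>U\<close> is killed
  by all maps to the forbidden injectives, that is, \<open>U\<close> lies in \<open>V0\<close>; so
  the \<open>GREATEST\<close> is attained.\<close>

lemma costandard_eq: assumes l: "l : La" shows "costandard S La r L I l = (I l)(|carrier := V0 r l|)"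
proof -
  interpret I: left_module S "I l" by (rule ObD[OF IO[OF l]])
  have "(sbm S (I l) U & factors_below S La r L l ((I l)(|carrier := U|))) <-> sbm S (I l) U & U <= V0 r l" for U
    using factors_below_iff[OF Ob_sub[OF IO[OF l]], of U r l] cf_sub_iff[OF l, of _ U] I.submodD(1)[of U] unfolding V0_def bad_def by blast
  moreover have "(GREATEST U. sbm S (I l) U & U <= V0 r l) = V0 r l" by (rule Greatest_equality) (use V0[OF l] in auto)
  ultimately show ?thesis unfolding costandard_def by simp
qed

abbreviation Std :: "'l rel => 'l => ('k, 'a) umodule" where "Std r == %l. um (standard S La r L P l)"
abbreviation Cos :: "'l rel => 'l => ('k, 'a) umodule" where "Cos r == %l. um (costandard S La r L I l)"

definition pS :: "'l rel => 'l => (nat => 'k) => nat => 'k" where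
  "pS r l = umap (P l) (standard S La r L P l) (%x. U0 r l +>\<^bsub>P l\<^esub> x)"
definition iC :: "'l rel => 'l => (nat => 'k) => nat => 'k" where
  "iC r l = umap (costandard S La r L I l) (I l) (%x. x)"

lemma standard_props:
  assumes l: "l : La"
  shows "Ob (standard S La r L P l)" "pS r l : lhom S (um (P l)) (Std r l)" "pS r l ` car (um (P l)) = car (Std r l)"
    "!!mu. mu : La ==> cf (Std r l) mu ==> (mu, l) : r"
    "!!(X :: ('k, 'a) umodule) f x. Ob X ==> f : lhom S (um (P l)) X ==> (!!mu. mu : La ==> cf X mu ==> (mu, l) : r) ==>
      x : car (um (P l)) ==> pS r l x = 0[Std r l] ==> f x = 0[X]"
proof -
  note po = PO[OF l]
  have ok: "okP r l (U0 r l)" by (rule U0[OF l])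
  hence U: "sbm S (P l) (U0 r l)" unfolding okP_def by blast
  interpret P: left_module S "P l" by (rule ObD[OF po])
  note q = quot_left_module[OF P.left_module_axioms U, folded standard_eq[OF l]]
  show Q: "Ob (standard S La r L P l)" unfolding standard_eq[OF l] by (rule Ob_quot[OF po U])
  show "pS r l : lhom S (um (P l)) (Std r l)" unfolding pS_def by (rule umap[OF po Q q(2)])
  have s: "ses (um ((P l)(|carrier := U0 r l|))) (umap ((P l)(|carrier := U0 r l|)) (P l) (%x. x)) (um (P l)) (pS r l) (Std r l)"
    unfolding pS_def by (rule ses_um[OF Ob_sub[OF po U] po Q incl_left_hom[OF U P.left_module_axioms] _ q(2,3)]) (use q(4) P.submodD(1)[OF U] in auto)
  show "pS r l ` car (um (P l)) = car (Std r l)" by (rule sesD(7)[OF s])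
  show "(mu, l) : r" if "mu : La" "cf (Std r l) mu" for mu
    using that cf_quot_iff[OF l that(1) U] ok unfolding standard_eq[OF l] okP_def bad_def by blast
  fix X :: "('k, 'a) umodule" and f x
  assume X: "Ob X" and f: "f : lhom S (um (P l)) X" and b: "!!mu. mu : La ==> cf X mu ==> (mu, l) : r"
    and x: "x : car (um (P l))" "pS r l x = 0[Std r l]"
  have "uinv (P l) x : U0 r l" using x umap_zero[OF po Q q(2) x(1)] q(4)[OF uinv_closed[OF po x(1)]] unfolding pS_def by simp
  moreover have h: "(%y. f (uemb (P l) y)) : lhom S (P l) X" by (rule lhom_comp[OF um(2)[OF po] f])
  interpret h: lhom_loc S "P l" X "%y. f (uemb (P l) y)" by (rule lhom_locI[OF P.left_module_axioms ObD(1)[OF X] h])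
  \<comment> \<open>Images of forbidden projectives die in \<open>X\<close>, which has no such
    factor. So the kernel of \<open>f\<close> is one of the submodules whose intersection is
    \<open>U0\<close>.\<close>
  have "okP r l {y : car (P l). f (uemb (P l) y) = 0[X]}" unfolding okP_def
  proof (intro conjI h.submod_kernel ballI subsetI)
    fix mu g y assume mu: "mu : bad r l" and g: "g : lhom S (um (P mu)) (P l)" and "y : g ` car (um (P mu))"
    then obtain z where z: "z : car (um (P mu))" "y = g z" by blast
    have "~ cf X mu" using b mu unfolding bad_def by blast
    hence "f (uemb (P l) (g z)) = 0[X]" using cfI[OF lhom_comp[OF g h] z(1)] by blast
    thus "y : {y : car (P l). f (uemb (P l) y) = 0[X]}" using z lhom_closed[OF g] by simp
  qed
  ultimately have "uinv (P l) x : {y : car (P l). f (uemb (P l) y) = 0[X]}" unfolding U0_def by blast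
  thus "f x = 0[X]" using uinv(3)[OF po x(1)] by simp
qed

lemma costandard_props:
  assumes l: "l : La"
  shows "Ob (costandard S La r L I l)" "iC r l : lhom S (Cos r l) (um (I l))" "inj_on (iC r l) (car (Cos r l))"
    "!!mu. mu : La ==> cf (Cos r l) mu ==> (mu, l) : r"
    "!!(X :: ('k, 'a) umodule) f x. Ob X ==> f : lhom S X (um (I l)) ==> (!!mu. mu : La ==> cf X mu ==> (mu, l) : r) ==>
      x : car X ==> f x : iC r l ` car (Cos r l)"
proof -
  note io = IO[OF l] and U = V0[OF l]
  interpret I: left_module S "I l" by (rule ObD[OF io])
  note q = quot_left_module[OF I.left_module_axioms U[of r]]
  show Q: "Ob (costandard S La r L I l)" unfolding costandard_eq[OF l] by (rule Ob_sub[OF io U])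
  have inc: "(%x. x) : lhom S (costandard S La r L I l) (I l)" unfolding costandard_eq[OF l] by (rule incl_left_hom[OF U I.left_module_axioms])
  have s: "ses (Cos r l) (iC r l) (um (I l)) (umap (I l) (quot_module (I l) (V0 r l)) (%x. V0 r l +>\<^bsub>I l\<^esub> x)) (um (quot_module (I l) (V0 r l)))"
    unfolding iC_def by (rule ses_um[OF Q io Ob_quot[OF io U] inc _ q(2,3)]) (use q(4) I.submodD(1)[OF U] in "auto simp: costandard_eq[OF l]")
  show "iC r l : lhom S (Cos r l) (um (I l))" "inj_on (iC r l) (car (Cos r l))" by (rule sesD(4,6)[OF s])+
  show "(mu, l) : r" if "mu : La" "cf (Cos r l) mu" for mu
    using that cf_sub_iff[OF l that(1) U] unfolding costandard_eq[OF l] V0_def bad_def by blast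
  fix X :: "('k, 'a) umodule" and f x
  assume X: "Ob X" and f: "f : lhom S X (um (I l))" and b: "!!mu. mu : La ==> cf X mu ==> (mu, l) : r" and x: "x : car X"
  have fx: "f x : car (um (I l))" by (rule lhom_closed[OF f x])
  have "uinv (I l) (f x) : V0 r l" unfolding V0_def
  proof (intro CollectI conjI ballI uinv_closed[OF io fx])
    fix mu h assume mu: "mu : bad r l" and h: "h : lhom S (I l) (um (I mu))"
    have "hz X (um (I mu))" using b[of mu] mu cf_iff_I[OF _ X, of mu] unfolding bad_def by blast
    thus "h (uinv (I l) (f x)) = 0[um (I mu)]" using hzD[OF _ lhom_comp[OF lhom_comp[OF f uinv(1)[OF io]] h] x] by blast
  qed
  hence c: "uinv (I l) (f x) : car (costandard S La r L I l)" by (simp add: costandard_eq[OF l])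
  show "f x : iC r l ` car (Cos r l)"
    by (rule image_eqI[OF _ uemb_closed[OF Q c]]) (simp add: iC_def umap_def uinv(2)[OF Q c] uinv(3)[OF io fx])
qed

end

section \<open>From the definitions of quasi-hereditary algebra and tilting module to the locale
  axioms\<close>

context labelled
begin

lemma qh_hw:
  assumes qh: "quasi_hereditary K S La r L P I"
  shows "hw K S La uL (%l. um (P l)) (%l. um (I l)) up ui r (Std r) (Cos r) (pS r) (iC r)"
proof (intro hw.intro hw_axioms.intro simp_data_axioms)
  have po: "partial_order_on La r" using qh unfolding quasi_hereditary_def by blast
  have refl: "(l, l) : r" if "l : La" for l using po that unfolding partial_order_on_def preorder_on_def refl_on_def by blast
  show "(l, l) : r" if "l : La" for l by (rule refl[OF that])
  show "(l, tau) : r" if "(l, mu) : r" "(mu, tau) : r" for l mu tau using po that unfolding partial_order_on_def preorder_on_def trans_def by blast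
  show "l = mu" if "(l, mu) : r" "(mu, l) : r" for l mu using po that unfolding partial_order_on_def antisym_def by blast
  fix l assume l: "l : La"
  note D = standard_props[OF l] and N = costandard_props[OF l]
  show "Ob (Std r l)" "Ob (Cos r l)" by (rule um(1)[OF D(1)]) (rule um(1)[OF N(1)])
  show "pS r l : lhom S (um (P l)) (Std r l)" "pS r l ` car (um (P l)) = car (Std r l)"
    "!!mu. mu : La ==> cf (Std r l) mu ==> (mu, l) : r" by (rule D)+
  show "f x = 0[X]" if "Ob X" "f : lhom S (um (P l)) X" "!!mu. mu : La ==> cf X mu ==> (mu, l) : r"
    "x : car (um (P l))" "pS r l x = 0[Std r l]" for X :: "('k, 'a) umodule" and f x by (rule D(5)[OF that])
  show "iC r l : lhom S (Cos r l) (um (I l))" "inj_on (iC r l) (car (Cos r l))"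
    "!!mu. mu : La ==> cf (Cos r l) mu ==> (mu, l) : r" by (rule N)+
  show "f x : iC r l ` car (Cos r l)" if "Ob X" "f : lhom S X (um (I l))" "!!mu. mu : La ==> cf X mu ==> (mu, l) : r"
    "x : car X" for X :: "('k, 'a) umodule" and f x by (rule N(5)[OF that])
  obtain cs ls where cs: "composition_labels S La L (standard S La r L P l) cs" "count_list cs l = 1"
    and ls: "set ls <= La" "has_filtration S (standard S La r L P) (P l) ls" "count_list ls l = 1" "ALL mu:set ls. (l, mu) : r"
    using qh l unfolding quasi_hereditary_def by blast
  show "mult1 l (Std r l)" using mult1_LF[OF _ _ l cs(2)] cs(1) unfolding comp_LF[OF D(1)] by blast
  have "LF (Std r) (um (P l)) ls" using has_filtration_LF[OF PO[OF l], of ls "standard S La r L P"] standard_props(1) ls(1,2) by blast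
  thus "EX Y. Ses Y (um (P l)) (Std r l) & Filt (cls (Std r) {tau : La. (l, tau) : r & tau ~= l}) Y"
  proof cases
    case LF_nil
    thus ?thesis using ls(3) by simp
  next
    \<comment> \<open>The definition says only that the standard module of \<open>l\<close> occurs
      once in the filtration. That it is the top section follows because the head
      \<open>L mu\<close> of the top section is a quotient of \<open>P l\<close>, so
      \<open>mu = l\<close>; the remaining labels are then strictly above \<open>l\<close>.\<close>
    case (LF_snoc X Z ms mu)
    have mu: "mu : La" using ls(1) LF_snoc(1) by auto
    obtain i q where s: "ses X i (um (P l)) q Z" using LF_snoc(2) unfolding Ses_def by blast
    note d = sesD[OF s]
    obtain f where f: "f : lhom S Z (Std r mu)" "bij_betw f (car Z) (car (Std r mu))" using LF_snoc(4) unfolding module_iso_def by blast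
    note M = standard_props[OF mu] and mo = um(1)[OF standard_props(1)[OF mu]]
    have "(tau, mu) : r" if "tau : La" "cf (uL mu) tau" for tau using cf_L[OF mu that] refl[OF mu] by simp
    hence "EX h:lhom S (Std r mu) (uL mu). ALL y:car (um (P mu)). h (pS r mu y) = up mu y"
      by (intro factor_epi[OF ObD(1)[OF P_Ob[OF mu]] ObD(1)[OF mo] ObD(1)[OF L_Ob[OF mu]] M(2,3) p0[OF mu]] M(5)[OF L_Ob[OF mu] p0[OF mu]])
    then obtain h where h: "h : lhom S (Std r mu) (uL mu)" "ALL y:car (um (P mu)). h (pS r mu y) = up mu y" by blast
    obtain y where y: "y : car (um (P mu))" "up mu y ~= 0[uL mu]" using p0_nz[OF mu] by blast
    have "pS r mu y : f ` car Z" using f(2) lhom_closed[OF M(2) y(1)] by (simp add: bij_betw_def)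
    then obtain z where z: "z : car Z" "f z = pS r mu y" by force
    obtain x where x: "x : car (um (P l))" "q x = z" using d(10)[OF z(1)] by blast
    have "cf (uL mu) l" by (rule cfI[OF lhom_comp[OF lhom_comp[OF d(5) f(1)] h(1)] x(1)]) (use x z h(2) y in simp)
    hence "mu = l" using cf_L[OF mu l] by blast
    hence "Ses X (um (P l)) (Std r l)" using Ses_iso_right[OF LF_snoc(2) mo LF_snoc(4)] by blast
    moreover have "set ms <= {tau : La. (l, tau) : r & tau ~= l}"
      using ls LF_snoc(1) `mu = l` by (auto simp: count_list_0_iff)
    ultimately show ?thesis using LF_Filt[OF LF_snoc(3)] by blast
  qed
qed

text \<open>For \<open>phi\<close> the power of \<open>e\<close> from Fitting's lemma, the module is
  the direct sum of kernel and image of \<open>phi\<close>. Indecomposability refers to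
  \<open>T\<close> on its own type, so both summands are written down there.\<close>

lemma tilting_local:
  fixes T :: "('a, 't) module"
  assumes T: "Ob T" and ind: "indecomposable_module S T"
  shows "local_endo (um T)"
  unfolding local_endo_def
proof (intro ballI)
  fix e assume e: "e : lhom S (um T) (um T)"
  note uT = um(1)[OF T]
  interpret T: left_module S T by (rule ObD[OF T])
  interpret uT: left_module S "um T" by (rule ObD[OF uT])
  obtain n where n: "n > 0" "ALL x:car (um T). (e ^^ n) ((e ^^ n) x) = 0[um T] --> (e ^^ n) x = 0[um T]" using fitting[OF uT e] by blast
  define phi where "phi = e ^^ n"
  have phi: "phi : lhom S (um T) (um T)" unfolding phi_def by (rule endo_pow[OF e])
  have phi2: "phi (phi x) = 0[um T] ==> phi x = 0[um T]" if "x : car (um T)" for x using n(2) that unfolding phi_def by blast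
  interpret phi: lhom_loc S "um T" "um T" phi by (rule hom_loc[OF uT uT phi])
  interpret k: lhom_loc S T "um T" "%x. phi (uemb T x)"
    by (rule lhom_locI[OF T.left_module_axioms uT.left_module_axioms lhom_comp[OF um(2)[OF T] phi]])
  interpret j: lhom_loc S "um T" T "%x. uinv T (phi x)"
    by (rule lhom_locI[OF uT.left_module_axioms T.left_module_axioms lhom_comp[OF phi uinv(1)[OF T]]])
  let ?W = "(um T)(|carrier := phi ` car (um T)|)"
  note W = img_factor[OF uT uT phi]
  have phiW: "phi : lhom S ?W ?W"
    by (rule left_homI) (auto simp: phi.closed)
  interpret w: lhom_loc S ?W ?W phi by (rule hom_loc[OF W(1,1) phiW])
  have "inj_on phi (car ?W)" unfolding w.inj_iff using phi2 by auto
  hence "bij_betw phi (car ?W) (car ?W)" by (rule inj_len_eq_surj[OF W(1,1) phiW]) simp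
  hence im: "phi ` phi ` car (um T) = phi ` car (um T)" by (simp add: bij_betw_def)
  let ?U = "{x : car T. phi (uemb T x) = 0[um T]}" and ?V = "(%x. uinv T (phi x)) ` car (um T)"
  have U: "sbm S T ?U" by (rule k.submod_kernel)
  have V: "sbm S T ?V" by (rule j.submod_image[OF uT.submod_carrier])
  have "?U Int ?V = {0[T]}"
  proof (intro equalityI subsetI)
    fix y assume "y : ?U Int ?V"
    then obtain x where x: "x : car (um T)" "y = uinv T (phi x)" "phi (uemb T (uinv T (phi x))) = 0[um T]" by blast
    hence "phi x = 0[um T]" using phi2[OF x(1)] uinv(3)[OF T phi.closed[OF x(1)]] by simp
    thus "y : {0[T]}" using x(2) j.zero phi.zero by simp
  qed (use T.submodD(2)[OF U] T.submodD(2)[OF V] in blast)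
  moreover have "?U <+>\<^bsub>T\<^esub> ?V = car T"
  proof (intro equalityI subsetI)
    fix y assume "y : ?U <+>\<^bsub>T\<^esub> ?V"
    thus "y : car T" using T.submodD(1)[OF V] unfolding set_add_def' by blast
  next
    fix y assume y: "y : car T"
    have "phi (uemb T y) : phi ` phi ` car (um T)" unfolding im using uemb_closed[OF T y] by blast
    then obtain x where x: "x : car (um T)" "phi (uemb T y) = phi (phi x)" by blast
    have v: "uinv T (phi x) : ?V" "uinv T (phi x) : car T" using x(1) j.closed by blast+
    have e: "phi (uemb T (uinv T (phi x))) = phi (phi x)" using uinv(3)[OF T phi.closed[OF x(1)]] by simp
    have "phi (uemb T (y -[T] uinv T (phi x))) = 0[um T]" unfolding k.minus[OF y v(2)] e x(2) using phi.closed[OF phi.closed[OF x(1)]] by simp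
    hence u: "y -[T] uinv T (phi x) : ?U" using y v(2) by simp
    show "y : ?U <+>\<^bsub>T\<^esub> ?V" unfolding set_add_def' using u v(1) T.minus_add_cancel[OF y v(2), symmetric] by blast
  qed
  ultimately have "?U = {0[T]} | ?V = {0[T]}" using ind U V unfolding indecomposable_module_def direct_decomp_def by blast
  thus "bij_betw e (car (um T)) (car (um T)) | (EX n. ALL x:car (um T). (e ^^ n) x = 0[um T])"
  proof
    assume u: "?U = {0[T]}"
    interpret e: lhom_loc S "um T" "um T" e by (rule hom_loc[OF uT uT e])
    have "inj_on e (car (um T))" unfolding e.inj_iff
    proof (intro ballI impI)
      fix x assume x: "x : car (um T)" "e x = 0[um T]"
      obtain m where "n = Suc m" using n(1) by (cases n) auto
      hence "phi x = (e ^^ m) 0[um T]" using x(2) by (simp add: phi_def funpow_swap1)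
      also have "... = 0[um T]" by (induction m) simp_all
      finally have "uinv T x : ?U" using x(1) uinv_closed[OF T x(1)] uinv(3)[OF T x(1)] by simp
      hence "uinv T x = 0[T]" unfolding u by blast
      thus "x = 0[um T]" using uemb_zero[OF T uinv_closed[OF T x(1)]] uinv(3)[OF T x(1)] by simp
    qed
    thus ?thesis using inj_len_eq_surj[OF uT uT e] by blast
  next
    assume v: "?V = {0[T]}"
    have "(e ^^ n) x = 0[um T]" if x: "x : car (um T)" for x
    proof -
      have "uinv T (phi x) = 0[T]" using x v by blast
      thus ?thesis using uemb_zero[OF T j.closed[OF x]] uinv(3)[OF T phi.closed[OF x]] by (simp add: phi_def)
    qed
    thus ?thesis by blast
  qed
qed

lemma tilting_data:
  fixes T :: "('a, 't) module"
  assumes l: "l : La" and r: "(l, l) : r"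
    and t: "indecomposable_tilting K S La r L (standard S La r L P) (costandard S La r L I) l T"
  shows "Ob T" "Filt (cls (Std r) La) (um T)" "Filt (cls (Cos r) La) (um T)" "ALL mu:La. cf (um T) mu --> (mu, l) : r"
    "cf (um T) l" "mult1 l (um T)" "local_endo (um T)"
proof -
  have f: "filtered K S La (standard S La r L P) T" "filtered K S La (costandard S La r L I) T" and ind: "indecomposable_module S T"
    using t unfolding indecomposable_tilting_def tilting_module_def by blast+
  obtain ls where ls: "composition_labels S La L T ls" "count_list ls l = 1" "ALL mu:set ls. mu ~= l --> (mu, l) : r"
    using t unfolding indecomposable_tilting_def by blast
  show T: "Ob T" using f(1) unfolding filtered_def by blast
  show "Filt (cls (Std r) La) (um T)" using f(1) filtered_Filt[of La "standard S La r L P", OF standard_props(1) T] by blast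
  show "Filt (cls (Cos r) La) (um T)" using f(2) filtered_Filt[of La "costandard S La r L I", OF costandard_props(1) T] by blast
  have lf: "set ls <= La" "LF uL (um T) ls" using ls(1) unfolding comp_LF[OF T] by blast+
  have "l : set ls" using ls(2) count_notin by fastforce
  thus "cf (um T) l" using cf_LF[OF lf(2,1) l] by blast
  show "ALL mu:La. cf (um T) mu --> (mu, l) : r"
  proof (intro ballI impI)
    fix mu assume "mu : La" "cf (um T) mu"
    hence "mu : set ls" using cf_LF[OF lf(2,1)] by simp
    thus "(mu, l) : r" using ls(3) r by (cases "mu = l") auto
  qed
  show "mult1 l (um T)" by (rule mult1_LF[OF lf(2,1) l ls(2)])
  show "local_endo (um T)" by (rule tilting_local[OF T ind])
qed

end

section \<open>The endomorphism algebra\<close>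

lemma left_module_cong:
  assumes "left_module R X" "car Y = car X" "0[Y] = 0[X]" "add Y = add X"
    and sm: "!!a x. a : car R ==> x : car X ==> a *[Y] x = a *[X] x"
  shows "left_module R Y"
proof -
  interpret X: left_module R X by fact
  show ?thesis
  proof (rule left_moduleI)
    show "EX y:car Y. y +[Y] x = 0[Y]" if "x : car Y" for x
      using that assms(2-4) by (intro bexI[of _ "-[X] x"]) (simp_all add: X.M.l_neg)
  qed (simp_all add: assms X.R.ring_axioms X.M.a_ac X.smult_closed X.smult_l_distr X.smult_r_distr X.smult_assoc X.smult_one)
qed

context fdalg
begin

text \<open>Finite dimension is obtained from \<open>H_fd\<close>: letting the field act on
  \<open>T\<close> by scalars turns Hom(T, T) into an instance of \<open>homf\<close> with target
  \<open>base K\<close>. Commutativity of the field absorbs the reversed order of products.\<close>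

lemma End_op_algebra:
  fixes T :: "('a, 't) module"
  assumes T: "Ob T"
  shows "fd_algebra K (End_op S T)" and "homf K S (End_op S T) T (%f. f)"
proof -
  let ?E = "End_op S T"
  interpret T: left_module S T by (rule ObD[OF T])
  interpret B: fdalg K "base K" by unfold_locales (rule base_fd_algebra[OF field_K])
  interpret F: field K by (rule field_K)
  interpret h0: homf K S "base K" T "%c x. (sc S c) *[T] x"
  proof (intro homf.intro homf_axioms.intro fdalg_axioms B.fdalg_axioms T)
    fix a assume "a : car (base K)"
    hence a: "a : car K" by simp
    show "(%x. (sc S a) *[T] x) : lhom S T T" by (rule scal_hom[OF T.left_module_axioms a])
    fix b x assume "b : car (base K)" and x: "x : car T"
    hence b: "b : car K" by simp
    show "((a +[base K] b) *[S] 1[S]) *[T] x = (sc S a) *[T] x +[T] (sc S b) *[T] x"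
      using a b x scal_closed[OF a] scal_closed[OF b] by (simp add: SV.smult_l_distr T.smult_l_distr)
    have "(a **[K] b) *[S] 1[S] = (sc S b) **[S] (sc S a)"
      using a b scal_comm(2)[OF a scal_closed[OF b]] by (simp add: SV.smult_assoc1)
    thus "((a **[base K] b) *[S] 1[S]) *[T] x = (sc S b) *[T] ((sc S a) *[T] x)"
      using T.smult_assoc[OF scal_closed[OF b] scal_closed[OF a] x] by simp
  qed (simp_all add: T.smult_one)
  have e_simps: "car ?E = lhom S T T Int extensional (car T)" "0[?E] = (\<lambda>x\<in>car T. 0[T])" "1[?E] = (\<lambda>x\<in>car T. x)"
    "f +[?E] g = (\<lambda>x\<in>car T. f x +[T] g x)" "f **[?E] g = compose (car T) g f"
    "c *[?E] f = (\<lambda>x\<in>car T. (sc S c) *[T] f x)" for f g c by (simp_all add: End_op_def)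
  let ?V = "us (base K) (h0.H T)"
  have V: "vectorspace K ?V" "vectorspace.fin_dim K ?V" using B.us_vs B.ObD[OF h0.H_fd[OF T]] by blast+
  have sm: "c *[?E] f = c *[?V] f" if "c : car K" "f : car ?V" for c f
    using that lhom_smult[of f S T T] scal_closed[OF that(1)] by (auto simp: e_simps compose_def intro!: restrict_ext)
  have lm: "left_module K ?E"
    by (rule left_module_cong[OF vectorspace.left_module[OF V(1)] _ _ _ sm]) (simp_all add: End_op_def underlying_space_def hom_mod_def)
  have E: "vectorspace K ?E" by (rule vectorspaceI[OF field_K lm])
  interpret E: left_module K ?E by (rule lm)
  have "(%f. f) : lhom K ?V ?E"
    by (rule left_homI) (use sm in "simp_all add: End_op_def")
  moreover have "(%f. f) ` car ?V = car ?E" unfolding image_ident by (simp add: End_op_def)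
  ultimately have fd: "vectorspace.fin_dim K ?E"
    by (rule vs_hom.fin_dim_image[OF vs_hom.intro[OF V(1) E vs_hom_axioms.intro] V(2)])
  have c: "f x : car T" if "f : car ?E" "x : car T" for f x using that lhom_closed by (auto simp: e_simps)
  have ext: "f = g" if "f : extensional (car T)" "g : extensional (car T)" "!!x. x : car T ==> f x = g x" for f g :: "'t => 't"
    using that by (rule extensionalityI)
  have mc: "f **[?E] g : car ?E" if "f : car ?E" "g : car ?E" for f g
    using lhom_comp[of f S T T g T] that by (simp add: e_simps compose_def lhom_restrict[OF T.left_module_axioms])
  have R: "ring ?E"
  proof (rule ringI)
    show "abelian_group ?E" by (rule E.M.abelian_group_axioms)
    show "monoid ?E"
    proof (rule monoidI)
      show "f **[?E] g : car ?E" if "f : car ?E" "g : car ?E" for f g by (rule mc[OF that])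
      show "1[?E] : car ?E" by (simp add: e_simps lhom_restrict[OF T.left_module_axioms] lhom_id)
      show "f **[?E] g **[?E] h = f **[?E] (g **[?E] h)" if "f : car ?E" "g : car ?E" "h : car ?E" for f g h
        by (rule ext; simp add: e_simps(5) compose_def c[OF that(1)])
      show "1[?E] **[?E] f = f" "f **[?E] 1[?E] = f" if "f : car ?E" for f
        by (rule ext; use that c[OF that] in "simp add: e_simps compose_def")+
    qed
    show "(f +[?E] g) **[?E] h = f **[?E] h +[?E] g **[?E] h" if "f : car ?E" "g : car ?E" "h : car ?E" for f g h
    proof -
      have h: "h : lhom S T T" using that(3) by (simp add: e_simps(1))
      show ?thesis by (rule ext; simp add: e_simps(4,5) compose_def c[OF that(1)] c[OF that(2)] lhom_add[OF h])
    qed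
    show "h **[?E] (f +[?E] g) = h **[?E] f +[?E] h **[?E] g" if "f : car ?E" "g : car ?E" "h : car ?E" for f g h
      by (rule ext; simp add: e_simps(4,5) compose_def c[OF that(3)])
  qed
  have "(a *[?E] f) **[?E] g = a *[?E] (f **[?E] g) & f **[?E] (a *[?E] g) = a *[?E] (f **[?E] g)"
    if "a : car K" "f : car ?E" "g : car ?E" for a f g
  proof -
    have g: "g : lhom S T T" using that(3) by (simp add: e_simps(1))
    note s = lhom_smult[OF g scal_closed[OF that(1)]]
    show ?thesis by (intro conjI; rule ext; simp add: e_simps(5,6) compose_def c[OF that(2)] s T.smult_closed scal_closed[OF that(1)])
  qed
  with E fd R show A: "fd_algebra K ?E" unfolding fd_algebra_def by blast
  show "homf K S ?E T (%f. f)"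
    by (intro homf.intro homf_axioms.intro fdalg_axioms fdalg.intro A T)
      (auto simp: e_simps compose_def)
qed

text \<open>\<open>p\<close> is the projection to \<open>U\<close> along \<open>V\<close>. The
  component in \<open>U\<close> is unique because \<open>U\<close> and \<open>V\<close> meet in
  zero, and uniqueness yields linearity.\<close>

lemma summand_retract:
  assumes M: "Ob M" and N: "Ob N" and d: "direct_summand S N M"
  shows "EX i:lhom S N M. EX r:lhom S M N. ALL x:car N. r (i x) = x"
proof -
  interpret M: left_module S M by (rule ObD[OF M])
  obtain U V where U: "sbm S M U" and V: "sbm S M V" and UV: "U Int V = {0[M]}" "U <+>\<^bsub>M\<^esub> V = car M"
    and iso: "module_iso S N (M(|carrier := U|))" using d unfolding direct_summand_def direct_decomp_def by blast
  note u = M.submodD[OF U] and v = M.submodD[OF V]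
  note UO = Ob_sub[OF M U]
  obtain f where f: "f : lhom S N (M(|carrier := U|))" "bij_betw f (car N) (car (M(|carrier := U|)))" using iso unfolding module_iso_def by blast
  obtain g where g: "g : lhom S (M(|carrier := U|)) N" "ALL x:car N. g (f x) = x"
    using lhom_inverse_ex[OF ObD(1)[OF N] ObD(1)[OF UO] f] by blast
  define p where "p m = (SOME x. x : U & m -[M] x : V)" for m
  have ex: "EX x. x : U & m -[M] x : V" if m: "m : car M" for m
  proof -
    obtain x y where xy: "x : U" "y : V" "m = x +[M] y" using m UV(2) unfolding set_add_def' by blast
    have c: "x : car M" "y : car M" using xy(1,2) u(1) v(1) by blast+
    hence "m -[M] x = y" unfolding xy(3) a_minus_def M.M.a_comm[OF c] by (simp add: M.M.a_assoc M.M.r_neg)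
    thus ?thesis using xy by blast
  qed
  have p: "p m : U" "m -[M] p m : V" if "m : car M" for m using someI_ex[OF ex[OF that]] unfolding p_def by blast+
  have eq: "p m = x" if m: "m : car M" and x: "x : U" "m -[M] x : V" for m x
  proof -
    have c: "p m : car M" "x : car M" using p(1)[OF m] x(1) u(1) by blast+
    have "(m -[M] x) -[M] (m -[M] p m) = p m -[M] x"
    proof -
      have "(m +[M] -[M] x) +[M] -[M] (m +[M] -[M] p m) = p m +[M] (m +[M] (-[M] m +[M] -[M] x))"
        using m c by (simp add: M.M.minus_add M.M.minus_minus M.M.a_ac)
      also have "... = p m +[M] -[M] x" using m c M.M.r_neg2[of m "-[M] x"] by simp
      finally show ?thesis unfolding a_minus_def .
    qed
    hence "p m -[M] x : U Int V" using v(6)[OF x(2) p(2)[OF m]] u(6)[OF p(1)[OF m] x(1)] by simp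
    thus ?thesis using UV(1) c by simp
  qed
  have ph: "p : lhom S M (M(|carrier := U|))"
  proof (rule left_homI)
    show "p m : car (M(|carrier := U|))" if "m : car M" for m using p(1)[OF that] by simp
    show "p (x +[M] y) = p x +[M(|carrier := U|)] p y" if x: "x : car M" and y: "y : car M" for x y
    proof -
      have c: "p x : car M" "p y : car M" using p(1) u(1) x y by blast+
      have "(x +[M] y) -[M] (p x +[M] p y) = (x -[M] p x) +[M] (y -[M] p y)"
        unfolding a_minus_def using x y c by (simp add: M.M.minus_add M.M.a_ac)
      hence "p (x +[M] y) = p x +[M] p y"
        using v(3)[OF p(2)[OF x] p(2)[OF y]] u(3)[OF p(1)[OF x] p(1)[OF y]] x y by (intro eq) auto
      thus ?thesis by simp
    qed
    show "p (a *[M] x) = a *[M(|carrier := U|)] p x" if a: "a : car S" and x: "x : car M" for a x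
    proof -
      have c: "p x : car M" using p(1) u(1) x by blast
      have "(a *[M] x) -[M] (a *[M] p x) = a *[M] (x -[M] p x)"
        unfolding a_minus_def using a x c by (simp add: M.smult_r_distr M.smult_r_minus)
      hence "p (a *[M] x) = a *[M] p x"
        using v(4)[OF a p(2)[OF x]] u(4)[OF a p(1)[OF x]] M.smult_closed[OF a x] by (intro eq) auto
      thus ?thesis by simp
    qed
  qed
  have pf: "p (f x) = f x" if "x : car N" for x
  proof -
    have fU: "f x : U" using lhom_closed[OF f(1) that] by simp
    hence fM: "f x : car M" using u(1) by blast
    have "f x -[M] f x = 0[M]" by (rule iffD2[OF M.minus_eq_zero[OF fM fM] refl])
    with v(2) have "f x -[M] f x : V" by metis
    thus ?thesis by (rule eq[OF fM fU])
  qed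
  show ?thesis
    by (rule bexI[OF bexI[OF _ lhom_comp[OF ph g(1)]] lhom_comp[OF f(1) incl_left_hom[OF U M.left_module_axioms]]])
      (use pf g(2) in simp)
qed

end

theorem proposition3p1p1:
  fixes K :: "'k ring"
    and S :: "('k, 'a) module"
    and \<Lambda> :: "'l set"
    and le :: "'l rel"
    and L :: "'l \<Rightarrow> ('a, 'b) module"
    and P :: "'l \<Rightarrow> ('a, 'c) module"
    and I :: "'l \<Rightarrow> ('a, 'd) module"
    and Delta :: "'l \<Rightarrow> ('a, 'c set) module"
    and Nabla :: "'l \<Rightarrow> ('a, 'd) module"
    and T :: "'l \<Rightarrow> ('a, 'e) module"
    and T0 :: "('a, 't) module"
    and S' :: "('k, 't \<Rightarrow> 't) module"
    and L' :: "'l \<Rightarrow> ('t \<Rightarrow> 't, 'f) module"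
    and P' :: "'l \<Rightarrow> ('t \<Rightarrow> 't, 't \<Rightarrow> 'e) module"
    and I' :: "'l \<Rightarrow> ('t \<Rightarrow> 't, 'g) module"
    and Delta' :: "'l \<Rightarrow> ('t \<Rightarrow> 't, ('t \<Rightarrow> 'e) set) module"
    and Nabla' :: "'l \<Rightarrow> ('t \<Rightarrow> 't, 'g) module"
  assumes "quasi_hereditary K S \<Lambda> le L P I"
    and "Delta = standard S \<Lambda> le L P"
    and "Nabla = costandard S \<Lambda> le L I"
    and "\<forall>\<mu>\<in>\<Lambda>. indecomposable_tilting K S \<Lambda> le L Delta Nabla \<mu> (T \<mu>)"
    and "full_tilting K S \<Lambda> Delta Nabla T T0"
    and "S' = End_op S T0"
    and "P' = (\<lambda>\<mu>. Hom_module S T0 (T \<mu>))"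
    and "labelled_simples K S' \<Lambda> L' P' I'"
    and "Delta' = standard S' \<Lambda> (le\<inverse>) L' P'"
    and "Nabla' = costandard S' \<Lambda> (le\<inverse>) L' I'"
    and "\<nu> \<in> \<Lambda>"
  shows "Delta_fd K S \<Lambda> Delta (Nabla \<nu>) = proj_dim K S' (Delta' \<nu>) \<and>
         inj_dim K S (Nabla \<nu>) = Nabla_fd K S' \<Lambda> Nabla' (Delta' \<nu>) \<and>
         proj_dim K S (Delta \<nu>) = Delta_fd K S' \<Lambda> Delta' (Nabla' \<nu>) \<and>
         Nabla_fd K S \<Lambda> Nabla (Delta \<nu>) = inj_dim K S' (Nabla' \<nu>)"
proof -
  note qh = assms(1)
  have fdS: "fd_algebra K S" and fin: "finite \<Lambda>" and po: "partial_order_on \<Lambda> le" and lab: "labelled_simples K S \<Lambda> L P I"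
    using qh unfolding quasi_hereditary_def by blast+
  interpret A: labelled K S \<Lambda> L P I by (intro labelled.intro labelled_axioms.intro fdalg.intro fdS fin lab)
  let ?uP = "%\<nu>. A.um (P \<nu>)" and ?uI = "%\<nu>. A.um (I \<nu>)" and ?uT = "%\<nu>. A.um (T \<nu>)"
  have Dl: "standard S \<Lambda> le L P = Delta" "costandard S \<Lambda> le L I = Nabla" using assms(2,3) by simp_all
  interpret h: hw K S \<Lambda> A.uL ?uP ?uI A.up A.ui le "A.Std le" "A.Cos le" "A.pS le" "A.iC le" by (rule A.qh_hw[OF qh])
  have til: "indecomposable_tilting K S \<Lambda> le L (standard S \<Lambda> le L P) (costandard S \<Lambda> le L I) mu (T mu)" if "mu : \<Lambda>" for mu
    using assms(4) that unfolding Dl by blast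
  note td = A.tilting_data[OF _ h.le_refl til]
  have T0: "filtered K S \<Lambda> (standard S \<Lambda> le L P) T0" "!!mu. mu : \<Lambda> ==> direct_summand S (T mu) T0"
    using assms(5) unfolding full_tilting_def tilting_module_def Dl by blast+
  have T0O: "A.Ob T0" using T0(1) unfolding filtered_def by blast
  have T0D: "h.FD (A.um T0)" using T0(1) A.filtered_Filt[of \<Lambda> "standard S \<Lambda> le L P", OF A.standard_props(1) T0O] by blast
  note S' = A.End_op_algebra[OF T0O, folded assms(6)]
  interpret B: labelled K S' \<Lambda> L' P' I' by (intro labelled.intro labelled_axioms.intro fdalg.intro S'(1) fin assms(8))
  interpret H: homf K S S' T0 "%f. f" by (rule S'(2))
  let ?uP' = "%\<nu>. B.um (P' \<nu>)" and ?uI' = "%\<nu>. B.um (I' \<nu>)"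
  have Dl': "standard S' \<Lambda> (le^-1) L' P' = Delta'" "costandard S' \<Lambda> (le^-1) L' I' = Nabla'" using assms(9,10) by simp_all
  have retr: "EX i:lhom S (?uT mu) T0. EX r:lhom S T0 (?uT mu). ALL x:car (?uT mu). r (i x) = x" if mu: "mu : \<Lambda>" for mu
  proof -
    note O = td(1)[OF mu mu  mu]
    obtain i r where ir: "i : lhom S (T mu) T0" "r : lhom S T0 (T mu)" "ALL x:car (T mu). r (i x) = x"
      using A.summand_retract[OF T0O O T0(2)[OF mu]] by blast
    show ?thesis
      by (rule bexI[OF bexI[OF _ lhom_comp[OF ir(2) A.um(2)[OF O]]] lhom_comp[OF A.uinv(1)[OF O] ir(1)]])
        (use ir(3) A.uinv(3)[OF O] A.uinv_closed[OF O] in simp)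
  qed
  have ring: "ringel_dual K S \<Lambda> A.uL ?uP ?uI A.up A.ui le (A.Std le) (A.Cos le) (A.pS le) (A.iC le) S' B.uL ?uP' ?uI' B.up B.ui
    H.FO H.FA ?uT (B.Cos (le^-1)) (B.iC (le^-1))"
  proof (intro ringel_dual.intro ringel.intro ringel_axioms.intro h.hw_axioms B.simp_data_axioms H.lin_functor)
    fix \<nu> assume \<nu>: "\<nu> : \<Lambda>"
    note t = td[OF \<nu> \<nu> \<nu>] and N' = B.costandard_props[where r = "le^-1", OF \<nu>]
    note tO = A.um(1)[OF t(1)]
    show "h.FD (?uT \<nu>)" "h.FN (?uT \<nu>)" "h.below (?uT \<nu>) \<nu>" "A.cf (?uT \<nu>) \<nu>" "A.mult1 \<nu> (?uT \<nu>)" "A.local_endo (?uT \<nu>)" by (rule t)+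
    show "B.Ob (B.Cos (le^-1) \<nu>)" by (rule B.um(1)[OF N'(1)])
    show "B.iC (le^-1) \<nu> : lhom S' (B.Cos (le^-1) \<nu>) (?uI' \<nu>)" "inj_on (B.iC (le^-1) \<nu>) (car (B.Cos (le^-1) \<nu>))" by (rule N'(2,3))+
    show "(\<nu>, mu) : le" if "mu : \<Lambda>" "B.cf (B.Cos (le^-1) \<nu>) mu" for mu using N'(4)[OF that] by simp
    show "f x : B.iC (le^-1) \<nu> ` car (B.Cos (le^-1) \<nu>)"
      if "B.Ob X" "f : lhom S' X (?uI' \<nu>)" "!!mu. mu : \<Lambda> ==> B.cf X mu ==> (\<nu>, mu) : le" "x : car X"
      for X :: "('k, 't => 't) umodule" and f x by (rule N'(5)[OF that(1,2) _ that(4)]) (use that(3) in auto)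
    obtain i r where ir: "i : lhom S (?uT \<nu>) T0" "r : lhom S T0 (?uT \<nu>)" "ALL x:car (?uT \<nu>). r (i x) = x" using retr[OF \<nu>] by blast
    show "EX g:lhom S (?uT \<nu>) X. ALL x:car (H.FO (?uT \<nu>)). H.FA (?uT \<nu>) X g x = h x"
      if "A.Ob X" "h : lhom S' (H.FO (?uT \<nu>)) (H.FO X)" for X :: "('k, 'a) umodule" and h
    proof (rule H.FA_full[OF tO ir(2,1) _ that(1) _ that(2)])
      show "r (i x) = x" if "x : car (?uT \<nu>)" for x using ir(3) that by blast
      \<comment> \<open>Here \<open>rho\<close> is the identity: elements of \<open>S'\<close> are
        themselves the endomorphisms of \<open>T0\<close>, in extensional form.\<close>
      show "EX a:car S'. ALL x:car T0. a x = e x" if "e : lhom S T0 T0" for e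
        by (rule bexI[of _ "restrict e (car T0)"]) (simp_all add: assms(6) End_op_def that lhom_restrict[OF H.M_mod])
    qed
    have rs: "r ` car T0 = car (?uT \<nu>)"
    proof (intro equalityI subsetI)
      fix x assume "x : car (?uT \<nu>)"
      thus "x : r ` car T0" using ir(3) lhom_closed[OF ir(1)] by (intro image_eqI[of _ _ "i x"]) auto
    qed (use lhom_closed[OF ir(2)] in auto)
    show "g x = 0[X]" if "A.Ob X" "g : lhom S (?uT \<nu>) X"
      "!!x. x : car (H.FO (?uT \<nu>)) ==> H.FA (?uT \<nu>) X g x = 0[H.FO X]" "x : car (?uT \<nu>)" for X :: "('k, 'a) umodule" and g x
      by (rule H.FA_faithful[OF tO ir(2) rs that])
    have HT: "B.Ob (H.H (T \<nu>))" "B.Ob (H.H (?uT \<nu>))" by (rule H.H_fd[OF t(1)]) (rule H.H_fd[OF tO])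
    \<comment> \<open>\<open>P'\<close> is built from \<open>T\<close> on its own type while the
      functor sees the relocated copy; composition with the relocating map identifies the two Hom
      modules.\<close>
    have "module_iso S' (H.H (T \<nu>)) (H.H (?uT \<nu>))" unfolding module_iso_def
    proof (intro bexI[of _ "compose (car T0) (A.uemb (T \<nu>))"] bij_betw_byWitness[of _ "compose (car T0) (A.uinv (T \<nu>))"] ballI)
      show "compose (car T0) (A.uemb (T \<nu>)) : lhom S' (H.H (T \<nu>)) (H.H (?uT \<nu>))" by (rule H.H_map[OF A.um(2)[OF t(1)]])
      show "compose (car T0) (A.uemb (T \<nu>)) ` car (H.H (T \<nu>)) <= car (H.H (?uT \<nu>))" using H.H_comp[OF A.um(2)[OF t(1)]] by blast
      show "compose (car T0) (A.uinv (T \<nu>)) ` car (H.H (?uT \<nu>)) <= car (H.H (T \<nu>))" using H.H_comp[OF A.uinv(1)[OF t(1)]] by blast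
      show "compose (car T0) (A.uinv (T \<nu>)) (compose (car T0) (A.uemb (T \<nu>)) f) = f" if f: "f : car (H.H (T \<nu>))" for f
        by (rule H.H_eqI[OF H.H_comp[OF A.uinv(1)[OF t(1)] H.H_comp[OF A.um(2)[OF t(1)] f]] f])
          (use f in \<open>simp add: compose_eq A.uinv(2)[OF t(1)] lhom_closed[of f S T0 "T \<nu>"]\<close>)
      show "compose (car T0) (A.uemb (T \<nu>)) (compose (car T0) (A.uinv (T \<nu>)) f) = f" if f: "f : car (H.H (?uT \<nu>))" for f
        by (rule H.H_eqI[OF H.H_comp[OF A.um(2)[OF t(1)] H.H_comp[OF A.uinv(1)[OF t(1)] f]] f])
          (use f in \<open>simp add: compose_eq A.uinv(3)[OF t(1)] lhom_closed[of f S T0 "?uT \<nu>"]\<close>)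
    qed
    from B.um_cong_iso[OF HT this] show "module_iso S' (?uP' \<nu>) (H.FO (?uT \<nu>))"
      unfolding H.FO_def assms(7) Hom_module_eq .
  next
    \<comment> \<open>Surjectivity at the right end is lifting from \<open>T0\<close>, possible
      because \<open>T0\<close> has a standard filtration and the left term a costandard
      one.\<close>
    show "B.ses (H.FO X) (H.FA X Y f) (H.FO Y) (H.FA Y Z g) (H.FO Z)" if s: "A.ses X f Y g Z" and X: "h.FN X" for X f Y g Z
    proof (rule H.FA_exact[OF s])
      fix k assume k: "k : lhom S T0 Z"
      obtain l where l: "l : lhom S (A.um T0) Y" "ALL x:car (A.um T0). g (l x) = k (A.uinv T0 x)"
        using A.Ev_lift[OF h.Ev_FD_FN[OF T0D X] s A.um(1)[OF T0O] lhom_comp[OF A.uinv(1)[OF T0O] k]] by blast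
      show "EX l:lhom S T0 Y. ALL m:car T0. g (l m) = k m"
        by (rule bexI[OF _ lhom_comp[OF A.um(2)[OF T0O] l(1)]]) (use l(2) A.uemb_closed[OF T0O] A.uinv(2)[OF T0O] in simp)
    qed
  qed
  interpret R: ringel_dual K S \<Lambda> A.uL ?uP ?uI A.up A.ui le "A.Std le" "A.Cos le" "A.pS le" "A.iC le" S' B.uL ?uP' ?uI' B.up B.ui
    H.FO H.FA ?uT "B.Cos (le^-1)" "B.iC (le^-1)" by (rule ring)
  \<comment> \<open>The standard module computed from the definition and F Nabla(mu) have the same
    universal property as quotients of P'(mu), hence equal kernels.\<close>
  have iso: "module_iso S' (B.Std (le^-1) mu) (R.D' mu)" if mu: "mu : \<Lambda>" for mu
  proof -
    note D = B.standard_props[where r = "le^-1", OF mu]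
    note O = B.P_Ob[OF mu] B.um(1)[OF D(1)] R.D'_Ob[OF mu]
    show ?thesis
    proof (rule B.quot_iso_of_kernels[OF O[THEN B.ObD(1)] D(2,3) R.B'.pD[OF mu] R.B'.pD_surj[OF mu]])
      fix x assume x: "x : car (?uP' mu)"
      show "B.pS (le^-1) mu x = 0[B.Std (le^-1) mu] <-> R.pD' mu x = 0[R.D' mu]"
        using D(5)[OF O(3) R.B'.pD[OF mu] R.B'.cf_D[OF mu] x] R.B'.D_univ[OF mu O(2) D(2) D(4) x] by blast
    qed
  qed
  have iso': "module_iso S' (R.D' mu) (B.Std (le^-1) mu)" if mu: "mu : \<Lambda>" for mu
    by (rule module_iso_sym[OF B.ObD(1)[OF B.um(1)[OF B.standard_props(1)[OF mu]]] B.ObD(1)[OF R.D'_Ob[OF mu]] iso[OF mu]])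
  \<comment> \<open>Isomorphic families of sections define the same filtered modules, so filtration
    dimensions over \<open>S'\<close> may be computed with F Nabla as the standard modules.\<close>
  have "B.cls (B.Std (le^-1)) \<Lambda> Z <-> B.cls R.D' \<Lambda> Z" for Z
    unfolding B.cls_def using module_iso_trans[OF _ iso] module_iso_trans[OF _ iso'] by blast
  hence cls: "B.cls (B.Std (le^-1)) \<Lambda> = B.cls R.D' \<Lambda>" by blast
  have C: "filtered K S \<Lambda> Delta = h.FD" "filtered K S \<Lambda> Nabla = h.FN" "filtered K S' \<Lambda> Delta' = R.B'.FD" "filtered K S' \<Lambda> Nabla' = R.B'.FN"
    unfolding Dl[symmetric] Dl'[symmetric] cls[symmetric]
    by (rule ext, rule A.filtered_Filt_u B.filtered_Filt_u, rule A.standard_props A.costandard_props B.standard_props B.costandard_props, assumption)+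
  note \<nu> = assms(11)
  note O = A.standard_props(1)[OF \<nu>, of le] A.costandard_props(1)[OF \<nu>, of le]
    B.standard_props(1)[OF \<nu>, of "le^-1"] B.costandard_props(1)[OF \<nu>, of "le^-1"]
  note O' = B.um(1)[OF O(3)] R.D'_Ob[OF \<nu>]
  have T: "B.Rs (Proj K S') d (B.Std (le^-1) \<nu>) <-> B.Rs (Proj K S') d (R.D' \<nu>)" for d
    using B.Rs_iso[OF B.iclass_projective O'(1) iso'[OF \<nu>]] B.Rs_iso[OF B.iclass_projective O'(2) iso[OF \<nu>]] by blast
  have T': "B.cRs R.B'.FN d (B.Std (le^-1) \<nu>) <-> B.cRs R.B'.FN d (R.D' \<nu>)" for d
    using B.cRs_iso[OF B.iclass_Filt O' iso[OF \<nu>]] B.cRs_iso[OF B.iclass_Filt O'(2,1) iso'[OF \<nu>]] by blast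
  have "Delta_fd K S \<Lambda> Delta (Nabla \<nu>) = proj_dim K S' (Delta' \<nu>)"
    unfolding Delta_fd_def proj_dim_def C unfolding Dl[symmetric] Dl'[symmetric]
      A.resolution_dim_Rs(1)[OF A.iclass_Filt O(2)] B.resolution_dim_Rs(1)[OF B.iclass_projective O(3)] T R.duality(1)[OF \<nu>] by (rule refl)
  moreover have "inj_dim K S (Nabla \<nu>) = Nabla_fd K S' \<Lambda> Nabla' (Delta' \<nu>)"
    unfolding Nabla_fd_def inj_dim_def C unfolding Dl[symmetric] Dl'[symmetric]
      A.resolution_dim_Rs(2)[OF A.iclass_injective O(2)] B.resolution_dim_Rs(2)[OF B.iclass_Filt O(3)] T' R.duality(2)[OF \<nu>] by (rule refl)
  moreover have "proj_dim K S (Delta \<nu>) = Delta_fd K S' \<Lambda> Delta' (Nabla' \<nu>)"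
    unfolding Delta_fd_def proj_dim_def C unfolding Dl[symmetric] Dl'[symmetric]
      A.resolution_dim_Rs(1)[OF A.iclass_projective O(1)] B.resolution_dim_Rs(1)[OF B.iclass_Filt O(4)] R.duality(3)[OF \<nu>] by (rule refl)
  moreover have "Nabla_fd K S \<Lambda> Nabla (Delta \<nu>) = inj_dim K S' (Nabla' \<nu>)"
    unfolding Nabla_fd_def inj_dim_def C unfolding Dl[symmetric] Dl'[symmetric]
      A.resolution_dim_Rs(2)[OF A.iclass_Filt O(1)] B.resolution_dim_Rs(2)[OF B.iclass_injective O(4)] R.duality(4)[OF \<nu>] by (rule refl)
  ultimately show ?thesis by blast
qed

end
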